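(* Let $i:X\hookrightarrow Y$ be a closed embedding of smooth algebraic varieties over $\mathbf{k}$ and let $X\overset{j}{\to}\widetilde{X}\overset{\pi}{\to}Y$ be a smooth resolution of $i$. Then the pair $(\mathcal O_{\widetilde{X}},T_{\widetilde{X}/Y})$ is a dg-Lie algebroid over $\mathcal O_Y$, and it is the dg-Lie algebroid of the groupoid $(\widetilde{X},\widetilde{X}\times_Y\widetilde{X})$ in dg-$Y$-schemes.
   Context: $\mathbf{k}$ is an algebraically closed field of characteristic zero; everything is over $\mathbf{k}$. Gradings are cohomological, and $E[k]$ denotes the graded object with $E[k]^l=E^{k+l}$. Smooth resolution of $i$: $\widetilde X$ is the dg-scheme with underlying scheme $Y$ and structure sheaf the sheaf of dg-commutative $\mathcal O_Y$-algebras $\mathcal O_{\widetilde X}=(\mathbf S_{\mathcal O_Y}(E[1]),Q)$, where $E=E_0\oplus E_{-1}\oplus E_{-2}\oplus\cdots$ is a non-positively graded locally free $\mathcal O_Y$-module with every $E_j$ of finite rank, $\mathbf S$ is the graded symmetric algebra, and $Q$ is an $\mathcal O_Y$-linear derivation of degree $1$ with $Q^2=0$. It comes with a quasi-isomorphism of dg-$\mathcal O_Y$-algebras $\mathcal O_{\widetilde X}\to i_*\mathcal O_X$, which defines $j:X\to\widetilde X$; $\pi:\widetilde X\to Y$ is given by $\mathcal O_Y\subset\mathcal O_{\widetilde X}$, and $\pi\circ j=i$. $T_{\widetilde X/Y}:=\mathrm{Der}_{\mathcal O_Y}(\mathcal O_{\widetilde X})$ with differential $[Q,-]$, bracket the graded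 commutator, and anchor the inclusion into $\mathrm{Der}_{\mathbf k}(\mathcal O_{\widetilde X})$. A dg-Lie algebroid is a sheaf of dg Lie–Rinehart algebras $(\mathcal A,\mathfrak g)$; it is over $\mathcal O_Y$ if $\mathcal A$ is an $\mathcal O_Y$-algebra, the bracket is $\mathcal O_Y$-linear and the anchor takes values in $\mathcal O_Y$-linear derivations of $\mathcal A$. The groupoid $(\widetilde{X},\widetilde{X}\times_Y\widetilde{X})$ has objects $\widetilde X$, arrows $\widetilde{X}\times_Y\widetilde{X}$ (underlying scheme $Y$, structure sheaf $\mathcal O_{\widetilde X}\otimes_{\mathcal O_Y}\mathcal O_{\widetilde X}$), source and target the two projections, and unit the diagonal. The dg-Lie algebroid of a groupoid $(M,G)$ in dg-$Y$-schemes with unit $e$, source $s$, target $t$ is the sheaf on $M$ obtained by restricting along $e$ the $\mathcal O_Y$-linear derivations of $\mathcal O_G$ that are $s$-vertical (i.e. $s^{-1}\mathcal O_M$-linear); its bracket comes from identifying its sections with the translation-invariant $s$-vertical derivations, and its anchor is given by letting them act on functions pulled back along $t$. *)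

theory Defs
  imports
    "HOL-Analysis.Abstract_Topology"
    "HOL-Algebra.Algebraic_Closure"
    "HOL-Algebra.Generated_Rings"
    "HOL-Algebra.Ring_Divisibility"
    "HOL-Algebra.Free_Abelian_Groups"
begin

section \<open>Sheaves on a topological space\<close>

definition presheaf_on ::
    "'a topology \<Rightarrow> ('a set \<Rightarrow> 's set) \<Rightarrow> ('a set \<Rightarrow> 'a set \<Rightarrow> 's \<Rightarrow> 's) \<Rightarrow> bool" where
  "presheaf_on T F r \<longleftrightarrow>
     (\<forall>U V. openin T U \<and> openin T V \<and> V \<subseteq> U \<longrightarrow> r U V \<in> F U \<rightarrow> F V) \<and>
     (\<forall>U. openin T U \<longrightarrow> (\<forall>s\<in>F U. r U U s = s)) \<and>
     (\<forall>U V W. openin T U \<and> openin T V \<and> openin T W \<and> W \<subseteq> V \<and> V \<subseteq> U \<longrightarrow>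
        (\<forall>s\<in>F U. r V W (r U V s) = r U W s))"

text \<open>The empty family of open sets is allowed, so there is exactly one section over the empty set.\<close>

definition sheaf_on ::
    "'a topology \<Rightarrow> ('a set \<Rightarrow> 's set) \<Rightarrow> ('a set \<Rightarrow> 'a set \<Rightarrow> 's \<Rightarrow> 's) \<Rightarrow> bool" where
  "sheaf_on T F r \<longleftrightarrow> presheaf_on T F r \<and>
     (\<forall>\<U> \<sigma>. (\<forall>U\<in>\<U>. openin T U \<and> \<sigma> U \<in> F U) \<and>
            (\<forall>U\<in>\<U>. \<forall>V\<in>\<U>. r U (U \<inter> V) (\<sigma> U) = r V (U \<inter> V) (\<sigma> V)) \<longrightarrow>
        (\<exists>!s. s \<in> F (\<Union>\<U>) \<and> (\<forall>U\<in>\<U>. r (\<Union>\<U>) U s = \<sigma> U)))"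

definition germ ::
    "'a topology \<Rightarrow> ('a set \<Rightarrow> 's set) \<Rightarrow> ('a set \<Rightarrow> 'a set \<Rightarrow> 's \<Rightarrow> 's) \<Rightarrow>
     'a \<Rightarrow> 'a set \<Rightarrow> 's \<Rightarrow> ('a set \<times> 's) set" where
  "germ T F r x U s =
     {(V, t). openin T V \<and> x \<in> V \<and> t \<in> F V \<and>
        (\<exists>W. openin T W \<and> x \<in> W \<and> W \<subseteq> U \<inter> V \<and> r U W s = r V W t)}"


section \<open>Ringed spaces and schemes\<close>

record ('a, 'r) ringed_space =
  tp :: "'a topology"
  rsec :: "'a set \<Rightarrow> 'r ring"
  rres :: "'a set \<Rightarrow> 'a set \<Rightarrow> 'r \<Rightarrow> 'r"

definition is_ringed_space :: "('a, 'r, 'z) ringed_space_scheme \<Rightarrow> bool" where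
  "is_ringed_space Z \<longleftrightarrow>
     sheaf_on (tp Z) (\<lambda>U. carrier (rsec Z U)) (rres Z) \<and>
     (\<forall>U. openin (tp Z) U \<longrightarrow> cring (rsec Z U)) \<and>
     (\<forall>U V. openin (tp Z) U \<and> openin (tp Z) V \<and> V \<subseteq> U \<longrightarrow>
        rres Z U V \<in> ring_hom (rsec Z U) (rsec Z V))"

definition rgerm ::
    "('a, 'r, 'z) ringed_space_scheme \<Rightarrow> 'a \<Rightarrow> 'a set \<Rightarrow> 'r \<Rightarrow> ('a set \<times> 'r) set" where
  "rgerm Z = germ (tp Z) (\<lambda>U. carrier (rsec Z U)) (rres Z)"

text \<open>Two germs always have representatives over a common open set, and the germ of the sum
  (product) of such representatives does not depend on their choice; the union below is that germ.\<close>

definition stalk :: "('a, 'r, 'z) ringed_space_scheme \<Rightarrow> 'a \<Rightarrow> ('a set \<times> 'r) set ring" where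
  "stalk Z x =
     \<lparr>carrier = {rgerm Z x U s |U s. openin (tp Z) U \<and> x \<in> U \<and> s \<in> carrier (rsec Z U)},
      monoid.mult = (\<lambda>g h. \<Union>{rgerm Z x U (s \<otimes>\<^bsub>rsec Z U\<^esub> t) |U s t. (U, s) \<in> g \<and> (U, t) \<in> h}),
      monoid.one = rgerm Z x (topspace (tp Z)) \<one>\<^bsub>rsec Z (topspace (tp Z))\<^esub>,
      ring.zero = rgerm Z x (topspace (tp Z)) \<zero>\<^bsub>rsec Z (topspace (tp Z))\<^esub>,
      ring.add = (\<lambda>g h. \<Union>{rgerm Z x U (s \<oplus>\<^bsub>rsec Z U\<^esub> t) |U s t. (U, s) \<in> g \<and> (U, t) \<in> h})\<rparr>"

definition open_sub :: "('a, 'r, 'z) ringed_space_scheme \<Rightarrow> 'a set \<Rightarrow> ('a, 'r) ringed_space" where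
  "open_sub Z U = \<lparr>tp = subtopology (tp Z) U, rsec = rsec Z, rres = rres Z\<rparr>"

definition pre :: "('a, 'r, 'z) ringed_space_scheme \<Rightarrow> ('a \<Rightarrow> 'b) \<Rightarrow> 'b set \<Rightarrow> 'a set" where
  "pre Z f V = {x \<in> topspace (tp Z). f x \<in> V}"

definition ringed_morphism ::
    "('a, 'r, 'z) ringed_space_scheme \<Rightarrow> ('b, 's, 'y) ringed_space_scheme \<Rightarrow>
     ('a \<Rightarrow> 'b) \<Rightarrow> ('b set \<Rightarrow> 's \<Rightarrow> 'r) \<Rightarrow> bool" where
  "ringed_morphism Z Y f fs \<longleftrightarrow>
     continuous_map (tp Z) (tp Y) f \<and>
     (\<forall>V. openin (tp Y) V \<longrightarrow> fs V \<in> ring_hom (rsec Y V) (rsec Z (pre Z f V))) \<and>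
     (\<forall>V W. openin (tp Y) V \<and> openin (tp Y) W \<and> W \<subseteq> V \<longrightarrow>
        (\<forall>s\<in>carrier (rsec Y V). fs W (rres Y V W s) = rres Z (pre Z f V) (pre Z f W) (fs V s)))"

definition ringed_iso ::
    "('a, 'r, 'z) ringed_space_scheme \<Rightarrow> ('b, 's, 'y) ringed_space_scheme \<Rightarrow>
     ('a \<Rightarrow> 'b) \<Rightarrow> ('b set \<Rightarrow> 's \<Rightarrow> 'r) \<Rightarrow> bool" where
  "ringed_iso Z Y f fs \<longleftrightarrow>
     ringed_morphism Z Y f fs \<and> homeomorphic_map (tp Z) (tp Y) f \<and>
     (\<forall>V. openin (tp Y) V \<longrightarrow> fs V \<in> ring_iso (rsec Y V) (rsec Z (pre Z f V)))"

subsection \<open>Spectra\<close>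

definition frac :: "'r ring \<Rightarrow> 'r set \<Rightarrow> 'r \<Rightarrow> 'r \<Rightarrow> ('r \<times> 'r) set" where
  "frac R P a s =
     {(b, t). b \<in> carrier R \<and> t \<in> carrier R - P \<and>
        (\<exists>u\<in>carrier R - P. u \<otimes>\<^bsub>R\<^esub> (a \<otimes>\<^bsub>R\<^esub> t) = u \<otimes>\<^bsub>R\<^esub> (b \<otimes>\<^bsub>R\<^esub> s))}"

definition localization :: "'r ring \<Rightarrow> 'r set \<Rightarrow> ('r \<times> 'r) set ring" where
  "localization R P =
     \<lparr>carrier = {frac R P a s |a s. a \<in> carrier R \<and> s \<in> carrier R - P},
      monoid.mult = (\<lambda>c d. \<Union>{frac R P (a \<otimes>\<^bsub>R\<^esub> b) (s \<otimes>\<^bsub>R\<^esub> t) |a s b t. (a, s) \<in> c \<and> (b, t) \<in> d}),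
      monoid.one = frac R P \<one>\<^bsub>R\<^esub> \<one>\<^bsub>R\<^esub>,
      ring.zero = frac R P \<zero>\<^bsub>R\<^esub> \<one>\<^bsub>R\<^esub>,
      ring.add = (\<lambda>c d. \<Union>{frac R P ((a \<otimes>\<^bsub>R\<^esub> t) \<oplus>\<^bsub>R\<^esub> (b \<otimes>\<^bsub>R\<^esub> s)) (s \<otimes>\<^bsub>R\<^esub> t) |a s b t.
                        (a, s) \<in> c \<and> (b, t) \<in> d})\<rparr>"

definition spec_top :: "'r ring \<Rightarrow> 'r set topology" where
  "spec_top R = topology_generated_by ((\<lambda>f. {P. primeideal P R \<and> f \<notin> P}) ` carrier R)"

definition Spec :: "'r ring \<Rightarrow> ('r set, 'r set \<Rightarrow> ('r \<times> 'r) set) ringed_space" where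
  "Spec R =
     \<lparr>tp = spec_top R,
      rsec = (\<lambda>U.
        \<lparr>carrier = {\<sigma> \<in> extensional U. \<forall>P\<in>U. \<exists>V a f. openin (spec_top R) V \<and> P \<in> V \<and> V \<subseteq> U \<and>
                      a \<in> carrier R \<and> f \<in> carrier R \<and> (\<forall>Q\<in>V. f \<notin> Q \<and> \<sigma> Q = frac R Q a f)},
         monoid.mult = (\<lambda>\<sigma> \<tau>. \<lambda>P\<in>U. \<sigma> P \<otimes>\<^bsub>localization R P\<^esub> \<tau> P),
         monoid.one = (\<lambda>P\<in>U. \<one>\<^bsub>localization R P\<^esub>),
         ring.zero = (\<lambda>P\<in>U. \<zero>\<^bsub>localization R P\<^esub>),
         ring.add = (\<lambda>\<sigma> \<tau>. \<lambda>P\<in>U. \<sigma> P \<oplus>\<^bsub>localization R P\<^esub> \<tau> P)\<rparr>),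
      rres = (\<lambda>U V \<sigma>. restrict \<sigma> V)\<rparr>"

text \<open>If \<open>Z\<close> is the spectrum of some ring then it is the spectrum of its ring of global sections;
  hence it is no restriction to look for \<open>R\<close> among rings with elements of the section type.\<close>

definition affine :: "('a, 'r, 'z) ringed_space_scheme \<Rightarrow> bool" where
  "affine Z \<longleftrightarrow> (\<exists>(R :: 'r ring) f fs. cring R \<and> ringed_iso Z (Spec R) f fs)"

definition affine_open :: "('a, 'r, 'z) ringed_space_scheme \<Rightarrow> 'a set \<Rightarrow> bool" where
  "affine_open Z U \<longleftrightarrow> openin (tp Z) U \<and> affine (open_sub Z U)"

definition is_scheme :: "('a, 'r, 'z) ringed_space_scheme \<Rightarrow> bool" where
  "is_scheme Z \<longleftrightarrow> is_ringed_space Z \<and> (\<forall>x\<in>topspace (tp Z). \<exists>U. x \<in> U \<and> affine_open Z U)"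

text \<open>The last condition says that the maps induced on stalks are local homomorphisms.\<close>

definition scheme_morphism ::
    "('a, 'r, 'z) ringed_space_scheme \<Rightarrow> ('b, 's, 'y) ringed_space_scheme \<Rightarrow>
     ('a \<Rightarrow> 'b) \<Rightarrow> ('b set \<Rightarrow> 's \<Rightarrow> 'r) \<Rightarrow> bool" where
  "scheme_morphism Z Y f fs \<longleftrightarrow>
     is_scheme Z \<and> is_scheme Y \<and> ringed_morphism Z Y f fs \<and>
     (\<forall>V x s. openin (tp Y) V \<and> x \<in> pre Z f V \<and> s \<in> carrier (rsec Y V) \<and>
        rgerm Z x (pre Z f V) (fs V s) \<in> Units (stalk Z x) \<longrightarrow>
        rgerm Y (f x) V s \<in> Units (stalk Y (f x)))"


section \<open>Smooth varieties and closed embeddings\<close>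

definition is_local_ring :: "('r, 'z) ring_scheme \<Rightarrow> bool" where
  "is_local_ring R \<longleftrightarrow> cring R \<and> (\<exists>!m. maximalideal m R)"

definition prime_chain :: "('r, 'z) ring_scheme \<Rightarrow> (nat \<Rightarrow> 'r set) \<Rightarrow> nat \<Rightarrow> bool" where
  "prime_chain R P n \<longleftrightarrow> (\<forall>i\<le>n. primeideal (P i) R) \<and> (\<forall>i<n. P i \<subset> P (Suc i))"

definition has_krull_dim :: "('r, 'z) ring_scheme \<Rightarrow> nat \<Rightarrow> bool" where
  "has_krull_dim R d \<longleftrightarrow> (\<exists>P. prime_chain R P d) \<and> (\<forall>n P. prime_chain R P n \<longrightarrow> n \<le> d)"

definition regular_local_ring :: "('r, 'z) ring_scheme \<Rightarrow> bool" where
  "regular_local_ring R \<longleftrightarrow>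
     is_local_ring R \<and> noetherian_ring R \<and>
     (\<exists>S d. has_krull_dim R d \<and> S \<subseteq> carrier R \<and> finite S \<and> card S = d \<and>
        maximalideal (genideal R S) R)"

definition alg_closed_char_zero :: "'k ring \<Rightarrow> bool" where
  "alg_closed_char_zero K \<longleftrightarrow>
     algebraically_closed K \<and> (\<forall>n::nat. n > 0 \<longrightarrow> add_pow K n \<one>\<^bsub>K\<^esub> \<noteq> \<zero>\<^bsub>K\<^esub>)"

text \<open>A morphism to the spectrum of \<open>K\<close> is the same thing as a structure of a sheaf of
  \<open>K\<close>-algebras on the structure sheaf.\<close>

record ('a, 'r, 'k) kspace = "('a, 'r) ringed_space" +
  scal :: "'a set \<Rightarrow> 'k \<Rightarrow> 'r"

definition k_scheme :: "'k ring \<Rightarrow> ('a, 'r, 'k) kspace \<Rightarrow> bool" where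
  "k_scheme K Z \<longleftrightarrow>
     is_scheme Z \<and>
     (\<forall>U. openin (tp Z) U \<longrightarrow> scal Z U \<in> ring_hom K (rsec Z U)) \<and>
     (\<forall>U V. openin (tp Z) U \<and> openin (tp Z) V \<and> V \<subseteq> U \<longrightarrow>
        (\<forall>c\<in>carrier K. rres Z U V (scal Z U c) = scal Z V c))"

definition k_morphism ::
    "'k ring \<Rightarrow> ('a, 'r, 'k) kspace \<Rightarrow> ('b, 's, 'k) kspace \<Rightarrow>
     ('a \<Rightarrow> 'b) \<Rightarrow> ('b set \<Rightarrow> 's \<Rightarrow> 'r) \<Rightarrow> bool" where
  "k_morphism K Z Y f fs \<longleftrightarrow>
     scheme_morphism Z Y f fs \<and>
     (\<forall>V. openin (tp Y) V \<longrightarrow> (\<forall>c\<in>carrier K. fs V (scal Y V c) = scal Z (pre Z f V) c))"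

definition finite_type :: "'k ring \<Rightarrow> ('a, 'r, 'k) kspace \<Rightarrow> bool" where
  "finite_type K Z \<longleftrightarrow>
     compact_space (tp Z) \<and>
     (\<forall>x\<in>topspace (tp Z). \<exists>U F. x \<in> U \<and> affine_open Z U \<and> finite F \<and> F \<subseteq> carrier (rsec Z U) \<and>
        generate_ring (rsec Z U) (scal Z U ` carrier K \<union> F) = carrier (rsec Z U))"

definition reduced :: "('a, 'r, 'z) ringed_space_scheme \<Rightarrow> bool" where
  "reduced Z \<longleftrightarrow>
     (\<forall>U s. openin (tp Z) U \<and> s \<in> carrier (rsec Z U) \<and>
        (\<exists>n::nat. s [^]\<^bsub>rsec Z U\<^esub> n = \<zero>\<^bsub>rsec Z U\<^esub>) \<longrightarrow> s = \<zero>\<^bsub>rsec Z U\<^esub>)"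

text \<open>The diagonal of \<open>Z\<close> over \<open>K\<close> is a closed immersion: over the open set \<open>U \<times> V\<close> of the product
  (the spectrum of the tensor product of the rings of sections over affine \<open>U\<close> and \<open>V\<close>) it is the
  map from \<open>U \<inter> V\<close>, so the condition is that \<open>U \<inter> V\<close> is affine and that the tensor product maps
  onto the sections over \<open>U \<inter> V\<close>.\<close>

definition separated :: "('a, 'r, 'z) ringed_space_scheme \<Rightarrow> bool" where
  "separated Z \<longleftrightarrow>
     (\<forall>U V. affine_open Z U \<and> affine_open Z V \<longrightarrow>
        affine_open Z (U \<inter> V) \<and>
        generate_ring (rsec Z (U \<inter> V))
          (rres Z U (U \<inter> V) ` carrier (rsec Z U) \<union> rres Z V (U \<inter> V) ` carrier (rsec Z V))
        = carrier (rsec Z (U \<inter> V)))"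

text \<open>Irreducibility is not part of the definition of a variety.  Over an algebraically closed
  field, smooth means that all local rings are regular.\<close>

definition smooth_variety :: "'k ring \<Rightarrow> ('a, 'r, 'k) kspace \<Rightarrow> bool" where
  "smooth_variety K Z \<longleftrightarrow>
     k_scheme K Z \<and> finite_type K Z \<and> separated Z \<and> reduced Z \<and>
     (\<forall>x\<in>topspace (tp Z). regular_local_ring (stalk Z x))"

definition closed_embedding ::
    "'k ring \<Rightarrow> ('a, 'r, 'k) kspace \<Rightarrow> ('b, 's, 'k) kspace \<Rightarrow>
     ('a \<Rightarrow> 'b) \<Rightarrow> ('b set \<Rightarrow> 's \<Rightarrow> 'r) \<Rightarrow> bool" where
  "closed_embedding K Z Y f fs \<longleftrightarrow>
     k_morphism K Z Y f fs \<and> embedding_map (tp Z) (tp Y) f \<and>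
     closedin (tp Y) (f ` topspace (tp Z)) \<and>
     (\<forall>V s. openin (tp Y) V \<and> s \<in> carrier (rsec Z (pre Z f V)) \<longrightarrow>
        (\<forall>y\<in>V. \<exists>W t. openin (tp Y) W \<and> y \<in> W \<and> W \<subseteq> V \<and> t \<in> carrier (rsec Y W) \<and>
           fs W t = rres Z (pre Z f V) (pre Z f W) s))"


section \<open>Graded modules and dg-algebras over the structure sheaf\<close>

text \<open>A graded object is a family of sheaves indexed by the cohomological degree.  The fields
  \<open>mult\<close> and \<open>one\<close> of the module records are irrelevant throughout.\<close>

record ('a, 'r, 'm) gmod =
  gsec :: "int \<Rightarrow> 'a set \<Rightarrow> ('r, 'm) module"
  gres :: "int \<Rightarrow> 'a set \<Rightarrow> 'a set \<Rightarrow> 'm \<Rightarrow> 'm"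

abbreviation sec :: "('a, 'r, 'm, 'z) gmod_scheme \<Rightarrow> int \<Rightarrow> 'a set \<Rightarrow> 'm set" where
  "sec M l U \<equiv> carrier (gsec M l U)"

locale graded_module_sheaf =
  fixes Y :: "('a, 'r, 'y) ringed_space_scheme" and M :: "('a, 'r, 'm, 'z) gmod_scheme"
  assumes sheaf: "sheaf_on (tp Y) (sec M l) (gres M l)"
    and module: "openin (tp Y) U \<Longrightarrow> module (rsec Y U) (gsec M l U)"
    and res_add: "\<lbrakk>openin (tp Y) U; openin (tp Y) V; V \<subseteq> U; x \<in> sec M l U; x' \<in> sec M l U\<rbrakk> \<Longrightarrow>
       gres M l U V (x \<oplus>\<^bsub>gsec M l U\<^esub> x') = gres M l U V x \<oplus>\<^bsub>gsec M l V\<^esub> gres M l U V x'"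
    and res_smult: "\<lbrakk>openin (tp Y) U; openin (tp Y) V; V \<subseteq> U; r \<in> carrier (rsec Y U); x \<in> sec M l U\<rbrakk> \<Longrightarrow>
       gres M l U V (r \<odot>\<^bsub>gsec M l U\<^esub> x) = rres Y U V r \<odot>\<^bsub>gsec M l V\<^esub> gres M l U V x"

definition locally_free_finite ::
    "('a, 'r, 'y) ringed_space_scheme \<Rightarrow> ('a, 'r, 'm, 'z) gmod_scheme \<Rightarrow> int \<Rightarrow> bool" where
  "locally_free_finite Y M l \<longleftrightarrow>
     (\<forall>y\<in>topspace (tp Y). \<exists>U n e. openin (tp Y) U \<and> y \<in> U \<and> (\<forall>i<n::nat. e i \<in> sec M l U) \<and>
        (\<forall>V. openin (tp Y) V \<and> V \<subseteq> U \<longrightarrow>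
          (\<forall>x\<in>sec M l V. \<exists>!c. c \<in> {..<n} \<rightarrow>\<^sub>E carrier (rsec Y V) \<and>
             x = finsum (gsec M l V) (\<lambda>i. c i \<odot>\<^bsub>gsec M l V\<^esub> gres M l U V (e i)) {..<n})))"

definition shift :: "('a, 'r, 'm) gmod \<Rightarrow> int \<Rightarrow> ('a, 'r, 'm) gmod" where
  "shift M k = \<lparr>gsec = (\<lambda>l. gsec M (k + l)), gres = (\<lambda>l. gres M (k + l))\<rparr>"

definition ksign :: "int \<Rightarrow> int" where
  "ksign n = (if even n then 1 else -1)"

abbreviation signed :: "('s, 'z) ring_scheme \<Rightarrow> int \<Rightarrow> 's \<Rightarrow> 's" where
  "signed M n x \<equiv> add_pow M (ksign n) x"

record ('a, 'r, 'm) dgalg = "('a, 'r, 'm) gmod" +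
  gmul :: "int \<Rightarrow> int \<Rightarrow> 'a set \<Rightarrow> 'm \<Rightarrow> 'm \<Rightarrow> 'm"
  gone :: "'a set \<Rightarrow> 'm"
  gdif :: "int \<Rightarrow> 'a set \<Rightarrow> 'm \<Rightarrow> 'm"

text \<open>Sheaves of dg-commutative algebras over the structure sheaf of \<open>Y\<close>.  The differential is
  linear over the structure sheaf, i.e. the latter maps to the cocycles of degree 0.\<close>

locale dg_algebra_sheaf = graded_module_sheaf Y A
  for Y :: "('a, 'r, 'y) ringed_space_scheme" and A :: "('a, 'r, 'm) dgalg" +
  assumes mul_closed: "\<lbrakk>openin (tp Y) U; x \<in> sec A p U; y \<in> sec A q U\<rbrakk> \<Longrightarrow>
       gmul A p q U x y \<in> sec A (p + q) U"
    and mul_add_left: "\<lbrakk>openin (tp Y) U; x \<in> sec A p U; x' \<in> sec A p U; y \<in> sec A q U\<rbrakk> \<Longrightarrow>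
       gmul A p q U (x \<oplus>\<^bsub>gsec A p U\<^esub> x') y =
         gmul A p q U x y \<oplus>\<^bsub>gsec A (p + q) U\<^esub> gmul A p q U x' y"
    and mul_add_right: "\<lbrakk>openin (tp Y) U; x \<in> sec A p U; y \<in> sec A q U; y' \<in> sec A q U\<rbrakk> \<Longrightarrow>
       gmul A p q U x (y \<oplus>\<^bsub>gsec A q U\<^esub> y') =
         gmul A p q U x y \<oplus>\<^bsub>gsec A (p + q) U\<^esub> gmul A p q U x y'"
    and mul_smult_left: "\<lbrakk>openin (tp Y) U; r \<in> carrier (rsec Y U); x \<in> sec A p U; y \<in> sec A q U\<rbrakk> \<Longrightarrow>
       gmul A p q U (r \<odot>\<^bsub>gsec A p U\<^esub> x) y = r \<odot>\<^bsub>gsec A (p + q) U\<^esub> gmul A p q U x y"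
    and mul_smult_right: "\<lbrakk>openin (tp Y) U; r \<in> carrier (rsec Y U); x \<in> sec A p U; y \<in> sec A q U\<rbrakk> \<Longrightarrow>
       gmul A p q U x (r \<odot>\<^bsub>gsec A q U\<^esub> y) = r \<odot>\<^bsub>gsec A (p + q) U\<^esub> gmul A p q U x y"
    and mul_assoc: "\<lbrakk>openin (tp Y) U; x \<in> sec A p U; y \<in> sec A q U; z \<in> sec A n U\<rbrakk> \<Longrightarrow>
       gmul A (p + q) n U (gmul A p q U x y) z = gmul A p (q + n) U x (gmul A q n U y z)"
    and mul_graded_comm: "\<lbrakk>openin (tp Y) U; x \<in> sec A p U; y \<in> sec A q U\<rbrakk> \<Longrightarrow>
       gmul A p q U x y = signed (gsec A (p + q) U) (p * q) (gmul A q p U y x)"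
    and one_closed: "openin (tp Y) U \<Longrightarrow> gone A U \<in> sec A 0 U"
    and one_left: "\<lbrakk>openin (tp Y) U; x \<in> sec A p U\<rbrakk> \<Longrightarrow> gmul A 0 p U (gone A U) x = x"
    and mul_res: "\<lbrakk>openin (tp Y) U; openin (tp Y) V; V \<subseteq> U; x \<in> sec A p U; y \<in> sec A q U\<rbrakk> \<Longrightarrow>
       gres A (p + q) U V (gmul A p q U x y) = gmul A p q V (gres A p U V x) (gres A q U V y)"
    and one_res: "\<lbrakk>openin (tp Y) U; openin (tp Y) V; V \<subseteq> U\<rbrakk> \<Longrightarrow> gres A 0 U V (gone A U) = gone A V"
    and dif_closed: "\<lbrakk>openin (tp Y) U; x \<in> sec A p U\<rbrakk> \<Longrightarrow> gdif A p U x \<in> sec A (p + 1) U"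
    and dif_add: "\<lbrakk>openin (tp Y) U; x \<in> sec A p U; x' \<in> sec A p U\<rbrakk> \<Longrightarrow>
       gdif A p U (x \<oplus>\<^bsub>gsec A p U\<^esub> x') = gdif A p U x \<oplus>\<^bsub>gsec A (p + 1) U\<^esub> gdif A p U x'"
    and dif_smult: "\<lbrakk>openin (tp Y) U; r \<in> carrier (rsec Y U); x \<in> sec A p U\<rbrakk> \<Longrightarrow>
       gdif A p U (r \<odot>\<^bsub>gsec A p U\<^esub> x) = r \<odot>\<^bsub>gsec A (p + 1) U\<^esub> gdif A p U x"
    and dif_res: "\<lbrakk>openin (tp Y) U; openin (tp Y) V; V \<subseteq> U; x \<in> sec A p U\<rbrakk> \<Longrightarrow>
       gres A (p + 1) U V (gdif A p U x) = gdif A p V (gres A p U V x)"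
    and dif_dif: "\<lbrakk>openin (tp Y) U; x \<in> sec A p U\<rbrakk> \<Longrightarrow>
       gdif A (p + 1) U (gdif A p U x) = \<zero>\<^bsub>gsec A (p + 1 + 1) U\<^esub>"
    and dif_mul: "\<lbrakk>openin (tp Y) U; x \<in> sec A p U; y \<in> sec A q U\<rbrakk> \<Longrightarrow>
       gdif A (p + q) U (gmul A p q U x y) =
         gmul A (p + 1) q U (gdif A p U x) y \<oplus>\<^bsub>gsec A (p + q + 1) U\<^esub>
         signed (gsec A (p + q + 1) U) p (gmul A p (q + 1) U x (gdif A q U y))"

type_synonym ('a, 'm, 'n) family = "int \<Rightarrow> 'a set \<Rightarrow> 'm \<Rightarrow> 'n"

definition graded_alg_hom ::
    "('a, 'r, 'y) ringed_space_scheme \<Rightarrow> ('a, 'r, 'm) dgalg \<Rightarrow> ('a, 'r, 'n) dgalg \<Rightarrow>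
     ('a, 'm, 'n) family \<Rightarrow> bool" where
  "graded_alg_hom Y A B f \<longleftrightarrow>
     (\<forall>U. openin (tp Y) U \<longrightarrow>
        (\<forall>l. f l U \<in> sec A l U \<rightarrow> sec B l U) \<and>
        (\<forall>l. \<forall>x\<in>sec A l U. \<forall>x'\<in>sec A l U.
           f l U (x \<oplus>\<^bsub>gsec A l U\<^esub> x') = f l U x \<oplus>\<^bsub>gsec B l U\<^esub> f l U x') \<and>
        (\<forall>l. \<forall>r\<in>carrier (rsec Y U). \<forall>x\<in>sec A l U.
           f l U (r \<odot>\<^bsub>gsec A l U\<^esub> x) = r \<odot>\<^bsub>gsec B l U\<^esub> f l U x) \<and>
        (\<forall>p q. \<forall>x\<in>sec A p U. \<forall>y\<in>sec A q U.
           f (p + q) U (gmul A p q U x y) = gmul B p q U (f p U x) (f q U y)) \<and>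
        f 0 U (gone A U) = gone B U \<and>
        (\<forall>l V. openin (tp Y) V \<and> V \<subseteq> U \<longrightarrow>
           (\<forall>x\<in>sec A l U. f l V (gres A l U V x) = gres B l U V (f l U x))))"

definition dg_alg_hom ::
    "('a, 'r, 'y) ringed_space_scheme \<Rightarrow> ('a, 'r, 'm) dgalg \<Rightarrow> ('a, 'r, 'n) dgalg \<Rightarrow>
     ('a, 'm, 'n) family \<Rightarrow> bool" where
  "dg_alg_hom Y A B f \<longleftrightarrow>
     graded_alg_hom Y A B f \<and>
     (\<forall>U l. openin (tp Y) U \<longrightarrow> (\<forall>x\<in>sec A l U. f (l + 1) U (gdif A l U x) = gdif B l U (f l U x)))"

definition graded_alg_iso ::
    "('a, 'r, 'y) ringed_space_scheme \<Rightarrow> ('a, 'r, 'm) dgalg \<Rightarrow> ('a, 'r, 'n) dgalg \<Rightarrow>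
     ('a, 'm, 'n) family \<Rightarrow> bool" where
  "graded_alg_iso Y A B f \<longleftrightarrow>
     graded_alg_hom Y A B f \<and> (\<forall>l U. openin (tp Y) U \<longrightarrow> bij_betw (f l U) (sec A l U) (sec B l U))"

definition fcomp :: "('a, 'n, 'o) family \<Rightarrow> ('a, 'm, 'n) family \<Rightarrow> ('a, 'm, 'o) family"
    (infixl "\<circ>\<circ>\<circ>" 55) where
  "g \<circ>\<circ>\<circ> f = (\<lambda>l U x. g l U (f l U x))"

definition fid :: "('a, 'm, 'm) family" where
  "fid = (\<lambda>l U x. x)"

definition eq_on_sections ::
    "('a, 'r, 'y) ringed_space_scheme \<Rightarrow> ('a, 'r, 'm) dgalg \<Rightarrow>
     ('a, 'm, 'n) family \<Rightarrow> ('a, 'm, 'n) family \<Rightarrow> bool" where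
  "eq_on_sections Y A f g \<longleftrightarrow>
     (\<forall>l U. openin (tp Y) U \<longrightarrow> (\<forall>x\<in>sec A l U. f l U x = g l U x))"

text \<open>The map induced by \<open>f\<close> on cohomology sheaves is injective and surjective.\<close>

definition quasi_iso ::
    "('a, 'r, 'y) ringed_space_scheme \<Rightarrow> ('a, 'r, 'm) dgalg \<Rightarrow> ('a, 'r, 'n) dgalg \<Rightarrow>
     ('a, 'm, 'n) family \<Rightarrow> bool" where
  "quasi_iso Y A B f \<longleftrightarrow>
     (\<forall>l U x. openin (tp Y) U \<and> x \<in> sec A (l + 1) U \<and>
        gdif A (l + 1) U x = \<zero>\<^bsub>gsec A (l + 1 + 1) U\<^esub> \<and>
        (\<exists>y\<in>sec B l U. f (l + 1) U x = gdif B l U y) \<longrightarrow>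
        (\<forall>p\<in>U. \<exists>V. openin (tp Y) V \<and> p \<in> V \<and> V \<subseteq> U \<and>
           (\<exists>z\<in>sec A l V. gres A (l + 1) U V x = gdif A l V z))) \<and>
     (\<forall>l U y. openin (tp Y) U \<and> y \<in> sec B (l + 1) U \<and>
        gdif B (l + 1) U y = \<zero>\<^bsub>gsec B (l + 1 + 1) U\<^esub> \<longrightarrow>
        (\<forall>p\<in>U. \<exists>V. openin (tp Y) V \<and> p \<in> V \<and> V \<subseteq> U \<and>
           (\<exists>x\<in>sec A (l + 1) V. \<exists>z\<in>sec B l V. gdif A (l + 1) V x = \<zero>\<^bsub>gsec A (l + 1 + 1) V\<^esub> \<and>
              gres B (l + 1) U V y = f (l + 1) V x \<oplus>\<^bsub>gsec B (l + 1) V\<^esub> gdif B l V z)))"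

text \<open>A sheaf of rings \<open>R\<close>, with an algebra structure \<open>h\<close>, as a dg-algebra in degree 0.\<close>

definition concentrated ::
    "('a set \<Rightarrow> 's ring) \<Rightarrow> ('a set \<Rightarrow> 'a set \<Rightarrow> 's \<Rightarrow> 's) \<Rightarrow> ('a set \<Rightarrow> 'r \<Rightarrow> 's) \<Rightarrow>
     ('a, 'r, 's) dgalg" where
  "concentrated R rs h =
     \<lparr>gsec = (\<lambda>l U. \<lparr>carrier = (if l = 0 then carrier (R U) else {\<zero>\<^bsub>R U\<^esub>}),
                     monoid.mult = monoid.mult (R U), monoid.one = monoid.one (R U), ring.zero = ring.zero (R U), ring.add = ring.add (R U),
                     smult = (\<lambda>r x. h U r \<otimes>\<^bsub>R U\<^esub> x)\<rparr>),
      gres = (\<lambda>l. rs),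
      gmul = (\<lambda>p q U. monoid.mult (R U)),
      gone = (\<lambda>U. monoid.one (R U)),
      gdif = (\<lambda>l U x. ring.zero (R U))\<rparr>"

definition structure_alg :: "('a, 'r, 'y) ringed_space_scheme \<Rightarrow> ('a, 'r, 'r) dgalg" where
  "structure_alg Y = concentrated (rsec Y) (rres Y) (\<lambda>U r. r)"

definition unit_map ::
    "('a, 'r, 'y) ringed_space_scheme \<Rightarrow> ('a, 'r, 'm) dgalg \<Rightarrow> ('a, 'r, 'm) family" where
  "unit_map Y A = (\<lambda>l U r. if l = 0 then r \<odot>\<^bsub>gsec A 0 U\<^esub> gone A U else \<zero>\<^bsub>gsec A l U\<^esub>)"

definition direct_image ::
    "('x, 's, 'z) ringed_space_scheme \<Rightarrow> ('x \<Rightarrow> 'a) \<Rightarrow> ('a set \<Rightarrow> 'r \<Rightarrow> 's) \<Rightarrow> ('a, 'r, 's) dgalg" where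
  "direct_image Z i is =
     concentrated (\<lambda>V. rsec Z (pre Z i V)) (\<lambda>V W. rres Z (pre Z i V) (pre Z i W)) is"


section \<open>Sheafification, symmetric algebras and tensor products\<close>

definition ggerm ::
    "('a, 'r, 'y) ringed_space_scheme \<Rightarrow> ('a, 'r, 'p) dgalg \<Rightarrow> int \<Rightarrow> 'a \<Rightarrow> 'a set \<Rightarrow> 'p \<Rightarrow>
     ('a set \<times> 'p) set" where
  "ggerm Y P l = germ (tp Y) (sec P l) (gres P l)"

text \<open>Sections of the sheafification are the families of germs that locally come from a section of
  the presheaf; operations are germwise (as in the stalks above, the unions are unions of equal
  germs).\<close>

definition sheafify ::
    "('a, 'r, 'y) ringed_space_scheme \<Rightarrow> ('a, 'r, 'p) dgalg \<Rightarrow>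
     ('a, 'r, 'a \<Rightarrow> ('a set \<times> 'p) set) dgalg" where
  "sheafify Y P =
     \<lparr>gsec = (\<lambda>l U.
        \<lparr>carrier = {\<sigma> \<in> extensional U. \<forall>x\<in>U. \<exists>V s. openin (tp Y) V \<and> x \<in> V \<and> V \<subseteq> U \<and>
                      s \<in> sec P l V \<and> (\<forall>y\<in>V. \<sigma> y = ggerm Y P l y V s)},
         monoid.mult = undefined, monoid.one = undefined,
         ring.zero = (\<lambda>x\<in>U. ggerm Y P l x U \<zero>\<^bsub>gsec P l U\<^esub>),
         ring.add = (\<lambda>\<sigma> \<tau>. \<lambda>x\<in>U. \<Union>{ggerm Y P l x V (s \<oplus>\<^bsub>gsec P l V\<^esub> t) |V s t.
                  (V, s) \<in> \<sigma> x \<and> (V, t) \<in> \<tau> x}),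
         smult = (\<lambda>r \<sigma>. \<lambda>x\<in>U. \<Union>{ggerm Y P l x V (rres Y U V r \<odot>\<^bsub>gsec P l V\<^esub> s) |V s.
                  V \<subseteq> U \<and> (V, s) \<in> \<sigma> x})\<rparr>),
      gres = (\<lambda>l U V \<sigma>. restrict \<sigma> V),
      gmul = (\<lambda>p q U \<sigma> \<tau>. \<lambda>x\<in>U. \<Union>{ggerm Y P (p + q) x V (gmul P p q V s t) |V s t.
                  (V, s) \<in> \<sigma> x \<and> (V, t) \<in> \<tau> x}),
      gone = (\<lambda>U. \<lambda>x\<in>U. ggerm Y P 0 x U (gone P U)),
      gdif = (\<lambda>l U \<sigma>. \<lambda>x\<in>U. \<Union>{ggerm Y P (l + 1) x V (gdif P l V s) |V s. (V, s) \<in> \<sigma> x})\<rparr>"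

text \<open>The coset of \<open>z\<close> in the abelian group with generators \<open>S\<close> and relators \<open>Rel\<close>.\<close>

definition ab_relators :: "'g set \<Rightarrow> ('g \<Rightarrow>\<^sub>0 int) set \<Rightarrow> ('g \<Rightarrow>\<^sub>0 int) set" where
  "ab_relators S Rel = generate (free_Abelian_group S) Rel"

definition ab_coset :: "'g set \<Rightarrow> ('g \<Rightarrow>\<^sub>0 int) set \<Rightarrow> ('g \<Rightarrow>\<^sub>0 int) \<Rightarrow> ('g \<Rightarrow>\<^sub>0 int) set" where
  "ab_coset S Rel z = ab_relators S Rel #>\<^bsub>free_Abelian_group S\<^esub> z"

definition ab_quot :: "'g set \<Rightarrow> ('g \<Rightarrow>\<^sub>0 int) set \<Rightarrow> ('g \<Rightarrow>\<^sub>0 int) set monoid" where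
  "ab_quot S Rel = free_Abelian_group S Mod ab_relators S Rel"

subsection \<open>The graded symmetric algebra\<close>

text \<open>A generator \<open>(r, [(l\<^sub>1, x\<^sub>1), \<dots>, (l\<^sub>n, x\<^sub>n)])\<close> stands for the monomial \<open>r x\<^sub>1 \<cdots> x\<^sub>n\<close> with \<open>x\<^sub>i\<close>
  homogeneous of degree \<open>l\<^sub>i\<close>.  Since 2 is invertible, the commutation relations imply that squares
  of elements of odd degree vanish.\<close>

type_synonym ('r, 'm) smono = "'r \<times> (int \<times> 'm) list"

definition sym_gens ::
    "('a, 'r, 'y) ringed_space_scheme \<Rightarrow> ('a, 'r, 'm) gmod \<Rightarrow> int \<Rightarrow> 'a set \<Rightarrow> ('r, 'm) smono set" where
  "sym_gens Y M n U =
     {(r, w). r \<in> carrier (rsec Y U) \<and> (\<forall>(l, x)\<in>set w. x \<in> sec M l U) \<and> sum_list (map fst w) = n}"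

definition sym_rels ::
    "('a, 'r, 'y) ringed_space_scheme \<Rightarrow> ('a, 'r, 'm) gmod \<Rightarrow> int \<Rightarrow> 'a set \<Rightarrow>
     (('r, 'm) smono \<Rightarrow>\<^sub>0 int) set" where
  "sym_rels Y M n U =
     {frag_of (r \<oplus>\<^bsub>rsec Y U\<^esub> r', w) - frag_of (r, w) - frag_of (r', w) |r r' w.
        (r, w) \<in> sym_gens Y M n U \<and> (r', w) \<in> sym_gens Y M n U} \<union>
     {frag_of (r, u @ (l, x \<oplus>\<^bsub>gsec M l U\<^esub> x') # v) - frag_of (r, u @ (l, x) # v)
        - frag_of (r, u @ (l, x') # v) |r u l x x' v.
        (r, u @ (l, x) # v) \<in> sym_gens Y M n U \<and> (r, u @ (l, x') # v) \<in> sym_gens Y M n U} \<union>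
     {frag_of (r, u @ (l, c \<odot>\<^bsub>gsec M l U\<^esub> x) # v) - frag_of (r \<otimes>\<^bsub>rsec Y U\<^esub> c, u @ (l, x) # v) |r c u l x v.
        (r, u @ (l, x) # v) \<in> sym_gens Y M n U \<and> c \<in> carrier (rsec Y U)} \<union>
     {frag_of (r, u @ (l, x) # (m, y) # v)
        - frag_cmul (ksign (l * m)) (frag_of (r, u @ (m, y) # (l, x) # v)) |r u l x m y v.
        (r, u @ (l, x) # (m, y) # v) \<in> sym_gens Y M n U}"

abbreviation sym_coset where
  "sym_coset Y M n U \<equiv> ab_coset (sym_gens Y M n U) (sym_rels Y M n U)"

definition sym_presheaf ::
    "('a, 'r, 'y) ringed_space_scheme \<Rightarrow> ('a, 'r, 'm) gmod \<Rightarrow>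
     ('a, 'r, (('r, 'm) smono \<Rightarrow>\<^sub>0 int) set) dgalg" where
  "sym_presheaf Y M =
     \<lparr>gsec = (\<lambda>n U. let Q = ab_quot (sym_gens Y M n U) (sym_rels Y M n U) in
        \<lparr>carrier = carrier Q, monoid.mult = undefined, monoid.one = undefined, ring.zero = monoid.one Q, ring.add = monoid.mult Q,
         smult = (\<lambda>c S. \<Union>z\<in>S. sym_coset Y M n U
                   (frag_extend (\<lambda>(r, w). frag_of (c \<otimes>\<^bsub>rsec Y U\<^esub> r, w)) z))\<rparr>),
      gres = (\<lambda>n U V S. \<Union>z\<in>S. sym_coset Y M n V
                (frag_extend (\<lambda>(r, w). frag_of (rres Y U V r, map (\<lambda>(l, x). (l, gres M l U V x)) w)) z)),
      gmul = (\<lambda>m n U S T. \<Union>z\<in>S. \<Union>z'\<in>T. sym_coset Y M (m + n) U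
                (frag_extend (\<lambda>(r, w). frag_extend (\<lambda>(r', w').
                   frag_of (r \<otimes>\<^bsub>rsec Y U\<^esub> r', w @ w')) z') z)),
      gone = (\<lambda>U. sym_coset Y M 0 U (frag_of (\<one>\<^bsub>rsec Y U\<^esub>, []))),
      gdif = (\<lambda>n U S. monoid.one (ab_quot (sym_gens Y M (n + 1) U) (sym_rels Y M (n + 1) U)))\<rparr>"

text \<open>The graded symmetric algebra of \<open>M\<close>, with zero differential.\<close>

definition symmetric_algebra ::
    "('a, 'r, 'y) ringed_space_scheme \<Rightarrow> ('a, 'r, 'm) gmod \<Rightarrow>
     ('a, 'r, 'a \<Rightarrow> ('a set \<times> (('r, 'm) smono \<Rightarrow>\<^sub>0 int) set) set) dgalg" where
  "symmetric_algebra Y M = sheafify Y (sym_presheaf Y M)"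

subsection \<open>Tensor products\<close>

text \<open>\<open>B \<otimes>\<^sub>A C\<close> for homomorphisms \<open>f : A \<rightarrow> B\<close> and \<open>g : A \<rightarrow> C\<close>.  A generator \<open>((p, b), (q, c))\<close> stands
  for \<open>b \<otimes> c\<close> with \<open>b\<close> of degree \<open>p\<close> and \<open>c\<close> of degree \<open>q\<close>.\<close>

type_synonym ('b, 'c) tgen = "(int \<times> 'b) \<times> (int \<times> 'c)"
type_synonym ('a, 'b, 'c) tsec = "'a \<Rightarrow> ('a set \<times> (('b, 'c) tgen \<Rightarrow>\<^sub>0 int) set) set"

definition ten_gens ::
    "('a, 'r, 'b) dgalg \<Rightarrow> ('a, 'r, 'c) dgalg \<Rightarrow> int \<Rightarrow> 'a set \<Rightarrow> ('b, 'c) tgen set" where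
  "ten_gens B C n U = {((p, b), (q, c)) |p b q c. p + q = n \<and> b \<in> sec B p U \<and> c \<in> sec C q U}"

definition ten_rels ::
    "('a, 'r, 'm) dgalg \<Rightarrow> ('a, 'r, 'b) dgalg \<Rightarrow> ('a, 'm, 'b) family \<Rightarrow>
     ('a, 'r, 'c) dgalg \<Rightarrow> ('a, 'm, 'c) family \<Rightarrow> int \<Rightarrow> 'a set \<Rightarrow> (('b, 'c) tgen \<Rightarrow>\<^sub>0 int) set" where
  "ten_rels A B f C g n U =
     {frag_of ((p, b \<oplus>\<^bsub>gsec B p U\<^esub> b'), (q, c)) - frag_of ((p, b), (q, c)) - frag_of ((p, b'), (q, c)) |p b b' q c.
        p + q = n \<and> b \<in> sec B p U \<and> b' \<in> sec B p U \<and> c \<in> sec C q U} \<union>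
     {frag_of ((p, b), (q, c \<oplus>\<^bsub>gsec C q U\<^esub> c')) - frag_of ((p, b), (q, c)) - frag_of ((p, b), (q, c')) |p b q c c'.
        p + q = n \<and> b \<in> sec B p U \<and> c \<in> sec C q U \<and> c' \<in> sec C q U} \<union>
     {frag_of ((p + j, gmul B p j U b (f j U a)), (q, c))
        - frag_of ((p, b), (j + q, gmul C j q U (g j U a) c)) |p b j a q c.
        p + j + q = n \<and> b \<in> sec B p U \<and> a \<in> sec A j U \<and> c \<in> sec C q U}"

abbreviation ten_coset where
  "ten_coset A B f C g n U \<equiv> ab_coset (ten_gens B C n U) (ten_rels A B f C g n U)"

definition ten_presheaf ::
    "('a, 'r, 'y) ringed_space_scheme \<Rightarrow> ('a, 'r, 'm) dgalg \<Rightarrow> ('a, 'r, 'b) dgalg \<Rightarrow> ('a, 'm, 'b) family \<Rightarrow>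
     ('a, 'r, 'c) dgalg \<Rightarrow> ('a, 'm, 'c) family \<Rightarrow> ('a, 'r, (('b, 'c) tgen \<Rightarrow>\<^sub>0 int) set) dgalg" where
  "ten_presheaf Y A B f C g =
     \<lparr>gsec = (\<lambda>n U. let Q = ab_quot (ten_gens B C n U) (ten_rels A B f C g n U) in
        \<lparr>carrier = carrier Q, monoid.mult = undefined, monoid.one = undefined, ring.zero = monoid.one Q, ring.add = monoid.mult Q,
         smult = (\<lambda>r S. \<Union>z\<in>S. ten_coset A B f C g n U
                   (frag_extend (\<lambda>((p, b), (q, c)). frag_of ((p, r \<odot>\<^bsub>gsec B p U\<^esub> b), (q, c))) z))\<rparr>),
      gres = (\<lambda>n U V S. \<Union>z\<in>S. ten_coset A B f C g n V
                (frag_extend (\<lambda>((p, b), (q, c)). frag_of ((p, gres B p U V b), (q, gres C q U V c))) z)),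
      gmul = (\<lambda>m n U S T. \<Union>z\<in>S. \<Union>z'\<in>T. ten_coset A B f C g (m + n) U
                (frag_extend (\<lambda>((p, b), (q, c)). frag_extend (\<lambda>((p', b'), (q', c')).
                   frag_cmul (ksign (q * p'))
                     (frag_of ((p + p', gmul B p p' U b b'), (q + q', gmul C q q' U c c')))) z') z)),
      gone = (\<lambda>U. ten_coset A B f C g 0 U (frag_of ((0, gone B U), (0, gone C U)))),
      gdif = (\<lambda>n U S. \<Union>z\<in>S. ten_coset A B f C g (n + 1) U
                (frag_extend (\<lambda>((p, b), (q, c)).
                   frag_of ((p + 1, gdif B p U b), (q, c)) +
                   frag_cmul (ksign p) (frag_of ((p, b), (q + 1, gdif C q U c)))) z))\<rparr>"

definition tensor ::
    "('a, 'r, 'y) ringed_space_scheme \<Rightarrow> ('a, 'r, 'm) dgalg \<Rightarrow> ('a, 'r, 'b) dgalg \<Rightarrow> ('a, 'm, 'b) family \<Rightarrow>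
     ('a, 'r, 'c) dgalg \<Rightarrow> ('a, 'm, 'c) family \<Rightarrow> ('a, 'r, ('a, 'b, 'c) tsec) dgalg" where
  "tensor Y A B f C g = sheafify Y (ten_presheaf Y A B f C g)"

definition incl1 ::
    "('a, 'r, 'y) ringed_space_scheme \<Rightarrow> ('a, 'r, 'm) dgalg \<Rightarrow> ('a, 'r, 'b) dgalg \<Rightarrow> ('a, 'm, 'b) family \<Rightarrow>
     ('a, 'r, 'c) dgalg \<Rightarrow> ('a, 'm, 'c) family \<Rightarrow> ('a, 'b, ('a, 'b, 'c) tsec) family" where
  "incl1 Y A B f C g = (\<lambda>l U b. \<lambda>x\<in>U. ggerm Y (ten_presheaf Y A B f C g) l x U
      (ten_coset A B f C g l U (frag_of ((l, b), (0, gone C U)))))"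

definition incl2 ::
    "('a, 'r, 'y) ringed_space_scheme \<Rightarrow> ('a, 'r, 'm) dgalg \<Rightarrow> ('a, 'r, 'b) dgalg \<Rightarrow> ('a, 'm, 'b) family \<Rightarrow>
     ('a, 'r, 'c) dgalg \<Rightarrow> ('a, 'm, 'c) family \<Rightarrow> ('a, 'c, ('a, 'b, 'c) tsec) family" where
  "incl2 Y A B f C g = (\<lambda>l U c. \<lambda>x\<in>U. ggerm Y (ten_presheaf Y A B f C g) l x U
      (ten_coset A B f C g l U (frag_of ((0, gone B U), (l, c)))))"

text \<open>The homomorphism from \<open>B \<otimes>\<^sub>A C\<close> to \<open>D\<close> with components \<open>h\<close> and \<open>k\<close>.  By the universal property
  its values on sections are unique as soon as \<open>h \<circ> f = k \<circ> g\<close>.\<close>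

definition copair ::
    "('a, 'r, 'y) ringed_space_scheme \<Rightarrow> ('a, 'r, 'm) dgalg \<Rightarrow> ('a, 'r, 'b) dgalg \<Rightarrow> ('a, 'm, 'b) family \<Rightarrow>
     ('a, 'r, 'c) dgalg \<Rightarrow> ('a, 'm, 'c) family \<Rightarrow> ('a, 'r, 'd) dgalg \<Rightarrow>
     ('a, 'b, 'd) family \<Rightarrow> ('a, 'c, 'd) family \<Rightarrow> ('a, ('a, 'b, 'c) tsec, 'd) family" where
  "copair Y A B f C g D h k = (SOME u. dg_alg_hom Y (tensor Y A B f C g) D u \<and>
      eq_on_sections Y B (u \<circ>\<circ>\<circ> incl1 Y A B f C g) h \<and> eq_on_sections Y C (u \<circ>\<circ>\<circ> incl2 Y A B f C g) k)"


section \<open>Smooth resolutions\<close>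

text \<open>\<open>E\<close> is graded by cohomological degree.  The derivation \<open>Q\<close> is the differential of \<open>A\<close>, and \<open>\<theta>\<close>
  identifies \<open>A\<close>, without differential, with the symmetric algebra of \<open>E[1]\<close>.  The
  quasi-isomorphism \<open>\<epsilon>\<close> is the map \<open>j\<close>; that it is a homomorphism of algebras over the structure
  sheaf of \<open>Y\<close> says that \<open>\<pi> \<circ> j = i\<close>.\<close>

definition smooth_resolution ::
    "('x, 's, 'z) ringed_space_scheme \<Rightarrow> ('a, 'r, 'y) ringed_space_scheme \<Rightarrow>
     ('x \<Rightarrow> 'a) \<Rightarrow> ('a set \<Rightarrow> 'r \<Rightarrow> 's) \<Rightarrow> ('a, 'r, 'e) gmod \<Rightarrow> ('a, 'r, 'm) dgalg \<Rightarrow>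
     ('a, 'a \<Rightarrow> ('a set \<times> (('r, 'e) smono \<Rightarrow>\<^sub>0 int) set) set, 'm) family \<Rightarrow> ('a, 'm, 's) family \<Rightarrow> bool" where
  "smooth_resolution Z Y i is E A \<theta> \<epsilon> \<longleftrightarrow>
     graded_module_sheaf Y E \<and>
     (\<forall>l U. l > 0 \<and> openin (tp Y) U \<longrightarrow> sec E l U = {\<zero>\<^bsub>gsec E l U\<^esub>}) \<and>
     (\<forall>l. locally_free_finite Y E l) \<and>
     dg_algebra_sheaf Y A \<and>
     graded_alg_iso Y (symmetric_algebra Y (shift E 1)) A \<theta> \<and>
     dg_alg_hom Y A (direct_image Z i is) \<epsilon> \<and>
     quasi_iso Y A (direct_image Z i is) \<epsilon>"


section \<open>Sheaves of derivations\<close>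

text \<open>A section over \<open>U\<close> of a sheaf of homomorphisms is a family of maps on the sections over the
  open subsets of \<open>U\<close>; it is made extensional so that equality of families is equality of sections.\<close>

definition ext_fam ::
    "('a, 'r, 'y) ringed_space_scheme \<Rightarrow> ('a, 'r, 'm) dgalg \<Rightarrow> 'a set \<Rightarrow>
     ('a, 'm, 'n) family \<Rightarrow> ('a, 'm, 'n) family" where
  "ext_fam Y A U h = (\<lambda>l V x. if openin (tp Y) V \<and> V \<subseteq> U \<and> x \<in> sec A l V then h l V x else undefined)"

text \<open>Derivations of degree \<open>d\<close> from \<open>A\<close> to \<open>B\<close> along \<open>\<phi> : A \<rightarrow> B\<close>, restricted to \<open>U\<close>.\<close>

definition derivations ::
    "('a, 'r, 'y) ringed_space_scheme \<Rightarrow> ('a, 'r, 'm) dgalg \<Rightarrow> ('a, 'r, 'n) dgalg \<Rightarrow>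
     ('a, 'm, 'n) family \<Rightarrow> int \<Rightarrow> 'a set \<Rightarrow> ('a, 'm, 'n) family set" where
  "derivations Y A B \<phi> d U = {D. ext_fam Y A U D = D \<and>
     (\<forall>V. openin (tp Y) V \<and> V \<subseteq> U \<longrightarrow>
        (\<forall>l. D l V \<in> sec A l V \<rightarrow> sec B (l + d) V) \<and>
        (\<forall>l. \<forall>x\<in>sec A l V. \<forall>x'\<in>sec A l V.
           D l V (x \<oplus>\<^bsub>gsec A l V\<^esub> x') = D l V x \<oplus>\<^bsub>gsec B (l + d) V\<^esub> D l V x') \<and>
        (\<forall>p q. \<forall>x\<in>sec A p V. \<forall>y\<in>sec A q V.
           D (p + q) V (gmul A p q V x y) =
             gmul B (p + d) q V (D p V x) (\<phi> q V y) \<oplus>\<^bsub>gsec B (p + q + d) V\<^esub>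
             signed (gsec B (p + q + d) V) (d * p) (gmul B p (q + d) V (\<phi> p V x) (D q V y))) \<and>
        (\<forall>l W. openin (tp Y) W \<and> W \<subseteq> V \<longrightarrow>
           (\<forall>x\<in>sec A l V. D l W (gres A l V W x) = gres B (l + d) V W (D l V x))))}"

definition O_derivations ::
    "('a, 'r, 'y) ringed_space_scheme \<Rightarrow> ('a, 'r, 'm) dgalg \<Rightarrow> ('a, 'r, 'n) dgalg \<Rightarrow>
     ('a, 'm, 'n) family \<Rightarrow> int \<Rightarrow> 'a set \<Rightarrow> ('a, 'm, 'n) family set" where
  "O_derivations Y A B \<phi> d U = {D \<in> derivations Y A B \<phi> d U.
     \<forall>l V. openin (tp Y) V \<and> V \<subseteq> U \<longrightarrow> (\<forall>r\<in>carrier (rsec Y V). \<forall>x\<in>sec A l V.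
        D l V (r \<odot>\<^bsub>gsec A l V\<^esub> x) = r \<odot>\<^bsub>gsec B (l + d) V\<^esub> D l V x)}"

definition k_derivations ::
    "'k ring \<Rightarrow> ('a, 'r, 'k) kspace \<Rightarrow> ('a, 'r, 'm) dgalg \<Rightarrow> int \<Rightarrow> 'a set \<Rightarrow> ('a, 'm, 'm) family set" where
  "k_derivations K Y A d U = {D \<in> derivations Y A A fid d U.
     \<forall>l V. openin (tp Y) V \<and> V \<subseteq> U \<longrightarrow> (\<forall>c\<in>carrier K. \<forall>x\<in>sec A l V.
        D l V (scal Y V c \<odot>\<^bsub>gsec A l V\<^esub> x) = scal Y V c \<odot>\<^bsub>gsec A (l + d) V\<^esub> D l V x)}"

text \<open>Operations on families with values in \<open>B\<close>; \<open>fam_act\<close> is multiplication by a section of degree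
  \<open>p\<close> of \<open>B\<close> over \<open>U\<close>.\<close>

definition fam_add where
  "fam_add Y A B d U D D' = ext_fam Y A U (\<lambda>l V x. D l V x \<oplus>\<^bsub>gsec B (l + d) V\<^esub> D' l V x)"

definition fam_zero where
  "fam_zero Y A B d U = ext_fam Y A U (\<lambda>l V x. \<zero>\<^bsub>gsec B (l + d) V\<^esub>)"

definition fam_smult where
  "fam_smult Y A B d U r D = ext_fam Y A U (\<lambda>l V x. rres Y U V r \<odot>\<^bsub>gsec B (l + d) V\<^esub> D l V x)"

definition fam_act where
  "fam_act Y A B p d U a D = ext_fam Y A U (\<lambda>l V x. gmul B p (l + d) V (gres B p U V a) (D l V x))"

definition fam_commutator ::
    "('a, 'r, 'y) ringed_space_scheme \<Rightarrow> ('a, 'r, 'm) dgalg \<Rightarrow> int \<Rightarrow> int \<Rightarrow> 'a set \<Rightarrow>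
     ('a, 'm, 'm) family \<Rightarrow> ('a, 'm, 'm) family \<Rightarrow> ('a, 'm, 'm) family" where
  "fam_commutator Y A d e U D D' = ext_fam Y A U (\<lambda>l V x.
     D (l + e) V (D' l V x) \<ominus>\<^bsub>gsec A (l + d + e) V\<^esub>
     signed (gsec A (l + d + e) V) (d * e) (D' (l + d) V (D l V x)))"

definition fam_module ::
    "('a, 'r, 'y) ringed_space_scheme \<Rightarrow> ('a, 'r, 'm) dgalg \<Rightarrow> ('a, 'r, 'n) dgalg \<Rightarrow>
     (int \<Rightarrow> 'a set \<Rightarrow> ('a, 'm, 'n) family set) \<Rightarrow> int \<Rightarrow> 'a set \<Rightarrow> ('r, ('a, 'm, 'n) family) module" where
  "fam_module Y A B C d U =
     \<lparr>carrier = C d U, monoid.mult = undefined, monoid.one = undefined, ring.zero = fam_zero Y A B d U,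
      ring.add = fam_add Y A B d U, smult = fam_smult Y A B d U\<rparr>"


section \<open>dg-Lie algebroids\<close>

text \<open>The sheaf \<open>g\<close> of a pair \<open>(A, g)\<close>: module structure over \<open>A\<close>, bracket, differential and anchor,
  the latter with values in the sheaf of derivations of \<open>A\<close>.\<close>

record ('a, 'r, 'm, 'g) algebroid = "('a, 'r, 'g) gmod" +
  lact :: "int \<Rightarrow> int \<Rightarrow> 'a set \<Rightarrow> 'm \<Rightarrow> 'g \<Rightarrow> 'g"
  lbr :: "int \<Rightarrow> int \<Rightarrow> 'a set \<Rightarrow> 'g \<Rightarrow> 'g \<Rightarrow> 'g"
  ldif :: "int \<Rightarrow> 'a set \<Rightarrow> 'g \<Rightarrow> 'g"
  lanc :: "int \<Rightarrow> 'a set \<Rightarrow> 'g \<Rightarrow> ('a, 'm, 'm) family"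

text \<open>Since \<open>A\<close> is an algebra over the structure sheaf of \<open>Y\<close>, every \<open>A\<close>-module is also a module over
  that sheaf (\<open>smult_act\<close>); a priori the bracket is only linear over \<open>K\<close>.\<close>

locale dg_lie_algebroid = alg: dg_algebra_sheaf Y A + mod: graded_module_sheaf Y g
  for K :: "'k ring" and Y :: "('a, 'r, 'k) kspace" and A :: "('a, 'r, 'm) dgalg"
    and g :: "('a, 'r, 'm, 'g) algebroid" +
  assumes act_closed: "\<lbrakk>openin (tp Y) U; a \<in> sec A p U; x \<in> sec g d U\<rbrakk> \<Longrightarrow>
       lact g p d U a x \<in> sec g (p + d) U"
    and act_add_left: "\<lbrakk>openin (tp Y) U; a \<in> sec A p U; b \<in> sec A p U; x \<in> sec g d U\<rbrakk> \<Longrightarrow>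
       lact g p d U (a \<oplus>\<^bsub>gsec A p U\<^esub> b) x = lact g p d U a x \<oplus>\<^bsub>gsec g (p + d) U\<^esub> lact g p d U b x"
    and act_add_right: "\<lbrakk>openin (tp Y) U; a \<in> sec A p U; x \<in> sec g d U; y \<in> sec g d U\<rbrakk> \<Longrightarrow>
       lact g p d U a (x \<oplus>\<^bsub>gsec g d U\<^esub> y) = lact g p d U a x \<oplus>\<^bsub>gsec g (p + d) U\<^esub> lact g p d U a y"
    and act_assoc: "\<lbrakk>openin (tp Y) U; a \<in> sec A p U; b \<in> sec A q U; x \<in> sec g d U\<rbrakk> \<Longrightarrow>
       lact g (p + q) d U (gmul A p q U a b) x = lact g p (q + d) U a (lact g q d U b x)"
    and act_one: "\<lbrakk>openin (tp Y) U; x \<in> sec g d U\<rbrakk> \<Longrightarrow> lact g 0 d U (gone A U) x = x"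
    and smult_act: "\<lbrakk>openin (tp Y) U; r \<in> carrier (rsec Y U); x \<in> sec g d U\<rbrakk> \<Longrightarrow>
       r \<odot>\<^bsub>gsec g d U\<^esub> x = lact g 0 d U (r \<odot>\<^bsub>gsec A 0 U\<^esub> gone A U) x"
    and act_res: "\<lbrakk>openin (tp Y) U; openin (tp Y) V; V \<subseteq> U; a \<in> sec A p U; x \<in> sec g d U\<rbrakk> \<Longrightarrow>
       gres g (p + d) U V (lact g p d U a x) = lact g p d V (gres A p U V a) (gres g d U V x)"
    and dif_closed: "\<lbrakk>openin (tp Y) U; x \<in> sec g d U\<rbrakk> \<Longrightarrow> ldif g d U x \<in> sec g (d + 1) U"
    and dif_add: "\<lbrakk>openin (tp Y) U; x \<in> sec g d U; y \<in> sec g d U\<rbrakk> \<Longrightarrow>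
       ldif g d U (x \<oplus>\<^bsub>gsec g d U\<^esub> y) = ldif g d U x \<oplus>\<^bsub>gsec g (d + 1) U\<^esub> ldif g d U y"
    and dif_scal: "\<lbrakk>openin (tp Y) U; c \<in> carrier K; x \<in> sec g d U\<rbrakk> \<Longrightarrow>
       ldif g d U (scal Y U c \<odot>\<^bsub>gsec g d U\<^esub> x) = scal Y U c \<odot>\<^bsub>gsec g (d + 1) U\<^esub> ldif g d U x"
    and dif_res: "\<lbrakk>openin (tp Y) U; openin (tp Y) V; V \<subseteq> U; x \<in> sec g d U\<rbrakk> \<Longrightarrow>
       gres g (d + 1) U V (ldif g d U x) = ldif g d V (gres g d U V x)"
    and dif_dif: "\<lbrakk>openin (tp Y) U; x \<in> sec g d U\<rbrakk> \<Longrightarrow>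
       ldif g (d + 1) U (ldif g d U x) = \<zero>\<^bsub>gsec g (d + 1 + 1) U\<^esub>"
    and dif_act: "\<lbrakk>openin (tp Y) U; a \<in> sec A p U; x \<in> sec g d U\<rbrakk> \<Longrightarrow>
       ldif g (p + d) U (lact g p d U a x) =
         lact g (p + 1) d U (gdif A p U a) x \<oplus>\<^bsub>gsec g (p + d + 1) U\<^esub>
         signed (gsec g (p + d + 1) U) p (lact g p (d + 1) U a (ldif g d U x))"
    and br_closed: "\<lbrakk>openin (tp Y) U; x \<in> sec g d U; y \<in> sec g e U\<rbrakk> \<Longrightarrow>
       lbr g d e U x y \<in> sec g (d + e) U"
    and br_add_left: "\<lbrakk>openin (tp Y) U; x \<in> sec g d U; x' \<in> sec g d U; y \<in> sec g e U\<rbrakk> \<Longrightarrow>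
       lbr g d e U (x \<oplus>\<^bsub>gsec g d U\<^esub> x') y = lbr g d e U x y \<oplus>\<^bsub>gsec g (d + e) U\<^esub> lbr g d e U x' y"
    and br_add_right: "\<lbrakk>openin (tp Y) U; x \<in> sec g d U; y \<in> sec g e U; y' \<in> sec g e U\<rbrakk> \<Longrightarrow>
       lbr g d e U x (y \<oplus>\<^bsub>gsec g e U\<^esub> y') = lbr g d e U x y \<oplus>\<^bsub>gsec g (d + e) U\<^esub> lbr g d e U x y'"
    and br_scal_left: "\<lbrakk>openin (tp Y) U; c \<in> carrier K; x \<in> sec g d U; y \<in> sec g e U\<rbrakk> \<Longrightarrow>
       lbr g d e U (scal Y U c \<odot>\<^bsub>gsec g d U\<^esub> x) y = scal Y U c \<odot>\<^bsub>gsec g (d + e) U\<^esub> lbr g d e U x y"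
    and br_scal_right: "\<lbrakk>openin (tp Y) U; c \<in> carrier K; x \<in> sec g d U; y \<in> sec g e U\<rbrakk> \<Longrightarrow>
       lbr g d e U x (scal Y U c \<odot>\<^bsub>gsec g e U\<^esub> y) = scal Y U c \<odot>\<^bsub>gsec g (d + e) U\<^esub> lbr g d e U x y"
    and br_res: "\<lbrakk>openin (tp Y) U; openin (tp Y) V; V \<subseteq> U; x \<in> sec g d U; y \<in> sec g e U\<rbrakk> \<Longrightarrow>
       gres g (d + e) U V (lbr g d e U x y) = lbr g d e V (gres g d U V x) (gres g e U V y)"
    and br_antisym: "\<lbrakk>openin (tp Y) U; x \<in> sec g d U; y \<in> sec g e U\<rbrakk> \<Longrightarrow>
       lbr g d e U x y = \<ominus>\<^bsub>gsec g (d + e) U\<^esub> signed (gsec g (d + e) U) (d * e) (lbr g e d U y x)"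
    and br_jacobi: "\<lbrakk>openin (tp Y) U; x \<in> sec g d U; y \<in> sec g e U; z \<in> sec g n U\<rbrakk> \<Longrightarrow>
       lbr g d (e + n) U x (lbr g e n U y z) =
         lbr g (d + e) n U (lbr g d e U x y) z \<oplus>\<^bsub>gsec g (d + e + n) U\<^esub>
         signed (gsec g (d + e + n) U) (d * e) (lbr g e (d + n) U y (lbr g d n U x z))"
    and dif_br: "\<lbrakk>openin (tp Y) U; x \<in> sec g d U; y \<in> sec g e U\<rbrakk> \<Longrightarrow>
       ldif g (d + e) U (lbr g d e U x y) =
         lbr g (d + 1) e U (ldif g d U x) y \<oplus>\<^bsub>gsec g (d + e + 1) U\<^esub>
         signed (gsec g (d + e + 1) U) d (lbr g d (e + 1) U x (ldif g e U y))"
    and anc_closed: "\<lbrakk>openin (tp Y) U; x \<in> sec g d U\<rbrakk> \<Longrightarrow> lanc g d U x \<in> k_derivations K Y A d U"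
    and anc_res: "\<lbrakk>openin (tp Y) U; openin (tp Y) V; V \<subseteq> U; x \<in> sec g d U\<rbrakk> \<Longrightarrow>
       lanc g d V (gres g d U V x) = ext_fam Y A V (lanc g d U x)"
    and anc_add: "\<lbrakk>openin (tp Y) U; x \<in> sec g d U; y \<in> sec g d U\<rbrakk> \<Longrightarrow>
       lanc g d U (x \<oplus>\<^bsub>gsec g d U\<^esub> y) = fam_add Y A A d U (lanc g d U x) (lanc g d U y)"
    and anc_act: "\<lbrakk>openin (tp Y) U; a \<in> sec A p U; x \<in> sec g d U\<rbrakk> \<Longrightarrow>
       lanc g (p + d) U (lact g p d U a x) = fam_act Y A A p d U a (lanc g d U x)"
    and anc_br: "\<lbrakk>openin (tp Y) U; x \<in> sec g d U; y \<in> sec g e U\<rbrakk> \<Longrightarrow>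
       lanc g (d + e) U (lbr g d e U x y) = fam_commutator Y A d e U (lanc g d U x) (lanc g e U y)"
    and anc_dif: "\<lbrakk>openin (tp Y) U; x \<in> sec g d U\<rbrakk> \<Longrightarrow>
       lanc g (d + 1) U (ldif g d U x) = fam_commutator Y A 1 d U (gdif A) (lanc g d U x)"
    and leibniz: "\<lbrakk>openin (tp Y) U; a \<in> sec A p U; x \<in> sec g d U; y \<in> sec g e U\<rbrakk> \<Longrightarrow>
       lbr g d (p + e) U x (lact g p e U a y) =
         lact g (p + d) e U (lanc g d U x p U a) y \<oplus>\<^bsub>gsec g (p + d + e) U\<^esub>
         signed (gsec g (p + d + e) U) (p * d) (lact g p (d + e) U a (lbr g d e U x y))"

locale dg_lie_algebroid_over_OY = dg_lie_algebroid +
  assumes br_smult_left: "\<lbrakk>openin (tp Y) U; r \<in> carrier (rsec Y U); x \<in> sec g d U; y \<in> sec g e U\<rbrakk> \<Longrightarrow>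
       lbr g d e U (r \<odot>\<^bsub>gsec g d U\<^esub> x) y = r \<odot>\<^bsub>gsec g (d + e) U\<^esub> lbr g d e U x y"
    and br_smult_right: "\<lbrakk>openin (tp Y) U; r \<in> carrier (rsec Y U); x \<in> sec g d U; y \<in> sec g e U\<rbrakk> \<Longrightarrow>
       lbr g d e U x (r \<odot>\<^bsub>gsec g e U\<^esub> y) = r \<odot>\<^bsub>gsec g (d + e) U\<^esub> lbr g d e U x y"
    and anc_linear: "\<lbrakk>openin (tp Y) U; x \<in> sec g d U\<rbrakk> \<Longrightarrow> lanc g d U x \<in> O_derivations Y A A fid d U"

text \<open>Isomorphisms from \<open>(A, g)\<close> to \<open>(A, h)\<close> that are the identity on \<open>A\<close>.\<close>

definition algebroid_iso ::
    "('a, 'r, 'y) ringed_space_scheme \<Rightarrow> ('a, 'r, 'm) dgalg \<Rightarrow> ('a, 'r, 'm, 'g) algebroid \<Rightarrow>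
     ('a, 'r, 'm, 'h) algebroid \<Rightarrow> ('a, 'g, 'h) family \<Rightarrow> bool" where
  "algebroid_iso Y A g h \<phi> \<longleftrightarrow>
     (\<forall>U. openin (tp Y) U \<longrightarrow>
        (\<forall>d. bij_betw (\<phi> d U) (sec g d U) (sec h d U)) \<and>
        (\<forall>d. \<forall>x\<in>sec g d U. \<forall>y\<in>sec g d U.
           \<phi> d U (x \<oplus>\<^bsub>gsec g d U\<^esub> y) = \<phi> d U x \<oplus>\<^bsub>gsec h d U\<^esub> \<phi> d U y) \<and>
        (\<forall>d. \<forall>r\<in>carrier (rsec Y U). \<forall>x\<in>sec g d U.
           \<phi> d U (r \<odot>\<^bsub>gsec g d U\<^esub> x) = r \<odot>\<^bsub>gsec h d U\<^esub> \<phi> d U x) \<and>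
        (\<forall>p d. \<forall>a\<in>sec A p U. \<forall>x\<in>sec g d U.
           \<phi> (p + d) U (lact g p d U a x) = lact h p d U a (\<phi> d U x)) \<and>
        (\<forall>d e. \<forall>x\<in>sec g d U. \<forall>y\<in>sec g e U.
           \<phi> (d + e) U (lbr g d e U x y) = lbr h d e U (\<phi> d U x) (\<phi> e U y)) \<and>
        (\<forall>d. \<forall>x\<in>sec g d U. \<phi> (d + 1) U (ldif g d U x) = ldif h d U (\<phi> d U x)) \<and>
        (\<forall>d. \<forall>x\<in>sec g d U. lanc h d U (\<phi> d U x) = lanc g d U x) \<and>
        (\<forall>d V. openin (tp Y) V \<and> V \<subseteq> U \<longrightarrow>
           (\<forall>x\<in>sec g d U. \<phi> d V (gres g d U V x) = gres h d U V (\<phi> d U x))))"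

definition relative_tangent ::
    "('a, 'r, 'y) ringed_space_scheme \<Rightarrow> ('a, 'r, 'm) dgalg \<Rightarrow>
     ('a, 'r, 'm, ('a, 'm, 'm) family) algebroid" where
  "relative_tangent Y A =
     \<lparr>gsec = fam_module Y A A (O_derivations Y A A fid),
      gres = (\<lambda>d U V D. ext_fam Y A V D),
      lact = fam_act Y A A,
      lbr = fam_commutator Y A,
      ldif = (\<lambda>d U D. fam_commutator Y A 1 d U (gdif A) D),
      lanc = (\<lambda>d U D. D)\<rparr>"


section \<open>Groupoids in dg-schemes over \<open>Y\<close>\<close>

text \<open>A dg-scheme over \<open>Y\<close> with underlying scheme \<open>Y\<close> is given by its structure sheaf, a sheaf of
  dg-algebras over the structure sheaf of \<open>Y\<close>; a morphism \<open>M \<rightarrow> N\<close> over \<open>Y\<close> is a homomorphism in the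
  opposite direction, and fibre products are tensor products.  All maps below are these
  homomorphisms.\<close>

record ('a, 'r, 'm, 'g) groupoid =
  obj :: "('a, 'r, 'm) dgalg"
  arr :: "('a, 'r, 'g) dgalg"
  src :: "('a, 'm, 'g) family"
  tgt :: "('a, 'm, 'g) family"
  unt :: "('a, 'g, 'm) family"
  cmp :: "('a, 'g, ('a, 'g, 'g) tsec) family"
  inver :: "('a, 'g, 'g) family"

text \<open>Composable pairs \<open>(h, k)\<close> satisfy \<open>s(h) = t(k)\<close> and have composite \<open>h k : s(k) \<rightarrow> t(h)\<close>;
  composable triples are built from \<open>(h, k)\<close> and \<open>l\<close> with \<open>s(k) = t(l)\<close>.\<close>

abbreviation "pairs Y G \<equiv> tensor Y (obj G) (arr G) (src G) (arr G) (tgt G)"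
abbreviation "pair1 Y G \<equiv> incl1 Y (obj G) (arr G) (src G) (arr G) (tgt G)"
abbreviation "pair2 Y G \<equiv> incl2 Y (obj G) (arr G) (src G) (arr G) (tgt G)"

abbreviation "triples Y G \<equiv>
  tensor Y (obj G) (pairs Y G) (pair2 Y G \<circ>\<circ>\<circ> src G) (arr G) (tgt G)"
abbreviation "triple12 Y G \<equiv>
  incl1 Y (obj G) (pairs Y G) (pair2 Y G \<circ>\<circ>\<circ> src G) (arr G) (tgt G)"
abbreviation "triple3 Y G \<equiv>
  incl2 Y (obj G) (pairs Y G) (pair2 Y G \<circ>\<circ>\<circ> src G) (arr G) (tgt G)"

text \<open>For \<open>T\<close>-valued arrows \<open>h\<close> and \<open>k\<close>, i.e. homomorphisms from \<open>arr G\<close> to \<open>T\<close>, the composite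
  arrow \<open>h k\<close>.\<close>

abbreviation "composite Y G T h k \<equiv>
  copair Y (obj G) (arr G) (src G) (arr G) (tgt G) T h k \<circ>\<circ>\<circ> cmp G"

definition dg_groupoid ::
    "('a, 'r, 'y) ringed_space_scheme \<Rightarrow> ('a, 'r, 'm, 'g) groupoid \<Rightarrow> bool" where
  "dg_groupoid Y G \<longleftrightarrow>
     dg_algebra_sheaf Y (obj G) \<and> dg_algebra_sheaf Y (arr G) \<and>
     dg_alg_hom Y (obj G) (arr G) (src G) \<and> dg_alg_hom Y (obj G) (arr G) (tgt G) \<and>
     dg_alg_hom Y (arr G) (obj G) (unt G) \<and> dg_alg_hom Y (arr G) (arr G) (inver G) \<and>
     dg_algebra_sheaf Y (pairs Y G) \<and> dg_algebra_sheaf Y (triples Y G) \<and>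
     dg_alg_hom Y (arr G) (pairs Y G) (cmp G) \<and>
     eq_on_sections Y (obj G) (unt G \<circ>\<circ>\<circ> src G) fid \<and>
     eq_on_sections Y (obj G) (unt G \<circ>\<circ>\<circ> tgt G) fid \<and>
     eq_on_sections Y (obj G) (cmp G \<circ>\<circ>\<circ> src G) (pair2 Y G \<circ>\<circ>\<circ> src G) \<and>
     eq_on_sections Y (obj G) (cmp G \<circ>\<circ>\<circ> tgt G) (pair1 Y G \<circ>\<circ>\<circ> tgt G) \<and>
     eq_on_sections Y (obj G) (inver G \<circ>\<circ>\<circ> src G) (tgt G) \<and>
     eq_on_sections Y (obj G) (inver G \<circ>\<circ>\<circ> tgt G) (src G) \<and>
     eq_on_sections Y (arr G)
       (composite Y G (triples Y G) (triple12 Y G \<circ>\<circ>\<circ> cmp G) (triple3 Y G))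
       (composite Y G (triples Y G) (triple12 Y G \<circ>\<circ>\<circ> pair1 Y G)
          (composite Y G (triples Y G) (triple12 Y G \<circ>\<circ>\<circ> pair2 Y G) (triple3 Y G))) \<and>
     eq_on_sections Y (arr G) (composite Y G (arr G) fid (src G \<circ>\<circ>\<circ> unt G)) fid \<and>
     eq_on_sections Y (arr G) (composite Y G (arr G) (tgt G \<circ>\<circ>\<circ> unt G) fid) fid \<and>
     eq_on_sections Y (arr G) (composite Y G (arr G) fid (inver G)) (tgt G \<circ>\<circ>\<circ> unt G) \<and>
     eq_on_sections Y (arr G) (composite Y G (arr G) (inver G) fid) (src G \<circ>\<circ>\<circ> unt G)"

definition vertical_derivations ::
    "('a, 'r, 'y) ringed_space_scheme \<Rightarrow> ('a, 'r, 'm, 'g) groupoid \<Rightarrow> int \<Rightarrow> 'a set \<Rightarrow>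
     ('a, 'g, 'g) family set" where
  "vertical_derivations Y G d U = {D \<in> O_derivations Y (arr G) (arr G) fid d U.
     \<forall>p q V. openin (tp Y) V \<and> V \<subseteq> U \<longrightarrow> (\<forall>a\<in>sec (obj G) p V. \<forall>x\<in>sec (arr G) q V.
        D (p + q) V (gmul (arr G) p q V (src G p V a) x) =
          signed (gsec (arr G) (p + q + d) V) (d * p)
            (gmul (arr G) p (q + d) V (src G p V a) (D q V x)))}"

text \<open>Invariance under right translations \<open>h \<mapsto> h k\<close> (which carry fibres of the source map
  to fibres of the source map): the composition intertwines \<open>D\<close> with the derivation \<open>D \<otimes> 1\<close> of the
  algebra of composable pairs, which is determined by its values on the two factors.\<close>

definition invariant_derivations ::
    "('a, 'r, 'y) ringed_space_scheme \<Rightarrow> ('a, 'r, 'm, 'g) groupoid \<Rightarrow> int \<Rightarrow> 'a set \<Rightarrow>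
     ('a, 'g, 'g) family set" where
  "invariant_derivations Y G d U = {D \<in> vertical_derivations Y G d U.
     \<exists>D1\<in>O_derivations Y (pairs Y G) (pairs Y G) fid d U.
       \<forall>l V. openin (tp Y) V \<and> V \<subseteq> U \<longrightarrow> (\<forall>x\<in>sec (arr G) l V.
          D1 l V (pair1 Y G l V x) = pair1 Y G (l + d) V (D l V x) \<and>
          D1 l V (pair2 Y G l V x) = \<zero>\<^bsub>gsec (pairs Y G) (l + d) V\<^esub> \<and>
          D1 l V (cmp G l V x) = cmp G (l + d) V (D l V x))}"

definition restrict_unit ::
    "('a, 'r, 'y) ringed_space_scheme \<Rightarrow> ('a, 'r, 'm, 'g) groupoid \<Rightarrow> int \<Rightarrow> 'a set \<Rightarrow>
     ('a, 'g, 'g) family \<Rightarrow> ('a, 'g, 'm) family" where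
  "restrict_unit Y G d U D = ext_fam Y (arr G) U (\<lambda>l V x. unt G (l + d) V (D l V x))"

text \<open>The image sheaf of restriction along the unit \<open>e\<close>, which sends a vertical derivation \<open>D\<close> to the
  derivation \<open>e \<circ> D\<close> along \<open>e\<close>.  (The module pullback along \<open>e\<close> can be strictly larger when infinitely
  many of the modules generating the resolution are nonzero.)\<close>

definition restricted_derivations ::
    "('a, 'r, 'y) ringed_space_scheme \<Rightarrow> ('a, 'r, 'm, 'g) groupoid \<Rightarrow> int \<Rightarrow> 'a set \<Rightarrow>
     ('a, 'g, 'm) family set" where
  "restricted_derivations Y G d U = {\<delta> \<in> O_derivations Y (arr G) (obj G) (unt G) d U.
     \<forall>y\<in>U. \<exists>V. openin (tp Y) V \<and> y \<in> V \<and> V \<subseteq> U \<and>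
       (\<exists>D\<in>vertical_derivations Y G d V. ext_fam Y (arr G) V \<delta> = restrict_unit Y G d V D)}"

definition invariant_lift ::
    "('a, 'r, 'y) ringed_space_scheme \<Rightarrow> ('a, 'r, 'm, 'g) groupoid \<Rightarrow> int \<Rightarrow> 'a set \<Rightarrow>
     ('a, 'g, 'm) family \<Rightarrow> ('a, 'g, 'g) family" where
  "invariant_lift Y G d U \<delta> =
     (THE D. D \<in> invariant_derivations Y G d U \<and> restrict_unit Y G d U D = \<delta>)"

text \<open>The differential of the restriction of \<open>D\<close> is the restriction of the commutator of \<open>D\<close> with the
  differential of the algebra of arrows; as the unit commutes with differentials, this is the
  formula below.\<close>

definition groupoid_algebroid ::
    "('a, 'r, 'y) ringed_space_scheme \<Rightarrow> ('a, 'r, 'm, 'g) groupoid \<Rightarrow>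
     ('a, 'r, 'm, ('a, 'g, 'm) family) algebroid" where
  "groupoid_algebroid Y G =
     \<lparr>gsec = fam_module Y (arr G) (obj G) (restricted_derivations Y G),
      gres = (\<lambda>d U V \<delta>. ext_fam Y (arr G) V \<delta>),
      lact = fam_act Y (arr G) (obj G),
      lbr = (\<lambda>d e U \<delta> \<delta>'. restrict_unit Y G (d + e) U
               (fam_commutator Y (arr G) d e U (invariant_lift Y G d U \<delta>) (invariant_lift Y G e U \<delta>'))),
      ldif = (\<lambda>d U \<delta>. ext_fam Y (arr G) U (\<lambda>l V x.
               gdif (obj G) (l + d) V (\<delta> l V x) \<ominus>\<^bsub>gsec (obj G) (l + d + 1) V\<^esub>
               signed (gsec (obj G) (l + d + 1) V) d (\<delta> (l + 1) V (gdif (arr G) l V x)))),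
      lanc = (\<lambda>d U \<delta>. ext_fam Y (obj G) U (\<lambda>l V a. \<delta> l V (tgt G l V a)))\<rparr>"

definition is_algebroid_of_groupoid ::
    "('a, 'r, 'y) ringed_space_scheme \<Rightarrow> ('a, 'r, 'm) dgalg \<Rightarrow> ('a, 'r, 'm, 'h) algebroid \<Rightarrow>
     ('a, 'r, 'm, 'g) groupoid \<Rightarrow> bool" where
  "is_algebroid_of_groupoid Y A g G \<longleftrightarrow>
     dg_groupoid Y G \<and> obj G = A \<and>
     (\<forall>d U. openin (tp Y) U \<longrightarrow>
        bij_betw (restrict_unit Y G d U) (invariant_derivations Y G d U) (restricted_derivations Y G d U)) \<and>
     (\<exists>\<phi>. algebroid_iso Y A g (groupoid_algebroid Y G) \<phi>)"

subsection \<open>The fibre square of a dg-scheme over \<open>Y\<close>\<close>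

definition fibre_square ::
    "('a, 'r, 'y) ringed_space_scheme \<Rightarrow> ('a, 'r, 'm) dgalg \<Rightarrow> ('a, 'r, ('a, 'm, 'm) tsec) dgalg" where
  "fibre_square Y A = tensor Y (structure_alg Y) A (unit_map Y A) A (unit_map Y A)"

definition proj1 ::
    "('a, 'r, 'y) ringed_space_scheme \<Rightarrow> ('a, 'r, 'm) dgalg \<Rightarrow> ('a, 'm, ('a, 'm, 'm) tsec) family" where
  "proj1 Y A = incl1 Y (structure_alg Y) A (unit_map Y A) A (unit_map Y A)"

definition proj2 ::
    "('a, 'r, 'y) ringed_space_scheme \<Rightarrow> ('a, 'r, 'm) dgalg \<Rightarrow> ('a, 'm, ('a, 'm, 'm) tsec) family" where
  "proj2 Y A = incl2 Y (structure_alg Y) A (unit_map Y A) A (unit_map Y A)"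

text \<open>The homomorphism dual to the map with components \<open>u\<close> and \<open>v\<close> into the fibre square.\<close>

definition into_square ::
    "('a, 'r, 'y) ringed_space_scheme \<Rightarrow> ('a, 'r, 'm) dgalg \<Rightarrow> ('a, 'r, 't) dgalg \<Rightarrow>
     ('a, 'm, 't) family \<Rightarrow> ('a, 'm, 't) family \<Rightarrow> ('a, ('a, 'm, 'm) tsec, 't) family" where
  "into_square Y A T u v = copair Y (structure_alg Y) A (unit_map Y A) A (unit_map Y A) T u v"

text \<open>The arrow \<open>(x, y)\<close> goes from \<open>x\<close> to \<open>y\<close>: the unit is the diagonal, \<open>(y, z) (x, y) = (x, z)\<close>
  and the inverse of \<open>(x, y)\<close> is \<open>(y, x)\<close>.\<close>

definition pair_groupoid ::
    "('a, 'r, 'y) ringed_space_scheme \<Rightarrow> ('a, 'r, 'm) dgalg \<Rightarrow>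
     ('a, 'r, 'm, ('a, 'm, 'm) tsec) groupoid" where
  "pair_groupoid Y A =
     (let G = fibre_square Y A; s = proj1 Y A; t = proj2 Y A in
      \<lparr>obj = A, arr = G, src = s, tgt = t,
       unt = into_square Y A A fid fid,
       cmp = into_square Y A (tensor Y A G s G t)
               (incl2 Y A G s G t \<circ>\<circ>\<circ> s) (incl1 Y A G s G t \<circ>\<circ>\<circ> t),
       inver = into_square Y A G t s\<rparr>)"

end

theory Submission imports Defs begin

text \<open>A derivation \<open>T\<close> of \<open>A\<close> over the structure sheaf of \<open>Y\<close> lifts to the derivation \<open>D = 1 \<otimes> T\<close> of
  \<open>A \<otimes> A\<close> that vanishes on functions of the source and is \<open>T\<close> on functions of the target.  It is
  invariant: \<open>D \<otimes> 1\<close> on composable pairs and \<open>D\<close> are intertwined by the composition because derivations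
  on a tensor product are determined by their values on the two factors.  Conversely, a vertical
  derivation kills functions of the source, and invariance makes \<open>D (t a)\<close> a function of the target, so
  that \<open>D\<close> is the lift of \<open>e \<circ> D \<circ> t\<close>, where \<open>e\<close> is the unit.  Hence \<open>T \<mapsto> e \<circ> D\<close> is bijective, and its
  compatibility with brackets, differentials and anchors is again checked on the two factors.\<close>

text \<open>Two points shape the proof. First, the structure maps of the groupoid and the invariant
  lifts are only specified by choice (\<open>copair\<close>, \<open>invariant_lift\<close>), so
  nothing can be computed before the sheafified graded tensor product is known to be a dg-algebra
  with its universal property. Its sections are sums of products of the two factors only locally;
  each uniqueness argument therefore compares families of additive maps that commute with
  restriction, over all smaller open sets. Second, a derivation of the first factor of a tensor
  product \<open>B \<otimes> C\<close> over \<open>A\<close> extends by zero on the second factor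
  exactly when it kills the image of \<open>A\<close>. Over the structure sheaf this is automatic,
  since linear derivations kill scalars. On composable pairs, where the middle algebra acts on the
  left arrow through its source, it is precisely verticality. One extension lemma thus produces both
  the lift of \<open>T\<close> and the derivation \<open>D \<otimes> 1\<close> in the definition of
  invariance.\<close>

abbreviation "opn Y \<equiv> openin (tp Y)"

section \<open>Abelian groups given by additive records\<close>

text \<open>The \<open>mult\<close> and \<open>one\<close> fields of the module records carry no
  meaning, so ring or module homomorphisms are out of place and only the additive monoids count.
  Both group hypotheses are bundled in, so that one fact about a map gives its values on zero,
  negatives, differences and signs.\<close>

definition add_hom :: "('m, 'x) ring_scheme \<Rightarrow> ('n, 'y) ring_scheme \<Rightarrow> ('m \<Rightarrow> 'n) \<Rightarrow> bool" where
  "add_hom M N f \<longleftrightarrow> abelian_group M \<and> abelian_group N \<and> f \<in> carrier M \<rightarrow> carrier N \<and>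
     (\<forall>x\<in>carrier M. \<forall>y\<in>carrier M. f (x \<oplus>\<^bsub>M\<^esub> y) = f x \<oplus>\<^bsub>N\<^esub> f y)"

lemma add_homI:
  assumes "abelian_group M" "abelian_group N" "\<And>x. x \<in> carrier M \<Longrightarrow> f x \<in> carrier N"
    "\<And>x y. x \<in> carrier M \<Longrightarrow> y \<in> carrier M \<Longrightarrow> f (x \<oplus>\<^bsub>M\<^esub> y) = f x \<oplus>\<^bsub>N\<^esub> f y"
  shows "add_hom M N f"
  using assms by (auto simp: add_hom_def)

lemma add_hom_group_hom:
  assumes "add_hom M N f"
  shows "group_hom (add_monoid M) (add_monoid N) f"
proof -
  interpret M: abelian_group M using assms by (simp add: add_hom_def)
  interpret N: abelian_group N using assms by (simp add: add_hom_def)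
  show ?thesis
    using assms M.a_group N.a_group by (auto simp: add_hom_def group_hom_def group_hom_axioms_def hom_def)
qed

lemma
  assumes f: "add_hom M N f"
  shows add_hom_zero: "f \<zero>\<^bsub>M\<^esub> = \<zero>\<^bsub>N\<^esub>"
    and add_hom_neg: "x \<in> carrier M \<Longrightarrow> f (\<ominus>\<^bsub>M\<^esub> x) = \<ominus>\<^bsub>N\<^esub> f x"
    and add_hom_pow: "x \<in> carrier M \<Longrightarrow> f (add_pow M (k::int) x) = add_pow N k (f x)"
    and add_hom_closed: "x \<in> carrier M \<Longrightarrow> f x \<in> carrier N"
    and add_hom_add: "x \<in> carrier M \<Longrightarrow> y \<in> carrier M \<Longrightarrow> f (x \<oplus>\<^bsub>M\<^esub> y) = f x \<oplus>\<^bsub>N\<^esub> f y"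
    and add_hom_minus: "x \<in> carrier M \<Longrightarrow> y \<in> carrier M \<Longrightarrow> f (x \<ominus>\<^bsub>M\<^esub> y) = f x \<ominus>\<^bsub>N\<^esub> f y"
proof -
  interpret M: abelian_group M using f by (simp add: add_hom_def)
  interpret N: abelian_group N using f by (simp add: add_hom_def)
  interpret h: group_hom "add_monoid M" "add_monoid N" f by (rule add_hom_group_hom[OF f])
  show "f \<zero>\<^bsub>M\<^esub> = \<zero>\<^bsub>N\<^esub>" using h.hom_one by simp
  show neg: "f (\<ominus>\<^bsub>M\<^esub> x) = \<ominus>\<^bsub>N\<^esub> f x" if "x \<in> carrier M" for x
    using h.hom_inv that by (simp add: a_inv_def)
  show "f (add_pow M (k::int) x) = add_pow N k (f x)" if "x \<in> carrier M" for x k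
    using h.hom_int_pow[of x k] that by (simp add: add_pow_def)
  show cl: "f x \<in> carrier N" if "x \<in> carrier M" for x using that f by (auto simp: add_hom_def)
  show add: "f (x \<oplus>\<^bsub>M\<^esub> y) = f x \<oplus>\<^bsub>N\<^esub> f y" if "x \<in> carrier M" "y \<in> carrier M" for x y
    using that f by (auto simp: add_hom_def)
  show "f (x \<ominus>\<^bsub>M\<^esub> y) = f x \<ominus>\<^bsub>N\<^esub> f y" if "x \<in> carrier M" "y \<in> carrier M" for x y
    using that by (simp add: a_minus_def add neg)
qed

lemma ksign_0 [simp]: "ksign 0 = 1" and ksign_1 [simp]: "ksign 1 = -1"
  by (simp_all add: ksign_def)

lemma (in abelian_group)
  shows signed_closed: "x \<in> carrier G \<Longrightarrow> signed G n x \<in> carrier G"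
    and signed_even: "x \<in> carrier G \<Longrightarrow> even n \<Longrightarrow> signed G n x = x"
    and signed_odd: "x \<in> carrier G \<Longrightarrow> odd n \<Longrightarrow> signed G n x = \<ominus> x"
  by (auto simp: ksign_def add_pow_def a_inv_def add.int_pow_closed
      group.int_pow_neg[OF a_group] group.int_pow_1[OF a_group] group.int_pow_closed[OF a_group, simplified])

lemma (in abelian_group) add_pow_zero: "add_pow G (k::int) \<zero> = \<zero>"
  using group.int_pow_one[OF a_group, of k] by (simp add: add_pow_def)

lemma (in abelian_group) add_pow_add:
  "x \<in> carrier G \<Longrightarrow> y \<in> carrier G \<Longrightarrow> add_pow G (k::int) (x \<oplus> y) = add_pow G k x \<oplus> add_pow G k y"
  using comm_group.int_pow_distrib[of "add_monoid G" x y k] a_comm_group by (simp add: add_pow_def)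

text \<open>Identities in an abelian group are proved by lifting both sides to the free abelian group on
  its carrier, where they become identities of integer linear combinations: \<open>frag_rep M z x\<close> says
  that the formal combination \<open>z\<close> has value \<open>x\<close>.\<close>

definition frag_value :: "('m, 'x) ring_scheme \<Rightarrow> ('m \<Rightarrow>\<^sub>0 int) \<Rightarrow> 'm" where
  "frag_value M = (SOME h. h \<in> hom (free_Abelian_group (carrier M)) (add_monoid M) \<and>
     (\<forall>x\<in>carrier M. h (frag_of x) = x))"

definition frag_rep :: "('m, 'x) ring_scheme \<Rightarrow> ('m \<Rightarrow>\<^sub>0 int) \<Rightarrow> 'm \<Rightarrow> bool" where
  "frag_rep M z x \<longleftrightarrow> abelian_group M \<and> Poly_Mapping.keys z \<subseteq> carrier M \<and> frag_value M z = x"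

text \<open>The universal property of the free abelian group, applied to the identity of the
  carrier, provides the map that the choice in \<open>frag_value\<close> selects.\<close>

lemma frag_value_hom:
  assumes "abelian_group M"
  shows "group_hom (free_Abelian_group (carrier M)) (add_monoid M) (frag_value M)"
    and "x \<in> carrier M \<Longrightarrow> frag_value M (frag_of x) = x"
proof -
  interpret abelian_group M by fact
  have "\<exists>h. h \<in> hom (free_Abelian_group (carrier M)) (add_monoid M) \<and> (\<forall>x\<in>carrier M. h (frag_of x) = x)"
  proof -
    have "(\<lambda>x. x) ` carrier M \<subseteq> carrier (add_monoid M)" by simp
    then obtain h where "h \<in> hom (free_Abelian_group (carrier M)) (add_monoid M)"
      "\<And>x. x \<in> carrier M \<Longrightarrow> h (frag_of x) = x"
      using comm_group.free_Abelian_group_universal[OF a_comm_group] by metis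
    then show ?thesis by blast
  qed
  note * = someI_ex[OF this, folded frag_value_def]
  show "group_hom (free_Abelian_group (carrier M)) (add_monoid M) (frag_value M)"
    using * a_group by (simp add: group_hom_def group_hom_axioms_def)
  show "frag_value M (frag_of x) = x" if "x \<in> carrier M" using * that by blast
qed

lemma frag_rep_atom: "abelian_group M \<Longrightarrow> x \<in> carrier M \<Longrightarrow> frag_rep M (frag_of x) x"
  by (simp add: frag_rep_def frag_value_hom)

lemma frag_rep_zero: "abelian_group M \<Longrightarrow> frag_rep M 0 \<zero>\<^bsub>M\<^esub>"
  using group_hom.hom_one[OF frag_value_hom(1), of M] by (simp add: frag_rep_def)

lemma frag_rep_add: "frag_rep M z x \<Longrightarrow> frag_rep M w y \<Longrightarrow> frag_rep M (z + w) (x \<oplus>\<^bsub>M\<^esub> y)"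
  using group_hom.hom_mult[OF frag_value_hom(1), of M z w] Poly_Mapping.keys_add[of z w]
  by (auto simp: frag_rep_def)

lemma frag_rep_neg: "frag_rep M z x \<Longrightarrow> frag_rep M (- z) (\<ominus>\<^bsub>M\<^esub> x)"
  using group_hom.hom_inv[OF frag_value_hom(1), of M z]
  by (auto simp: frag_rep_def a_inv_def)

lemma frag_rep_minus: "frag_rep M z x \<Longrightarrow> frag_rep M w y \<Longrightarrow> frag_rep M (z - w) (x \<ominus>\<^bsub>M\<^esub> y)"
  using frag_rep_add[OF _ frag_rep_neg] by (auto simp: a_minus_def)

lemma frag_rep_pow: "frag_rep M z x \<Longrightarrow> frag_rep M (frag_cmul k z) (add_pow M (k::int) x)"
  using group_hom.hom_int_pow[OF frag_value_hom(1), of M z k]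
  using keys_cmul[of k z] by (auto simp: frag_rep_def add_pow_def)

text \<open>The order matters: \<open>rule\<close> takes the first fact that fits, so a zero becomes
  the empty combination and only what cannot be taken apart any further becomes a generator.\<close>

lemmas frag_rep_rules = frag_rep_add frag_rep_minus frag_rep_neg frag_rep_pow frag_rep_zero frag_rep_atom

text \<open>The combinations \<open>z\<close> and \<open>w\<close> are computed by the rules above,
  so that only \<open>z = w\<close> is left. This is an identity of integer coefficients, and the
  Koszul signs in it are settled by parity cases.\<close>

lemma frag_rep_eqI: "\<lbrakk>frag_rep M z x; frag_rep M w y; z = w\<rbrakk> \<Longrightarrow> x = y"
  by (simp add: frag_rep_def)

section \<open>Abelian groups given by generators and relations\<close>

lemma ab_relators_closed:
  assumes "Rel \<subseteq> carrier (free_Abelian_group S)"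
  shows "0 \<in> ab_relators S Rel"
    and "z \<in> ab_relators S Rel \<Longrightarrow> w \<in> ab_relators S Rel \<Longrightarrow> z + w \<in> ab_relators S Rel"
    and "z \<in> ab_relators S Rel \<Longrightarrow> - z \<in> ab_relators S Rel"
    and "z \<in> ab_relators S Rel \<Longrightarrow> w \<in> ab_relators S Rel \<Longrightarrow> z - w \<in> ab_relators S Rel"
    and "z \<in> ab_relators S Rel \<Longrightarrow> Poly_Mapping.keys z \<subseteq> S"
proof -
  interpret F: group "free_Abelian_group S" by simp
  note sub = F.generate_is_subgroup[OF assms, folded ab_relators_def]
  show "0 \<in> ab_relators S Rel" using subgroup.one_closed[OF sub] by simp
  show add: "z + w \<in> ab_relators S Rel" if "z \<in> ab_relators S Rel" "w \<in> ab_relators S Rel" for z w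
    using subgroup.m_closed[OF sub that] by simp
  show k: "Poly_Mapping.keys z \<subseteq> S" if "z \<in> ab_relators S Rel" for z
    using subgroup.mem_carrier[OF sub that] by simp
  show neg: "- z \<in> ab_relators S Rel" if "z \<in> ab_relators S Rel" for z
    using subgroup.m_inv_closed[OF sub that] k[OF that] by simp
  show "z - w \<in> ab_relators S Rel" if "z \<in> ab_relators S Rel" "w \<in> ab_relators S Rel"
    using add[OF that(1) neg[OF that(2)]] by simp
qed

lemma ab_relators_rel: "z \<in> Rel \<Longrightarrow> z \<in> ab_relators S Rel"
  by (simp add: ab_relators_def generate.incl)

text \<open>The group operation is addition of arbitrary formal combinations, so a coset can be
  described by differences for every \<open>z\<close>, also one not supported on \<open>S\<close>.
  Equality of classes becomes membership in one subgroup.\<close>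

lemma ab_coset_alt:
  assumes "Rel \<subseteq> carrier (free_Abelian_group S)"
  shows "ab_coset S Rel z = {w. w - z \<in> ab_relators S Rel}"
proof -
  have "(\<exists>h\<in>N. w = h + z) \<longleftrightarrow> w - z \<in> N" for N w
    by (metis add_diff_cancel diff_add_cancel)
  then show ?thesis by (auto simp: ab_coset_def r_coset_def)
qed

lemma ab_coset_eq_iff:
  assumes "Rel \<subseteq> carrier (free_Abelian_group S)"
  shows "ab_coset S Rel z = ab_coset S Rel w \<longleftrightarrow> z - w \<in> ab_relators S Rel"
proof
  assume "ab_coset S Rel z = ab_coset S Rel w"
  moreover have "z \<in> ab_coset S Rel z" using ab_relators_closed(1)[OF assms] by (simp add: ab_coset_alt[OF assms])
  ultimately show "z - w \<in> ab_relators S Rel" by (simp add: ab_coset_alt[OF assms])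
next
  assume *: "z - w \<in> ab_relators S Rel"
  have "x - z \<in> ab_relators S Rel \<longleftrightarrow> x - w \<in> ab_relators S Rel" for x
    using ab_relators_closed(2)[OF assms _ *, of "x - z"] ab_relators_closed(4)[OF assms _ *, of "x - w"] by auto
  then show "ab_coset S Rel z = ab_coset S Rel w" by (simp add: ab_coset_alt[OF assms])
qed

lemma ab_quot_carrier: "carrier (ab_quot S Rel) = {ab_coset S Rel z |z. Poly_Mapping.keys z \<subseteq> S}"
  by (auto simp: ab_quot_def FactGroup_def RCOSETS_def ab_coset_def)

lemma ab_quot_one:
  assumes "Rel \<subseteq> carrier (free_Abelian_group S)"
  shows "\<one>\<^bsub>ab_quot S Rel\<^esub> = ab_coset S Rel 0"
  by (simp add: ab_quot_def FactGroup_def ab_coset_alt[OF assms])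

lemma ab_quot_mult:
  assumes "Rel \<subseteq> carrier (free_Abelian_group S)"
  shows "ab_coset S Rel z \<otimes>\<^bsub>ab_quot S Rel\<^esub> ab_coset S Rel w = ab_coset S Rel (z + w)"
proof -
  note cl = ab_relators_closed[OF assms]
  have "\<exists>a. a - z \<in> ab_relators S Rel \<and> (\<exists>b. b - w \<in> ab_relators S Rel \<and> x = a + b)"
    if "x - (z + w) \<in> ab_relators S Rel" for x
    using that cl(1) by (intro exI[of _ "x - w"] conjI exI[of _ w]) (auto simp: algebra_simps)
  moreover have "a + b - (z + w) \<in> ab_relators S Rel"
    if "a - z \<in> ab_relators S Rel" "b - w \<in> ab_relators S Rel" for a b
    using cl(2)[OF that] by (simp add: algebra_simps)
  ultimately show ?thesis
    by (auto simp: ab_quot_def FactGroup_def set_mult_def ab_coset_alt[OF assms])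
qed

text \<open>The operations of the presheaves below are defined by applying a map to all representatives of
  a class and taking the union of the (equal) resulting classes.\<close>

lemma ab_coset_UN:
  assumes R: "Rel \<subseteq> carrier (free_Abelian_group S)" and R': "Rel' \<subseteq> carrier (free_Abelian_group S')"
    and diff: "\<And>z w. f (z - w) = f z - f w"
    and rel: "\<And>z. z \<in> ab_relators S Rel \<Longrightarrow> f z \<in> ab_relators S' Rel'"
  shows "(\<Union>z\<in>ab_coset S Rel w. ab_coset S' Rel' (f z)) = ab_coset S' Rel' (f w)"
proof -
  have "ab_coset S' Rel' (f z) = ab_coset S' Rel' (f w)" if "z \<in> ab_coset S Rel w" for z
    using that rel[of "z - w"] by (simp add: ab_coset_eq_iff[OF R'] ab_coset_alt[OF R] diff)
  moreover have "w \<in> ab_coset S Rel w" using ab_relators_closed(1)[OF R] by (simp add: ab_coset_alt[OF R])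
  ultimately show ?thesis by blast
qed

section \<open>Sheaves and sheafification\<close>

lemma presheafD:
  assumes "presheaf_on T F r"
  shows "\<lbrakk>openin T U; openin T V; V \<subseteq> U; s \<in> F U\<rbrakk> \<Longrightarrow> r U V s \<in> F V"
    and "openin T U \<Longrightarrow> s \<in> F U \<Longrightarrow> r U U s = s"
    and "\<lbrakk>openin T U; openin T V; openin T W; W \<subseteq> V; V \<subseteq> U; s \<in> F U\<rbrakk> \<Longrightarrow>
      r V W (r U V s) = r U W s"
proof -
  note * = assms[unfolded presheaf_on_def]
  note c = conjunct1[OF *] conjunct1[OF conjunct2[OF *]] conjunct2[OF conjunct2[OF *]]
  show "\<lbrakk>openin T U; openin T V; V \<subseteq> U; s \<in> F U\<rbrakk> \<Longrightarrow> r U V s \<in> F V"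
    using c(1) by (meson PiE funcset_mem)
  show "openin T U \<Longrightarrow> s \<in> F U \<Longrightarrow> r U U s = s" using c(2) by simp
  show "\<lbrakk>openin T U; openin T V; openin T W; W \<subseteq> V; V \<subseteq> U; s \<in> F U\<rbrakk> \<Longrightarrow>
      r V W (r U V s) = r U W s"
    using c(3) by simp
qed

lemma sheaf_presheaf: "sheaf_on T F r \<Longrightarrow> presheaf_on T F r"
  by (simp add: sheaf_on_def)

lemma sheafD:
  assumes "sheaf_on T F r" "\<And>U. U \<in> \<U> \<Longrightarrow> openin T U \<and> \<sigma> U \<in> F U"
    and "\<And>U V. U \<in> \<U> \<Longrightarrow> V \<in> \<U> \<Longrightarrow> r U (U \<inter> V) (\<sigma> U) = r V (U \<inter> V) (\<sigma> V)"
  shows "\<exists>!s. s \<in> F (\<Union>\<U>) \<and> (\<forall>U\<in>\<U>. r (\<Union>\<U>) U s = \<sigma> U)"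
  using conjunct2[OF assms(1)[unfolded sheaf_on_def], THEN spec, of \<U>, THEN spec, of \<sigma>, THEN mp]
    assms(2,3) by blast

text \<open>Both sections glue the restrictions of \<open>s\<close> to those open sets on which the
  two sections agree; by hypothesis these sets cover \<open>U\<close>.\<close>

lemma sheaf_eqI:
  assumes F: "sheaf_on T F r" and U: "openin T U" and st: "s \<in> F U" "t \<in> F U"
    and loc: "\<And>x. x \<in> U \<Longrightarrow> \<exists>V. openin T V \<and> x \<in> V \<and> V \<subseteq> U \<and> r U V s = r U V t"
  shows "s = t"
proof -
  note P = presheafD[OF sheaf_presheaf[OF F]]
  define \<U> where "\<U> = {V. openin T V \<and> V \<subseteq> U \<and> r U V s = r U V t}"
  have UU: "\<Union>\<U> = U" using loc by (auto simp: \<U>_def)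
  have sec: "\<forall>V\<in>\<U>. openin T V \<and> r U V s \<in> F V" using P(1)[OF U] st by (auto simp: \<U>_def)
  have compat: "r V (V \<inter> W) (r U V s) = r W (V \<inter> W) (r U W s)" if "V \<in> \<U>" "W \<in> \<U>" for V W
  proof -
    have "openin T V" "openin T W" "V \<subseteq> U" "W \<subseteq> U" "openin T (V \<inter> W)" using that by (auto simp: \<U>_def)
    then show ?thesis using P(3)[of U V "V \<inter> W" s] P(3)[of U W "V \<inter> W" s] U st by simp
  qed
  then have "\<exists>!a. a \<in> F (\<Union>\<U>) \<and> (\<forall>V\<in>\<U>. r (\<Union>\<U>) V a = r U V s)"
    using sec compat by (intro sheafD[OF F]) blast+
  then show ?thesis unfolding UU using st by (auto simp: \<U>_def)
qed

text \<open>Here \<open>\<Phi> V s\<close> reads: \<open>s\<close> is the right section over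
  \<open>V\<close>. Uniqueness of the right section and its stability under restriction make any
  local choices compatible, so a section can be glued from a characterization without naming a
  cover.\<close>

lemma sheaf_glue:
  assumes F: "sheaf_on T F r" and U: "openin T U"
    and loc: "\<And>x. x \<in> U \<Longrightarrow> \<exists>V s. openin T V \<and> x \<in> V \<and> V \<subseteq> U \<and> s \<in> F V \<and> \<Phi> V s"
    and uniq: "\<And>V s t. \<lbrakk>openin T V; V \<subseteq> U; s \<in> F V; t \<in> F V; \<Phi> V s; \<Phi> V t\<rbrakk> \<Longrightarrow> s = t"
    and res: "\<And>V W s. \<lbrakk>openin T V; V \<subseteq> U; openin T W; W \<subseteq> V; s \<in> F V; \<Phi> V s\<rbrakk> \<Longrightarrow> \<Phi> W (r V W s)"
  shows "\<exists>s\<in>F U. \<forall>V t. openin T V \<and> V \<subseteq> U \<and> t \<in> F V \<and> \<Phi> V t \<longrightarrow> r U V s = t"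
proof -
  note P = presheafD[OF sheaf_presheaf[OF F]]
  \<comment> \<open>All open sets that carry a right section are taken, not a chosen cover, so that
    the glued section restricts correctly to every one of them.\<close>
  define \<U> where "\<U> = {V. openin T V \<and> V \<subseteq> U \<and> (\<exists>s\<in>F V. \<Phi> V s)}"
  define \<sigma> where "\<sigma> V = (SOME s. s \<in> F V \<and> \<Phi> V s)" for V
  have \<sigma>: "\<sigma> V \<in> F V \<and> \<Phi> V (\<sigma> V)" if "V \<in> \<U>" for V
    using someI_ex[of "\<lambda>s. s \<in> F V \<and> \<Phi> V s"] that by (auto simp: \<U>_def \<sigma>_def)
  have UU: "\<Union>\<U> = U" using loc by (auto simp: \<U>_def) blast
  have sec: "\<forall>V\<in>\<U>. openin T V \<and> \<sigma> V \<in> F V" using \<sigma> by (auto simp: \<U>_def)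
  have compat: "r V (V \<inter> W) (\<sigma> V) = r W (V \<inter> W) (\<sigma> W)" if VW: "V \<in> \<U>" "W \<in> \<U>" for V W
  proof (rule uniq)
    show "openin T (V \<inter> W)" "V \<inter> W \<subseteq> U" using VW by (auto simp: \<U>_def)
    then show "r V (V \<inter> W) (\<sigma> V) \<in> F (V \<inter> W)" "r W (V \<inter> W) (\<sigma> W) \<in> F (V \<inter> W)"
      using \<sigma>[OF VW(1)] \<sigma>[OF VW(2)] VW by (auto simp: \<U>_def P(1))
    show "\<Phi> (V \<inter> W) (r V (V \<inter> W) (\<sigma> V))" "\<Phi> (V \<inter> W) (r W (V \<inter> W) (\<sigma> W))"
      using \<sigma>[OF VW(1)] \<sigma>[OF VW(2)] VW \<open>openin T (V \<inter> W)\<close> by (auto simp: \<U>_def intro!: res)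
  qed
  then have "\<exists>!a. a \<in> F (\<Union>\<U>) \<and> (\<forall>V\<in>\<U>. r (\<Union>\<U>) V a = \<sigma> V)"
    using sec compat by (intro sheafD[OF F]) blast+
  then obtain s where s: "s \<in> F U" "\<forall>V\<in>\<U>. r U V s = \<sigma> V"
    unfolding UU by blast
  have "r U V s = t" if "openin T V" "V \<subseteq> U" "t \<in> F V" "\<Phi> V t" for V t
  proof -
    have V: "V \<in> \<U>" using that by (auto simp: \<U>_def)
    have "\<sigma> V = t" using \<sigma>[OF V] that by (intro uniq[of V]) auto
    then show ?thesis using s(2) V by simp
  qed
  then show ?thesis using s(1) by blast
qed

lemma germ_self: "\<lbrakk>openin T U; x \<in> U; s \<in> F U\<rbrakk> \<Longrightarrow> (U, s) \<in> germ T F r x U s"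
  by (auto simp: germ_def)

lemma germ_eqI:
  assumes F: "presheaf_on T F r" and U: "openin T U" "s \<in> F U" and V: "openin T V" "t \<in> F V"
    and W: "openin T W" "x \<in> W" "W \<subseteq> U" "W \<subseteq> V" "r U W s = r V W t"
  shows "germ T F r x U s = germ T F r x V t"
proof -
  note P = presheafD[OF F]
  have sub: "germ T F r x U s \<subseteq> germ T F r x V t"
    if U: "openin T U" "s \<in> F U" and V: "openin T V" "t \<in> F V"
      and W: "W \<subseteq> U" "W \<subseteq> V" "r U W s = r V W t" for U V s t
  proof (clarsimp simp: germ_def)
    fix U' s' W' assume *: "openin T U'" "x \<in> U'" "s' \<in> F U'" "openin T W'" "x \<in> W'" "W' \<subseteq> U" "W' \<subseteq> U'"
      "r U W' s = r U' W' s'"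
    have "r V (W \<inter> W') t = r W (W \<inter> W') (r V W t)" using V W \<open>openin T W\<close> * by (subst P(3)) auto
    also have "\<dots> = r U (W \<inter> W') s" unfolding W(3)[symmetric] using U W \<open>openin T W\<close> * by (subst P(3)) auto
    also have "\<dots> = r W' (W \<inter> W') (r U W' s)" using U * \<open>openin T W\<close> by (subst P(3)) auto
    also have "\<dots> = r U' (W \<inter> W') s'" unfolding *(8) using * \<open>openin T W\<close> by (subst P(3)) auto
    finally show "\<exists>W. openin T W \<and> x \<in> W \<and> W \<subseteq> V \<and> W \<subseteq> U' \<and> r V W t = r U' W s'"
      using * W \<open>openin T W\<close> \<open>x \<in> W\<close> by (intro exI[of _ "W \<inter> W'"]) auto
  qed
  show ?thesis using sub[OF U V W(3-5)] sub[OF V U W(4,3) W(5)[symmetric]] by blast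
qed

lemma germ_memD:
  assumes "(V, t) \<in> germ T F r x U s"
  shows "openin T V" "x \<in> V" "t \<in> F V"
    "\<exists>W. openin T W \<and> x \<in> W \<and> W \<subseteq> U \<and> W \<subseteq> V \<and> r U W s = r V W t"
  using assms by (auto simp: germ_def)

lemma germ_eqD:
  assumes "openin T U" "x \<in> U" "t \<in> F U" "germ T F r x U s = germ T F r x U t"
  shows "\<exists>W. openin T W \<and> x \<in> W \<and> W \<subseteq> U \<and> r U W s = r U W t"
proof -
  have "(U, t) \<in> germ T F r x U s" using germ_self[of T U x t F r] assms by simp
  then show ?thesis using germ_memD(4) by fastforce
qed

text \<open>This justifies reading the unions in the definitions of germwise operations as single
  germs: representatives of one germ agree on some \<open>W\<close>, and naturality of
  \<open>op\<close> carries the agreement over. The condition \<open>Q\<close> accommodates scalar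
  multiplication, whose representatives must live inside the open set that carries the
  scalar.\<close>

lemma germ_Union1:
  assumes F: "presheaf_on T F r" and G: "presheaf_on T G q"
    and U: "openin T U" "x \<in> U" "s \<in> F U" "Q U"
    and cl: "\<And>V s. \<lbrakk>openin T V; Q V; s \<in> F V\<rbrakk> \<Longrightarrow> op V s \<in> G V"
    and nat: "\<And>V W s. \<lbrakk>openin T V; openin T W; W \<subseteq> V; Q V; s \<in> F V\<rbrakk> \<Longrightarrow> q V W (op V s) = op W (r V W s)"
  shows "\<Union>{germ T G q x V (op V s') |V s'. Q V \<and> (V, s') \<in> germ T F r x U s} = germ T G q x U (op U s)"
proof -
  have "germ T G q x V (op V s') = germ T G q x U (op U s)"
    if Q: "Q V" and V: "(V, s') \<in> germ T F r x U s" for V s'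
  proof -
    obtain W where W: "openin T W" "x \<in> W" "W \<subseteq> U" "W \<subseteq> V" "r U W s = r V W s'"
      using germ_memD(4)[OF V] by blast
    show ?thesis
      using germ_memD(1-3)[OF V] W U Q
      by (intro germ_eqI[OF G _ _ _ _ W(1,2)]) (auto simp: cl nat)
  qed
  moreover have "(U, s) \<in> germ T F r x U s" using U by (intro germ_self)
  ultimately show ?thesis using U(4) by blast
qed

text \<open>Each argument has its own neighbourhood on which representatives agree; naturality is
  applied on the intersection of the two.\<close>

lemma germ_Union2:
  assumes F: "presheaf_on T F r" and F': "presheaf_on T F' r'" and G: "presheaf_on T G q"
    and U: "openin T U" "x \<in> U" "s \<in> F U" "t \<in> F' U"
    and cl: "\<And>V s t. \<lbrakk>openin T V; s \<in> F V; t \<in> F' V\<rbrakk> \<Longrightarrow> op V s t \<in> G V"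
    and nat: "\<And>V W s t. \<lbrakk>openin T V; openin T W; W \<subseteq> V; s \<in> F V; t \<in> F' V\<rbrakk> \<Longrightarrow>
       q V W (op V s t) = op W (r V W s) (r' V W t)"
  shows "\<Union>{germ T G q x V (op V s' t') |V s' t'. (V, s') \<in> germ T F r x U s \<and> (V, t') \<in> germ T F' r' x U t}
    = germ T G q x U (op U s t)"
proof -
  have "germ T G q x V (op V s' t') = germ T G q x U (op U s t)"
    if V: "(V, s') \<in> germ T F r x U s" and V': "(V, t') \<in> germ T F' r' x U t" for V s' t'
  proof -
    obtain W where W: "openin T W" "x \<in> W" "W \<subseteq> U" "W \<subseteq> V" "r U W s = r V W s'"
      using germ_memD(4)[OF V] by blast
    obtain W' where W': "openin T W'" "x \<in> W'" "W' \<subseteq> U" "W' \<subseteq> V" "r' U W' t = r' V W' t'"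
      using germ_memD(4)[OF V'] by blast
    note m = germ_memD(1-3)[OF V] germ_memD(3)[OF V']
    have o: "openin T (W \<inter> W')" using W W' by blast
    have "r U (W \<inter> W') s = r V (W \<inter> W') s'"
      using presheafD(3)[OF F, of U W "W \<inter> W'" s] presheafD(3)[OF F, of V W "W \<inter> W'" s'] W U m o by simp
    moreover have "r' U (W \<inter> W') t = r' V (W \<inter> W') t'"
      using presheafD(3)[OF F', of U W' "W \<inter> W'" t] presheafD(3)[OF F', of V W' "W \<inter> W'" t'] W' U m o by simp
    moreover have "W \<inter> W' \<subseteq> V" "W \<inter> W' \<subseteq> U" using W W' by auto
    ultimately show ?thesis
      using m U W W' o by (intro germ_eqI[OF G _ _ _ _ o]) (auto simp: cl nat)
  qed
  moreover have "(U, s) \<in> germ T F r x U s" "(U, t) \<in> germ T F' r' x U t" using U by (auto intro: germ_self)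
  ultimately show ?thesis by blast
qed

subsection \<open>Presheaves of dg-algebras\<close>

text \<open>The tensor product is built as a presheaf first and its laws are proved there, so the
  axioms of a graded module are isolated from the gluing condition.\<close>

locale graded_module_presheaf =
  fixes Y :: "('a, 'r, 'y) ringed_space_scheme" and M :: "('a, 'r, 'm, 'z) gmod_scheme"
  assumes presheaf: "presheaf_on (tp Y) (sec M l) (gres M l)"
    and module: "opn Y U \<Longrightarrow> module (rsec Y U) (gsec M l U)"
    and res_add: "\<lbrakk>opn Y U; opn Y V; V \<subseteq> U; x \<in> sec M l U; x' \<in> sec M l U\<rbrakk> \<Longrightarrow>
       gres M l U V (x \<oplus>\<^bsub>gsec M l U\<^esub> x') = gres M l U V x \<oplus>\<^bsub>gsec M l V\<^esub> gres M l U V x'"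
    and res_smult: "\<lbrakk>opn Y U; opn Y V; V \<subseteq> U; r \<in> carrier (rsec Y U); x \<in> sec M l U\<rbrakk> \<Longrightarrow>
       gres M l U V (r \<odot>\<^bsub>gsec M l U\<^esub> x) = rres Y U V r \<odot>\<^bsub>gsec M l V\<^esub> gres M l U V x"
begin

lemmas res_closed = presheafD(1)[OF presheaf]
lemmas res_id = presheafD(2)[OF presheaf]
lemmas res_res = presheafD(3)[OF presheaf]

lemma abelian: "opn Y U \<Longrightarrow> abelian_group (gsec M l U)"
  using module by (simp add: module_def)

lemma cring: "opn Y U \<Longrightarrow> cring (rsec Y U)"
  using module[of U 0] by (simp add: module_def)

lemma smult_closed: "\<lbrakk>opn Y U; r \<in> carrier (rsec Y U); x \<in> sec M l U\<rbrakk> \<Longrightarrow>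
    r \<odot>\<^bsub>gsec M l U\<^esub> x \<in> sec M l U"
  using module.smult_closed[OF module] .

lemma smult_add: "\<lbrakk>opn Y U; r \<in> carrier (rsec Y U); x \<in> sec M l U; y \<in> sec M l U\<rbrakk> \<Longrightarrow>
    r \<odot>\<^bsub>gsec M l U\<^esub> (x \<oplus>\<^bsub>gsec M l U\<^esub> y) = r \<odot>\<^bsub>gsec M l U\<^esub> x \<oplus>\<^bsub>gsec M l U\<^esub> r \<odot>\<^bsub>gsec M l U\<^esub> y"
  using module.smult_r_distr[OF module] .

lemma add_closed: "\<lbrakk>opn Y U; x \<in> sec M l U; y \<in> sec M l U\<rbrakk> \<Longrightarrow> x \<oplus>\<^bsub>gsec M l U\<^esub> y \<in> sec M l U"
  using abelian_monoid.a_closed[OF abelian_group.axioms(1)[OF abelian]] .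

lemma zero_closed: "opn Y U \<Longrightarrow> \<zero>\<^bsub>gsec M l U\<^esub> \<in> sec M l U"
  using abelian_monoid.zero_closed[OF abelian_group.axioms(1)[OF abelian]] .

lemma neg_closed: "opn Y U \<Longrightarrow> x \<in> sec M l U \<Longrightarrow> \<ominus>\<^bsub>gsec M l U\<^esub> x \<in> sec M l U"
  using abelian_group.a_inv_closed[OF abelian] .

lemma minus_closed: "\<lbrakk>opn Y U; x \<in> sec M l U; y \<in> sec M l U\<rbrakk> \<Longrightarrow> x \<ominus>\<^bsub>gsec M l U\<^esub> y \<in> sec M l U"
  using abelian_group.minus_closed[OF abelian] .

lemma sign_closed: "opn Y U \<Longrightarrow> x \<in> sec M l U \<Longrightarrow> signed (gsec M l U) n x \<in> sec M l U"
  using abelian_group.signed_closed[OF abelian] .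

lemma add_hom_res: "\<lbrakk>opn Y U; opn Y V; V \<subseteq> U\<rbrakk> \<Longrightarrow>
    add_hom (gsec M l U) (gsec M l V) (gres M l U V)"
  by (intro add_homI abelian res_add res_closed)

lemma add_hom_smult: "opn Y U \<Longrightarrow> r \<in> carrier (rsec Y U) \<Longrightarrow>
    add_hom (gsec M l U) (gsec M l U) ((\<odot>\<^bsub>gsec M l U\<^esub>) r)"
  by (intro add_homI abelian smult_closed smult_add)

end

locale dg_algebra_presheaf = graded_module_presheaf Y A
  for Y :: "('a, 'r, 'y) ringed_space_scheme" and A :: "('a, 'r, 'm) dgalg" +
  assumes mul_closed: "\<lbrakk>opn Y U; x \<in> sec A p U; y \<in> sec A q U\<rbrakk> \<Longrightarrow>
       gmul A p q U x y \<in> sec A (p + q) U"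
    and mul_add_left: "\<lbrakk>opn Y U; x \<in> sec A p U; x' \<in> sec A p U; y \<in> sec A q U\<rbrakk> \<Longrightarrow>
       gmul A p q U (x \<oplus>\<^bsub>gsec A p U\<^esub> x') y =
         gmul A p q U x y \<oplus>\<^bsub>gsec A (p + q) U\<^esub> gmul A p q U x' y"
    and mul_add_right: "\<lbrakk>opn Y U; x \<in> sec A p U; y \<in> sec A q U; y' \<in> sec A q U\<rbrakk> \<Longrightarrow>
       gmul A p q U x (y \<oplus>\<^bsub>gsec A q U\<^esub> y') =
         gmul A p q U x y \<oplus>\<^bsub>gsec A (p + q) U\<^esub> gmul A p q U x y'"
    and mul_smult_left: "\<lbrakk>opn Y U; r \<in> carrier (rsec Y U); x \<in> sec A p U; y \<in> sec A q U\<rbrakk> \<Longrightarrow>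
       gmul A p q U (r \<odot>\<^bsub>gsec A p U\<^esub> x) y = r \<odot>\<^bsub>gsec A (p + q) U\<^esub> gmul A p q U x y"
    and mul_smult_right: "\<lbrakk>opn Y U; r \<in> carrier (rsec Y U); x \<in> sec A p U; y \<in> sec A q U\<rbrakk> \<Longrightarrow>
       gmul A p q U x (r \<odot>\<^bsub>gsec A q U\<^esub> y) = r \<odot>\<^bsub>gsec A (p + q) U\<^esub> gmul A p q U x y"
    and mul_assoc: "\<lbrakk>opn Y U; x \<in> sec A p U; y \<in> sec A q U; z \<in> sec A n U\<rbrakk> \<Longrightarrow>
       gmul A (p + q) n U (gmul A p q U x y) z = gmul A p (q + n) U x (gmul A q n U y z)"
    and mul_graded_comm: "\<lbrakk>opn Y U; x \<in> sec A p U; y \<in> sec A q U\<rbrakk> \<Longrightarrow>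
       gmul A p q U x y = signed (gsec A (p + q) U) (p * q) (gmul A q p U y x)"
    and one_closed: "opn Y U \<Longrightarrow> gone A U \<in> sec A 0 U"
    and one_left: "\<lbrakk>opn Y U; x \<in> sec A p U\<rbrakk> \<Longrightarrow> gmul A 0 p U (gone A U) x = x"
    and mul_res: "\<lbrakk>opn Y U; opn Y V; V \<subseteq> U; x \<in> sec A p U; y \<in> sec A q U\<rbrakk> \<Longrightarrow>
       gres A (p + q) U V (gmul A p q U x y) = gmul A p q V (gres A p U V x) (gres A q U V y)"
    and one_res: "\<lbrakk>opn Y U; opn Y V; V \<subseteq> U\<rbrakk> \<Longrightarrow> gres A 0 U V (gone A U) = gone A V"
    and dif_closed: "\<lbrakk>opn Y U; x \<in> sec A p U\<rbrakk> \<Longrightarrow> gdif A p U x \<in> sec A (p + 1) U"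
    and dif_add: "\<lbrakk>opn Y U; x \<in> sec A p U; x' \<in> sec A p U\<rbrakk> \<Longrightarrow>
       gdif A p U (x \<oplus>\<^bsub>gsec A p U\<^esub> x') = gdif A p U x \<oplus>\<^bsub>gsec A (p + 1) U\<^esub> gdif A p U x'"
    and dif_smult: "\<lbrakk>opn Y U; r \<in> carrier (rsec Y U); x \<in> sec A p U\<rbrakk> \<Longrightarrow>
       gdif A p U (r \<odot>\<^bsub>gsec A p U\<^esub> x) = r \<odot>\<^bsub>gsec A (p + 1) U\<^esub> gdif A p U x"
    and dif_res: "\<lbrakk>opn Y U; opn Y V; V \<subseteq> U; x \<in> sec A p U\<rbrakk> \<Longrightarrow>
       gres A (p + 1) U V (gdif A p U x) = gdif A p V (gres A p U V x)"
    and dif_dif: "\<lbrakk>opn Y U; x \<in> sec A p U\<rbrakk> \<Longrightarrow>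
       gdif A (p + 1) U (gdif A p U x) = \<zero>\<^bsub>gsec A (p + 1 + 1) U\<^esub>"
    and dif_mul: "\<lbrakk>opn Y U; x \<in> sec A p U; y \<in> sec A q U\<rbrakk> \<Longrightarrow>
       gdif A (p + q) U (gmul A p q U x y) =
         gmul A (p + 1) q U (gdif A p U x) y \<oplus>\<^bsub>gsec A (p + q + 1) U\<^esub>
         signed (gsec A (p + q + 1) U) p (gmul A p (q + 1) U x (gdif A q U y))"
begin

lemma add_hom_mul_left: "opn Y U \<Longrightarrow> y \<in> sec A q U \<Longrightarrow>
    add_hom (gsec A p U) (gsec A (p + q) U) (\<lambda>x. gmul A p q U x y)"
  by (intro add_homI abelian mul_closed mul_add_left)

lemma add_hom_mul_right: "opn Y U \<Longrightarrow> x \<in> sec A p U \<Longrightarrow>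
    add_hom (gsec A q U) (gsec A (p + q) U) (\<lambda>y. gmul A p q U x y)"
  by (intro add_homI abelian mul_closed mul_add_right)

lemma add_hom_dif: "opn Y U \<Longrightarrow> add_hom (gsec A p U) (gsec A (p + 1) U) (gdif A p U)"
  by (intro add_homI abelian dif_closed dif_add)

lemma one_right: "opn Y U \<Longrightarrow> x \<in> sec A p U \<Longrightarrow> gmul A p 0 U x (gone A U) = x"
  using mul_graded_comm[of U x p "gone A U" 0] one_left one_closed
    abelian_group.signed_even[OF abelian, of U x p 0] by simp

end

lemma (in graded_module_sheaf) is_presheaf: "graded_module_presheaf Y M"
  using sheaf_presheaf[OF sheaf] module res_add res_smult by (rule graded_module_presheaf.intro)

sublocale graded_module_sheaf \<subseteq> pre: graded_module_presheaf Y M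
  by (rule is_presheaf)

sublocale dg_algebra_sheaf \<subseteq> pre: dg_algebra_presheaf Y A
  by (intro dg_algebra_presheaf.intro dg_algebra_presheaf_axioms.intro is_presheaf) (fact mul_closed mul_add_left mul_add_right mul_smult_left mul_smult_right mul_assoc
    mul_graded_comm one_closed one_left mul_res one_res dif_closed dif_add dif_smult dif_res dif_dif dif_mul)+

lemma dg_algebra_sheafI:
  assumes "dg_algebra_presheaf Y A" and "\<And>l. sheaf_on (tp Y) (sec A l) (gres A l)"
  shows "dg_algebra_sheaf Y A"
proof -
  interpret dg_algebra_presheaf Y A by fact
  show ?thesis
    by (intro dg_algebra_sheaf.intro graded_module_sheaf.intro dg_algebra_sheaf_axioms.intro) (fact assms(2) module res_add res_smult mul_closed mul_add_left mul_add_right mul_smult_left mul_smult_right mul_assoc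
    mul_graded_comm one_closed one_left mul_res one_res dif_closed dif_add dif_smult dif_res dif_dif dif_mul)+
qed

section \<open>Sheafification of a presheaf of dg-algebras over a ringed space\<close>

lemma
  assumes "is_ringed_space Y"
  shows ringed_res_closed: "\<lbrakk>opn Y U; opn Y V; V \<subseteq> U; r \<in> carrier (rsec Y U)\<rbrakk> \<Longrightarrow>
      rres Y U V r \<in> carrier (rsec Y V)"
    and ringed_res_id: "opn Y U \<Longrightarrow> r \<in> carrier (rsec Y U) \<Longrightarrow> rres Y U U r = r"
    and ringed_res_res: "\<lbrakk>opn Y U; opn Y V; opn Y W; W \<subseteq> V; V \<subseteq> U;
      r \<in> carrier (rsec Y U)\<rbrakk> \<Longrightarrow> rres Y V W (rres Y U V r) = rres Y U W r"
    and ringed_res_hom: "\<lbrakk>opn Y U; opn Y V; V \<subseteq> U\<rbrakk> \<Longrightarrow>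
      rres Y U V \<in> ring_hom (rsec Y U) (rsec Y V)"
    and ringed_cring: "opn Y U \<Longrightarrow> cring (rsec Y U)"
  using assms presheafD[OF sheaf_presheaf, of "tp Y" "\<lambda>U. carrier (rsec Y U)" "rres Y"]
  by (simp_all add: is_ringed_space_def)

text \<open>Additive inverses of sections, and later of derivations, are produced as multiples by
  minus one, and odd signs are treated as such multiples; this is why minus one has to restrict to
  minus one.\<close>

lemma ringed_res_minus_one:
  assumes R: "is_ringed_space Y" and U: "opn Y U" and V: "opn Y V" "V \<subseteq> U"
  shows "rres Y U V (\<ominus>\<^bsub>rsec Y U\<^esub> \<one>\<^bsub>rsec Y U\<^esub>) = \<ominus>\<^bsub>rsec Y V\<^esub> \<one>\<^bsub>rsec Y V\<^esub>"
proof -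
  interpret S: cring "rsec Y U" by (rule ringed_cring[OF R U])
  have "ring_hom_cring (rsec Y U) (rsec Y V) (rres Y U V)"
    using ringed_res_hom[OF R U V] ringed_cring[OF R] U V
    by (simp add: ring_hom_cring_def ring_hom_cring_axioms_def)
  then interpret h: ring_hom_cring "rsec Y U" "rsec Y V" "rres Y U V" .
  show ?thesis by (simp add: h.hom_a_inv h.hom_one)
qed

text \<open>All laws of the sheafification are checked through this relation: every section is
  represented locally, and operations on sections become operations on representatives. Nothing is
  asked of \<open>\<sigma>\<close> outside \<open>V\<close>, so the relation serves a section and
  its restrictions alike.\<close>

definition represents ::
    "('a, 'r, 'y) ringed_space_scheme \<Rightarrow> ('a, 'r, 'p) dgalg \<Rightarrow> int \<Rightarrow> 'a set \<Rightarrow>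
     ('a \<Rightarrow> ('a set \<times> 'p) set) \<Rightarrow> 'p \<Rightarrow> bool" where
  "represents Y P l V \<sigma> s \<longleftrightarrow> opn Y V \<and> s \<in> sec P l V \<and> (\<forall>y\<in>V. \<sigma> y = ggerm Y P l y V s)"

locale sheafification = dg_algebra_presheaf Y P
  for Y :: "('a, 'r, 'y) ringed_space_scheme" and P :: "('a, 'r, 'p) dgalg" +
  assumes ringed: "is_ringed_space Y"
begin

abbreviation "S \<equiv> sheafify Y P"
abbreviation "rep \<equiv> represents Y P"

lemma sec_S: "sec S l U = {\<sigma> \<in> extensional U. \<forall>x\<in>U. \<exists>V s. x \<in> V \<and> V \<subseteq> U \<and> rep l V \<sigma> s}"
  by (simp add: sheafify_def represents_def conj_ac)

lemma res_S: "gres S l U V \<sigma> = restrict \<sigma> V"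
  by (simp add: sheafify_def)

lemma repD: "rep l V \<sigma> s \<Longrightarrow> opn Y V" "rep l V \<sigma> s \<Longrightarrow> s \<in> sec P l V"
  "rep l V \<sigma> s \<Longrightarrow> y \<in> V \<Longrightarrow> \<sigma> y = ggerm Y P l y V s"
  by (auto simp: represents_def)

lemma secI:
  assumes "\<sigma> \<in> extensional U" "\<And>x. x \<in> U \<Longrightarrow> \<exists>V s. x \<in> V \<and> V \<subseteq> U \<and> rep l V \<sigma> s"
  shows "\<sigma> \<in> sec S l U"
  using assms by (simp add: sec_S)

lemma secE:
  assumes "\<sigma> \<in> sec S l U" "x \<in> U"
  obtains V s where "x \<in> V" "V \<subseteq> U" "rep l V \<sigma> s"
  using assms by (auto simp: sec_S)

lemma germ_res:
  assumes "opn Y V" "opn Y W" "W \<subseteq> V" "s \<in> sec P l V" "y \<in> W"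
  shows "ggerm Y P l y W (gres P l V W s) = ggerm Y P l y V s"
  unfolding ggerm_def using assms
  by (intro germ_eqI[OF presheaf, where W = W]) (auto simp: res_closed res_res)

lemma rep_mono:
  assumes "rep l V \<sigma> s" "opn Y W" "W \<subseteq> V"
  shows "rep l W \<sigma> (gres P l V W s)"
  using assms germ_res[of V W s l] by (auto simp: represents_def res_closed)

lemma rep_restrict: "rep l V \<sigma> s \<Longrightarrow> V \<subseteq> U \<Longrightarrow> rep l V (restrict \<sigma> U) s"
  by (auto simp: represents_def)

lemma rep_of_restrict: "rep l V (restrict \<sigma> U) s \<Longrightarrow> V \<subseteq> U \<Longrightarrow> rep l V \<sigma> s"
  by (simp add: represents_def subset_iff)

lemma secE2:
  assumes "\<sigma> \<in> sec S l U" "\<tau> \<in> sec S m U" "x \<in> U"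
  obtains V s t where "x \<in> V" "V \<subseteq> U" "rep l V \<sigma> s" "rep m V \<tau> t"
proof -
  obtain V s where V: "x \<in> V" "V \<subseteq> U" "rep l V \<sigma> s" using assms by (elim secE)
  obtain W t where W: "x \<in> W" "W \<subseteq> U" "rep m W \<tau> t" using assms by (elim secE)
  have o: "opn Y (V \<inter> W)" using V W repD(1) by blast
  show ?thesis
    using that[of "V \<inter> W"] rep_mono[OF V(3) o] rep_mono[OF W(3) o] V W by blast
qed

lemma secE3:
  assumes "\<sigma> \<in> sec S l U" "\<tau> \<in> sec S m U" "\<upsilon> \<in> sec S n U" "x \<in> U"
  obtains V s t u where "x \<in> V" "V \<subseteq> U" "rep l V \<sigma> s" "rep m V \<tau> t" "rep n V \<upsilon> u"
proof -
  obtain V s t where V: "x \<in> V" "V \<subseteq> U" "rep l V \<sigma> s" "rep m V \<tau> t" using assms by (elim secE2[of \<sigma>])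
  obtain W u where W: "x \<in> W" "W \<subseteq> U" "rep n W \<upsilon> u" using assms by (elim secE[of \<upsilon>])
  have o: "opn Y (V \<inter> W)" using V W repD(1) by blast
  show ?thesis
    using that[of "V \<inter> W"] rep_mono[OF V(3) o] rep_mono[OF V(4) o] rep_mono[OF W(3) o] V W by blast
qed

lemma eqI:
  assumes "\<sigma> \<in> extensional U" "\<tau> \<in> extensional U"
    and "\<And>x. x \<in> U \<Longrightarrow> \<exists>V s. x \<in> V \<and> V \<subseteq> U \<and> rep l V \<sigma> s \<and> rep l V \<tau> s"
  shows "\<sigma> = \<tau>"
proof (rule extensionalityI[OF assms(1,2)])
  fix x assume "x \<in> U"
  then show "\<sigma> x = \<tau> x" using assms(3)[of x] repD(3) by metis
qed

text \<open>A presheaf need not be separated: two representatives of one section over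
  \<open>V\<close> have equal germs and hence agree only after shrinking around each point.\<close>

lemma rep_eqD:
  assumes "rep l V \<sigma> s" "rep l V \<sigma> t" "x \<in> V"
  shows "\<exists>W. opn Y W \<and> x \<in> W \<and> W \<subseteq> V \<and> gres P l V W s = gres P l V W t"
  using assms by (intro germ_eqD) (auto simp: represents_def ggerm_def)

lemma rep_zero: "\<lbrakk>opn Y U; opn Y V; V \<subseteq> U\<rbrakk> \<Longrightarrow> rep l V \<zero>\<^bsub>gsec S l U\<^esub> \<zero>\<^bsub>gsec P l V\<^esub>"
  using germ_res[of U V "\<zero>\<^bsub>gsec P l U\<^esub>" l] add_hom_zero[OF add_hom_res, of U V]
  by (auto simp: represents_def sheafify_def zero_closed)

lemma rep_one: "\<lbrakk>opn Y U; opn Y V; V \<subseteq> U\<rbrakk> \<Longrightarrow> rep 0 V (gone S U) (gone P V)"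
  using germ_res[of U V "gone P U" 0] one_res[of U V]
  by (auto simp: represents_def sheafify_def one_closed)

lemma rep_add:
  assumes "rep l V \<sigma> s" "rep l V \<tau> t" "V \<subseteq> U"
  shows "rep l V (\<sigma> \<oplus>\<^bsub>gsec S l U\<^esub> \<tau>) (s \<oplus>\<^bsub>gsec P l V\<^esub> t)"
proof -
  have "(\<sigma> \<oplus>\<^bsub>gsec S l U\<^esub> \<tau>) y = ggerm Y P l y V (s \<oplus>\<^bsub>gsec P l V\<^esub> t)" if "y \<in> V" for y
    using assms that repD[OF assms(1)] repD[OF assms(2)]
      germ_Union2[OF presheaf presheaf presheaf, of V y s l t l "\<lambda>V s t. s \<oplus>\<^bsub>gsec P l V\<^esub> t" l]
    by (auto simp: sheafify_def ggerm_def res_add add_closed subset_iff)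
  then show ?thesis using assms by (simp add: represents_def add_closed)
qed

lemma rep_mul:
  assumes "rep p V \<sigma> s" "rep q V \<tau> t" "V \<subseteq> U"
  shows "rep (p + q) V (gmul S p q U \<sigma> \<tau>) (gmul P p q V s t)"
proof -
  have "gmul S p q U \<sigma> \<tau> y = ggerm Y P (p + q) y V (gmul P p q V s t)" if "y \<in> V" for y
    using assms that repD[OF assms(1)] repD[OF assms(2)]
      germ_Union2[OF presheaf presheaf presheaf, of V y s p t q "\<lambda>V s t. gmul P p q V s t" "p + q"]
    by (auto simp: sheafify_def ggerm_def mul_res mul_closed subset_iff)
  then show ?thesis using assms by (simp add: represents_def mul_closed)
qed

lemma rep_dif:
  assumes "rep p V \<sigma> s" "V \<subseteq> U"
  shows "rep (p + 1) V (gdif S p U \<sigma>) (gdif P p V s)"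
proof -
  have "gdif S p U \<sigma> y = ggerm Y P (p + 1) y V (gdif P p V s)" if "y \<in> V" for y
    using assms that repD[OF assms(1)]
      germ_Union1[OF presheaf presheaf, of V y s p "\<lambda>_. True" "gdif P p" "p + 1"]
    by (auto simp: sheafify_def ggerm_def dif_res dif_closed subset_iff)
  then show ?thesis using assms by (simp add: represents_def dif_closed)
qed

lemma rep_smult:
  assumes "rep p V \<sigma> s" "V \<subseteq> U" "opn Y U" "r \<in> carrier (rsec Y U)"
  shows "rep p V (r \<odot>\<^bsub>gsec S p U\<^esub> \<sigma>) (rres Y U V r \<odot>\<^bsub>gsec P p V\<^esub> s)"
proof -
  have "(r \<odot>\<^bsub>gsec S p U\<^esub> \<sigma>) y = ggerm Y P p y V (rres Y U V r \<odot>\<^bsub>gsec P p V\<^esub> s)" if "y \<in> V" for y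
    using assms that repD[OF assms(1)]
      germ_Union1[OF presheaf presheaf, of V y s p "\<lambda>V. V \<subseteq> U" "\<lambda>V s. rres Y U V r \<odot>\<^bsub>gsec P p V\<^esub> s" p]
    by (auto simp: sheafify_def ggerm_def res_smult smult_closed subset_iff ringed_res_closed[OF ringed]
        ringed_res_res[OF ringed])
  then show ?thesis using assms by (simp add: represents_def smult_closed ringed_res_closed[OF ringed])
qed

lemma ext_S: "\<sigma> \<in> sec S l U \<Longrightarrow> \<sigma> \<in> extensional U"
  "\<zero>\<^bsub>gsec S l U\<^esub> \<in> extensional U" "gone S U \<in> extensional U" "\<sigma> \<oplus>\<^bsub>gsec S l U\<^esub> \<tau> \<in> extensional U"
  "r \<odot>\<^bsub>gsec S l U\<^esub> \<sigma> \<in> extensional U" "gmul S p q U \<sigma> \<tau> \<in> extensional U" "gdif S l U \<sigma> \<in> extensional U"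
  by (simp_all add: sheafify_def)

lemma zero_S: "opn Y U \<Longrightarrow> \<zero>\<^bsub>gsec S l U\<^esub> \<in> sec S l U"
  using rep_zero[of U U] by (intro secI ext_S(2)) blast

lemma one_S: "opn Y U \<Longrightarrow> gone S U \<in> sec S 0 U"
  using rep_one[of U U] by (intro secI ext_S(3)) blast

lemma add_S: "\<sigma> \<in> sec S l U \<Longrightarrow> \<tau> \<in> sec S l U \<Longrightarrow> \<sigma> \<oplus>\<^bsub>gsec S l U\<^esub> \<tau> \<in> sec S l U"
proof (rule secI[OF ext_S(4)])
  fix x assume "\<sigma> \<in> sec S l U" "\<tau> \<in> sec S l U" "x \<in> U"
  then obtain V s t where V: "x \<in> V" "V \<subseteq> U" "rep l V \<sigma> s" "rep l V \<tau> t" by (rule secE2)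
  then show "\<exists>V s. x \<in> V \<and> V \<subseteq> U \<and> rep l V (\<sigma> \<oplus>\<^bsub>gsec S l U\<^esub> \<tau>) s"
    using rep_add[OF V(3,4,2)] by blast
qed

lemma mul_S: "\<sigma> \<in> sec S p U \<Longrightarrow> \<tau> \<in> sec S q U \<Longrightarrow> gmul S p q U \<sigma> \<tau> \<in> sec S (p + q) U"
proof (rule secI[OF ext_S(6)])
  fix x assume "\<sigma> \<in> sec S p U" "\<tau> \<in> sec S q U" "x \<in> U"
  then obtain V s t where V: "x \<in> V" "V \<subseteq> U" "rep p V \<sigma> s" "rep q V \<tau> t" by (rule secE2)
  then show "\<exists>V s. x \<in> V \<and> V \<subseteq> U \<and> rep (p + q) V (gmul S p q U \<sigma> \<tau>) s"
    using rep_mul[OF V(3,4,2)] by blast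
qed

lemma dif_S: "\<sigma> \<in> sec S p U \<Longrightarrow> gdif S p U \<sigma> \<in> sec S (p + 1) U"
proof (rule secI[OF ext_S(7)])
  fix x assume *: "\<sigma> \<in> sec S p U" "x \<in> U" 
  from *(1,2) obtain V s where V: "x \<in> V" "V \<subseteq> U" "rep p V \<sigma> s" by (rule secE)
  then show "\<exists>V s. x \<in> V \<and> V \<subseteq> U \<and> rep (p + 1) V (gdif S p U \<sigma>) s"
    using rep_dif[OF V(3,2)] by blast
qed

lemma smult_S: "\<lbrakk>opn Y U; r \<in> carrier (rsec Y U); \<sigma> \<in> sec S p U\<rbrakk> \<Longrightarrow>
    r \<odot>\<^bsub>gsec S p U\<^esub> \<sigma> \<in> sec S p U"
proof (rule secI[OF ext_S(5)])
  fix x assume *: "\<sigma> \<in> sec S p U" "x \<in> U" "opn Y U" "r \<in> carrier (rsec Y U)"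
  from *(1,2) obtain V s where V: "x \<in> V" "V \<subseteq> U" "rep p V \<sigma> s" by (rule secE)
  then show "\<exists>V s. x \<in> V \<and> V \<subseteq> U \<and> rep p V (r \<odot>\<^bsub>gsec S p U\<^esub> \<sigma>) s"
    using rep_smult[OF V(3,2) *(3,4)] by blast
qed

lemma sheaf_S: "sheaf_on (tp Y) (sec S l) (gres S l)"
proof -
  have res: "restrict \<sigma> V \<in> sec S l V"
    if "opn Y U" "opn Y V" "V \<subseteq> U" "\<sigma> \<in> sec S l U" for U V \<sigma>
  proof (rule secI)
    fix x assume x: "x \<in> V"
    then have "x \<in> U" using that by blast
    with that(4) obtain W s where W: "x \<in> W" "W \<subseteq> U" "rep l W \<sigma> s" by (rule secE)
    have o: "opn Y (W \<inter> V)" using W that repD(1) by blast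
    show "\<exists>W s. x \<in> W \<and> W \<subseteq> V \<and> rep l W (restrict \<sigma> V) s"
      using W x rep_restrict[OF rep_mono[OF W(3) o]] by blast
  qed simp
  have pre: "presheaf_on (tp Y) (sec S l) (gres S l)"
    unfolding presheaf_on_def res_S
    using res ext_S(1) by (auto simp: extensional_restrict Int_absorb1)
  have "\<exists>!s. s \<in> sec S l (\<Union>\<U>) \<and> (\<forall>U\<in>\<U>. restrict s U = \<sigma> U)"
    if \<U>: "\<forall>U\<in>\<U>. opn Y U \<and> \<sigma> U \<in> sec S l U"
      and c: "\<forall>U\<in>\<U>. \<forall>V\<in>\<U>. restrict (\<sigma> U) (U \<inter> V) = restrict (\<sigma> V) (U \<inter> V)" for \<U> \<sigma>
  proof -
    \<comment> \<open>A point is sent to its germ under an arbitrary member of the family that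
      contains it; compatibility makes the choice of the member irrelevant.\<close>
    define s where "s = (\<lambda>x\<in>\<Union>\<U>. \<sigma> (SOME U. U \<in> \<U> \<and> x \<in> U) x)"
    have s: "s x = \<sigma> U x" if "U \<in> \<U>" "x \<in> U" for U x
    proof -
      let ?V = "SOME U. U \<in> \<U> \<and> x \<in> U"
      have V: "?V \<in> \<U> \<and> x \<in> ?V" using someI[of "\<lambda>U. U \<in> \<U> \<and> x \<in> U" U] that by simp
      have "restrict (\<sigma> U) (U \<inter> ?V) x = restrict (\<sigma> ?V) (U \<inter> ?V) x"
        using c[THEN bspec, OF that(1), THEN bspec, OF conjunct1[OF V]] by simp
      then show ?thesis using that V by (auto simp: s_def)
    qed
    have r: "restrict s U = \<sigma> U" if "U \<in> \<U>" for U
      using that \<U> ext_S(1) s by (intro extensionalityI[of _ U]) auto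
    have "s \<in> sec S l (\<Union>\<U>)"
    proof (rule secI)
      show "s \<in> extensional (\<Union>\<U>)" by (simp add: s_def)
      fix x assume "x \<in> \<Union>\<U>"
      then obtain U where U: "U \<in> \<U>" "x \<in> U" by blast
      then obtain V t where "x \<in> V" "V \<subseteq> U" "rep l V (\<sigma> U) t" using \<U> secE by metis
      then show "\<exists>V t. x \<in> V \<and> V \<subseteq> \<Union>\<U> \<and> rep l V s t"
        using U r[OF U(1)] rep_of_restrict[of l V s U t] by auto
    qed
    then show ?thesis using r
    proof (intro ex1I[of _ s] conjI ballI)
      fix t assume that: "t \<in> sec S l (\<Union>\<U>) \<and> (\<forall>U\<in>\<U>. restrict t U = \<sigma> U)"
      show "t = s"
      proof (rule extensionalityI[of _ "\<Union>\<U>"])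
      fix x assume "x \<in> \<Union>\<U>"
      then obtain U where U: "U \<in> \<U>" "x \<in> U" by blast
      then have "restrict t U x = restrict s U x" using that r by simp
      then show "t x = s x" using U by simp
      qed (use that ext_S(1) in \<open>auto simp: s_def\<close>)
    qed simp
  qed
  then have "\<forall>\<U> \<sigma>. (\<forall>U\<in>\<U>. opn Y U \<and> \<sigma> U \<in> sec S l U) \<and>
      (\<forall>U\<in>\<U>. \<forall>V\<in>\<U>. restrict (\<sigma> U) (U \<inter> V) = restrict (\<sigma> V) (U \<inter> V)) \<longrightarrow>
      (\<exists>!s. s \<in> sec S l (\<Union>\<U>) \<and> (\<forall>U\<in>\<U>. restrict s U = \<sigma> U))"
    by (intro allI impI) (elim conjE)
  with pre show ?thesis unfolding sheaf_on_def res_S by (rule conjI)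
qed

lemma rep_agree: "rep l V \<rho> z \<Longrightarrow> rep l V \<rho>' z \<Longrightarrow> \<exists>z. rep l V \<rho> z \<and> rep l V \<rho>' z"
  by blast

text \<open>The transfer principle for the laws of the sheafification, with variants for two and
  three arguments: two expressions agree if, wherever the arguments are represented, some presheaf
  section represents both. A law of the presheaf thus passes to the sheafification by rewriting the
  representative of one side.\<close>

lemma eqI1:
  assumes "\<sigma> \<in> sec S p U" "\<rho> \<in> extensional U" "\<rho>' \<in> extensional U"
    and "\<And>V s. \<lbrakk>V \<subseteq> U; rep p V \<sigma> s; opn Y V; s \<in> sec P p V\<rbrakk> \<Longrightarrow>
      \<exists>z. rep l V \<rho> z \<and> rep l V \<rho>' z"
  shows "\<rho> = \<rho>'"
proof (rule eqI[OF assms(2,3)])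
  fix x assume "x \<in> U"
  with assms(1) obtain V s where V: "x \<in> V" "V \<subseteq> U" "rep p V \<sigma> s" by (rule secE)
  then show "\<exists>V s. x \<in> V \<and> V \<subseteq> U \<and> rep l V \<rho> s \<and> rep l V \<rho>' s"
    using assms(4)[OF V(2,3) repD(1,2)[OF V(3)]] by blast
qed

lemma eqI2:
  assumes "\<sigma> \<in> sec S p U" "\<tau> \<in> sec S q U" "\<rho> \<in> extensional U" "\<rho>' \<in> extensional U"
    and "\<And>V s t. \<lbrakk>V \<subseteq> U; rep p V \<sigma> s; rep q V \<tau> t; opn Y V; s \<in> sec P p V;
      t \<in> sec P q V\<rbrakk> \<Longrightarrow> \<exists>z. rep l V \<rho> z \<and> rep l V \<rho>' z"
  shows "\<rho> = \<rho>'"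
proof (rule eqI[OF assms(3,4)])
  fix x assume "x \<in> U"
  with assms(1,2) obtain V s t where V: "x \<in> V" "V \<subseteq> U" "rep p V \<sigma> s" "rep q V \<tau> t" by (rule secE2)
  then show "\<exists>V s. x \<in> V \<and> V \<subseteq> U \<and> rep l V \<rho> s \<and> rep l V \<rho>' s"
    using assms(5)[OF V(2,3,4) repD(1,2)[OF V(3)] repD(2)[OF V(4)]] by blast
qed

lemma eqI3:
  assumes "\<sigma> \<in> sec S p U" "\<tau> \<in> sec S q U" "\<upsilon> \<in> sec S n U" "\<rho> \<in> extensional U" "\<rho>' \<in> extensional U"
    and "\<And>V s t u. \<lbrakk>V \<subseteq> U; rep p V \<sigma> s; rep q V \<tau> t; rep n V \<upsilon> u; opn Y V;
      s \<in> sec P p V; t \<in> sec P q V; u \<in> sec P n V\<rbrakk> \<Longrightarrow> \<exists>z. rep l V \<rho> z \<and> rep l V \<rho>' z"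
  shows "\<rho> = \<rho>'"
proof (rule eqI[OF assms(4,5)])
  fix x assume "x \<in> U"
  with assms(1,2,3) obtain V s t u where V: "x \<in> V" "V \<subseteq> U" "rep p V \<sigma> s" "rep q V \<tau> t" "rep n V \<upsilon> u"
    by (rule secE3)
  then show "\<exists>V s. x \<in> V \<and> V \<subseteq> U \<and> rep l V \<rho> s \<and> rep l V \<rho>' s"
    using assms(6)[OF V(2,3,4,5) repD(1,2)[OF V(3)] repD(2)[OF V(4)] repD(2)[OF V(5)]] by blast
qed

lemmas ringed_hom_simps =
  ring_hom_add[OF ringed_res_hom[OF ringed]] ring_hom_mult[OF ringed_res_hom[OF ringed]]
  ring_hom_one[OF ringed_res_hom[OF ringed]]

lemma abelian_S: assumes U: "opn Y U" shows "abelian_group (gsec S l U)"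
proof (rule abelian_groupI)
  let ?G = "gsec S l U"
  show "\<zero>\<^bsub>?G\<^esub> \<in> carrier ?G" by (rule zero_S[OF U])
  fix \<sigma> \<tau> \<upsilon> assume \<sigma>: "\<sigma> \<in> carrier ?G"
  have pc: "abelian_monoid (gsec P l V)" if "opn Y V" for V
    using abelian[OF that] abelian_group.axioms(1) by blast
  show "\<zero>\<^bsub>?G\<^esub> \<oplus>\<^bsub>?G\<^esub> \<sigma> = \<sigma>"
  proof (rule eqI1[OF \<sigma>, where l = l])
    fix V s assume V: "V \<subseteq> U" "rep l V \<sigma> s" "opn Y V" "s \<in> sec P l V"
    show "\<exists>z. rep l V (\<zero>\<^bsub>?G\<^esub> \<oplus>\<^bsub>?G\<^esub> \<sigma>) z \<and> rep l V \<sigma> z"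
      using rep_add[OF rep_zero[OF U V(3,1)] V(2,1)] V abelian_monoid.l_zero[OF pc] by auto
  qed (use \<sigma> in \<open>auto simp: ext_S\<close>)
  show "\<exists>\<tau>\<in>carrier ?G. \<tau> \<oplus>\<^bsub>?G\<^esub> \<sigma> = \<zero>\<^bsub>?G\<^esub>"
  proof
    interpret R: cring "rsec Y U" using ringed_cring[OF ringed U] .
    let ?m = "\<ominus>\<^bsub>rsec Y U\<^esub> \<one>\<^bsub>rsec Y U\<^esub>"
    show "?m \<odot>\<^bsub>?G\<^esub> \<sigma> \<in> carrier ?G" using smult_S[OF U _ \<sigma>] by simp
    show "?m \<odot>\<^bsub>?G\<^esub> \<sigma> \<oplus>\<^bsub>?G\<^esub> \<sigma> = \<zero>\<^bsub>?G\<^esub>"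
    proof (rule eqI1[OF \<sigma>, where l = l])
      fix V s assume V: "V \<subseteq> U" "rep l V \<sigma> s" "opn Y V" "s \<in> sec P l V"
      interpret V: module "rsec Y V" "gsec P l V" by (rule module[OF V(3)])
      have c: "?m \<in> carrier (rsec Y U)" by simp
      have "rres Y U V ?m \<odot>\<^bsub>gsec P l V\<^esub> s \<oplus>\<^bsub>gsec P l V\<^esub> s = \<zero>\<^bsub>gsec P l V\<^esub>"
        using V by (simp add: ringed_res_minus_one[OF ringed U V(3,1)] V.smult_l_minus V.l_neg)
      then show "\<exists>z. rep l V (?m \<odot>\<^bsub>?G\<^esub> \<sigma> \<oplus>\<^bsub>?G\<^esub> \<sigma>) z \<and> rep l V \<zero>\<^bsub>?G\<^esub> z"
        using rep_add[OF rep_smult[OF V(2,1) U c] V(2,1)] rep_zero[OF U V(3,1)] by metis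
    qed (auto simp: ext_S)
  qed
  assume \<tau>: "\<tau> \<in> carrier ?G"
  show "\<sigma> \<oplus>\<^bsub>?G\<^esub> \<tau> \<in> carrier ?G" using \<sigma> \<tau> by (rule add_S)
  show "\<sigma> \<oplus>\<^bsub>?G\<^esub> \<tau> = \<tau> \<oplus>\<^bsub>?G\<^esub> \<sigma>"
  proof (rule eqI2[OF \<sigma> \<tau>, where l = l])
    fix V s t assume V: "V \<subseteq> U" "rep l V \<sigma> s" "rep l V \<tau> t" "opn Y V" "s \<in> sec P l V" "t \<in> sec P l V"
    show "\<exists>z. rep l V (\<sigma> \<oplus>\<^bsub>?G\<^esub> \<tau>) z \<and> rep l V (\<tau> \<oplus>\<^bsub>?G\<^esub> \<sigma>) z"
      using rep_add[OF V(2,3,1)] rep_add[OF V(3,2,1)] V abelian_monoid.a_comm[OF pc] by metis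
  qed (auto simp: ext_S)
  assume \<upsilon>: "\<upsilon> \<in> carrier ?G"
  show "(\<sigma> \<oplus>\<^bsub>?G\<^esub> \<tau>) \<oplus>\<^bsub>?G\<^esub> \<upsilon> = \<sigma> \<oplus>\<^bsub>?G\<^esub> (\<tau> \<oplus>\<^bsub>?G\<^esub> \<upsilon>)"
  proof (rule eqI3[OF \<sigma> \<tau> \<upsilon>, where l = l])
    fix V s t u assume V: "V \<subseteq> U" "rep l V \<sigma> s" "rep l V \<tau> t" "rep l V \<upsilon> u" "opn Y V"
      "s \<in> sec P l V" "t \<in> sec P l V" "u \<in> sec P l V"
    show "\<exists>z. rep l V ((\<sigma> \<oplus>\<^bsub>?G\<^esub> \<tau>) \<oplus>\<^bsub>?G\<^esub> \<upsilon>) z \<and> rep l V (\<sigma> \<oplus>\<^bsub>?G\<^esub> (\<tau> \<oplus>\<^bsub>?G\<^esub> \<upsilon>)) z"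
      using rep_add[OF rep_add[OF V(2,3,1)] V(4,1)] rep_add[OF V(2) rep_add[OF V(3,4,1)] V(1)] V
        abelian_monoid.a_assoc[OF pc] by metis
  qed (auto simp: ext_S)
qed

lemma module_S: assumes U: "opn Y U" shows "module (rsec Y U) (gsec S l U)"
proof (rule moduleI[OF ringed_cring[OF ringed U] abelian_S[OF U]])
  let ?G = "gsec S l U"
  fix a \<sigma> assume a: "a \<in> carrier (rsec Y U)" and \<sigma>: "\<sigma> \<in> sec S l U"
  show "a \<odot>\<^bsub>?G\<^esub> \<sigma> \<in> sec S l U" by (rule smult_S[OF U a \<sigma>])
  fix b assume b: "b \<in> carrier (rsec Y U)"
  interpret R: cring "rsec Y U" using ringed_cring[OF ringed U] .
  note [simp] = ringed_hom_simps ringed_res_closed[OF ringed]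
  show "(a \<oplus>\<^bsub>rsec Y U\<^esub> b) \<odot>\<^bsub>?G\<^esub> \<sigma> = a \<odot>\<^bsub>?G\<^esub> \<sigma> \<oplus>\<^bsub>?G\<^esub> b \<odot>\<^bsub>?G\<^esub> \<sigma>"
  proof (rule eqI1[OF \<sigma> ext_S(5,4), where l = l], goal_cases)
    case (1 V s) note V = 1
    have e: "rres Y U V (a \<oplus>\<^bsub>rsec Y U\<^esub> b) \<odot>\<^bsub>gsec P l V\<^esub> s =
        rres Y U V a \<odot>\<^bsub>gsec P l V\<^esub> s \<oplus>\<^bsub>gsec P l V\<^esub> rres Y U V b \<odot>\<^bsub>gsec P l V\<^esub> s"
      using module.smult_l_distr[OF module[OF V(3)] _ _ V(4)] U V a b by simp
    show ?case
      by (rule rep_agree[OF rep_smult[OF V(2,1) U R.a_closed[OF a b], unfolded e]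
        rep_add[OF rep_smult[OF V(2,1) U a] rep_smult[OF V(2,1) U b] V(1)]])
  qed
  show "(a \<otimes>\<^bsub>rsec Y U\<^esub> b) \<odot>\<^bsub>?G\<^esub> \<sigma> = a \<odot>\<^bsub>?G\<^esub> (b \<odot>\<^bsub>?G\<^esub> \<sigma>)"
  proof (rule eqI1[OF \<sigma> ext_S(5,5), where l = l], goal_cases)
    case (1 V s) note V = 1
    have e: "rres Y U V (a \<otimes>\<^bsub>rsec Y U\<^esub> b) \<odot>\<^bsub>gsec P l V\<^esub> s =
        rres Y U V a \<odot>\<^bsub>gsec P l V\<^esub> (rres Y U V b \<odot>\<^bsub>gsec P l V\<^esub> s)"
      using module.smult_assoc1[OF module[OF V(3)] _ _ V(4)] U V a b by simp
    show ?case
      by (rule rep_agree[OF rep_smult[OF V(2,1) U R.m_closed[OF a b], unfolded e]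
        rep_smult[OF rep_smult[OF V(2,1) U b] V(1) U a]])
  qed
  fix \<tau> assume \<tau>: "\<tau> \<in> sec S l U"
  show "a \<odot>\<^bsub>?G\<^esub> (\<sigma> \<oplus>\<^bsub>?G\<^esub> \<tau>) = a \<odot>\<^bsub>?G\<^esub> \<sigma> \<oplus>\<^bsub>?G\<^esub> a \<odot>\<^bsub>?G\<^esub> \<tau>"
  proof (rule eqI2[OF \<sigma> \<tau> ext_S(5,4), where l = l], goal_cases)
    case (1 V s t) note V = 1
    have e: "rres Y U V a \<odot>\<^bsub>gsec P l V\<^esub> (s \<oplus>\<^bsub>gsec P l V\<^esub> t) =
        rres Y U V a \<odot>\<^bsub>gsec P l V\<^esub> s \<oplus>\<^bsub>gsec P l V\<^esub> rres Y U V a \<odot>\<^bsub>gsec P l V\<^esub> t"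
      using smult_add[OF V(4) _ V(5,6)] U V a by simp
    show ?case
      by (rule rep_agree[OF rep_smult[OF rep_add[OF V(2,3,1)] V(1) U a, unfolded e]
        rep_add[OF rep_smult[OF V(2,1) U a] rep_smult[OF V(3,1) U a] V(1)]])
  qed
next
  let ?G = "gsec S l U"
  fix \<sigma> assume \<sigma>: "\<sigma> \<in> sec S l U"
  interpret R: cring "rsec Y U" using ringed_cring[OF ringed U] .
  show "\<one>\<^bsub>rsec Y U\<^esub> \<odot>\<^bsub>?G\<^esub> \<sigma> = \<sigma>"
  proof (rule eqI1[OF \<sigma> ext_S(5) ext_S(1)[OF \<sigma>], where l = l], goal_cases)
    case (1 V s) note V = 1
    have e: "rres Y U V \<one>\<^bsub>rsec Y U\<^esub> \<odot>\<^bsub>gsec P l V\<^esub> s = s"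
      using module.smult_one[OF module[OF V(3)] V(4)] U V by (simp add: ringed_hom_simps)
    show ?case
      by (rule rep_agree[OF rep_smult[OF V(2,1) U R.one_closed, unfolded e] V(2)])
  qed
qed

lemma res_closed_S: "\<lbrakk>opn Y U; opn Y V; V \<subseteq> U; \<sigma> \<in> sec S l U\<rbrakk> \<Longrightarrow>
    restrict \<sigma> V \<in> sec S l V"
  using presheafD(1)[OF sheaf_presheaf[OF sheaf_S]] by (simp add: res_S)

text \<open>An even sign is the identity and an odd one is multiplication by the scalar minus one,
  so the claim reduces to the one for scalars.\<close>

lemma rep_signed:
  assumes "rep l V \<sigma> s" "V \<subseteq> U" "opn Y U" "\<sigma> \<in> sec S l U"
  shows "rep l V (signed (gsec S l U) n \<sigma>) (signed (gsec P l V) n s)"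
proof -
  interpret A: abelian_group "gsec S l U" by (rule abelian_S[OF assms(3)])
  interpret B: abelian_group "gsec P l V" using abelian repD(1) assms(1) by blast
  interpret M: module "rsec Y U" "gsec S l U" by (rule module_S[OF assms(3)])
  interpret N: module "rsec Y V" "gsec P l V" using module repD(1) assms(1) by blast
  have V: "opn Y V" "s \<in> sec P l V" using assms repD by auto
  show ?thesis
  proof (cases "even n")
    case True
    then show ?thesis using assms V by (simp add: A.signed_even B.signed_even)
  next
    case False
    then have e1: "signed (gsec S l U) n \<sigma> = (\<ominus>\<^bsub>rsec Y U\<^esub> \<one>\<^bsub>rsec Y U\<^esub>) \<odot>\<^bsub>gsec S l U\<^esub> \<sigma>"
      using assms by (simp add: A.signed_odd M.smult_l_minus)
    have e2: "signed (gsec P l V) n s = rres Y U V (\<ominus>\<^bsub>rsec Y U\<^esub> \<one>\<^bsub>rsec Y U\<^esub>) \<odot>\<^bsub>gsec P l V\<^esub> s"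
      using False V by (simp add: B.signed_odd N.smult_l_minus ringed_res_minus_one[OF ringed assms(3) V(1) assms(2)])
    have "\<ominus>\<^bsub>rsec Y U\<^esub> \<one>\<^bsub>rsec Y U\<^esub> \<in> carrier (rsec Y U)" by simp
    from rep_smult[OF assms(1-3) this] show ?thesis by (simp only: e1 e2)
  qed
qed

text \<open>The transfer principle for compatibility with restriction, where an operation over
  \<open>U\<close> meets the same operation over \<open>W\<close>. For operations with one argument
  that argument is entered twice.\<close>

lemma res_eqI2:
  assumes "opn Y U" "opn Y W" "W \<subseteq> U"
    and "\<sigma> \<in> sec S p U" "\<tau> \<in> sec S q U" "\<rho>' \<in> extensional W"
    and "\<And>V s t. \<lbrakk>V \<subseteq> W; V \<subseteq> U; rep p V \<sigma> s; rep q V \<tau> t; rep p V (restrict \<sigma> W) s;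
      rep q V (restrict \<tau> W) t; opn Y V\<rbrakk> \<Longrightarrow> \<exists>z. rep l V \<rho> z \<and> rep l V \<rho>' z"
  shows "restrict \<rho> W = \<rho>'"
proof (rule eqI2[OF res_closed_S[OF assms(1-4)] res_closed_S[OF assms(1-3,5)] _ assms(6)])
  fix V s t assume V: "V \<subseteq> W" "rep p V (restrict \<sigma> W) s" "rep q V (restrict \<tau> W) t" "opn Y V"
  obtain z where "rep l V \<rho> z" "rep l V \<rho>' z"
    using assms(7)[OF V(1) subset_trans[OF V(1) assms(3)] rep_of_restrict[OF V(2,1)] rep_of_restrict[OF V(3,1)] V(2-4)]
    by blast
  then show "\<exists>z. rep l V (restrict \<rho> W) z \<and> rep l V \<rho>' z"
    by (intro rep_agree[of _ _ _ z] rep_restrict V(1))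
qed simp

lemma dg_presheaf_S: "dg_algebra_presheaf Y S"
proof (intro dg_algebra_presheaf.intro graded_module_presheaf.intro dg_algebra_presheaf_axioms.intro)
  show "presheaf_on (tp Y) (sec S l) (gres S l)" for l by (rule sheaf_presheaf[OF sheaf_S])
  fix U assume U: "opn Y U"
  show "module (rsec Y U) (gsec S l U)" for l by (rule module_S[OF U])
  show "gone S U \<in> sec S 0 U" by (rule one_S[OF U])
  fix \<sigma> p assume \<sigma>: "\<sigma> \<in> sec S p U"
  show "gmul S 0 p U (gone S U) \<sigma> = \<sigma>"
  proof (rule eqI1[OF \<sigma> ext_S(6) ext_S(1)[OF \<sigma>], where l = p], goal_cases)
    case (1 V s) note V = 1
    show ?case
      using rep_mul[OF rep_one[OF U V(3,1)] V(2,1)] V one_left by auto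
  qed
  show dc: "gdif S p U \<sigma> \<in> sec S (p + 1) U" by (rule dif_S[OF \<sigma>])
  show "gdif S (p + 1) U (gdif S p U \<sigma>) = \<zero>\<^bsub>gsec S (p + 1 + 1) U\<^esub>"
  proof (rule eqI1[OF \<sigma> ext_S(7,2), where l = "p + 1 + 1"], goal_cases)
    case (1 V s) note V = 1
    show ?case
      by (rule rep_agree[OF rep_dif[OF rep_dif[OF V(2,1)] V(1), unfolded dif_dif[OF V(3,4)]] rep_zero[OF U V(3,1)]])
  qed
  fix \<tau> q assume \<tau>: "\<tau> \<in> sec S q U"
  show mc: "gmul S p q U \<sigma> \<tau> \<in> sec S (p + q) U" by (rule mul_S[OF \<sigma> \<tau>])
  show "gmul S p q U \<sigma> \<tau> = signed (gsec S (p + q) U) (p * q) (gmul S q p U \<tau> \<sigma>)"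
  proof -
    have mc': "gmul S q p U \<tau> \<sigma> \<in> sec S (p + q) U" using mul_S[OF \<tau> \<sigma>] by (simp add: add.commute)
    then have sc: "signed (gsec S (p + q) U) (p * q) (gmul S q p U \<tau> \<sigma>) \<in> sec S (p + q) U"
      using abelian_group.signed_closed[OF abelian_S[OF U]] by blast
    show ?thesis
    proof (rule eqI2[OF \<sigma> \<tau> ext_S(6) ext_S(1)[OF sc], where l = "p + q"], goal_cases)
      case (1 V s t) note V = 1
      have "rep (p + q) V (gmul S q p U \<tau> \<sigma>) (gmul P q p V t s)"
        using rep_mul[OF V(3,2,1)] by (simp add: add.commute)
      note r = rep_signed[OF this V(1) U mc', of "p * q"]
      show ?case
        by (rule rep_agree[OF rep_mul[OF V(2,3,1)] r[folded mul_graded_comm[OF V(4,5,6)]]])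
    qed
  qed
  show "gdif S (p + q) U (gmul S p q U \<sigma> \<tau>) = gmul S (p + 1) q U (gdif S p U \<sigma>) \<tau> \<oplus>\<^bsub>gsec S (p + q + 1) U\<^esub>
      signed (gsec S (p + q + 1) U) p (gmul S p (q + 1) U \<sigma> (gdif S q U \<tau>))"
  proof (rule eqI2[OF \<sigma> \<tau> ext_S(7,4), where l = "p + q + 1"], goal_cases)
    case (1 V s t) note V = 1
    have 1: "rep (p + q + 1) V (gmul S (p + 1) q U (gdif S p U \<sigma>) \<tau>) (gmul P (p + 1) q V (gdif P p V s) t)"
      using rep_mul[OF rep_dif[OF V(2,1)] V(3,1)] by (simp add: ac_simps)
    have "rep (p + q + 1) V (gmul S p (q + 1) U \<sigma> (gdif S q U \<tau>)) (gmul P p (q + 1) V s (gdif P q V t))"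
      using rep_mul[OF V(2) rep_dif[OF V(3,1)] V(1)] by (simp add: ac_simps)
    then have 2: "rep (p + q + 1) V (signed (gsec S (p + q + 1) U) p (gmul S p (q + 1) U \<sigma> (gdif S q U \<tau>)))
      (signed (gsec P (p + q + 1) V) p (gmul P p (q + 1) V s (gdif P q V t)))"
      using rep_signed[OF _ V(1) U] mul_S[OF \<sigma> dif_S[OF \<tau>]] by (simp add: ac_simps)
    show ?case
      by (rule rep_agree[OF rep_dif[OF rep_mul[OF V(2,3,1)] V(1), unfolded dif_mul[OF V(4-6)]] rep_add[OF 1 2 V(1)]])
  qed
  fix \<upsilon> n assume \<upsilon>: "\<upsilon> \<in> sec S n U"
  show "gmul S (p + q) n U (gmul S p q U \<sigma> \<tau>) \<upsilon> = gmul S p (q + n) U \<sigma> (gmul S q n U \<tau> \<upsilon>)"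
  proof (rule eqI3[OF \<sigma> \<tau> \<upsilon> ext_S(6,6), where l = "p + q + n"], goal_cases)
    case (1 V s t u) note V = 1
    have "rep (p + q + n) V (gmul S p (q + n) U \<sigma> (gmul S q n U \<tau> \<upsilon>)) (gmul P p (q + n) V s (gmul P q n V t u))"
      using rep_mul[OF V(2) rep_mul[OF V(3,4,1)] V(1)] by (simp add: ac_simps)
    note 1 = this[folded mul_assoc[OF V(5-8)]]
    show ?case
      by (rule rep_agree[OF rep_mul[OF rep_mul[OF V(2,3,1)] V(4,1)] 1])
  qed
next
  fix U \<sigma> p \<sigma>' assume U: "opn Y U" and \<sigma>: "\<sigma> \<in> sec S p U" "\<sigma>' \<in> sec S p U"
  show "gdif S p U (\<sigma> \<oplus>\<^bsub>gsec S p U\<^esub> \<sigma>') = gdif S p U \<sigma> \<oplus>\<^bsub>gsec S (p + 1) U\<^esub> gdif S p U \<sigma>'"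
  proof (rule eqI2[OF \<sigma> ext_S(7,4), where l = "p + 1"], goal_cases)
    case (1 V s t) note V = 1
    show ?case
      by (rule rep_agree[OF rep_dif[OF rep_add[OF V(2,3,1)] V(1), unfolded dif_add[OF V(4-6)]]
        rep_add[OF rep_dif[OF V(2,1)] rep_dif[OF V(3,1)] V(1)]])
  qed
  fix \<tau> q assume \<tau>: "\<tau> \<in> sec S q U"
  show "gmul S p q U (\<sigma> \<oplus>\<^bsub>gsec S p U\<^esub> \<sigma>') \<tau> = gmul S p q U \<sigma> \<tau> \<oplus>\<^bsub>gsec S (p + q) U\<^esub> gmul S p q U \<sigma>' \<tau>"
  proof (rule eqI3[OF \<sigma> \<tau> ext_S(6,4), where l = "p + q"], goal_cases)
    case (1 V s t u) note V = 1
    show ?case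
      by (rule rep_agree[OF rep_mul[OF rep_add[OF V(2,3,1)] V(4,1), unfolded mul_add_left[OF V(5-8)]]
        rep_add[OF rep_mul[OF V(2,4,1)] rep_mul[OF V(3,4,1)] V(1)]])
  qed
next
  fix U \<tau> q \<sigma> p \<sigma>' assume U: "opn Y U" and \<tau>: "\<tau> \<in> sec S q U" and \<sigma>: "\<sigma> \<in> sec S p U" "\<sigma>' \<in> sec S p U"
  show "gmul S q p U \<tau> (\<sigma> \<oplus>\<^bsub>gsec S p U\<^esub> \<sigma>') = gmul S q p U \<tau> \<sigma> \<oplus>\<^bsub>gsec S (q + p) U\<^esub> gmul S q p U \<tau> \<sigma>'"
  proof (rule eqI3[OF \<sigma> \<tau> ext_S(6,4), where l = "q + p"], goal_cases)
    case (1 V s t u) note V = 1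
    show ?case
      by (rule rep_agree[OF rep_mul[OF V(4) rep_add[OF V(2,3,1)] V(1), unfolded mul_add_right[OF V(5,8,6,7)]]
        rep_add[OF rep_mul[OF V(4,2,1)] rep_mul[OF V(4,3,1)] V(1)]])
  qed
next
  fix U r \<sigma> p assume U: "opn Y U" and r: "r \<in> carrier (rsec Y U)" and \<sigma>: "\<sigma> \<in> sec S p U"
  show "gdif S p U (r \<odot>\<^bsub>gsec S p U\<^esub> \<sigma>) = r \<odot>\<^bsub>gsec S (p + 1) U\<^esub> gdif S p U \<sigma>"
  proof (rule eqI1[OF \<sigma> ext_S(7,5), where l = "p + 1"], goal_cases)
    case (1 V s) note V = 1
    show ?case
      by (rule rep_agree[OF rep_dif[OF rep_smult[OF V(2,1) U r] V(1),
              unfolded dif_smult[OF V(3) ringed_res_closed[OF ringed U V(3,1) r] V(4)]]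
        rep_smult[OF rep_dif[OF V(2,1)] V(1) U r]])
  qed
  fix \<tau> q assume \<tau>: "\<tau> \<in> sec S q U"
  show "gmul S p q U (r \<odot>\<^bsub>gsec S p U\<^esub> \<sigma>) \<tau> = r \<odot>\<^bsub>gsec S (p + q) U\<^esub> gmul S p q U \<sigma> \<tau>"
  proof (rule eqI2[OF \<sigma> \<tau> ext_S(6,5), where l = "p + q"], goal_cases)
    case (1 V s t) note V = 1
    show ?case
      by (rule rep_agree[OF rep_mul[OF rep_smult[OF V(2,1) U r] V(3,1),
              unfolded mul_smult_left[OF V(4) ringed_res_closed[OF ringed U V(4,1) r] V(5,6)]]
        rep_smult[OF rep_mul[OF V(2,3,1)] V(1) U r]])
  qed
next
  fix U r \<sigma> p \<tau> q assume U: "opn Y U" and r: "r \<in> carrier (rsec Y U)" and \<sigma>: "\<sigma> \<in> sec S p U"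
    and \<tau>: "\<tau> \<in> sec S q U"
  show "gmul S p q U \<sigma> (r \<odot>\<^bsub>gsec S q U\<^esub> \<tau>) = r \<odot>\<^bsub>gsec S (p + q) U\<^esub> gmul S p q U \<sigma> \<tau>"
  proof (rule eqI2[OF \<sigma> \<tau> ext_S(6,5), where l = "p + q"], goal_cases)
    case (1 V s t) note V = 1
    show ?case
      by (rule rep_agree[OF rep_mul[OF V(2) rep_smult[OF V(3,1) U r] V(1),
              unfolded mul_smult_right[OF V(4) ringed_res_closed[OF ringed U V(4,1) r] V(5,6)]]
        rep_smult[OF rep_mul[OF V(2,3,1)] V(1) U r]])
  qed
next
  fix U W assume U: "opn Y U" and W: "opn Y W" "W \<subseteq> U"
  show "gres S 0 U W (gone S U) = gone S W"
    unfolding res_S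
  proof (rule eqI[OF restrict_extensional ext_S(3)])
    fix x assume "x \<in> W"
    then show "\<exists>V s. x \<in> V \<and> V \<subseteq> W \<and> rep 0 V (restrict (gone S U) W) s \<and> rep 0 V (gone S W) s"
      using rep_restrict[OF rep_one[OF U W] order_refl] rep_one[OF W(1) W(1) order_refl] by blast
  qed
  fix \<sigma> p assume \<sigma>: "\<sigma> \<in> sec S p U"
  show "gres S (p + 1) U W (gdif S p U \<sigma>) = gdif S p W (gres S p U W \<sigma>)"
    unfolding res_S
  proof (rule res_eqI2[OF U W \<sigma> \<sigma> ext_S(7)])
    fix V s assume V: "V \<subseteq> W" "V \<subseteq> U" "rep p V \<sigma> s" "rep p V (restrict \<sigma> W) s"
    show "\<exists>z. rep (p + 1) V (gdif S p U \<sigma>) z \<and> rep (p + 1) V (gdif S p W (restrict \<sigma> W)) z"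
      using rep_dif[OF V(3,2)] rep_dif[OF V(4,1)] by blast
  qed
  show "gres S p U W (r \<odot>\<^bsub>gsec S p U\<^esub> \<sigma>) = rres Y U W r \<odot>\<^bsub>gsec S p W\<^esub> gres S p U W \<sigma>"
    if r: "r \<in> carrier (rsec Y U)" for r
    unfolding res_S
  proof (rule res_eqI2[OF U W \<sigma> \<sigma> ext_S(5)])
    fix V s assume V: "V \<subseteq> W" "V \<subseteq> U" "rep p V \<sigma> s" "rep p V (restrict \<sigma> W) s" "opn Y V"
    have "rep p V (rres Y U W r \<odot>\<^bsub>gsec S p W\<^esub> restrict \<sigma> W) (rres Y U V r \<odot>\<^bsub>gsec P p V\<^esub> s)"
      using rep_smult[OF V(4,1) W(1) ringed_res_closed[OF ringed U W r]]
        ringed_res_res[OF ringed U W(1) V(5) V(1) W(2) r] by simp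
    then show "\<exists>z. rep p V (r \<odot>\<^bsub>gsec S p U\<^esub> \<sigma>) z \<and> rep p V (rres Y U W r \<odot>\<^bsub>gsec S p W\<^esub> restrict \<sigma> W) z"
      using rep_smult[OF V(3,2) U r] by blast
  qed
  fix \<tau> q assume \<tau>: "\<tau> \<in> sec S q U"
  show "gres S (p + q) U W (gmul S p q U \<sigma> \<tau>) = gmul S p q W (gres S p U W \<sigma>) (gres S q U W \<tau>)"
    unfolding res_S
  proof (rule res_eqI2[OF U W \<sigma> \<tau> ext_S(6)])
    fix V s t assume V: "V \<subseteq> W" "V \<subseteq> U" "rep p V \<sigma> s" "rep q V \<tau> t" "rep p V (restrict \<sigma> W) s"
      "rep q V (restrict \<tau> W) t"
    show "\<exists>z. rep (p + q) V (gmul S p q U \<sigma> \<tau>) z \<and> rep (p + q) V (gmul S p q W (restrict \<sigma> W) (restrict \<tau> W)) z"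
      using rep_mul[OF V(3,4,2)] rep_mul[OF V(5,6,1)] by blast
  qed
next
  fix U W \<sigma> \<tau> l assume U: "opn Y U" and W: "opn Y W" "W \<subseteq> U"
    and \<sigma>: "\<sigma> \<in> sec S l U" "\<tau> \<in> sec S l U"
  show "gres S l U W (\<sigma> \<oplus>\<^bsub>gsec S l U\<^esub> \<tau>) = gres S l U W \<sigma> \<oplus>\<^bsub>gsec S l W\<^esub> gres S l U W \<tau>"
    unfolding res_S
  proof (rule res_eqI2[OF U W \<sigma> ext_S(4)])
    fix V s t assume V: "V \<subseteq> W" "V \<subseteq> U" "rep l V \<sigma> s" "rep l V \<tau> t" "rep l V (restrict \<sigma> W) s"
      "rep l V (restrict \<tau> W) t"
    show "\<exists>z. rep l V (\<sigma> \<oplus>\<^bsub>gsec S l U\<^esub> \<tau>) z \<and> rep l V (restrict \<sigma> W \<oplus>\<^bsub>gsec S l W\<^esub> restrict \<tau> W) z"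
      using rep_add[OF V(3,4,2)] rep_add[OF V(5,6,1)] by blast
  qed
qed

lemma dg_sheaf_S: "dg_algebra_sheaf Y S"
  by (rule dg_algebra_sheafI[OF dg_presheaf_S sheaf_S])

lemma rep_induced:
  assumes "opn Y U" "s \<in> sec P l U"
  shows "rep l U (\<lambda>x\<in>U. ggerm Y P l x U s) s" "(\<lambda>x\<in>U. ggerm Y P l x U s) \<in> sec S l U"
proof -
  show *: "rep l U (\<lambda>x\<in>U. ggerm Y P l x U s) s" using assms by (simp add: represents_def)
  show "(\<lambda>x\<in>U. ggerm Y P l x U s) \<in> sec S l U"
    using * by (intro secI) auto
qed

text \<open>The universal property of sheafification: over the open sets where a section has a
  representative \<open>s\<close>, the image must be \<open>\<psi> l W s\<close>, and these values
  glue because the target is a sheaf. It is stated relative to an open set \<open>U\<close>, since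
  derivations over \<open>U\<close> are to be extended later; the maps \<open>\<psi>\<close> need
  not be additive.\<close>

lemma extend_to_sheafification:
  assumes F: "\<And>l. sheaf_on (tp Y) (F l) (r l)"
    and U: "opn Y U"
    and cl: "\<And>l V s. \<lbrakk>opn Y V; V \<subseteq> U; s \<in> sec P l V\<rbrakk> \<Longrightarrow> \<psi> l V s \<in> F l V"
    and nat: "\<And>l V W s. \<lbrakk>opn Y V; V \<subseteq> U; opn Y W; W \<subseteq> V; s \<in> sec P l V\<rbrakk> \<Longrightarrow>
       r l V W (\<psi> l V s) = \<psi> l W (gres P l V W s)"
  obtains \<chi> where
    "\<And>l V \<sigma>. \<lbrakk>opn Y V; V \<subseteq> U; \<sigma> \<in> sec S l V\<rbrakk> \<Longrightarrow> \<chi> l V \<sigma> \<in> F l V"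
    "\<And>l V \<sigma> W s. \<lbrakk>opn Y V; V \<subseteq> U; \<sigma> \<in> sec S l V; W \<subseteq> V; rep l W \<sigma> s\<rbrakk> \<Longrightarrow>
       r l V W (\<chi> l V \<sigma>) = \<psi> l W s"
proof -
  have ex: "\<exists>t\<in>F l V. \<forall>W t'. opn Y W \<and> W \<subseteq> V \<and> t' \<in> F l W \<and> (\<exists>s. rep l W \<sigma> s \<and> t' = \<psi> l W s) \<longrightarrow>
      r l V W t = t'"
    if V: "opn Y V" "V \<subseteq> U" and \<sigma>: "\<sigma> \<in> sec S l V" for l V \<sigma>
  proof (rule sheaf_glue[OF F V(1)])
    fix x assume "x \<in> V"
    with \<sigma> obtain W s where W: "x \<in> W" "W \<subseteq> V" "rep l W \<sigma> s" by (rule secE)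
    have "\<psi> l W s \<in> F l W" using W V repD(1,2)[OF W(3)] by (intro cl) auto
    then show "\<exists>W t. opn Y W \<and> x \<in> W \<and> W \<subseteq> V \<and> t \<in> F l W \<and> (\<exists>s. rep l W \<sigma> s \<and> t = \<psi> l W s)"
      using W repD(1)[OF W(3)] by blast
  next
    fix W t t' assume W: "opn Y W" "W \<subseteq> V" "t \<in> F l W" "t' \<in> F l W"
      "\<exists>s. rep l W \<sigma> s \<and> t = \<psi> l W s" "\<exists>s. rep l W \<sigma> s \<and> t' = \<psi> l W s"
    then obtain s s' where s: "rep l W \<sigma> s" "t = \<psi> l W s" "rep l W \<sigma> s'" "t' = \<psi> l W s'" by blast
    show "t = t'"
    \<comment> \<open>Two representatives of the same section agree only locally, but their images
      are sections of a sheaf, so local agreement is enough.\<close>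
    proof (rule sheaf_eqI[OF F W(1,3,4)])
      fix x assume "x \<in> W"
      then obtain W' where W': "opn Y W'" "x \<in> W'" "W' \<subseteq> W" "gres P l W W' s = gres P l W W' s'"
        using rep_eqD[OF s(1,3)] by blast
      have "r l W W' t = r l W W' t'"
        using nat[OF W(1) subset_trans[OF W(2) V(2)] W'(1,3) repD(2)[OF s(1)]]
          nat[OF W(1) subset_trans[OF W(2) V(2)] W'(1,3) repD(2)[OF s(3)]] W'(4) s(2,4) by simp
      then show "\<exists>W'. opn Y W' \<and> x \<in> W' \<and> W' \<subseteq> W \<and> r l W W' t = r l W W' t'"
        using W' by blast
    qed
  next
    fix W W' t assume W: "opn Y W" "W \<subseteq> V" "opn Y W'" "W' \<subseteq> W" "t \<in> F l W"
      "\<exists>s. rep l W \<sigma> s \<and> t = \<psi> l W s"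
    then obtain s where s: "rep l W \<sigma> s" "t = \<psi> l W s" by blast
    show "\<exists>s. rep l W' \<sigma> s \<and> r l W W' t = \<psi> l W' s"
      using rep_mono[OF s(1) W(3,4)] nat[OF W(1) subset_trans[OF W(2) V(2)] W(3,4) repD(2)[OF s(1)]] s(2)
      by blast
  qed
  define \<chi> where "\<chi> l V \<sigma> = (SOME t. t \<in> F l V \<and> (\<forall>W t'. opn Y W \<and> W \<subseteq> V \<and> t' \<in> F l W \<and>
     (\<exists>s. rep l W \<sigma> s \<and> t' = \<psi> l W s) \<longrightarrow> r l V W t = t'))" for l V \<sigma>
  have \<chi>: "\<chi> l V \<sigma> \<in> F l V \<and> (\<forall>W t'. opn Y W \<and> W \<subseteq> V \<and> t' \<in> F l W \<and>
     (\<exists>s. rep l W \<sigma> s \<and> t' = \<psi> l W s) \<longrightarrow> r l V W (\<chi> l V \<sigma>) = t')"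
    if "opn Y V" "V \<subseteq> U" "\<sigma> \<in> sec S l V" for l V \<sigma>
    unfolding \<chi>_def using ex[OF that, unfolded Bex_def] by (rule someI_ex)
  show ?thesis
  proof (rule that[of \<chi>])
    fix l V \<sigma> assume V: "opn Y V" "V \<subseteq> U" "\<sigma> \<in> sec S l V"
    show "\<chi> l V \<sigma> \<in> F l V" using \<chi>[OF V] by blast
    fix W s assume W: "W \<subseteq> V" "rep l W \<sigma> s"
    have "\<psi> l W s \<in> F l W" using W V repD(1,2)[OF W(2)] by (intro cl) auto
    then show "r l V W (\<chi> l V \<sigma>) = \<psi> l W s" using \<chi>[OF V] W repD(1)[OF W(2)] by blast
  qed
qed

end

section \<open>Calculus of additive maps, signs and homomorphisms of dg-algebras\<close>

lemma add_hom_ident: "abelian_group M \<Longrightarrow> add_hom M M (\<lambda>x. x)"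
  by (simp add: add_hom_def)

lemma add_hom_comp: "add_hom M N f \<Longrightarrow> add_hom N K g \<Longrightarrow> add_hom M K (\<lambda>x. g (f x))"
  unfolding add_hom_def by (auto simp: Pi_iff)

lemma add_pow_closed: "abelian_group M \<Longrightarrow> x \<in> carrier M \<Longrightarrow> add_pow M (k::int) x \<in> carrier M"
  using group.int_pow_closed[OF abelian_group.a_group, of M x k] by (simp add: add_pow_def)

lemma add_hom_scale: "abelian_group M \<Longrightarrow> add_hom M M (add_pow M (k::int))"
  by (intro add_homI add_pow_closed abelian_group.add_pow_add)

lemma add_hom_const_zero: "abelian_group M \<Longrightarrow> abelian_group N \<Longrightarrow> add_hom M N (\<lambda>x. \<zero>\<^bsub>N\<^esub>)"
  by (simp add: add_hom_def abelian_groupE abelian_group.axioms abelian_monoid.l_zero)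

lemma add_hom_plus: "add_hom M N f \<Longrightarrow> add_hom M N g \<Longrightarrow> add_hom M N (\<lambda>x. f x \<oplus>\<^bsub>N\<^esub> g x)"
proof (rule add_homI)
  assume f: "add_hom M N f" and g: "add_hom M N g"
  show M: "abelian_group M" and N: "abelian_group N" using f by (simp_all add: add_hom_def)
  interpret N: abelian_group N by fact
  fix x assume x: "x \<in> carrier M"
  show "f x \<oplus>\<^bsub>N\<^esub> g x \<in> carrier N" using add_hom_closed[OF f x] add_hom_closed[OF g x] by simp
  fix y assume y: "y \<in> carrier M"
  show "f (x \<oplus>\<^bsub>M\<^esub> y) \<oplus>\<^bsub>N\<^esub> g (x \<oplus>\<^bsub>M\<^esub> y) = f x \<oplus>\<^bsub>N\<^esub> g x \<oplus>\<^bsub>N\<^esub> (f y \<oplus>\<^bsub>N\<^esub> g y)"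
    using add_hom_closed[OF f x] add_hom_closed[OF g x] add_hom_closed[OF f y] add_hom_closed[OF g y]
    by (simp add: add_hom_add[OF f x y] add_hom_add[OF g x y] N.a_ac)
qed

lemma ksign_mult: "ksign a * ksign b = ksign (a + b)"
  by (simp add: ksign_def)

lemma ksign_cong: "even a = even b \<Longrightarrow> ksign a = ksign b"
  by (simp add: ksign_def)

lemma add_pow_pow: "abelian_group M \<Longrightarrow> x \<in> carrier M \<Longrightarrow> add_pow M (k::int) (add_pow M (l::int) x) = add_pow M (k * l) x"
  using group.int_pow_pow[OF abelian_group.a_group, of M x l k] by (simp add: add_pow_def mult.commute)

lemma signed_signed: "abelian_group M \<Longrightarrow> x \<in> carrier M \<Longrightarrow> signed M a (signed M b x) = signed M (a + b) x"
  by (simp add: add_pow_pow ksign_mult)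

text \<open>The product of tensors is defined by extending in the first factor outermost. Its
  additivity in the second factor, for a fixed representative of the first, becomes visible only
  with the two extensions exchanged.\<close>

lemma frag_extend_swap:
  "frag_extend (\<lambda>g. frag_extend (\<beta> g) z') z = frag_extend (\<lambda>g'. frag_extend (\<lambda>g. \<beta> g g') z) z'"
  unfolding frag_extend_def frag_cmul_sum frag_cmul_cmul
  by (subst sum.swap) (simp only: mult.commute)

lemma
  assumes "dg_alg_hom Y A B f" "opn Y U"
  shows dg_hom_closed: "x \<in> sec A l U \<Longrightarrow> f l U x \<in> sec B l U"
    and dg_hom_add: "x \<in> sec A l U \<Longrightarrow> x' \<in> sec A l U \<Longrightarrow> f l U (x \<oplus>\<^bsub>gsec A l U\<^esub> x') = f l U x \<oplus>\<^bsub>gsec B l U\<^esub> f l U x'"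
    and dg_hom_smult: "r \<in> carrier (rsec Y U) \<Longrightarrow> x \<in> sec A l U \<Longrightarrow>
      f l U (r \<odot>\<^bsub>gsec A l U\<^esub> x) = r \<odot>\<^bsub>gsec B l U\<^esub> f l U x"
    and dg_hom_mul: "x \<in> sec A p U \<Longrightarrow> y \<in> sec A q U \<Longrightarrow>
      f (p + q) U (gmul A p q U x y) = gmul B p q U (f p U x) (f q U y)"
    and dg_hom_one: "f 0 U (gone A U) = gone B U"
    and dg_hom_res: "\<lbrakk>opn Y V; V \<subseteq> U; x \<in> sec A l U\<rbrakk> \<Longrightarrow>
      f l V (gres A l U V x) = gres B l U V (f l U x)"
    and dg_hom_dif: "x \<in> sec A l U \<Longrightarrow> f (l + 1) U (gdif A l U x) = gdif B l U (f l U x)"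
proof -
  note 1 = conjunct1[OF assms(1)[unfolded dg_alg_hom_def], unfolded graded_alg_hom_def,
      THEN spec, THEN mp, OF assms(2)]
  note 2 = conjunct2[OF assms(1)[unfolded dg_alg_hom_def], rule_format, OF assms(2)]
  note c = 1[THEN conjunct1] 1[THEN conjunct2, THEN conjunct1] 1[THEN conjunct2, THEN conjunct2, THEN conjunct1]
    1[THEN conjunct2, THEN conjunct2, THEN conjunct2, THEN conjunct1]
    1[THEN conjunct2, THEN conjunct2, THEN conjunct2, THEN conjunct2, THEN conjunct1]
    1[THEN conjunct2, THEN conjunct2, THEN conjunct2, THEN conjunct2, THEN conjunct2]
  show "x \<in> sec A l U \<Longrightarrow> f l U x \<in> sec B l U" using c(1) by (simp add: Pi_iff)
  show "x \<in> sec A l U \<Longrightarrow> x' \<in> sec A l U \<Longrightarrow> f l U (x \<oplus>\<^bsub>gsec A l U\<^esub> x') = f l U x \<oplus>\<^bsub>gsec B l U\<^esub> f l U x'"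
    using c(2) by simp
  show "r \<in> carrier (rsec Y U) \<Longrightarrow> x \<in> sec A l U \<Longrightarrow> f l U (r \<odot>\<^bsub>gsec A l U\<^esub> x) = r \<odot>\<^bsub>gsec B l U\<^esub> f l U x"
    using c(3) by simp
  show "x \<in> sec A p U \<Longrightarrow> y \<in> sec A q U \<Longrightarrow> f (p + q) U (gmul A p q U x y) = gmul B p q U (f p U x) (f q U y)"
    using c(4) by simp
  show "f 0 U (gone A U) = gone B U" by (rule c(5))
  show "\<lbrakk>opn Y V; V \<subseteq> U; x \<in> sec A l U\<rbrakk> \<Longrightarrow> f l V (gres A l U V x) = gres B l U V (f l U x)"
    using c(6) by simp
  show "x \<in> sec A l U \<Longrightarrow> f (l + 1) U (gdif A l U x) = gdif B l U (f l U x)" by (rule 2)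
qed

lemma dg_alg_homI:
  assumes "\<And>U l x. opn Y U \<Longrightarrow> x \<in> sec A l U \<Longrightarrow> f l U x \<in> sec B l U"
    and "\<And>U l x x'. \<lbrakk>opn Y U; x \<in> sec A l U; x' \<in> sec A l U\<rbrakk> \<Longrightarrow>
      f l U (x \<oplus>\<^bsub>gsec A l U\<^esub> x') = f l U x \<oplus>\<^bsub>gsec B l U\<^esub> f l U x'"
    and "\<And>U l r x. \<lbrakk>opn Y U; r \<in> carrier (rsec Y U); x \<in> sec A l U\<rbrakk> \<Longrightarrow>
      f l U (r \<odot>\<^bsub>gsec A l U\<^esub> x) = r \<odot>\<^bsub>gsec B l U\<^esub> f l U x"
    and "\<And>U p q x y. \<lbrakk>opn Y U; x \<in> sec A p U; y \<in> sec A q U\<rbrakk> \<Longrightarrow>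
      f (p + q) U (gmul A p q U x y) = gmul B p q U (f p U x) (f q U y)"
    and "\<And>U. opn Y U \<Longrightarrow> f 0 U (gone A U) = gone B U"
    and "\<And>U V l x. \<lbrakk>opn Y U; opn Y V; V \<subseteq> U; x \<in> sec A l U\<rbrakk> \<Longrightarrow>
      f l V (gres A l U V x) = gres B l U V (f l U x)"
    and "\<And>U l x. opn Y U \<Longrightarrow> x \<in> sec A l U \<Longrightarrow> f (l + 1) U (gdif A l U x) = gdif B l U (f l U x)"
  shows "dg_alg_hom Y A B f"
  unfolding dg_alg_hom_def graded_alg_hom_def using assms by simp

section \<open>Tensor products\<close>

locale tensor_product =
  fixes Y :: "('a, 'r, 'y) ringed_space_scheme" and A :: "('a, 'r, 'm) dgalg"
    and B :: "('a, 'r, 'b) dgalg" and f :: "('a, 'm, 'b) family"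
    and C :: "('a, 'r, 'c) dgalg" and g :: "('a, 'm, 'c) family"
  assumes ringed: "is_ringed_space Y"
    and A: "dg_algebra_sheaf Y A" and B: "dg_algebra_sheaf Y B" and C: "dg_algebra_sheaf Y C"
    and f: "dg_alg_hom Y A B f" and g: "dg_alg_hom Y A C g"
begin

sublocale A: dg_algebra_sheaf Y A by (rule A)
sublocale B: dg_algebra_sheaf Y B by (rule B)
sublocale C: dg_algebra_sheaf Y C by (rule C)

abbreviation "P \<equiv> ten_presheaf Y A B f C g"
abbreviation "gens \<equiv> ten_gens B C"
abbreviation "rels \<equiv> ten_rels A B f C g"
abbreviation "cls \<equiv> ten_coset A B f C g"

definition ten :: "int \<Rightarrow> int \<Rightarrow> 'a set \<Rightarrow> 'b \<Rightarrow> 'c \<Rightarrow> (('b, 'c) tgen \<Rightarrow>\<^sub>0 int) set" where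
  "ten p q U b c = cls (p + q) U (frag_of ((p, b), (q, c)))"

lemmas hom_simps =
  dg_hom_closed[OF f] dg_hom_add[OF f] dg_hom_smult[OF f] dg_hom_mul[OF f] dg_hom_res[OF f] dg_hom_dif[OF f]
  dg_hom_closed[OF g] dg_hom_add[OF g] dg_hom_smult[OF g] dg_hom_mul[OF g] dg_hom_res[OF g] dg_hom_dif[OF g]

lemma rels_cases:
  assumes "z \<in> rels n U"
  obtains
      (l) p b b' q c where "z = frag_of ((p, b \<oplus>\<^bsub>gsec B p U\<^esub> b'), (q, c)) - frag_of ((p, b), (q, c)) - frag_of ((p, b'), (q, c))"
        "p + q = n" "b \<in> sec B p U" "b' \<in> sec B p U" "c \<in> sec C q U"
    | (r) p b q c c' where "z = frag_of ((p, b), (q, c \<oplus>\<^bsub>gsec C q U\<^esub> c')) - frag_of ((p, b), (q, c)) - frag_of ((p, b), (q, c'))"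
        "p + q = n" "b \<in> sec B p U" "c \<in> sec C q U" "c' \<in> sec C q U"
    | (bal) p b j a q c where "z = frag_of ((p + j, gmul B p j U b (f j U a)), (q, c))
        - frag_of ((p, b), (j + q, gmul C j q U (g j U a) c))"
        "p + j + q = n" "b \<in> sec B p U" "a \<in> sec A j U" "c \<in> sec C q U"
  using assms unfolding ten_rels_def by blast

lemma rels_sub: assumes U: "opn Y U" shows "rels n U \<subseteq> carrier (free_Abelian_group (gens n U))"
proof
  fix z assume "z \<in> rels n U"
  have k2: "Poly_Mapping.keys (frag_of x - frag_of y) \<subseteq> S" if "x \<in> S" "y \<in> S" for x y :: "('b, 'c) tgen" and S
    using keys_diff[of "frag_of x" "frag_of y"] that by (auto simp: keys_frag_of)
  have k3: "Poly_Mapping.keys (frag_of x - frag_of y - frag_of w) \<subseteq> S" if "x \<in> S" "y \<in> S" "w \<in> S"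
    for x y w :: "('b, 'c) tgen" and S
    using keys_diff[of "frag_of x - frag_of y" "frag_of w"] k2[OF that(1,2)] that(3) by (auto simp: keys_frag_of)
  from \<open>z \<in> rels n U\<close> have "Poly_Mapping.keys z \<subseteq> gens n U"
  proof (cases rule: rels_cases)
    case l
    then show ?thesis using U unfolding l(1) by (intro k3) (auto simp: ten_gens_def B.pre.add_closed)
  next
    case r
    then show ?thesis using U unfolding r(1) by (intro k3) (auto simp: ten_gens_def C.pre.add_closed)
  next
    case bal
    then show ?thesis using U unfolding bal(1)
      by (intro k2) (auto simp: ten_gens_def B.mul_closed C.mul_closed hom_simps)
  qed
  then show "z \<in> carrier (free_Abelian_group (gens n U))" by simp
qed

lemma sec_P: "sec P n U = {cls n U z |z. Poly_Mapping.keys z \<subseteq> gens n U}"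
  by (simp add: ten_presheaf_def Let_def ab_quot_carrier)

lemma cls_closed: "Poly_Mapping.keys z \<subseteq> gens n U \<Longrightarrow> cls n U z \<in> sec P n U"
  by (auto simp: sec_P)

lemma cls_zero: "opn Y U \<Longrightarrow> \<zero>\<^bsub>gsec P n U\<^esub> = cls n U 0"
  using ab_quot_one[OF rels_sub] by (simp add: ten_presheaf_def Let_def)

lemma cls_add: "opn Y U \<Longrightarrow> cls n U z \<oplus>\<^bsub>gsec P n U\<^esub> cls n U w = cls n U (z + w)"
  using ab_quot_mult[OF rels_sub] by (simp add: ten_presheaf_def Let_def)

lemma abelian_P: assumes U: "opn Y U" shows "abelian_group (gsec P n U)"
proof (rule abelian_groupI)
  note [simp] = cls_add[OF U] cls_zero[OF U]
  show "\<zero>\<^bsub>gsec P n U\<^esub> \<in> sec P n U" by (simp add: cls_closed)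
  fix x y z assume x: "x \<in> sec P n U"
  then show "\<zero>\<^bsub>gsec P n U\<^esub> \<oplus>\<^bsub>gsec P n U\<^esub> x = x" by (auto simp: sec_P)
  show "\<exists>y\<in>sec P n U. y \<oplus>\<^bsub>gsec P n U\<^esub> x = \<zero>\<^bsub>gsec P n U\<^esub>"
  proof -
    obtain w where w: "x = cls n U w" "Poly_Mapping.keys w \<subseteq> gens n U" using x by (auto simp: sec_P)
    show ?thesis using w by (intro bexI[of _ "cls n U (- w)"]) (auto intro!: cls_closed simp: keys_minus)
  qed
  assume y: "y \<in> sec P n U"
  obtain z' w where zw: "x = cls n U z'" "Poly_Mapping.keys z' \<subseteq> gens n U" "y = cls n U w" "Poly_Mapping.keys w \<subseteq> gens n U"
    using x y by (auto simp: sec_P)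
  then show "x \<oplus>\<^bsub>gsec P n U\<^esub> y \<in> sec P n U"
    using Poly_Mapping.keys_add[of z' w] cls_closed[of "z' + w" n U] by auto
  from x y show "x \<oplus>\<^bsub>gsec P n U\<^esub> y = y \<oplus>\<^bsub>gsec P n U\<^esub> x" by (auto simp: sec_P add.commute)
  assume z: "z \<in> sec P n U"
  with x y show "x \<oplus>\<^bsub>gsec P n U\<^esub> y \<oplus>\<^bsub>gsec P n U\<^esub> z = x \<oplus>\<^bsub>gsec P n U\<^esub> (y \<oplus>\<^bsub>gsec P n U\<^esub> z)"
    by (auto simp: sec_P add.assoc)
qed

lemma cls_hom: "opn Y U \<Longrightarrow>
    group_hom (free_Abelian_group (gens n U)) (add_monoid (gsec P n U)) (cls n U)"
  using abelian_group.a_group[OF abelian_P]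
  by (auto simp: group_hom_def group_hom_axioms_def hom_def cls_closed cls_add)

lemma cls_neg: "opn Y U \<Longrightarrow> Poly_Mapping.keys z \<subseteq> gens n U \<Longrightarrow> \<ominus>\<^bsub>gsec P n U\<^esub> cls n U z = cls n U (- z)"
  using group_hom.hom_inv[OF cls_hom, of U z n] by (simp add: a_inv_def)

lemma cls_pow: "opn Y U \<Longrightarrow> Poly_Mapping.keys z \<subseteq> gens n U \<Longrightarrow>
    add_pow (gsec P n U) (k::int) (cls n U z) = cls n U (frag_cmul k z)"
  using group_hom.hom_int_pow[OF cls_hom, of U z n k] by (simp add: add_pow_def)

text \<open>Here and below the total degree is a variable tied to \<open>p + q\<close> by an
  equation: \<open>p + 1 + q\<close> and \<open>p + q + 1\<close> are different terms indexing the
  same record, and the equation absorbs such reorderings.\<close>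

lemma ten_closed: "\<lbrakk>p + q = n; b \<in> sec B p U; c \<in> sec C q U\<rbrakk> \<Longrightarrow> ten p q U b c \<in> sec P n U"
  using cls_closed[of "frag_of ((p, b), (q, c))" n U] by (auto simp: ten_def ten_gens_def)

lemma cls_rel3:
  assumes "opn Y U" "frag_of x - frag_of y - frag_of z \<in> rels n U"
  shows "cls n U (frag_of x) = cls n U (frag_of y) \<oplus>\<^bsub>gsec P n U\<^esub> cls n U (frag_of z)"
  using ab_relators_rel[OF assms(2), of "gens n U"] assms(1)
  by (simp add: cls_add ab_coset_eq_iff[OF rels_sub] diff_diff_eq)

lemma ten_add_left:
  "\<lbrakk>opn Y U; p + q = n; b \<in> sec B p U; b' \<in> sec B p U; c \<in> sec C q U\<rbrakk> \<Longrightarrow>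
    ten p q U (b \<oplus>\<^bsub>gsec B p U\<^esub> b') c = ten p q U b c \<oplus>\<^bsub>gsec P n U\<^esub> ten p q U b' c"
  by (hypsubst, unfold ten_def, rule cls_rel3) (auto simp: ten_rels_def)

lemma ten_add_right:
  "\<lbrakk>opn Y U; p + q = n; b \<in> sec B p U; c \<in> sec C q U; c' \<in> sec C q U\<rbrakk> \<Longrightarrow>
    ten p q U b (c \<oplus>\<^bsub>gsec C q U\<^esub> c') = ten p q U b c \<oplus>\<^bsub>gsec P n U\<^esub> ten p q U b c'"
  by (hypsubst, unfold ten_def, rule cls_rel3) (auto simp: ten_rels_def)

lemma ten_balanced:
  assumes "opn Y U" "b \<in> sec B p U" "a \<in> sec A j U" "c \<in> sec C q U"
  shows "ten (p + j) q U (gmul B p j U b (f j U a)) c = ten p (j + q) U b (gmul C j q U (g j U a) c)"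
proof -
  have "frag_of ((p + j, gmul B p j U b (f j U a)), (q, c)) -
      frag_of ((p, b), (j + q, gmul C j q U (g j U a) c)) \<in> rels (p + j + q) U"
    using assms unfolding ten_rels_def by blast
  then show ?thesis
    unfolding ten_def add.assoc[symmetric] ab_coset_eq_iff[OF rels_sub[OF assms(1)]] by (rule ab_relators_rel)
qed

lemma add_hom_ten_left: "\<lbrakk>opn Y U; p + q = n; c \<in> sec C q U\<rbrakk> \<Longrightarrow>
    add_hom (gsec B p U) (gsec P n U) (\<lambda>b. ten p q U b c)"
  by (intro add_homI B.pre.abelian abelian_P ten_closed ten_add_left)

lemma add_hom_ten_right: "\<lbrakk>opn Y U; p + q = n; b \<in> sec B p U\<rbrakk> \<Longrightarrow>
    add_hom (gsec C q U) (gsec P n U) (\<lambda>c. ten p q U b c)"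
  by (intro add_homI C.pre.abelian abelian_P ten_closed ten_add_right)

text \<open>Sums of pure tensors exhaust the group: zero is the tensor of two zeros, and the
  negative of a pure tensor is pure again, the sign being put on the first factor. So neither zero
  nor negatives appear among the induction cases.\<close>

lemma ten_induct:
  assumes U: "opn Y U" and x: "x \<in> sec P n U"
    and gen: "\<And>p q b c. \<lbrakk>p + q = n; b \<in> sec B p U; c \<in> sec C q U\<rbrakk> \<Longrightarrow> Q (ten p q U b c)"
    and add: "\<And>x y. \<lbrakk>x \<in> sec P n U; y \<in> sec P n U; Q x; Q y\<rbrakk> \<Longrightarrow> Q (x \<oplus>\<^bsub>gsec P n U\<^esub> y)"
  shows "Q x"
proof -
  obtain z where z: "x = cls n U z" "Poly_Mapping.keys z \<subseteq> gens n U" using x by (auto simp: sec_P)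
  \<comment> \<open>Induction on the free abelian group proceeds by differences, so \<open>Q\<close>
    is carried along for a class together with its negative.\<close>
  have "Q (cls n U z) \<and> Q (cls n U (- z))"
    using z(2)
  proof (rule free_Abelian_group_induct)
    have "ten n 0 U \<zero>\<^bsub>gsec B n U\<^esub> \<zero>\<^bsub>gsec C 0 U\<^esub> = cls n U 0"
      using add_hom_zero[OF add_hom_ten_left[OF U, of n 0 n]] U by (simp add: cls_zero C.pre.zero_closed)
    then show "Q (cls n U 0) \<and> Q (cls n U (- 0))"
      using gen[of n 0] U by (simp add: B.pre.zero_closed C.pre.zero_closed) (metis B.pre.zero_closed C.pre.zero_closed)
  next
    fix x y assume *: "Poly_Mapping.keys x \<subseteq> gens n U" "Poly_Mapping.keys y \<subseteq> gens n U"
      "Q (cls n U x) \<and> Q (cls n U (- x))" "Q (cls n U y) \<and> Q (cls n U (- y))"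
    then have "cls n U x \<in> sec P n U" "cls n U (- x) \<in> sec P n U" "cls n U y \<in> sec P n U" "cls n U (- y) \<in> sec P n U"
      by (auto intro!: cls_closed simp: keys_minus)
    then show "Q (cls n U (x - y)) \<and> Q (cls n U (- (x - y)))"
      using add[of "cls n U x" "cls n U (- y)"] add[of "cls n U y" "cls n U (- x)"] * by (simp add: cls_add[OF U])
  next
    fix a assume "a \<in> gens n U"
    then obtain p q b c where a: "a = ((p, b), (q, c))" "p + q = n" "b \<in> sec B p U" "c \<in> sec C q U"
      by (auto simp: ten_gens_def)
    have 1: "cls n U (frag_of a) = ten p q U b c" using a by (simp add: ten_def)
    have "Poly_Mapping.keys (frag_of a) \<subseteq> gens n U" using \<open>a \<in> gens n U\<close> by simp
    then have 2: "cls n U (- frag_of a) = ten p q U (\<ominus>\<^bsub>gsec B p U\<^esub> b) c"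
      using cls_neg[OF U, of "frag_of a" n] add_hom_neg[OF add_hom_ten_left[OF U a(2,4)] a(3)] 1 by simp
    show "Q (cls n U (frag_of a)) \<and> Q (cls n U (- frag_of a))"
      unfolding 1 2 using a by (auto intro!: gen B.pre.neg_closed U)
  qed
  then show ?thesis using z by simp
qed

text \<open>The laws of the presheaf are proved with this: both sides are additive in each argument,
  so they are compared on pure tensors, one argument at a time.\<close>

lemma hom_eqI:
  assumes U: "opn Y U" and h: "add_hom (gsec P n U) M h" and k: "add_hom (gsec P n U) M k"
    and gen: "\<And>p q b c. \<lbrakk>p + q = n; b \<in> sec B p U; c \<in> sec C q U\<rbrakk> \<Longrightarrow> h (ten p q U b c) = k (ten p q U b c)"
    and x: "x \<in> sec P n U"
  shows "h x = k x"
  using U x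
proof (rule ten_induct)
  show "\<And>p q b c. \<lbrakk>p + q = n; b \<in> sec B p U; c \<in> sec C q U\<rbrakk> \<Longrightarrow> h (ten p q U b c) = k (ten p q U b c)"
    by (rule gen)
  fix x y assume "x \<in> sec P n U" "y \<in> sec P n U" "h x = k x" "h y = k y"
  then show "h (x \<oplus>\<^bsub>gsec P n U\<^esub> y) = k (x \<oplus>\<^bsub>gsec P n U\<^esub> y)"
    by (simp add: add_hom_add[OF h] add_hom_add[OF k])
qed

text \<open>Balancing moves a section of degree \<open>j\<close> from one factor to the other and
  thereby relates the components in degrees \<open>(p + j, q)\<close> and \<open>(p, j + q)\<close>.
  All splittings of the degree \<open>n\<close> therefore have to be treated together as one
  family.\<close>

definition bilinear :: "int \<Rightarrow> 'a set \<Rightarrow> ('x, 'z) ring_scheme \<Rightarrow> (int \<Rightarrow> int \<Rightarrow> 'b \<Rightarrow> 'c \<Rightarrow> 'x) \<Rightarrow> bool" where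
  "bilinear n U M \<psi> \<longleftrightarrow> abelian_group M \<and>
     (\<forall>p q b c. p + q = n \<and> b \<in> sec B p U \<and> c \<in> sec C q U \<longrightarrow> \<psi> p q b c \<in> carrier M) \<and>
     (\<forall>p q b b' c. p + q = n \<and> b \<in> sec B p U \<and> b' \<in> sec B p U \<and> c \<in> sec C q U \<longrightarrow>
        \<psi> p q (b \<oplus>\<^bsub>gsec B p U\<^esub> b') c = \<psi> p q b c \<oplus>\<^bsub>M\<^esub> \<psi> p q b' c) \<and>
     (\<forall>p q b c c'. p + q = n \<and> b \<in> sec B p U \<and> c \<in> sec C q U \<and> c' \<in> sec C q U \<longrightarrow>
        \<psi> p q b (c \<oplus>\<^bsub>gsec C q U\<^esub> c') = \<psi> p q b c \<oplus>\<^bsub>M\<^esub> \<psi> p q b c') \<and>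
     (\<forall>p j q b a c. p + j + q = n \<and> b \<in> sec B p U \<and> a \<in> sec A j U \<and> c \<in> sec C q U \<longrightarrow>
        \<psi> (p + j) q (gmul B p j U b (f j U a)) c = \<psi> p (j + q) b (gmul C j q U (g j U a) c))"

lemma bilinearI:
  assumes "abelian_group M"
    and "\<And>p q b c. \<lbrakk>p + q = n; b \<in> sec B p U; c \<in> sec C q U\<rbrakk> \<Longrightarrow> \<psi> p q b c \<in> carrier M"
    and "\<And>p q b b' c. \<lbrakk>p + q = n; b \<in> sec B p U; b' \<in> sec B p U; c \<in> sec C q U\<rbrakk> \<Longrightarrow>
        \<psi> p q (b \<oplus>\<^bsub>gsec B p U\<^esub> b') c = \<psi> p q b c \<oplus>\<^bsub>M\<^esub> \<psi> p q b' c"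
    and "\<And>p q b c c'. \<lbrakk>p + q = n; b \<in> sec B p U; c \<in> sec C q U; c' \<in> sec C q U\<rbrakk> \<Longrightarrow>
        \<psi> p q b (c \<oplus>\<^bsub>gsec C q U\<^esub> c') = \<psi> p q b c \<oplus>\<^bsub>M\<^esub> \<psi> p q b c'"
    and "\<And>p j q b a c. \<lbrakk>p + j + q = n; b \<in> sec B p U; a \<in> sec A j U; c \<in> sec C q U\<rbrakk> \<Longrightarrow>
        \<psi> (p + j) q (gmul B p j U b (f j U a)) c = \<psi> p (j + q) b (gmul C j q U (g j U a) c)"
  shows "bilinear n U M \<psi>"
  using assms unfolding bilinear_def by blast

text \<open>Each of the three kinds of relators is killed by one of the three laws of
  \<open>\<psi>\<close>. The fact is kept separate because it serves twice: for maps out of the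
  quotient, and for maps between quotients that are given on representatives.\<close>

lemma bilinear_rels:
  assumes U: "opn Y U" and \<psi>: "bilinear n U M \<psi>"
    and h: "group_hom (free_Abelian_group (gens n U)) (add_monoid M) h"
    and h\<psi>: "\<And>p q b c. \<lbrakk>p + q = n; b \<in> sec B p U; c \<in> sec C q U\<rbrakk> \<Longrightarrow> h (frag_of ((p, b), (q, c))) = \<psi> p q b c"
    and z: "z \<in> ab_relators (gens n U) (rels n U)"
  shows "h z = \<zero>\<^bsub>M\<^esub>"
proof -
  interpret h: group_hom "free_Abelian_group (gens n U)" "add_monoid M" h by (rule h)
  interpret M: abelian_group M using \<psi> by (simp add: bilinear_def)
  have keys: "Poly_Mapping.keys (frag_of x) \<subseteq> gens n U \<longleftrightarrow> x \<in> gens n U" for x by simp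
  have hd: "h (z - w) = h z \<ominus>\<^bsub>M\<^esub> h w" if "Poly_Mapping.keys z \<subseteq> gens n U" "Poly_Mapping.keys w \<subseteq> gens n U" for z w
    using h.hom_mult[of z "- w"] h.hom_inv[of w] that by (simp add: a_minus_def a_inv_def)
  have "h z = \<zero>\<^bsub>M\<^esub>" if "z \<in> rels n U" for z
  proof -
    note cl = subset_trans[OF keys_diff]
    from that show ?thesis
    proof (cases rule: rels_cases)
      case (l p b b' q c)
      have g: "((p, b \<oplus>\<^bsub>gsec B p U\<^esub> b'), (q, c)) \<in> gens n U" "((p, b), (q, c)) \<in> gens n U" "((p, b'), (q, c)) \<in> gens n U"
        using l U by (auto simp: ten_gens_def B.pre.add_closed)
      have c: "\<psi> p q b c \<in> carrier M" "\<psi> p q b' c \<in> carrier M"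
        "\<psi> p q (b \<oplus>\<^bsub>gsec B p U\<^esub> b') c = \<psi> p q b c \<oplus>\<^bsub>M\<^esub> \<psi> p q b' c"
        using \<psi> l unfolding bilinear_def by blast+
      have "h z = (\<psi> p q b c \<oplus>\<^bsub>M\<^esub> \<psi> p q b' c) \<ominus>\<^bsub>M\<^esub> \<psi> p q b c \<ominus>\<^bsub>M\<^esub> \<psi> p q b' c"
        unfolding l(1) using g l U by (subst hd, (auto intro!: cl)[2], subst hd)
          (auto simp: h\<psi> c(3)[symmetric] B.pre.add_closed)
      also have "\<dots> = \<zero>\<^bsub>M\<^esub>"
        by (rule frag_rep_eqI, (rule frag_rep_rules | simp add: c M.abelian_group_axioms; fail)+)
      finally show ?thesis .
    next
      case (r p b q c c')
      have g: "((p, b), (q, c \<oplus>\<^bsub>gsec C q U\<^esub> c')) \<in> gens n U" "((p, b), (q, c)) \<in> gens n U" "((p, b), (q, c')) \<in> gens n U"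
        using r U by (auto simp: ten_gens_def C.pre.add_closed)
      have c: "\<psi> p q b c \<in> carrier M" "\<psi> p q b c' \<in> carrier M"
        "\<psi> p q b (c \<oplus>\<^bsub>gsec C q U\<^esub> c') = \<psi> p q b c \<oplus>\<^bsub>M\<^esub> \<psi> p q b c'"
        using \<psi> r unfolding bilinear_def by blast+
      have "h z = (\<psi> p q b c \<oplus>\<^bsub>M\<^esub> \<psi> p q b c') \<ominus>\<^bsub>M\<^esub> \<psi> p q b c \<ominus>\<^bsub>M\<^esub> \<psi> p q b c'"
        unfolding r(1) using g r U by (subst hd, (auto intro!: cl)[2], subst hd)
          (auto simp: h\<psi> c(3)[symmetric] C.pre.add_closed)
      also have "\<dots> = \<zero>\<^bsub>M\<^esub>"
        by (rule frag_rep_eqI, (rule frag_rep_rules | simp add: c M.abelian_group_axioms; fail)+)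
      finally show ?thesis .
    next
      case (bal p b j a q c)
      have bc: "gmul B p j U b (f j U a) \<in> sec B (p + j) U" "gmul C j q U (g j U a) c \<in> sec C (j + q) U"
        using bal U by (auto simp: B.mul_closed C.mul_closed hom_simps)
      then have g: "((p + j, gmul B p j U b (f j U a)), (q, c)) \<in> gens n U"
        "((p, b), (j + q, gmul C j q U (g j U a) c)) \<in> gens n U"
        using bal by (auto simp: ten_gens_def)
      have c: "\<psi> p (j + q) b (gmul C j q U (g j U a) c) \<in> carrier M"
        "\<psi> (p + j) q (gmul B p j U b (f j U a)) c = \<psi> p (j + q) b (gmul C j q U (g j U a) c)"
        using \<psi> bal bc unfolding bilinear_def by (auto simp: add.assoc)
      have "h z = \<psi> (p + j) q (gmul B p j U b (f j U a)) c \<ominus>\<^bsub>M\<^esub> \<psi> p (j + q) b (gmul C j q U (g j U a) c)"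
        unfolding bal(1) using g bal bc by (subst hd) (auto simp: h\<psi>)
      also have "\<dots> = \<zero>\<^bsub>M\<^esub>" using c by (simp add: a_minus_def M.r_neg)
      finally show ?thesis .
    qed
  qed note rel = this
  have "z \<in> generate (free_Abelian_group (gens n U)) (rels n U)" using z by (simp add: ab_relators_def)
  then show ?thesis
  proof (induction rule: generate.induct)
    case one then show ?case using h.hom_one by simp
  next
    case (incl h) then show ?case by (rule rel)
  next
    case (inv h')
    then have "Poly_Mapping.keys h' \<subseteq> gens n U" using subsetD[OF rels_sub[OF U, of n], of h'] by simp
    then show ?case using rel[OF inv] h.hom_inv[of h'] monoid.inv_one[OF group.is_monoid[OF M.a_group]]
      by simp
  next
    case (eng h1 h2)
    then have "h1 \<in> carrier (free_Abelian_group (gens n U))" "h2 \<in> carrier (free_Abelian_group (gens n U))"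
      using ab_relators_closed(5)[OF rels_sub[OF U]] by (simp_all add: ab_relators_def)
    with eng show ?case using h.hom_mult[of h1 h2] M.l_zero[OF M.zero_closed] by simp
  qed
qed

lemma ten_universal:
  assumes U: "opn Y U" and \<psi>: "bilinear n U M \<psi>"
  obtains u where "add_hom (gsec P n U) M u"
    "\<And>p q b c. \<lbrakk>p + q = n; b \<in> sec B p U; c \<in> sec C q U\<rbrakk> \<Longrightarrow> u (ten p q U b c) = \<psi> p q b c"
proof -
  interpret M: abelian_group M using \<psi> by (simp add: bilinear_def)
  define \<psi>' where "\<psi>' = (\<lambda>((p, b), (q, c)). \<psi> p q b c)"
  have "\<psi>' ` gens n U \<subseteq> carrier (add_monoid M)"
    using \<psi> by (auto simp: bilinear_def ten_gens_def \<psi>'_def)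
  then obtain h where h: "h \<in> hom (free_Abelian_group (gens n U)) (add_monoid M)"
    "\<And>x. x \<in> gens n U \<Longrightarrow> h (frag_of x) = \<psi>' x"
    by (rule comm_group.free_Abelian_group_universal[OF M.a_comm_group]) (rule that)
  \<comment> \<open>The value on a class is read off from an arbitrary representative; it does not
    depend on the representative, because \<open>h\<close> kills the relators.\<close>
  define u where "u c = h (SOME z. z \<in> c)" for c
  from h have gh: "group_hom (free_Abelian_group (gens n U)) (add_monoid M) h"
    using M.a_group by (simp add: group_hom_def group_hom_axioms_def)
  interpret h: group_hom "free_Abelian_group (gens n U)" "add_monoid M" h by (rule gh)
  have h\<psi>: "h (frag_of ((p, b), (q, c))) = \<psi> p q b c" if "p + q = n" "b \<in> sec B p U" "c \<in> sec C q U" for p q b c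
    using h(2)[of "((p, b), (q, c))"] that by (simp add: ten_gens_def \<psi>'_def)
  have h0: "h z = \<zero>\<^bsub>M\<^esub>" if "z \<in> ab_relators (gens n U) (rels n U)" for z
    by (rule bilinear_rels[OF U \<psi> gh h\<psi> that])
  have u: "u (cls n U z) = h z" if z: "Poly_Mapping.keys z \<subseteq> gens n U" for z
  proof -
    note alt = ab_coset_alt[OF rels_sub[OF U, of n]]
    define w where "w = (SOME w. w \<in> cls n U z)"
    have "z \<in> cls n U z" using ab_relators_closed(1)[OF rels_sub[OF U]] by (simp add: alt)
    then have "w \<in> cls n U z" unfolding w_def by (rule someI)
    then have w: "w - z \<in> ab_relators (gens n U) (rels n U)" by (simp add: alt)
    have "Poly_Mapping.keys (w - z) \<subseteq> gens n U" using ab_relators_closed(5)[OF rels_sub[OF U] w] .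
    then have "h ((w - z) + z) = h (w - z) \<oplus>\<^bsub>M\<^esub> h z" using h.hom_mult[of "w - z" z] z by simp
    also have "\<dots> = h z" using h0[OF w] h.hom_closed[of z] z by simp
    finally show ?thesis by (simp add: u_def w_def)
  qed
  show ?thesis
  proof (rule that[of u])
    show "add_hom (gsec P n U) M u"
    proof (rule add_homI[OF abelian_P[OF U] M.abelian_group_axioms])
      fix x assume "x \<in> sec P n U"
      then obtain z where z: "x = cls n U z" "Poly_Mapping.keys z \<subseteq> gens n U" by (auto simp: sec_P)
      show "u x \<in> carrier M" using z h.hom_closed[of z] by (simp add: u)
      fix y assume "y \<in> sec P n U"
      then obtain w where w: "y = cls n U w" "Poly_Mapping.keys w \<subseteq> gens n U" by (auto simp: sec_P)
      have "Poly_Mapping.keys (z + w) \<subseteq> gens n U" using z w Poly_Mapping.keys_add[of z w] by blast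
      then show "u (x \<oplus>\<^bsub>gsec P n U\<^esub> y) = u x \<oplus>\<^bsub>M\<^esub> u y"
        using z w h.hom_mult[of z w] by (simp add: u cls_add[OF U])
    qed
    show "u (ten p q U b c) = \<psi> p q b c" if "p + q = n" "b \<in> sec B p U" "c \<in> sec C q U" for p q b c
      using that u[of "frag_of ((p, b), (q, c))"] by (auto simp: ten_def h\<psi> ten_gens_def)
  qed
qed

end

section \<open>The operations of the tensor product presheaf\<close>

context tensor_product
begin

lemma keys_frag_extend_gens:
  assumes "\<And>p q b c. \<lbrakk>p + q = n; b \<in> sec B p U; c \<in> sec C q U\<rbrakk> \<Longrightarrow>
      Poly_Mapping.keys (\<phi> ((p, b), (q, c))) \<subseteq> K"
    and "Poly_Mapping.keys z \<subseteq> gens n U"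
  shows "Poly_Mapping.keys (frag_extend \<phi> z) \<subseteq> K"
proof -
  have "Poly_Mapping.keys (\<phi> x) \<subseteq> K" if "x \<in> Poly_Mapping.keys z" for x
  proof -
    have "x \<in> gens n U" using that assms(2) by (rule rev_subsetD)
    then obtain p q b c where "x = ((p, b), (q, c))" "p + q = n" "b \<in> sec B p U" "c \<in> sec C q U"
      by (auto simp: ten_gens_def)
    then show ?thesis using assms(1) by simp
  qed
  then show ?thesis using keys_frag_extend[of \<phi> z] by blast
qed

text \<open>The presheaf operations apply a map \<open>\<phi>\<close> of generators to all
  representatives of a class and unite the resulting classes. Once the classes of the values of
  \<open>\<phi>\<close> form a balanced family \<open>\<psi>\<close>, the union is a single class
  and the operation is the additive map that \<open>\<psi>\<close> determines. Restriction, scalars,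
  differential and product all get their usable description this way.\<close>

lemma
  assumes U: "opn Y U" and V: "opn Y V"
    and keys: "\<And>p q b c. \<lbrakk>p + q = n; b \<in> sec B p U; c \<in> sec C q U\<rbrakk> \<Longrightarrow>
      Poly_Mapping.keys (\<phi> ((p, b), (q, c))) \<subseteq> gens n' V"
    and \<phi>: "\<And>p q b c. \<lbrakk>p + q = n; b \<in> sec B p U; c \<in> sec C q U\<rbrakk> \<Longrightarrow>
      cls n' V (\<phi> ((p, b), (q, c))) = \<psi> p q b c"
    and \<psi>: "bilinear n U (gsec P n' V) \<psi>"
  shows induced_cls: "Poly_Mapping.keys z \<subseteq> gens n U \<Longrightarrow>
      (\<Union>z\<in>cls n U z. cls n' V (frag_extend \<phi> z)) = cls n' V (frag_extend \<phi> z)"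
    and induced_hom: "add_hom (gsec P n U) (gsec P n' V) (\<lambda>S. \<Union>z\<in>S. cls n' V (frag_extend \<phi> z))"
    and induced_ten: "\<lbrakk>p + q = n; b \<in> sec B p U; c \<in> sec C q U\<rbrakk> \<Longrightarrow>
      (\<Union>z\<in>ten p q U b c. cls n' V (frag_extend \<phi> z)) = \<psi> p q b c"
proof -
  have k: "Poly_Mapping.keys (frag_extend \<phi> z) \<subseteq> gens n' V" if "Poly_Mapping.keys z \<subseteq> gens n U" for z
    using keys that by (rule keys_frag_extend_gens)
  have h: "group_hom (free_Abelian_group (gens n U)) (add_monoid (gsec P n' V)) (\<lambda>z. cls n' V (frag_extend \<phi> z))"
    using abelian_group.a_group[OF abelian_P[OF V]] k
    by (auto simp: group_hom_def group_hom_axioms_def hom_def cls_closed cls_add[OF V] frag_extend_add)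
  have 0: "cls n' V (frag_extend \<phi> z) = cls n' V 0" if "z \<in> ab_relators (gens n U) (rels n U)" for z
    using bilinear_rels[OF U \<psi> h _ that] \<phi> by (simp add: cls_zero[OF V])
  have rel: "frag_extend \<phi> z \<in> ab_relators (gens n' V) (rels n' V)" if "z \<in> ab_relators (gens n U) (rels n U)" for z
    using 0[OF that] by (simp add: ab_coset_eq_iff[OF rels_sub[OF V]])
  show un: "(\<Union>z\<in>cls n U z. cls n' V (frag_extend \<phi> z)) = cls n' V (frag_extend \<phi> z)" for z
    by (rule ab_coset_UN[OF rels_sub[OF U] rels_sub[OF V] frag_extend_diff rel])
  show "add_hom (gsec P n U) (gsec P n' V) (\<lambda>S. \<Union>z\<in>S. cls n' V (frag_extend \<phi> z))"
  proof (rule add_homI[OF abelian_P[OF U] abelian_P[OF V]])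
    fix x assume "x \<in> sec P n U"
    then obtain z where z: "x = cls n U z" "Poly_Mapping.keys z \<subseteq> gens n U" by (auto simp: sec_P)
    then show "(\<Union>z\<in>x. cls n' V (frag_extend \<phi> z)) \<in> sec P n' V"
      using cls_closed[OF k[OF z(2)]] by (simp only: z(1) un)
    fix y assume "y \<in> sec P n U"
    then obtain w where w: "y = cls n U w" "Poly_Mapping.keys w \<subseteq> gens n U" by (auto simp: sec_P)
    show "(\<Union>z\<in>x \<oplus>\<^bsub>gsec P n U\<^esub> y. cls n' V (frag_extend \<phi> z)) =
        (\<Union>z\<in>x. cls n' V (frag_extend \<phi> z)) \<oplus>\<^bsub>gsec P n' V\<^esub> (\<Union>z\<in>y. cls n' V (frag_extend \<phi> z))"
      by (simp only: z(1) w(1) cls_add[OF U] un cls_add[OF V] frag_extend_add)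
  qed
  show "(\<Union>z\<in>ten p q U b c. cls n' V (frag_extend \<phi> z)) = \<psi> p q b c"
    if "p + q = n" "b \<in> sec B p U" "c \<in> sec C q U"
    using that \<phi>[OF that] un[of "frag_of ((p, b), (q, c))"] by (simp add: ten_def)
qed

lemma bilinear_homI:
  assumes "abelian_group M"
    and l: "\<And>p q c. p + q = n \<Longrightarrow> c \<in> sec C q U \<Longrightarrow> add_hom (gsec B p U) M (\<lambda>b. \<psi> p q b c)"
    and r: "\<And>p q b. p + q = n \<Longrightarrow> b \<in> sec B p U \<Longrightarrow> add_hom (gsec C q U) M (\<lambda>c. \<psi> p q b c)"
    and "\<And>p j q b a c. \<lbrakk>p + j + q = n; b \<in> sec B p U; a \<in> sec A j U; c \<in> sec C q U\<rbrakk> \<Longrightarrow>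
        \<psi> (p + j) q (gmul B p j U b (f j U a)) c = \<psi> p (j + q) b (gmul C j q U (g j U a) c)"
  shows "bilinear n U M \<psi>"
  using assms(1) add_hom_closed[OF l] add_hom_add[OF l] add_hom_add[OF r] assms(4)
  by (rule bilinearI)

lemma f_closed: "opn Y U \<Longrightarrow> a \<in> sec A j U \<Longrightarrow> f j U a \<in> sec B j U"
  by (rule dg_hom_closed[OF f])

lemma g_closed: "opn Y U \<Longrightarrow> a \<in> sec A j U \<Longrightarrow> g j U a \<in> sec C j U"
  by (rule dg_hom_closed[OF g])

text \<open>The pattern of the next lemmas: \<open>\<phi>\<close> is the map on generators taken
  from the definition, \<open>\<psi>\<close> its effect on pure tensors, and the only mathematical
  content is that \<open>\<psi>\<close> is balanced.\<close>

lemma P_res: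
  assumes U: "opn Y U" and V: "opn Y V" "V \<subseteq> U"
  shows "add_hom (gsec P n U) (gsec P n V) (gres P n U V)"
    and "\<lbrakk>p + q = n; b \<in> sec B p U; c \<in> sec C q U\<rbrakk> \<Longrightarrow>
      gres P n U V (ten p q U b c) = ten p q V (gres B p U V b) (gres C q U V c)"
proof -
  let ?\<phi> = "\<lambda>((p, b), (q, c)). frag_of ((p, gres B p U V b), (q, gres C q U V c))"
  let ?\<psi> = "\<lambda>p q b c. ten p q V (gres B p U V b) (gres C q U V c)"
  note res = B.pre.res_closed[OF U V] C.pre.res_closed[OF U V]
  have keys: "Poly_Mapping.keys (?\<phi> ((p, b), (q, c))) \<subseteq> gens n V"
    if "p + q = n" "b \<in> sec B p U" "c \<in> sec C q U" for p q b c
    using that by (auto simp: ten_gens_def res)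
  have \<phi>: "cls n V (?\<phi> ((p, b), (q, c))) = ?\<psi> p q b c"
    if "p + q = n" "b \<in> sec B p U" "c \<in> sec C q U" for p q b c
    using that by (simp add: ten_def)
  have bil: "bilinear n U (gsec P n V) ?\<psi>"
  proof (rule bilinear_homI[OF abelian_P[OF V(1)]])
    show "add_hom (gsec B p U) (gsec P n V) (\<lambda>b. ten p q V (gres B p U V b) (gres C q U V c))"
      if "p + q = n" "c \<in> sec C q U" for p q c
      by (rule add_hom_comp[OF B.pre.add_hom_res[OF U V] add_hom_ten_left[OF V(1) that(1) res(2)[OF that(2)]]])
    show "add_hom (gsec C q U) (gsec P n V) (\<lambda>c. ten p q V (gres B p U V b) (gres C q U V c))"
      if "p + q = n" "b \<in> sec B p U" for p q b
      by (rule add_hom_comp[OF C.pre.add_hom_res[OF U V] add_hom_ten_right[OF V(1) that(1) res(1)[OF that(2)]]])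
    show "ten (p + j) q V (gres B (p + j) U V (gmul B p j U b (f j U a))) (gres C q U V c) =
        ten p (j + q) V (gres B p U V b) (gres C (j + q) U V (gmul C j q U (g j U a) c))"
      if "b \<in> sec B p U" "a \<in> sec A j U" "c \<in> sec C q U" for p j q b a c
      using that ten_balanced[OF V(1) res(1)[OF that(1)] A.pre.res_closed[OF U V that(2)] res(2)[OF that(3)]]
      by (simp add: B.mul_res[OF U V] C.mul_res[OF U V] f_closed U g_closed dg_hom_res[OF f U V] dg_hom_res[OF g U V])
  qed
  have eq: "gres P n U V = (\<lambda>S. \<Union>z\<in>S. cls n V (frag_extend ?\<phi> z))"
    by (simp add: ten_presheaf_def)
  show "add_hom (gsec P n U) (gsec P n V) (gres P n U V)"
    unfolding eq by (rule induced_hom[OF U V(1) keys \<phi> bil])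
  show "gres P n U V (ten p q U b c) = ten p q V (gres B p U V b) (gres C q U V c)"
    if "p + q = n" "b \<in> sec B p U" "c \<in> sec C q U" for p q b c
    unfolding eq by (rule induced_ten[OF U V(1) keys \<phi> bil that])
qed

lemma P_smult:
  assumes U: "opn Y U" and r: "r \<in> carrier (rsec Y U)"
  shows "add_hom (gsec P n U) (gsec P n U) ((\<odot>\<^bsub>gsec P n U\<^esub>) r)"
    and "\<lbrakk>p + q = n; b \<in> sec B p U; c \<in> sec C q U\<rbrakk> \<Longrightarrow>
      r \<odot>\<^bsub>gsec P n U\<^esub> ten p q U b c = ten p q U (r \<odot>\<^bsub>gsec B p U\<^esub> b) c"
proof -
  let ?\<phi> = "\<lambda>((p, b), (q, c)). frag_of ((p, r \<odot>\<^bsub>gsec B p U\<^esub> b), (q, c))"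
  let ?\<psi> = "\<lambda>p q b c. ten p q U (r \<odot>\<^bsub>gsec B p U\<^esub> b) c"
  note s = B.pre.smult_closed[OF U r]
  have keys: "Poly_Mapping.keys (?\<phi> ((p, b), (q, c))) \<subseteq> gens n U"
    if "p + q = n" "b \<in> sec B p U" "c \<in> sec C q U" for p q b c
    using that by (auto simp: ten_gens_def s)
  have \<phi>: "cls n U (?\<phi> ((p, b), (q, c))) = ?\<psi> p q b c"
    if "p + q = n" "b \<in> sec B p U" "c \<in> sec C q U" for p q b c
    using that by (simp add: ten_def)
  have bil: "bilinear n U (gsec P n U) ?\<psi>"
  proof (rule bilinear_homI[OF abelian_P[OF U]])
    show "add_hom (gsec B p U) (gsec P n U) (\<lambda>b. ten p q U (r \<odot>\<^bsub>gsec B p U\<^esub> b) c)"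
      if "p + q = n" "c \<in> sec C q U" for p q c
      by (rule add_hom_comp[OF B.pre.add_hom_smult[OF U r] add_hom_ten_left[OF U that]])
    show "add_hom (gsec C q U) (gsec P n U) (\<lambda>c. ten p q U (r \<odot>\<^bsub>gsec B p U\<^esub> b) c)"
      if "p + q = n" "b \<in> sec B p U" for p q b
      by (rule add_hom_ten_right[OF U that(1) s[OF that(2)]])
    show "ten (p + j) q U (r \<odot>\<^bsub>gsec B (p + j) U\<^esub> (gmul B p j U b (f j U a))) c =
        ten p (j + q) U (r \<odot>\<^bsub>gsec B p U\<^esub> b) (gmul C j q U (g j U a) c)"
      if "b \<in> sec B p U" "a \<in> sec A j U" "c \<in> sec C q U" for p j q b a c
      using ten_balanced[OF U s[OF that(1)] that(2,3)] B.mul_smult_left[OF U r that(1) f_closed[OF U that(2)]] by simp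
  qed
  have eq: "(\<odot>\<^bsub>gsec P n U\<^esub>) r = (\<lambda>S. \<Union>z\<in>S. cls n U (frag_extend ?\<phi> z))"
    by (simp add: ten_presheaf_def Let_def)
  show "add_hom (gsec P n U) (gsec P n U) ((\<odot>\<^bsub>gsec P n U\<^esub>) r)"
    unfolding eq by (rule induced_hom[OF U U keys \<phi> bil])
  show "r \<odot>\<^bsub>gsec P n U\<^esub> ten p q U b c = ten p q U (r \<odot>\<^bsub>gsec B p U\<^esub> b) c"
    if "p + q = n" "b \<in> sec B p U" "c \<in> sec C q U" for p q b c
    unfolding eq by (rule induced_ten[OF U U keys \<phi> bil that])
qed

text \<open>Balancing is the point. Expanding the differential of \<open>b a \<otimes> c\<close> and
  that of \<open>b \<otimes> a c\<close> gives the same three terms, with the differential on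
  \<open>b\<close>, on \<open>a\<close> or on \<open>c\<close>; the middle terms match because
  \<open>f\<close> and \<open>g\<close> both commute with the differentials.\<close>

lemma P_dif:
  assumes U: "opn Y U"
  shows "add_hom (gsec P n U) (gsec P (n + 1) U) (gdif P n U)"
    and "\<lbrakk>p + q = n; b \<in> sec B p U; c \<in> sec C q U\<rbrakk> \<Longrightarrow>
      gdif P n U (ten p q U b c) = ten (p + 1) q U (gdif B p U b) c \<oplus>\<^bsub>gsec P (n + 1) U\<^esub>
        signed (gsec P (n + 1) U) p (ten p (q + 1) U b (gdif C q U c))"
proof -
  let ?\<phi> = "\<lambda>((p, b), (q, c)). frag_of ((p + 1, gdif B p U b), (q, c)) +
                   frag_cmul (ksign p) (frag_of ((p, b), (q + 1, gdif C q U c)))"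
  let ?\<psi> = "\<lambda>p q b c. ten (p + 1) q U (gdif B p U b) c \<oplus>\<^bsub>gsec P (n + 1) U\<^esub>
        signed (gsec P (n + 1) U) p (ten p (q + 1) U b (gdif C q U c))"
  note d = B.dif_closed[OF U] C.dif_closed[OF U]
  have gens1: "((p + 1, gdif B p U b), (q, c)) \<in> gens (n + 1) U" "((p, b), (q + 1, gdif C q U c)) \<in> gens (n + 1) U"
    if "p + q = n" "b \<in> sec B p U" "c \<in> sec C q U" for p q b c
    using that by (auto simp: ten_gens_def d)
  have keys: "Poly_Mapping.keys (?\<phi> ((p, b), (q, c))) \<subseteq> gens (n + 1) U"
    if "p + q = n" "b \<in> sec B p U" "c \<in> sec C q U" for p q b c
    using Poly_Mapping.keys_add[of "frag_of ((p + 1, gdif B p U b), (q, c))"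
        "frag_cmul (ksign p) (frag_of ((p, b), (q + 1, gdif C q U c)))"]
      keys_cmul[of "ksign p" "frag_of ((p, b), (q + 1, gdif C q U c))"] gens1[OF that] by auto
  have \<phi>: "cls (n + 1) U (?\<phi> ((p, b), (q, c))) = ?\<psi> p q b c"
    if "p + q = n" "b \<in> sec B p U" "c \<in> sec C q U" for p q b c
  proof -
    have n: "n + 1 = p + 1 + q" "n + 1 = p + (q + 1)" using that by auto
    have "Poly_Mapping.keys (frag_of ((p, b), (q + 1, gdif C q U c))) \<subseteq> gens (n + 1) U" using gens1[OF that] by simp
    from cls_pow[OF U this, of "ksign p"] show ?thesis
      unfolding ten_def n(1)[symmetric] n(2)[symmetric] by (simp add: cls_add[OF U])
  qed
  have bil: "bilinear n U (gsec P (n + 1) U) ?\<psi>"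
  proof (rule bilinear_homI[OF abelian_P[OF U]])
    fix p q c assume *: "p + q = n" "c \<in> sec C q U"
    then have **: "p + 1 + q = n + 1" "p + (q + 1) = n + 1" by auto
    show "add_hom (gsec B p U) (gsec P (n + 1) U) (\<lambda>b. ?\<psi> p q b c)"
      by (intro add_hom_plus add_hom_comp[OF B.pre.add_hom_dif[OF U] add_hom_ten_left[OF U **(1) *(2)]]
        add_hom_comp[OF add_hom_ten_left[OF U **(2) d(2)[OF *(2)]] add_hom_scale[OF abelian_P[OF U]]])
  next
    fix p q b assume *: "p + q = n" "b \<in> sec B p U"
    then have **: "p + 1 + q = n + 1" "p + (q + 1) = n + 1" by auto
    show "add_hom (gsec C q U) (gsec P (n + 1) U) (\<lambda>c. ?\<psi> p q b c)"
      by (intro add_hom_plus add_hom_ten_right[OF U **(1) d(1)[OF *(2)]]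
        add_hom_comp[OF add_hom_comp[OF C.pre.add_hom_dif[OF U] add_hom_ten_right[OF U **(2) *(2)]]
          add_hom_scale[OF abelian_P[OF U]]])
  next
    fix p j q b a c assume n: "p + j + q = n" and b: "b \<in> sec B p U" and a: "a \<in> sec A j U" and c: "c \<in> sec C q U"
    note fa = f_closed[OF U a] and ga = g_closed[OF U a] and da = A.dif_closed[OF U a]
    let ?M = "gsec P (n + 1) U"
    let ?x = "ten (p + 1) (j + q) U (gdif B p U b) (gmul C j q U (g j U a) c)"
    let ?y = "ten p (j + q + 1) U b (gmul C (j + 1) q U (g (j + 1) U (gdif A j U a)) c)"
    let ?z = "ten p (j + q + 1) U b (gmul C j (q + 1) U (g j U a) (gdif C q U c))"
    have cl: "?x \<in> carrier ?M" "?y \<in> carrier ?M" "?z \<in> carrier ?M"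
      using n C.mul_closed[OF U ga c] C.mul_closed[OF U g_closed[OF U da] c] C.mul_closed[OF U ga d(2)[OF c]] d(1)[OF b] b
      by (auto intro!: ten_closed simp: ac_simps)
    have 1: "ten (p + j + 1) q U (gmul B (p + 1) j U (gdif B p U b) (f j U a)) c = ?x"
      using ten_balanced[OF U d(1)[OF b] a c] by (simp add: ac_simps)
    have 2: "ten (p + j + 1) q U (gmul B p (j + 1) U b (f (j + 1) U (gdif A j U a))) c = ?y"
      using ten_balanced[OF U b da c] by (simp add: ac_simps)
    have 3: "ten (p + j) (q + 1) U (gmul B p j U b (f j U a)) (gdif C q U c) = ?z"
      using ten_balanced[OF U b a d(2)[OF c]] by (simp add: ac_simps)
    have m: "gmul B (p + 1) j U (gdif B p U b) (f j U a) \<in> sec B (p + j + 1) U"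
      "gmul B p (j + 1) U b (f (j + 1) U (gdif A j U a)) \<in> sec B (p + j + 1) U"
      "gmul C (j + 1) q U (g (j + 1) U (gdif A j U a)) c \<in> sec C (j + q + 1) U"
      "gmul C j (q + 1) U (g j U a) (gdif C q U c) \<in> sec C (j + q + 1) U"
      using B.mul_closed[OF U d(1)[OF b] fa] B.mul_closed[OF U b f_closed[OF U da]]
        C.mul_closed[OF U g_closed[OF U da] c] C.mul_closed[OF U ga d(2)[OF c]] by (simp_all add: ac_simps)
    have n': "p + j + 1 + q = n + 1" "p + (j + q + 1) = n + 1" using n by auto
    note hl = add_hom_ten_left[OF U n'(1) c] and hr = add_hom_ten_right[OF U n'(2) b]
    have L: "ten (p + j + 1) q U (gdif B (p + j) U (gmul B p j U b (f j U a))) c = ?x \<oplus>\<^bsub>?M\<^esub> signed ?M p ?y"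
      using B.dif_mul[OF U b fa] 1 2
      by (simp add: dg_hom_dif[OF f U a, symmetric] add_hom_add[OF hl m(1) add_pow_closed[OF B.pre.abelian[OF U] m(2)]]
          add_hom_pow[OF hl m(2)])
    have R: "ten p (j + q + 1) U b (gdif C (j + q) U (gmul C j q U (g j U a) c)) = ?y \<oplus>\<^bsub>?M\<^esub> signed ?M j ?z"
      using C.dif_mul[OF U ga c]
      by (simp add: dg_hom_dif[OF g U a, symmetric] add_hom_add[OF hr m(3) add_pow_closed[OF C.pre.abelian[OF U] m(4)]]
          add_hom_pow[OF hr m(4)])
    have "(x \<oplus>\<^bsub>?M\<^esub> signed ?M p y) \<oplus>\<^bsub>?M\<^esub> signed ?M (p + j) z = x \<oplus>\<^bsub>?M\<^esub> signed ?M p (y \<oplus>\<^bsub>?M\<^esub> signed ?M j z)"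
      if "x \<in> carrier ?M" "y \<in> carrier ?M" "z \<in> carrier ?M" for x y z
      by (rule frag_rep_eqI, (rule frag_rep_rules
        | simp add: that abelian_P[OF U] frag_cmul_distrib2 ksign_mult add.assoc; fail)+)
    from this[OF cl]
    have "(?x \<oplus>\<^bsub>?M\<^esub> signed ?M p ?y) \<oplus>\<^bsub>?M\<^esub> signed ?M (p + j) ?z = ?x \<oplus>\<^bsub>?M\<^esub> signed ?M p (?y \<oplus>\<^bsub>?M\<^esub> signed ?M j ?z)" .
    then show "?\<psi> (p + j) q (gmul B p j U b (f j U a)) c = ?\<psi> p (j + q) b (gmul C j q U (g j U a) c)"
      unfolding L R 3 .
  qed
  have eq: "gdif P n U = (\<lambda>S. \<Union>z\<in>S. cls (n + 1) U (frag_extend ?\<phi> z))"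
    by (simp add: ten_presheaf_def)
  show "add_hom (gsec P n U) (gsec P (n + 1) U) (gdif P n U)"
    unfolding eq by (rule induced_hom[OF U U keys \<phi> bil])
  show "gdif P n U (ten p q U b c) = ?\<psi> p q b c"
    if "p + q = n" "b \<in> sec B p U" "c \<in> sec C q U" for p q b c
    unfolding eq by (rule induced_ten[OF U U keys \<phi> bil that])
qed

text \<open>Well-definedness is obtained one factor at a time. Multiplication by a fixed pure tensor
  on the right is an additive map of the left factor; for a fixed left factor these maps, viewed as
  a function of the right tensor, are again a balanced family.\<close>

lemma P_mul:
  assumes U: "opn Y U"
  shows "x \<in> sec P m U \<Longrightarrow> add_hom (gsec P n U) (gsec P (m + n) U) (gmul P m n U x)"
    and "y \<in> sec P n U \<Longrightarrow> add_hom (gsec P m U) (gsec P (m + n) U) (\<lambda>x. gmul P m n U x y)"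
    and "\<lbrakk>p + q = m; b \<in> sec B p U; c \<in> sec C q U; p' + q' = n; b' \<in> sec B p' U; c' \<in> sec C q' U\<rbrakk> \<Longrightarrow>
      gmul P m n U (ten p q U b c) (ten p' q' U b' c') =
        signed (gsec P (m + n) U) (q * p') (ten (p + p') (q + q') U (gmul B p p' U b b') (gmul C q q' U c c'))"
proof -
  let ?M = "gsec P (m + n) U"
  define \<beta> where "\<beta> = (\<lambda>((p, b), (q, c)). \<lambda>((p', b'), (q', c')).
                   frag_cmul (ksign (q * p'))
                     (frag_of ((p + p', gmul B p p' U b b'), (q + q', gmul C q q' U c c'))))"
  define \<psi> where "\<psi> = (\<lambda>p' q' b' c' p q b c. signed ?M (q * p') (ten (p + p') (q + q') U (gmul B p p' U b b') (gmul C q q' U c c')))"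
  \<comment> \<open>Multiplication by the pure tensor of \<open>b'\<close> and \<open>c'\<close>
    from the right.\<close>
  define L where "L = (\<lambda>p' q' b' c' S. \<Union>z\<in>S. cls (m + n) U (frag_extend (\<lambda>g. \<beta> g ((p', b'), (q', c'))) z))"
  note Bm = B.mul_closed[OF U] and Cm = C.mul_closed[OF U]
  have keys: "Poly_Mapping.keys (\<beta> ((p, b), (q, c)) ((p', b'), (q', c'))) \<subseteq> gens (m + n) U"
    if "p + q = m" "b \<in> sec B p U" "c \<in> sec C q U" "p' + q' = n" "b' \<in> sec B p' U" "c' \<in> sec C q' U"
    for p q b c p' q' b' c'
    using that by (auto simp: \<beta>_def ten_gens_def Bm Cm)
  have \<phi>: "cls (m + n) U (\<beta> ((p, b), (q, c)) ((p', b'), (q', c'))) = \<psi> p' q' b' c' p q b c"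
    if "p + q = m" "b \<in> sec B p U" "c \<in> sec C q U" "p' + q' = n" "b' \<in> sec B p' U" "c' \<in> sec C q' U"
    for p q b c p' q' b' c'
  proof -
    have n: "m + n = p + p' + (q + q')" using that by auto
    have "Poly_Mapping.keys (frag_of ((p + p', gmul B p p' U b b'), (q + q', gmul C q q' U c c'))) \<subseteq> gens (m + n) U"
      using that by (auto simp: ten_gens_def Bm Cm)
    from cls_pow[OF U this, of "ksign (q * p')"] show ?thesis
      by (simp add: \<beta>_def \<psi>_def ten_def n)
  qed
  have homB: "add_hom (gsec B p U) (gsec P k U) (\<lambda>b. signed (gsec P k U) s (ten (p + p') t U (gmul B p p' U b b') d))"
    if "b' \<in> sec B p' U" "d \<in> sec C t U" "p + p' + t = k" for p p' b' t d k s
    by (intro add_hom_comp[OF add_hom_comp[OF B.pre.add_hom_mul_left[OF U that(1)] add_hom_ten_left[OF U that(3,2)]]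
          add_hom_scale[OF abelian_P[OF U]]])
  have homC: "add_hom (gsec C q U) (gsec P k U) (\<lambda>c. signed (gsec P k U) s (ten t (q + q') U d (gmul C q q' U c c')))"
    if "c' \<in> sec C q' U" "d \<in> sec B t U" "t + (q + q') = k" for q q' c' t d k s
    by (intro add_hom_comp[OF add_hom_comp[OF C.pre.add_hom_mul_left[OF U that(1)] add_hom_ten_right[OF U that(3,2)]]
          add_hom_scale[OF abelian_P[OF U]]])
  have homB': "add_hom (gsec B p' U) (gsec P k U) (\<lambda>b'. signed (gsec P k U) s (ten (p + p') t U (gmul B p p' U b b') d))"
    if "b \<in> sec B p U" "d \<in> sec C t U" "p + p' + t = k" for p p' b t d k s
    by (intro add_hom_comp[OF add_hom_comp[OF B.pre.add_hom_mul_right[OF U that(1)] add_hom_ten_left[OF U that(3,2)]]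
          add_hom_scale[OF abelian_P[OF U]]])
  have homC': "add_hom (gsec C q' U) (gsec P k U) (\<lambda>c'. signed (gsec P k U) s (ten t (q + q') U d (gmul C q q' U c c')))"
    if "c \<in> sec C q U" "d \<in> sec B t U" "t + (q + q') = k" for q q' c t d k s
    by (intro add_hom_comp[OF add_hom_comp[OF C.pre.add_hom_mul_right[OF U that(1)] add_hom_ten_right[OF U that(3,2)]]
          add_hom_scale[OF abelian_P[OF U]]])
  \<comment> \<open>Moving \<open>a\<close> out of the left tensor means moving it past
    \<open>b'\<close> in \<open>B\<close>, at the cost of the sign \<open>j p'\<close>. This
    accounts for the change of the Koszul sign from \<open>q p'\<close> to
    \<open>(j + q) p'\<close>.\<close>
  have bal1: "\<psi> p' q' b' c' (p + j) q (gmul B p j U b (f j U a)) c = \<psi> p' q' b' c' p (j + q) b (gmul C j q U (g j U a) c)"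
    if "p + j + q = m" "b \<in> sec B p U" "a \<in> sec A j U" "c \<in> sec C q U" "p' + q' = n" "b' \<in> sec B p' U" "c' \<in> sec C q' U"
    for p q b c p' q' b' c' j a
  proof -
    note fa = f_closed[OF U that(3)] and ga = g_closed[OF U that(3)]
    let ?bb = "gmul B p p' U b b'" and ?cc = "gmul C q q' U c c'"
    let ?t = "ten (p + p' + j) (q + q') U (gmul B (p + p') j U ?bb (f j U a)) ?cc"
    have bb: "?bb \<in> sec B (p + p') U" and cc: "?cc \<in> sec C (q + q') U" using that Bm Cm by auto
    have k: "p + p' + j + (q + q') = m + n" "p + j + p' + (q + q') = m + n" using that by auto
    have bf: "gmul B (p + p') j U ?bb (f j U a) \<in> sec B (p + p' + j) U" using Bm[OF bb fa] .
    have t: "?t \<in> carrier ?M" by (rule ten_closed[OF k(1) bf cc])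
    have "gmul B (p + j) p' U (gmul B p j U b (f j U a)) b' = gmul B p (j + p') U b (gmul B j p' U (f j U a) b')"
      using that fa by (simp add: B.mul_assoc[OF U])
    also have "\<dots> = gmul B p (j + p') U b (signed (gsec B (j + p') U) (j * p') (gmul B p' j U b' (f j U a)))"
      using that fa by (subst B.mul_graded_comm[OF U, of "f j U a"]) auto
    also have "\<dots> = signed (gsec B (p + (j + p')) U) (j * p') (gmul B p (j + p') U b (gmul B p' j U b' (f j U a)))"
      using that fa Bm[of b' p' "f j U a" j]
      by (intro add_hom_pow[OF B.pre.add_hom_mul_right[OF U that(2)]]) (simp add: ac_simps)
    also have "gmul B p (j + p') U b (gmul B p' j U b' (f j U a)) = gmul B (p + p') j U ?bb (f j U a)"
      using B.mul_assoc[OF U that(2,6) fa] by (simp add: ac_simps)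
    finally have "ten (p + j + p') (q + q') U (gmul B (p + j) p' U (gmul B p j U b (f j U a)) b') ?cc =
       ten (p + p' + j) (q + q') U (signed (gsec B (p + p' + j) U) (j * p') (gmul B (p + p') j U ?bb (f j U a))) ?cc"
      by (simp add: ac_simps)
    also have "\<dots> = signed ?M (j * p') ?t"
      by (rule add_hom_pow[OF add_hom_ten_left[OF U k(1) cc] bf])
    finally have L: "\<psi> p' q' b' c' (p + j) q (gmul B p j U b (f j U a)) c = signed ?M (q * p') (signed ?M (j * p') ?t)"
      by (simp add: \<psi>_def)
    have "gmul C (j + q) q' U (gmul C j q U (g j U a) c) c' = gmul C j (q + q') U (g j U a) ?cc"
      using that ga by (simp add: C.mul_assoc[OF U])
    then have R: "\<psi> p' q' b' c' p (j + q) b (gmul C j q U (g j U a) c) = signed ?M ((j + q) * p') ?t"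
      using ten_balanced[OF U bb that(3) cc] by (simp add: \<psi>_def add.assoc)
    show ?thesis
      unfolding L R using signed_signed[OF abelian_P[OF U] t] by (simp add: distrib_right add.commute)
  qed
  have bil1: "bilinear m U ?M (\<psi> p' q' b' c')"
    if "p' + q' = n" "b' \<in> sec B p' U" "c' \<in> sec C q' U" for p' q' b' c'
    by (rule bilinear_homI[OF abelian_P[OF U]])
      (use that homB homC Bm Cm bal1 in \<open>auto simp: \<psi>_def intro!: homB homC\<close>)
  have Lhom: "add_hom (gsec P m U) ?M (L p' q' b' c')"
    and Lten: "\<lbrakk>p + q = m; b \<in> sec B p U; c \<in> sec C q U\<rbrakk> \<Longrightarrow> L p' q' b' c' (ten p q U b c) = \<psi> p' q' b' c' p q b c"
    and Lcls: "Poly_Mapping.keys z \<subseteq> gens m U \<Longrightarrow>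
      cls (m + n) U (frag_extend (\<lambda>g. \<beta> g ((p', b'), (q', c'))) z) = L p' q' b' c' (cls m U z)"
    if c': "p' + q' = n" "b' \<in> sec B p' U" "c' \<in> sec C q' U" for p' q' b' c' p q b c z
    unfolding L_def
      apply (rule induced_hom[OF U U keys[OF _ _ _ c'] \<phi>[OF _ _ _ c'] bil1[OF c']], assumption+)
     apply (rule induced_ten[OF U U keys[OF _ _ _ c'] \<phi>[OF _ _ _ c'] bil1[OF c']], assumption+)
    apply (rule induced_cls[OF U U keys[OF _ _ _ c'] \<phi>[OF _ _ _ c'] bil1[OF c'], symmetric], assumption+)
    done
  \<comment> \<open>The laws in the right factor are identities between additive maps of the left
    factor \<open>x\<close>, so they need checking only for a pure tensor \<open>x\<close>.\<close>
  have bil2: "bilinear n U ?M (\<lambda>p' q' b' c'. L p' q' b' c' x)" if x: "x \<in> sec P m U" for x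
  proof (rule bilinearI[OF abelian_P[OF U]])
    show "L p' q' b' c' x \<in> carrier ?M" if "p' + q' = n" "b' \<in> sec B p' U" "c' \<in> sec C q' U" for p' q' b' c'
      by (rule add_hom_closed[OF Lhom[OF that] x])
    show "L p' q' (b' \<oplus>\<^bsub>gsec B p' U\<^esub> b'') c' x = L p' q' b' c' x \<oplus>\<^bsub>?M\<^esub> L p' q' b'' c' x"
      if "p' + q' = n" "b' \<in> sec B p' U" "b'' \<in> sec B p' U" "c' \<in> sec C q' U" for p' q' b' b'' c'
    proof (rule hom_eqI[OF U _ _ _ x])
      have s: "b' \<oplus>\<^bsub>gsec B p' U\<^esub> b'' \<in> sec B p' U" using that B.pre.add_closed[OF U] by blast
      show "add_hom (gsec P m U) ?M (L p' q' (b' \<oplus>\<^bsub>gsec B p' U\<^esub> b'') c')" by (rule Lhom[OF that(1) s that(4)])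
      show "add_hom (gsec P m U) ?M (\<lambda>x. L p' q' b' c' x \<oplus>\<^bsub>?M\<^esub> L p' q' b'' c' x)"
        by (intro add_hom_plus Lhom that)
      fix p q b c assume *: "p + q = m" "b \<in> sec B p U" "c \<in> sec C q U"
      have k: "p + p' + (q + q') = m + n" using * that by auto
      show "L p' q' (b' \<oplus>\<^bsub>gsec B p' U\<^esub> b'') c' (ten p q U b c) =
          L p' q' b' c' (ten p q U b c) \<oplus>\<^bsub>?M\<^esub> L p' q' b'' c' (ten p q U b c)"
        using add_hom_add[OF homB'[OF *(2) Cm[OF *(3) that(4)] k] that(2,3)]
        by (simp only: Lten[OF that(1) s that(4) *] Lten[OF that(1,2,4) *] Lten[OF that(1,3,4) *] \<psi>_def)
    qed
    show "L p' q' b' (c' \<oplus>\<^bsub>gsec C q' U\<^esub> c'') x = L p' q' b' c' x \<oplus>\<^bsub>?M\<^esub> L p' q' b' c'' x"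
      if "p' + q' = n" "b' \<in> sec B p' U" "c' \<in> sec C q' U" "c'' \<in> sec C q' U" for p' q' b' c'' c'
    proof (rule hom_eqI[OF U _ _ _ x])
      have s: "c' \<oplus>\<^bsub>gsec C q' U\<^esub> c'' \<in> sec C q' U" using that C.pre.add_closed[OF U] by blast
      show "add_hom (gsec P m U) ?M (L p' q' b' (c' \<oplus>\<^bsub>gsec C q' U\<^esub> c''))" by (rule Lhom[OF that(1,2) s])
      show "add_hom (gsec P m U) ?M (\<lambda>x. L p' q' b' c' x \<oplus>\<^bsub>?M\<^esub> L p' q' b' c'' x)"
        by (intro add_hom_plus Lhom that)
      fix p q b c assume *: "p + q = m" "b \<in> sec B p U" "c \<in> sec C q U"
      have k: "p + p' + (q + q') = m + n" using * that by auto
      show "L p' q' b' (c' \<oplus>\<^bsub>gsec C q' U\<^esub> c'') (ten p q U b c) =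
          L p' q' b' c' (ten p q U b c) \<oplus>\<^bsub>?M\<^esub> L p' q' b' c'' (ten p q U b c)"
        using add_hom_add[OF homC'[OF *(3) Bm[OF *(2) that(2)] k] that(3,4)]
        by (simp only: Lten[OF that(1,2) s *] Lten[OF that(1,2,3) *] Lten[OF that(1,2,4) *] \<psi>_def)
    qed
    \<comment> \<open>Now \<open>a\<close> has to pass \<open>c\<close> in \<open>C\<close>, at the
      cost of the sign \<open>q j\<close>; on the other side the same sign sits in the Koszul sign
      \<open>q (p' + j)\<close>.\<close>
    show "L (p' + j) q' (gmul B p' j U b' (f j U a)) c' x = L p' (j + q') b' (gmul C j q' U (g j U a) c') x"
      if b': "p' + j + q' = n" "b' \<in> sec B p' U" "a \<in> sec A j U" "c' \<in> sec C q' U" for p' j q' b' a c'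
    proof (rule hom_eqI[OF U _ _ _ x])
      note fa = f_closed[OF U that(3)] and ga = g_closed[OF U that(3)]
      note bf = Bm[OF b'(2) fa] and gc = Cm[OF ga b'(4)]
      have k': "p' + (j + q') = n" using b' by auto
      show "add_hom (gsec P m U) ?M (L (p' + j) q' (gmul B p' j U b' (f j U a)) c')" by (rule Lhom[OF b'(1) bf b'(4)])
      show "add_hom (gsec P m U) ?M (L p' (j + q') b' (gmul C j q' U (g j U a) c'))" by (rule Lhom[OF k' b'(2) gc])
      fix p q b c assume *: "p + q = m" "b \<in> sec B p U" "c \<in> sec C q U"
      let ?bb = "gmul B p p' U b b'" and ?cc = "gmul C q q' U c c'"
      have bb: "?bb \<in> sec B (p + p') U" and cc: "?cc \<in> sec C (q + q') U" using b' * Bm Cm by auto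
      have k: "p + p' + (j + (q + q')) = m + n" using * b' by auto
      have gcc: "gmul C j (q + q') U (g j U a) ?cc \<in> sec C (j + (q + q')) U" using Cm[OF ga cc] .
      let ?t = "ten (p + p') (j + (q + q')) U ?bb (gmul C j (q + q') U (g j U a) ?cc)"
      have t: "?t \<in> carrier ?M" by (rule ten_closed[OF k bb gcc])
      have L: "\<psi> (p' + j) q' (gmul B p' j U b' (f j U a)) c' p q b c = signed ?M (q * (p' + j)) ?t"
        using ten_balanced[OF U bb b'(3) cc] B.mul_assoc[OF U *(2) b'(2) fa] by (simp add: \<psi>_def add.assoc)
      have "gmul C q (j + q') U c (gmul C j q' U (g j U a) c') = gmul C (q + j) q' U (gmul C q j U c (g j U a)) c'"
        using * b' ga by (simp add: C.mul_assoc[OF U])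
      also have "\<dots> = gmul C (q + j) q' U (signed (gsec C (q + j) U) (q * j) (gmul C j q U (g j U a) c)) c'"
        using * ga by (subst C.mul_graded_comm[OF U, of c]) auto
      also have "\<dots> = signed (gsec C (q + j + q') U) (q * j) (gmul C (q + j) q' U (gmul C j q U (g j U a) c) c')"
        using Cm[OF ga *(3)]
        by (intro add_hom_pow[OF C.pre.add_hom_mul_left[OF U b'(4)]]) (simp add: ac_simps)
      also have "gmul C (q + j) q' U (gmul C j q U (g j U a) c) c' = gmul C j (q + q') U (g j U a) ?cc"
        using C.mul_assoc[OF U ga *(3) b'(4)] by (simp add: ac_simps)
      finally have "ten (p + p') (q + (j + q')) U ?bb (gmul C q (j + q') U c (gmul C j q' U (g j U a) c')) =
          ten (p + p') (j + (q + q')) U ?bb (signed (gsec C (j + (q + q')) U) (q * j) (gmul C j (q + q') U (g j U a) ?cc))"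
        by (simp add: ac_simps)
      also have "\<dots> = signed ?M (q * j) ?t"
        by (rule add_hom_pow[OF add_hom_ten_right[OF U k bb] gcc])
      finally have R: "\<psi> p' (j + q') b' (gmul C j q' U (g j U a) c') p q b c = signed ?M (q * p') (signed ?M (q * j) ?t)"
        by (simp add: \<psi>_def)
      show "L (p' + j) q' (gmul B p' j U b' (f j U a)) c' (ten p q U b c) =
          L p' (j + q') b' (gmul C j q' U (g j U a) c') (ten p q U b c)"
        unfolding Lten[OF b'(1) bf b'(4) *] Lten[OF k' b'(2) gc *] L R
        using signed_signed[OF abelian_P[OF U] t] by (simp add: distrib_left)
    qed
  qed
  \<comment> \<open>Multiplication on the left by one fixed representative \<open>z\<close>; the
    union runs over the representatives of the right factor only.\<close>
  define R where "R = (\<lambda>z S. \<Union>z'\<in>S. cls (m + n) U (frag_extend (\<lambda>g'. frag_extend (\<lambda>g. \<beta> g g') z) z'))"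
  have Rhom: "add_hom (gsec P n U) ?M (R z)"
    and Rten: "\<lbrakk>p' + q' = n; b' \<in> sec B p' U; c' \<in> sec C q' U\<rbrakk> \<Longrightarrow> R z (ten p' q' U b' c') = L p' q' b' c' (cls m U z)"
    if z: "Poly_Mapping.keys z \<subseteq> gens m U" for z p' q' b' c'
  proof -
    have k: "Poly_Mapping.keys (frag_extend (\<lambda>g. \<beta> g ((p', b'), (q', c'))) z) \<subseteq> gens (m + n) U"
      if "p' + q' = n" "b' \<in> sec B p' U" "c' \<in> sec C q' U" for p' q' b' c'
      using keys[OF _ _ _ that] z by (rule keys_frag_extend_gens)
    show "add_hom (gsec P n U) ?M (R z)"
      unfolding R_def by (rule induced_hom[OF U U k Lcls[OF _ _ _ z] bil2[OF cls_closed[OF z]]])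
    show "\<lbrakk>p' + q' = n; b' \<in> sec B p' U; c' \<in> sec C q' U\<rbrakk> \<Longrightarrow> R z (ten p' q' U b' c') = L p' q' b' c' (cls m U z)"
      unfolding R_def by (rule induced_ten[OF U U k Lcls[OF _ _ _ z] bil2[OF cls_closed[OF z]]])
  qed
  \<comment> \<open>The remaining union over representatives of the left factor collapses: on pure
    tensors \<open>R z\<close> is given by \<open>L\<close>, which sees only the class of
    \<open>z\<close>.\<close>
  have mulR: "gmul P m n U (cls m U z) y = R z y" if z: "Poly_Mapping.keys z \<subseteq> gens m U" and y: "y \<in> sec P n U" for z y
  proof -
    have "gmul P m n U (cls m U z) y = (\<Union>w\<in>cls m U z. R w y)"
    proof -
      have "frag_extend (\<lambda>g'. frag_extend (\<lambda>g. \<beta> g g') w) z' = frag_extend (\<lambda>g. frag_extend (\<beta> g) z') w" for w z'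
        by (rule frag_extend_swap[symmetric])
      then have "R w y = (\<Union>z'\<in>y. cls (m + n) U (frag_extend (\<lambda>g. frag_extend (\<beta> g) z') w))" for w
        by (simp only: R_def)
      then show ?thesis by (simp add: ten_presheaf_def \<beta>_def case_prod_unfold)
    qed
    moreover have "R w y = R z y" if "w \<in> cls m U z" for w
    proof -
      have wz: "w - z \<in> ab_relators (gens m U) (rels m U)" using that by (simp add: ab_coset_alt[OF rels_sub[OF U]])
      then have eq: "cls m U w = cls m U z" by (simp add: ab_coset_eq_iff[OF rels_sub[OF U]])
      have "Poly_Mapping.keys (w - z + z) \<subseteq> gens m U"
        using ab_relators_closed(5)[OF rels_sub[OF U] wz] z Poly_Mapping.keys_add[of "w - z" z] by blast
      then have w: "Poly_Mapping.keys w \<subseteq> gens m U" by simp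
      show ?thesis
        by (rule hom_eqI[OF U Rhom[OF w] Rhom[OF z] _ y]) (simp add: Rten[OF w] Rten[OF z] eq)
    qed
    moreover have "z \<in> cls m U z" using ab_relators_closed(1)[OF rels_sub[OF U]] by (simp add: ab_coset_alt[OF rels_sub[OF U]])
    ultimately show ?thesis by blast
  qed
  have hom2: "add_hom (gsec P n U) ?M (gmul P m n U x)"
    and ten2: "\<lbrakk>p' + q' = n; b' \<in> sec B p' U; c' \<in> sec C q' U\<rbrakk> \<Longrightarrow>
      gmul P m n U x (ten p' q' U b' c') = L p' q' b' c' x"
    if x: "x \<in> sec P m U" for x p' q' b' c'
  proof -
    obtain z where z: "x = cls m U z" "Poly_Mapping.keys z \<subseteq> gens m U" using x by (auto simp: sec_P)
    show "add_hom (gsec P n U) ?M (gmul P m n U x)"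
    proof (rule add_homI[OF abelian_P[OF U] abelian_P[OF U]])
      fix y y' assume y: "y \<in> sec P n U"
      show "gmul P m n U x y \<in> carrier ?M" unfolding z(1) mulR[OF z(2) y] by (rule add_hom_closed[OF Rhom[OF z(2)] y])
      assume y': "y' \<in> sec P n U"
      have "y \<oplus>\<^bsub>gsec P n U\<^esub> y' \<in> sec P n U"
        using abelian_P[OF U] y y' abelian_monoid.a_closed[OF abelian_group.axioms(1)] by fast
      then show "gmul P m n U x (y \<oplus>\<^bsub>gsec P n U\<^esub> y') = gmul P m n U x y \<oplus>\<^bsub>?M\<^esub> gmul P m n U x y'"
        unfolding z(1) by (simp add: mulR[OF z(2)] y y' add_hom_add[OF Rhom[OF z(2)] y y'])
    qed
    show "gmul P m n U x (ten p' q' U b' c') = L p' q' b' c' x"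
      if "p' + q' = n" "b' \<in> sec B p' U" "c' \<in> sec C q' U"
      unfolding z(1) mulR[OF z(2) ten_closed[OF that]] by (rule Rten[OF z(2) that])
  qed
  show "add_hom (gsec P n U) ?M (gmul P m n U x)" if "x \<in> sec P m U" by (rule hom2[OF that])
  show "add_hom (gsec P m U) ?M (\<lambda>x. gmul P m n U x y)" if y: "y \<in> sec P n U"
  proof (rule add_homI[OF abelian_P[OF U] abelian_P[OF U]])
    fix x x' assume x: "x \<in> sec P m U"
    show "gmul P m n U x y \<in> carrier ?M" by (rule add_hom_closed[OF hom2[OF x] y])
    assume x': "x' \<in> sec P m U"
    have s: "x \<oplus>\<^bsub>gsec P m U\<^esub> x' \<in> sec P m U"
      using abelian_P[OF U] x x' abelian_monoid.a_closed[OF abelian_group.axioms(1)] by fast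
    show "gmul P m n U (x \<oplus>\<^bsub>gsec P m U\<^esub> x') y = gmul P m n U x y \<oplus>\<^bsub>?M\<^esub> gmul P m n U x' y"
      by (rule hom_eqI[OF U hom2[OF s] add_hom_plus[OF hom2[OF x] hom2[OF x']] _ y])
        (simp add: ten2[OF s] ten2[OF x] ten2[OF x'] add_hom_add[OF Lhom x x'])
  qed
  show "gmul P m n U (ten p q U b c) (ten p' q' U b' c') =
        signed ?M (q * p') (ten (p + p') (q + q') U (gmul B p p' U b b') (gmul C q q' U c c'))"
    if "p + q = m" "b \<in> sec B p U" "c \<in> sec C q U" "p' + q' = n" "b' \<in> sec B p' U" "c' \<in> sec C q' U"
    using ten2[OF ten_closed[OF that(1-3)] that(4-6)] Lten[OF that(4-6) that(1-3)] by (simp add: \<psi>_def)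
qed

end

section \<open>Units and products of products in a dg-algebra\<close>

context dg_algebra_presheaf
begin

lemma dif_one: assumes U: "opn Y U" shows "gdif A 0 U (gone A U) = \<zero>\<^bsub>gsec A 1 U\<^esub>"
proof -
  interpret M: abelian_group "gsec A 1 U" by (rule abelian[OF U])
  let ?d = "gdif A 0 U (gone A U)"
  have d: "?d \<in> carrier (gsec A 1 U)" using dif_closed[OF U one_closed[OF U]] by simp
  have "?d = ?d \<oplus>\<^bsub>gsec A 1 U\<^esub> ?d"
    using dif_mul[OF U one_closed[OF U] one_closed[OF U]] one_left[OF U] one_right[OF U] d one_closed[OF U]
      M.signed_even[OF d, of 0] by simp
  then show ?thesis using d M.add.l_cancel_one'[of ?d ?d] by simp
qed

text \<open>Moving \<open>x'\<close> to the left past \<open>y\<close> produces the Koszul sign.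
  With \<open>x\<close>, \<open>x'\<close> coming from one algebra and \<open>y\<close>,
  \<open>y'\<close> from another, this is the product rule of pure tensors, valid in any dg-algebra
  that receives homomorphisms from both.\<close>

lemma interchange:
  assumes U: "opn Y U" and x: "x \<in> sec A p U" and y: "y \<in> sec A q U" and x': "x' \<in> sec A p' U" and y': "y' \<in> sec A q' U"
  shows "gmul A (p + q) (p' + q') U (gmul A p q U x y) (gmul A p' q' U x' y') =
    signed (gsec A (p + q + (p' + q')) U) (q * p') (gmul A (p + p') (q + q') U (gmul A p p' U x x') (gmul A q q' U y y'))"
proof -
  note m = mul_closed[OF U]
  note c = m[OF x y] m[OF x' y'] m[OF y x'] m[OF x' y] m[OF x x'] m[OF y y']
  have "gmul A (p + q) (p' + q') U (gmul A p q U x y) (gmul A p' q' U x' y') =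
      gmul A p (q + (p' + q')) U x (gmul A (q + p') q' U (gmul A q p' U y x') y')"
    using mul_assoc[OF U x y c(2)] mul_assoc[OF U y x' y'] by simp
  also have "\<dots> = gmul A p (q + (p' + q')) U x (signed (gsec A (q + p' + q') U) (q * p') (gmul A (q + p') q' U (gmul A p' q U x' y) y'))"
    using mul_graded_comm[OF U y x'] add_hom_pow[OF add_hom_mul_left[OF U y'], of "gmul A p' q U x' y" "q + p'"] c
    by (simp add: add.commute)
  also have "\<dots> = signed (gsec A (p + (q + p' + q')) U) (q * p') (gmul A p (q + p' + q') U x (gmul A (q + p') q' U (gmul A p' q U x' y) y'))"
    using add_hom_pow[OF add_hom_mul_right[OF U x], of "gmul A (q + p') q' U (gmul A p' q U x' y) y'" "q + p' + q'"]
      m[OF c(4) y'] by (simp add: ac_simps)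
  also have "gmul A p (q + p' + q') U x (gmul A (q + p') q' U (gmul A p' q U x' y) y') =
      gmul A (p + p') (q + q') U (gmul A p p' U x x') (gmul A q q' U y y')"
    using mul_assoc[OF U x' y y'] mul_assoc[OF U x x' c(6)] by (simp add: ac_simps)
  finally show ?thesis by (simp add: ac_simps)
qed

end

section \<open>The canonical map from a presheaf to its sheafification\<close>

context sheafification
begin

definition induced :: "int \<Rightarrow> 'a set \<Rightarrow> 'p \<Rightarrow> 'a \<Rightarrow> ('a set \<times> 'p) set" where
  "induced l U s = (\<lambda>x\<in>U. ggerm Y P l x U s)"

lemma rep_induced': "opn Y U \<Longrightarrow> s \<in> sec P l U \<Longrightarrow> rep l U (induced l U s) s"
  unfolding induced_def by (rule rep_induced)

lemma induced_closed: "opn Y U \<Longrightarrow> s \<in> sec P l U \<Longrightarrow> induced l U s \<in> sec S l U"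
  unfolding induced_def by (rule rep_induced)

lemma rep_eq_induced: "rep l U \<sigma> s \<Longrightarrow> restrict \<sigma> U = induced l U s"
  by (auto simp: represents_def induced_def intro!: restrict_ext)

lemma rep_eq_induced': "\<sigma> \<in> extensional U \<Longrightarrow> rep l U \<sigma> s \<Longrightarrow> \<sigma> = induced l U s"
  using rep_eq_induced[of l U \<sigma> s] by (simp add: extensional_restrict)

lemma induced_add: "\<lbrakk>opn Y U; s \<in> sec P l U; t \<in> sec P l U\<rbrakk> \<Longrightarrow>
    induced l U (s \<oplus>\<^bsub>gsec P l U\<^esub> t) = induced l U s \<oplus>\<^bsub>gsec S l U\<^esub> induced l U t"
  by (rule rep_eq_induced'[OF ext_S(4) rep_add[OF rep_induced' rep_induced' order_refl], symmetric])

lemma induced_mul: "\<lbrakk>opn Y U; s \<in> sec P p U; t \<in> sec P q U\<rbrakk> \<Longrightarrow>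
    induced (p + q) U (gmul P p q U s t) = gmul S p q U (induced p U s) (induced q U t)"
  by (rule rep_eq_induced'[OF ext_S(6) rep_mul[OF rep_induced' rep_induced' order_refl], symmetric])

lemma induced_dif: "opn Y U \<Longrightarrow> s \<in> sec P p U \<Longrightarrow>
    induced (p + 1) U (gdif P p U s) = gdif S p U (induced p U s)"
  by (rule rep_eq_induced'[OF ext_S(7) rep_dif[OF rep_induced' order_refl], symmetric])

lemma induced_one: "opn Y U \<Longrightarrow> induced 0 U (gone P U) = gone S U"
  by (rule rep_eq_induced'[OF ext_S(3) rep_one[OF _ _ order_refl], symmetric])

lemma induced_smult: "\<lbrakk>opn Y U; r \<in> carrier (rsec Y U); s \<in> sec P p U\<rbrakk> \<Longrightarrow>
    induced p U (r \<odot>\<^bsub>gsec P p U\<^esub> s) = r \<odot>\<^bsub>gsec S p U\<^esub> induced p U s"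
  using rep_eq_induced'[OF ext_S(5) rep_smult[OF rep_induced' order_refl], of U s p r] ringed_res_id[OF ringed]
  by simp

lemma induced_res: "\<lbrakk>opn Y U; opn Y V; V \<subseteq> U; s \<in> sec P l U\<rbrakk> \<Longrightarrow>
    induced l V (gres P l U V s) = gres S l U V (induced l U s)"
  unfolding res_S using rep_eq_induced[OF rep_mono[OF rep_induced']] by simp

lemma add_hom_induced: "opn Y U \<Longrightarrow> add_hom (gsec P l U) (gsec S l U) (induced l U)"
  by (intro add_homI abelian abelian_S induced_closed induced_add)

end

section \<open>The laws of a dg-algebra for the tensor product presheaf\<close>

context tensor_product
begin

lemma hom_eqI2:
  assumes U: "opn Y U" and x: "x \<in> sec P m U" and y: "y \<in> sec P n U"
    and h: "\<And>x. x \<in> sec P m U \<Longrightarrow> add_hom (gsec P n U) M (h x)" "\<And>y. y \<in> sec P n U \<Longrightarrow> add_hom (gsec P m U) M (\<lambda>x. h x y)"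
    and k: "\<And>x. x \<in> sec P m U \<Longrightarrow> add_hom (gsec P n U) M (k x)" "\<And>y. y \<in> sec P n U \<Longrightarrow> add_hom (gsec P m U) M (\<lambda>x. k x y)"
    and gen: "\<And>p q b c p' q' b' c'. \<lbrakk>p + q = m; b \<in> sec B p U; c \<in> sec C q U; p' + q' = n; b' \<in> sec B p' U; c' \<in> sec C q' U\<rbrakk> \<Longrightarrow>
      h (ten p q U b c) (ten p' q' U b' c') = k (ten p q U b c) (ten p' q' U b' c')"
  shows "h x y = k x y"
proof (rule hom_eqI[OF U h(2)[OF y] k(2)[OF y] _ x], goal_cases)
  case (1 p q b c) note * = 1
  show ?case
    using hom_eqI[OF U h(1)[OF ten_closed[OF *]] k(1)[OF ten_closed[OF *]] gen[OF *] y] .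
qed

lemma presheaf_P: "presheaf_on (tp Y) (sec P l) (gres P l)"
proof -
  have "gres P l V W (gres P l U V s) = gres P l U W s"
    if U: "opn Y U" "opn Y V" "opn Y W" "W \<subseteq> V" "V \<subseteq> U" and s: "s \<in> sec P l U" for U V W s
  proof -
    have WU: "W \<subseteq> U" using U by blast
    show ?thesis
    proof (rule hom_eqI[OF U(1) add_hom_comp[OF P_res(1)[OF U(1,2,5)] P_res(1)[OF U(2,3,4)]] P_res(1)[OF U(1,3) WU] _ s], goal_cases)
      case (1 p q b c) note * = 1
      show ?case
        using * U WU by (simp add: P_res(2) B.pre.res_closed C.pre.res_closed B.pre.res_res C.pre.res_res)
    qed
  qed
  moreover have "gres P l U U s = s" if U: "opn Y U" and s: "s \<in> sec P l U" for U s
    by (rule hom_eqI[OF U P_res(1)[OF U U order_refl] add_hom_ident[OF abelian_P[OF U]] _ s])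
      (simp add: P_res(2) U B.pre.res_id C.pre.res_id)
  moreover have "gres P l U V s \<in> sec P l V" if "opn Y U" "opn Y V" "V \<subseteq> U" "s \<in> sec P l U" for U V s
    using add_hom_closed[OF P_res(1)] that by blast
  ultimately show ?thesis unfolding presheaf_on_def by (auto simp: Pi_iff)
qed

lemma module_P: assumes U: "opn Y U" shows "module (rsec Y U) (gsec P l U)"
proof (rule moduleI[OF ringed_cring[OF ringed U] abelian_P[OF U]])
  fix a x assume a: "a \<in> carrier (rsec Y U)" and x: "x \<in> sec P l U"
  show "a \<odot>\<^bsub>gsec P l U\<^esub> x \<in> sec P l U" by (rule add_hom_closed[OF P_smult(1)[OF U a] x])
  interpret R: cring "rsec Y U" using ringed_cring[OF ringed U] .
  fix b assume b: "b \<in> carrier (rsec Y U)"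
  show "(a \<oplus>\<^bsub>rsec Y U\<^esub> b) \<odot>\<^bsub>gsec P l U\<^esub> x = a \<odot>\<^bsub>gsec P l U\<^esub> x \<oplus>\<^bsub>gsec P l U\<^esub> b \<odot>\<^bsub>gsec P l U\<^esub> x"
  proof (rule hom_eqI[OF U P_smult(1)[OF U R.a_closed[OF a b]] add_hom_plus[OF P_smult(1)[OF U a] P_smult(1)[OF U b]] _ x])
    fix p q y c assume *: "p + q = l" "y \<in> sec B p U" "c \<in> sec C q U"
    show "(a \<oplus>\<^bsub>rsec Y U\<^esub> b) \<odot>\<^bsub>gsec P l U\<^esub> ten p q U y c =
        a \<odot>\<^bsub>gsec P l U\<^esub> ten p q U y c \<oplus>\<^bsub>gsec P l U\<^esub> b \<odot>\<^bsub>gsec P l U\<^esub> ten p q U y c"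
      by (simp add: P_smult(2)[OF U _ *] a b module.smult_l_distr[OF B.module[OF U] a b *(2)]
        ten_add_left[OF U *(1) B.pre.smult_closed[OF U a *(2)] B.pre.smult_closed[OF U b *(2)] *(3)])
  qed
  show "(a \<otimes>\<^bsub>rsec Y U\<^esub> b) \<odot>\<^bsub>gsec P l U\<^esub> x = a \<odot>\<^bsub>gsec P l U\<^esub> (b \<odot>\<^bsub>gsec P l U\<^esub> x)"
  proof (rule hom_eqI[OF U P_smult(1)[OF U R.m_closed[OF a b]] add_hom_comp[OF P_smult(1)[OF U b] P_smult(1)[OF U a]] _ x], goal_cases)
    case (1 p q y c) note * = 1
    show ?case
      by (simp add: P_smult(2)[OF U _ *] P_smult(2)[OF U _ *(1) B.pre.smult_closed[OF U b *(2)] *(3)]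
        a b module.smult_assoc1[OF B.module[OF U] a b *(2)])
  qed
  fix y assume y: "y \<in> sec P l U"
  show "a \<odot>\<^bsub>gsec P l U\<^esub> (x \<oplus>\<^bsub>gsec P l U\<^esub> y) = a \<odot>\<^bsub>gsec P l U\<^esub> x \<oplus>\<^bsub>gsec P l U\<^esub> a \<odot>\<^bsub>gsec P l U\<^esub> y"
    by (rule add_hom_add[OF P_smult(1)[OF U a] x y])
next
  interpret R: cring "rsec Y U" using ringed_cring[OF ringed U] .
  fix x assume x: "x \<in> sec P l U"
  show "\<one>\<^bsub>rsec Y U\<^esub> \<odot>\<^bsub>gsec P l U\<^esub> x = x"
    by (rule hom_eqI[OF U P_smult(1)[OF U R.one_closed] add_hom_ident[OF abelian_P[OF U]] _ x])
      (simp add: P_smult(2)[OF U R.one_closed] module.smult_one[OF B.module[OF U]])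
qed

lemma one_P: "gone P U = ten 0 0 U (gone B U) (gone C U)"
  by (simp add: ten_presheaf_def ten_def)

lemma signed_ten_right: "\<lbrakk>opn Y U; p + q = n; b \<in> sec B p U; c \<in> sec C q U\<rbrakk> \<Longrightarrow>
    ten p q U b (signed (gsec C q U) s c) = signed (gsec P n U) s (ten p q U b c)"
  by (rule add_hom_pow[OF add_hom_ten_right])

lemma signed_ten_left: "\<lbrakk>opn Y U; p + q = n; b \<in> sec B p U; c \<in> sec C q U\<rbrakk> \<Longrightarrow>
    ten p q U (signed (gsec B p U) s b) c = signed (gsec P n U) s (ten p q U b c)"
  by (rule add_hom_pow[OF add_hom_ten_left])

lemma P_mul_closed: "\<lbrakk>opn Y U; x \<in> sec P m U; y \<in> sec P n U\<rbrakk> \<Longrightarrow> gmul P m n U x y \<in> sec P (m + n) U"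
  by (rule add_hom_closed[OF P_mul(1)])

text \<open>On pure tensors the two bracketings collect the Koszul signs
  \<open>q p' + (q + q') p''\<close> and \<open>q' p'' + q (p' + p'')\<close>, which are the same
  integer.\<close>

lemma P_assoc:
  assumes U: "opn Y U" and x: "x \<in> sec P m U" and y: "y \<in> sec P n U" and z: "z \<in> sec P k U"
  shows "gmul P (m + n) k U (gmul P m n U x y) z = gmul P m (n + k) U x (gmul P n k U y z)"
proof (rule hom_eqI[OF U _ _ _ z])
  show "add_hom (gsec P k U) (gsec P (m + n + k) U) (gmul P (m + n) k U (gmul P m n U x y))"
    by (rule P_mul(1)[OF U P_mul_closed[OF U x y]])
  show "add_hom (gsec P k U) (gsec P (m + n + k) U) (\<lambda>z. gmul P m (n + k) U x (gmul P n k U y z))"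
    using add_hom_comp[OF P_mul(1)[OF U y] P_mul(1)[OF U x]] by (simp add: add.assoc)
  fix p'' q'' b'' c'' assume 3: "p'' + q'' = k" "b'' \<in> sec B p'' U" "c'' \<in> sec C q'' U"
  note z = ten_closed[OF 3]
  show "gmul P (m + n) k U (gmul P m n U x y) (ten p'' q'' U b'' c'') =
      gmul P m (n + k) U x (gmul P n k U y (ten p'' q'' U b'' c''))"
  proof (rule hom_eqI2[OF U x y])
    show "add_hom (gsec P n U) (gsec P (m + n + k) U) (\<lambda>y. gmul P (m + n) k U (gmul P m n U x y) (ten p'' q'' U b'' c''))"
      if "x \<in> sec P m U" for x
      by (rule add_hom_comp[OF P_mul(1)[OF U that] P_mul(2)[OF U z]])
    show "add_hom (gsec P m U) (gsec P (m + n + k) U) (\<lambda>x. gmul P (m + n) k U (gmul P m n U x y) (ten p'' q'' U b'' c''))"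
      if "y \<in> sec P n U" for y
      by (rule add_hom_comp[OF P_mul(2)[OF U that] P_mul(2)[OF U z]])
    show "add_hom (gsec P n U) (gsec P (m + n + k) U) (\<lambda>y. gmul P m (n + k) U x (gmul P n k U y (ten p'' q'' U b'' c'')))"
      if "x \<in> sec P m U" for x
      using add_hom_comp[OF P_mul(2)[OF U z] P_mul(1)[OF U that]] by (simp add: add.assoc)
    show "add_hom (gsec P m U) (gsec P (m + n + k) U) (\<lambda>x. gmul P m (n + k) U x (gmul P n k U y (ten p'' q'' U b'' c'')))"
      if "y \<in> sec P n U" for y
      using P_mul(2)[OF U P_mul_closed[OF U that z]] by (simp add: add.assoc)
    fix p q b c p' q' b' c'
    assume 1: "p + q = m" "b \<in> sec B p U" "c \<in> sec C q U" and 2: "p' + q' = n" "b' \<in> sec B p' U" "c' \<in> sec C q' U"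
    note Bm = B.mul_closed[OF U] and Cm = C.mul_closed[OF U]
    let ?M = "gsec P (m + n + k) U"
    let ?b = "gmul B (p + p') p'' U (gmul B p p' U b b') b''" and ?c = "gmul C (q + q') q'' U (gmul C q q' U c c') c''"
    let ?t = "ten (p + p' + p'') (q + q' + q'') U ?b ?c"
    have 12: "p + p' + (q + q') = m + n" "p' + p'' + (q' + q'') = n + k" "p + p' + p'' + (q + q' + q'') = m + n + k"
      using 1 2 3 by auto
    have t: "?t \<in> carrier ?M" using 1 2 3 by (intro ten_closed[OF 12(3)] Bm Cm)
    have b2: "gmul B p p' U b b' \<in> sec B (p + p') U" "gmul C q q' U c c' \<in> sec C (q + q') U"
      "gmul B p' p'' U b' b'' \<in> sec B (p' + p'') U" "gmul C q' q'' U c' c'' \<in> sec C (q' + q'') U"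
      using 1 2 3 Bm Cm by auto
    have L: "gmul P (m + n) k U (gmul P m n U (ten p q U b c) (ten p' q' U b' c')) (ten p'' q'' U b'' c'') =
        signed ?M (q * p') (signed ?M ((q + q') * p'') ?t)"
      by (simp add: P_mul(3)[OF U 1 2] add_hom_pow[OF P_mul(2)[OF U z] ten_closed[OF 12(1) b2(1,2)]]
          P_mul(3)[OF U 12(1) b2(1,2) 3])
    have bb: "gmul B p (p' + p'') U b (gmul B p' p'' U b' b'') = ?b" "gmul C q (q' + q'') U c (gmul C q' q'' U c' c'') = ?c"
      using B.mul_assoc[OF U 1(2) 2(2) 3(2)] C.mul_assoc[OF U 1(3) 2(3) 3(3)] by simp_all
    have R: "gmul P m (n + k) U (ten p q U b c) (gmul P n k U (ten p' q' U b' c') (ten p'' q'' U b'' c'')) =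
        signed ?M (q' * p'') (signed ?M (q * (p' + p'')) ?t)"
      unfolding P_mul(3)[OF U 2 3]
        add_hom_pow[OF P_mul(1)[OF U ten_closed[OF 1]] ten_closed[OF 12(2) b2(3,4)], of "ksign (q' * p'')"]
        P_mul(3)[OF U 1 12(2) b2(3,4)] bb by (simp only: add.assoc)
    show "gmul P (m + n) k U (gmul P m n U (ten p q U b c) (ten p' q' U b' c')) (ten p'' q'' U b'' c'') =
        gmul P m (n + k) U (ten p q U b c) (gmul P n k U (ten p' q' U b' c') (ten p'' q'' U b'' c''))"
      unfolding L R using signed_signed[OF abelian_P[OF U] t] by (simp add: algebra_simps)
  qed
qed

text \<open>The signs for commuting inside \<open>B\<close> and inside \<open>C\<close>, together
  with the Koszul sign \<open>q p'\<close>, differ from \<open>(p + q) (p' + q') + q' p\<close> by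
  the even number \<open>2 p q'\<close>.\<close>

lemma P_comm:
  assumes U: "opn Y U" and x: "x \<in> sec P m U" and y: "y \<in> sec P n U"
  shows "gmul P m n U x y = signed (gsec P (m + n) U) (m * n) (gmul P n m U y x)"
proof (rule hom_eqI2[OF U x y P_mul(1)[OF U] P_mul(2)[OF U]])
  let ?M = "gsec P (m + n) U"
  have e: "n + m = m + n" by simp
  show "add_hom (gsec P n U) ?M (\<lambda>y. signed ?M (m * n) (gmul P n m U y x))" if "x \<in> sec P m U" for x
    by (rule add_hom_comp[OF P_mul(2)[OF U that, of n, unfolded e] add_hom_scale[OF abelian_P[OF U]]])
  show "add_hom (gsec P m U) ?M (\<lambda>x. signed ?M (m * n) (gmul P n m U y x))" if "y \<in> sec P n U" for y
    by (rule add_hom_comp[OF P_mul(1)[OF U that, of m, unfolded e] add_hom_scale[OF abelian_P[OF U]]])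
  fix p q b c p' q' b' c'
  assume 1: "p + q = m" "b \<in> sec B p U" "c \<in> sec C q U" and 2: "p' + q' = n" "b' \<in> sec B p' U" "c' \<in> sec C q' U"
  have k: "p + p' + (q + q') = m + n" using 1 2 by auto
  have bb: "gmul B p' p U b' b \<in> sec B (p + p') U" "gmul C q' q U c' c \<in> sec C (q + q') U"
    using B.mul_closed[OF U 2(2) 1(2)] C.mul_closed[OF U 2(3) 1(3)] by (simp_all add: add.commute)
  let ?t = "ten (p + p') (q + q') U (gmul B p' p U b' b) (gmul C q' q U c' c)"
  have t: "?t \<in> carrier ?M" by (rule ten_closed[OF k bb])
  have L: "gmul P m n U (ten p q U b c) (ten p' q' U b' c') = signed ?M (q * p') (signed ?M (p * p') (signed ?M (q * q') ?t))"
    unfolding P_mul(3)[OF U 1 2] B.mul_graded_comm[OF U 1(2) 2(2)] C.mul_graded_comm[OF U 1(3) 2(3)]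
    by (simp add: signed_ten_right[OF U k bb] signed_ten_left[OF U k bb(1) C.pre.sign_closed[OF U bb(2)]])
  have R: "gmul P n m U (ten p' q' U b' c') (ten p q U b c) = signed ?M (q' * p) ?t"
    using P_mul(3)[OF U 2 1] by (simp add: e add.commute)
  have "ksign (q * p' + (p * p' + q * q')) = ksign (m * n + q' * p)"
    using 1 2 by (intro ksign_cong) auto
  then show "gmul P m n U (ten p q U b c) (ten p' q' U b' c') =
      signed ?M (m * n) (gmul P n m U (ten p' q' U b' c') (ten p q U b c))"
    unfolding L R by (simp add: signed_signed[OF abelian_P[OF U] t])
qed

text \<open>On pure tensors each side is a combination of the same four terms, one for each of
  \<open>b\<close>, \<open>b'\<close>, \<open>c\<close>, \<open>c'\<close> as the place where the
  differential acts; only the signs have to be compared.\<close>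

lemma P_dif_mul:
  assumes U: "opn Y U" and x: "x \<in> sec P m U" and y: "y \<in> sec P n U"
  shows "gdif P (m + n) U (gmul P m n U x y) =
         gmul P (m + 1) n U (gdif P m U x) y \<oplus>\<^bsub>gsec P (m + n + 1) U\<^esub>
         signed (gsec P (m + n + 1) U) m (gmul P m (n + 1) U x (gdif P n U y))"
proof (rule hom_eqI2[OF U x y])
  let ?M = "gsec P (m + n + 1) U"
  have e1: "m + 1 + n = m + n + 1" and e2: "m + (n + 1) = m + n + 1" by auto
  note m1 = P_mul[OF U, where m = "m + 1" and n = n, unfolded e1] and m2 = P_mul[OF U, where m = m and n = "n + 1", unfolded e2]
  note sc = add_hom_scale[OF abelian_P[OF U]] and d = P_dif(1)[OF U]
  show "add_hom (gsec P n U) ?M (\<lambda>y. gdif P (m + n) U (gmul P m n U x y))" if "x \<in> sec P m U" for x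
    by (rule add_hom_comp[OF P_mul(1)[OF U that] d])
  show "add_hom (gsec P m U) ?M (\<lambda>x. gdif P (m + n) U (gmul P m n U x y))" if "y \<in> sec P n U" for y
    by (rule add_hom_comp[OF P_mul(2)[OF U that] d])
  show "add_hom (gsec P n U) ?M (\<lambda>y. gmul P (m + 1) n U (gdif P m U x) y \<oplus>\<^bsub>?M\<^esub>
      signed ?M m (gmul P m (n + 1) U x (gdif P n U y)))" if "x \<in> sec P m U" for x
    by (rule add_hom_plus[OF m1(1)[OF add_hom_closed[OF d that]] add_hom_comp[OF add_hom_comp[OF d m2(1)[OF that]] sc]])
  show "add_hom (gsec P m U) ?M (\<lambda>x. gmul P (m + 1) n U (gdif P m U x) y \<oplus>\<^bsub>?M\<^esub>
      signed ?M m (gmul P m (n + 1) U x (gdif P n U y)))" if "y \<in> sec P n U" for y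
    by (rule add_hom_plus[OF add_hom_comp[OF d m1(2)[OF that]] add_hom_comp[OF m2(2)[OF add_hom_closed[OF d that]] sc]])
  fix p q b c p' q' b' c'
  assume 1: "p + q = m" "b \<in> sec B p U" "c \<in> sec C q U" and 2: "p' + q' = n" "b' \<in> sec B p' U" "c' \<in> sec C q' U"
  let ?b = "gmul B p p' U b b'" and ?c = "gmul C q q' U c c'"
  let ?t1 = "ten (p + p' + 1) (q + q') U (gmul B (p + 1) p' U (gdif B p U b) b') ?c"
  let ?t2 = "ten (p + p' + 1) (q + q') U (gmul B p (p' + 1) U b (gdif B p' U b')) ?c"
  let ?t3 = "ten (p + p') (q + q' + 1) U ?b (gmul C (q + 1) q' U (gdif C q U c) c')"
  let ?t4 = "ten (p + p') (q + q' + 1) U ?b (gmul C q (q' + 1) U c (gdif C q' U c'))"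
  note Bm = B.mul_closed[OF U] and Cm = C.mul_closed[OF U] and Bd = B.dif_closed[OF U] and Cd = C.dif_closed[OF U]
  have k: "p + p' + (q + q') = m + n" "p + p' + 1 + (q + q') = m + n + 1" "p + p' + (q + q' + 1) = m + n + 1"
    "p + 1 + q = m + 1" "p + (q + 1) = m + 1" "p' + 1 + q' = n + 1" "p' + (q' + 1) = n + 1"
    using 1 2 by auto
  have bc: "?b \<in> sec B (p + p') U" "?c \<in> sec C (q + q') U" using 1 2 Bm Cm by auto
  have db: "gmul B (p + 1) p' U (gdif B p U b) b' \<in> sec B (p + p' + 1) U"
    "gmul B p (p' + 1) U b (gdif B p' U b') \<in> sec B (p + p' + 1) U"
    "gmul C (q + 1) q' U (gdif C q U c) c' \<in> sec C (q + q' + 1) U"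
    "gmul C q (q' + 1) U c (gdif C q' U c') \<in> sec C (q + q' + 1) U"
    using Bm[OF Bd[OF 1(2)] 2(2)] Bm[OF 1(2) Bd[OF 2(2)]] Cm[OF Cd[OF 1(3)] 2(3)] Cm[OF 1(3) Cd[OF 2(3)]]
    by (simp_all add: ac_simps)
  have t: "?t1 \<in> carrier ?M" "?t2 \<in> carrier ?M" "?t3 \<in> carrier ?M" "?t4 \<in> carrier ?M"
    using ten_closed[OF k(2) db(1) bc(2)] ten_closed[OF k(2) db(2) bc(2)]
      ten_closed[OF k(3) bc(1) db(3)] ten_closed[OF k(3) bc(1) db(4)] by auto
  have "gdif P (m + n) U (ten (p + p') (q + q') U ?b ?c) =
      (?t1 \<oplus>\<^bsub>?M\<^esub> signed ?M p ?t2) \<oplus>\<^bsub>?M\<^esub> signed ?M (p + p') (?t3 \<oplus>\<^bsub>?M\<^esub> signed ?M q ?t4)"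
    unfolding P_dif(2)[OF U k(1) bc] B.dif_mul[OF U 1(2) 2(2)] C.dif_mul[OF U 1(3) 2(3)]
    using add_hom_add[OF add_hom_ten_left[OF U k(2) bc(2)] db(1) B.pre.sign_closed[OF U db(2)]]
      add_hom_add[OF add_hom_ten_right[OF U k(3) bc(1)] db(3) C.pre.sign_closed[OF U db(4)]]
    by (simp add: signed_ten_left[OF U k(2) db(2) bc(2)] signed_ten_right[OF U k(3) bc(1) db(4)])
  then have L: "gdif P (m + n) U (gmul P m n U (ten p q U b c) (ten p' q' U b' c')) = signed ?M (q * p')
      ((?t1 \<oplus>\<^bsub>?M\<^esub> signed ?M p ?t2) \<oplus>\<^bsub>?M\<^esub> signed ?M (p + p') (?t3 \<oplus>\<^bsub>?M\<^esub> signed ?M q ?t4))"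
    by (simp add: P_mul(3)[OF U 1 2] add_hom_pow[OF d ten_closed[OF k(1) bc]])
  have s: "ten (p + 1) q U (gdif B p U b) c \<in> sec P (m + 1) U" "ten p (q + 1) U b (gdif C q U c) \<in> sec P (m + 1) U"
    "ten (p' + 1) q' U (gdif B p' U b') c' \<in> sec P (n + 1) U" "ten p' (q' + 1) U b' (gdif C q' U c') \<in> sec P (n + 1) U"
    using ten_closed[OF k(4) Bd[OF 1(2)] 1(3)] ten_closed[OF k(5) 1(2) Cd[OF 1(3)]]
      ten_closed[OF k(6) Bd[OF 2(2)] 2(3)] ten_closed[OF k(7) 2(2) Cd[OF 2(3)]] by auto
  note h1 = m1(2)[OF ten_closed[OF 2]] and h2 = m2(1)[OF ten_closed[OF 1]]
  have i: "p + 1 + p' = p + p' + 1" "p + (p' + 1) = p + p' + 1" "q + 1 + q' = q + q' + 1" "q + (q' + 1) = q + q' + 1" by auto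
  have R1: "gmul P (m + 1) n U (gdif P m U (ten p q U b c)) (ten p' q' U b' c') =
      signed ?M (q * p') ?t1 \<oplus>\<^bsub>?M\<^esub> signed ?M p (signed ?M ((q + 1) * p') ?t3)"
    unfolding P_dif(2)[OF U 1] add_hom_add[OF h1 s(1) add_pow_closed[OF abelian_P[OF U] s(2)]] add_hom_pow[OF h1 s(2)]
      m1(3)[OF k(4) Bd[OF 1(2)] 1(3) 2] m1(3)[OF k(5) 1(2) Cd[OF 1(3)] 2] i ..
  have R2: "gmul P m (n + 1) U (ten p q U b c) (gdif P n U (ten p' q' U b' c')) =
      signed ?M (q * (p' + 1)) ?t2 \<oplus>\<^bsub>?M\<^esub> signed ?M p' (signed ?M (q * p') ?t4)"
    unfolding P_dif(2)[OF U 2] add_hom_add[OF h2 s(3) add_pow_closed[OF abelian_P[OF U] s(4)]] add_hom_pow[OF h2 s(4)]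
      m2(3)[OF 1 k(6) Bd[OF 2(2)] 2(3)] m2(3)[OF 1 k(7) 2(2) Cd[OF 2(3)]] i ..
  have "signed ?M (q * p') ((x1 \<oplus>\<^bsub>?M\<^esub> signed ?M p x2) \<oplus>\<^bsub>?M\<^esub> signed ?M (p + p') (x3 \<oplus>\<^bsub>?M\<^esub> signed ?M q x4)) =
      (signed ?M (q * p') x1 \<oplus>\<^bsub>?M\<^esub> signed ?M p (signed ?M ((q + 1) * p') x3)) \<oplus>\<^bsub>?M\<^esub>
      signed ?M (p + q) (signed ?M (q * (p' + 1)) x2 \<oplus>\<^bsub>?M\<^esub> signed ?M p' (signed ?M (q * p') x4))"
    if "x1 \<in> carrier ?M" "x2 \<in> carrier ?M" "x3 \<in> carrier ?M" "x4 \<in> carrier ?M" for x1 x2 x3 x4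
    apply (rule frag_rep_eqI, (rule frag_rep_rules that abelian_P[OF U])+)
    apply (cases "even p"; cases "even q"; cases "even p'"; simp add: ksign_def algebra_simps)
    done
  from this[OF t]
  show "gdif P (m + n) U (gmul P m n U (ten p q U b c) (ten p' q' U b' c')) =
      gmul P (m + 1) n U (gdif P m U (ten p q U b c)) (ten p' q' U b' c') \<oplus>\<^bsub>?M\<^esub>
      signed ?M m (gmul P m (n + 1) U (ten p q U b c) (gdif P n U (ten p' q' U b' c')))"
    unfolding L R1 R2 1(1) .
qed

text \<open>The terms with two differentials on the same factor vanish, and the mixed term arises
  twice, with the opposite signs \<open>p\<close> and \<open>p + 1\<close>.\<close>

lemma P_dif_dif:
  assumes U: "opn Y U" and x: "x \<in> sec P n U"
  shows "gdif P (n + 1) U (gdif P n U x) = \<zero>\<^bsub>gsec P (n + 1 + 1) U\<^esub>"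
proof (rule hom_eqI[OF U add_hom_comp[OF P_dif(1)[OF U] P_dif(1)[OF U]] add_hom_const_zero[OF abelian_P[OF U] abelian_P[OF U]] _ x])
  fix p q b c assume 1: "p + q = n" "b \<in> sec B p U" "c \<in> sec C q U"
  let ?M = "gsec P (n + 1 + 1) U"
  note Bd = B.dif_closed[OF U] and Cd = C.dif_closed[OF U]
  have k: "p + 1 + q = n + 1" "p + (q + 1) = n + 1" "p + 1 + (q + 1) = n + 1 + 1" "p + 1 + 1 + q = n + 1 + 1"
    "p + (q + 1 + 1) = n + 1 + 1" using 1 by auto
  let ?t = "ten (p + 1) (q + 1) U (gdif B p U b) (gdif C q U c)"
  have t: "?t \<in> carrier ?M" by (rule ten_closed[OF k(3) Bd[OF 1(2)] Cd[OF 1(3)]])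
  have s: "ten (p + 1) q U (gdif B p U b) c \<in> sec P (n + 1) U" "ten p (q + 1) U b (gdif C q U c) \<in> sec P (n + 1) U"
    using ten_closed[OF k(1) Bd[OF 1(2)] 1(3)] ten_closed[OF k(2) 1(2) Cd[OF 1(3)]] by auto
  have z: "ten (p + 1 + 1) q U (gdif B (p + 1) U (gdif B p U b)) c = \<zero>\<^bsub>?M\<^esub>"
    "ten p (q + 1 + 1) U b (gdif C (q + 1) U (gdif C q U c)) = \<zero>\<^bsub>?M\<^esub>"
    using add_hom_zero[OF add_hom_ten_left[OF U k(4) 1(3)]] add_hom_zero[OF add_hom_ten_right[OF U k(5) 1(2)]]
    by (simp_all add: B.dif_dif[OF U 1(2)] C.dif_dif[OF U 1(3)])
  have *: "gdif P (n + 1) U (gdif P n U (ten p q U b c)) =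
      (\<zero>\<^bsub>?M\<^esub> \<oplus>\<^bsub>?M\<^esub> signed ?M (p + 1) ?t) \<oplus>\<^bsub>?M\<^esub> signed ?M p (?t \<oplus>\<^bsub>?M\<^esub> signed ?M p \<zero>\<^bsub>?M\<^esub>)"
    unfolding P_dif(2)[OF U 1] add_hom_add[OF P_dif(1)[OF U] s(1) add_pow_closed[OF abelian_P[OF U] s(2)]]
      add_hom_pow[OF P_dif(1)[OF U] s(2)] P_dif(2)[OF U k(1) Bd[OF 1(2)] 1(3)] P_dif(2)[OF U k(2) 1(2) Cd[OF 1(3)]] z ..
  have "(\<zero>\<^bsub>?M\<^esub> \<oplus>\<^bsub>?M\<^esub> signed ?M (p + 1) w) \<oplus>\<^bsub>?M\<^esub> signed ?M p (w \<oplus>\<^bsub>?M\<^esub> signed ?M p \<zero>\<^bsub>?M\<^esub>) = \<zero>\<^bsub>?M\<^esub>"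
    if "w \<in> carrier ?M" for w
    apply (rule frag_rep_eqI, (rule frag_rep_rules that abelian_P[OF U])+)
    apply (cases "even p"; simp add: ksign_def)
    done
  from this[OF t] show "gdif P (n + 1) U (gdif P n U (ten p q U b c)) = \<zero>\<^bsub>?M\<^esub>" unfolding * .
qed

lemma dg_presheaf_P: "dg_algebra_presheaf Y P"
proof (intro dg_algebra_presheaf.intro graded_module_presheaf.intro dg_algebra_presheaf_axioms.intro)
  show "presheaf_on (tp Y) (sec P l) (gres P l)" for l by (rule presheaf_P)
  fix U assume U: "opn Y U"
  show "module (rsec Y U) (gsec P l U)" for l by (rule module_P[OF U])
  note one = ten_closed[OF add_0 B.one_closed[OF U] C.one_closed[OF U]]
  show oc: "gone P U \<in> sec P 0 U" unfolding one_P by (rule one)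
  fix x p assume x: "x \<in> sec P p U"
  show "gmul P 0 p U (gone P U) x = x"
  proof (rule hom_eqI[OF U _ add_hom_ident[OF abelian_P[OF U]] _ x])
    show "add_hom (gsec P p U) (gsec P p U) (gmul P 0 p U (gone P U))" using P_mul(1)[OF U oc, of p] by simp
    fix p' q b c assume *: "p' + q = p" "b \<in> sec B p' U" "c \<in> sec C q U"
    show "gmul P 0 p U (gone P U) (ten p' q U b c) = ten p' q U b c"
      using P_mul(3)[OF U add_0 B.one_closed[OF U] C.one_closed[OF U] *] B.one_left[OF U *(2)] C.one_left[OF U *(3)]
        abelian_group.signed_even[OF abelian_P[OF U] ten_closed[OF *], of 0]
      by (simp add: one_P)
  qed
  show "gdif P p U x \<in> sec P (p + 1) U" by (rule add_hom_closed[OF P_dif(1)[OF U] x])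
  show "gdif P (p + 1) U (gdif P p U x) = \<zero>\<^bsub>gsec P (p + 1 + 1) U\<^esub>" by (rule P_dif_dif[OF U x])
  show "gdif P p U (x \<oplus>\<^bsub>gsec P p U\<^esub> x') = gdif P p U x \<oplus>\<^bsub>gsec P (p + 1) U\<^esub> gdif P p U x'" if "x' \<in> sec P p U" for x'
    by (rule add_hom_add[OF P_dif(1)[OF U] x that])
  fix y q assume y: "y \<in> sec P q U"
  show "gmul P p q U x y \<in> sec P (p + q) U" by (rule P_mul_closed[OF U x y])
  show "gmul P p q U x y = signed (gsec P (p + q) U) (p * q) (gmul P q p U y x)" by (rule P_comm[OF U x y])
  show "gdif P (p + q) U (gmul P p q U x y) = gmul P (p + 1) q U (gdif P p U x) y \<oplus>\<^bsub>gsec P (p + q + 1) U\<^esub>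
      signed (gsec P (p + q + 1) U) p (gmul P p (q + 1) U x (gdif P q U y))" by (rule P_dif_mul[OF U x y])
  show "gmul P p q U (x \<oplus>\<^bsub>gsec P p U\<^esub> x') y = gmul P p q U x y \<oplus>\<^bsub>gsec P (p + q) U\<^esub> gmul P p q U x' y"
    if "x' \<in> sec P p U" for x' by (rule add_hom_add[OF P_mul(2)[OF U y] x that])
  show "gmul P p q U x (y \<oplus>\<^bsub>gsec P q U\<^esub> y') = gmul P p q U x y \<oplus>\<^bsub>gsec P (p + q) U\<^esub> gmul P p q U x y'"
    if "y' \<in> sec P q U" for y' by (rule add_hom_add[OF P_mul(1)[OF U x] y that])
  show "gmul P (p + q) n U (gmul P p q U x y) z = gmul P p (q + n) U x (gmul P q n U y z)" if "z \<in> sec P n U" for z n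
    by (rule P_assoc[OF U x y that])
next
  fix U r x p assume U: "opn Y U" and r: "r \<in> carrier (rsec Y U)" and x: "x \<in> sec P p U"
  note sm = P_smult(1)[OF U r] and s = add_hom_closed[OF P_smult(1)[OF U r]]
  show "gdif P p U (r \<odot>\<^bsub>gsec P p U\<^esub> x) = r \<odot>\<^bsub>gsec P (p + 1) U\<^esub> gdif P p U x"
  proof (rule hom_eqI[OF U add_hom_comp[OF sm P_dif(1)[OF U]] add_hom_comp[OF P_dif(1)[OF U] sm] _ x], goal_cases)
    case (1 p' q b c) note * = 1
    have k: "p' + 1 + q = p + 1" "p' + (q + 1) = p + 1" using * by auto
    note b = B.dif_closed[OF U *(2)] and c = C.dif_closed[OF U *(3)]
    show ?case
      by (simp add: P_smult(2)[OF U r *] P_dif(2)[OF U *(1) B.pre.smult_closed[OF U r *(2)] *(3)] P_dif(2)[OF U *]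
        add_hom_add[OF sm ten_closed[OF k(1) b *(3)] add_pow_closed[OF abelian_P[OF U] ten_closed[OF k(2) *(2) c]]]
        add_hom_pow[OF sm ten_closed[OF k(2) *(2) c]] P_smult(2)[OF U r k(1) b *(3)] P_smult(2)[OF U r k(2) *(2) c]
        B.dif_smult[OF U r *(2)])
  qed
  fix y q assume y: "y \<in> sec P q U"
  show "gmul P p q U (r \<odot>\<^bsub>gsec P p U\<^esub> x) y = r \<odot>\<^bsub>gsec P (p + q) U\<^esub> gmul P p q U x y"
  proof (rule hom_eqI2[OF U x y])
    show "add_hom (gsec P q U) (gsec P (p + q) U) (gmul P p q U (r \<odot>\<^bsub>gsec P p U\<^esub> x))" if "x \<in> sec P p U" for x
      by (rule P_mul(1)[OF U s[OF that]])
    show "add_hom (gsec P p U) (gsec P (p + q) U) (\<lambda>x. gmul P p q U (r \<odot>\<^bsub>gsec P p U\<^esub> x) y)" if "y \<in> sec P q U" for y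
      by (rule add_hom_comp[OF sm P_mul(2)[OF U that]])
    show "add_hom (gsec P q U) (gsec P (p + q) U) (\<lambda>y. r \<odot>\<^bsub>gsec P (p + q) U\<^esub> gmul P p q U x y)" if "x \<in> sec P p U" for x
      by (rule add_hom_comp[OF P_mul(1)[OF U that] sm])
    show "add_hom (gsec P p U) (gsec P (p + q) U) (\<lambda>x. r \<odot>\<^bsub>gsec P (p + q) U\<^esub> gmul P p q U x y)" if "y \<in> sec P q U" for y
      by (rule add_hom_comp[OF P_mul(2)[OF U that] sm])
    fix p1 q1 b c p2 q2 b' c'
    assume 1: "p1 + q1 = p" "b \<in> sec B p1 U" "c \<in> sec C q1 U" and 2: "p2 + q2 = q" "b' \<in> sec B p2 U" "c' \<in> sec C q2 U"
    have k: "p1 + p2 + (q1 + q2) = p + q" using 1 2 by auto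
    note bb = B.mul_closed[OF U 1(2) 2(2)] C.mul_closed[OF U 1(3) 2(3)]
    show "gmul P p q U (r \<odot>\<^bsub>gsec P p U\<^esub> ten p1 q1 U b c) (ten p2 q2 U b' c') =
        r \<odot>\<^bsub>gsec P (p + q) U\<^esub> gmul P p q U (ten p1 q1 U b c) (ten p2 q2 U b' c')"
      by (simp add: P_smult(2)[OF U r 1] P_mul(3)[OF U 1(1) B.pre.smult_closed[OF U r 1(2)] 1(3) 2] P_mul(3)[OF U 1 2]
        add_hom_pow[OF sm ten_closed[OF k bb]] P_smult(2)[OF U r k bb] B.mul_smult_left[OF U r 1(2) 2(2)])
  qed
next
  fix U r x p y q assume U: "opn Y U" and r: "r \<in> carrier (rsec Y U)" and x: "x \<in> sec P p U" and y: "y \<in> sec P q U"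
  note sm = P_smult(1)[OF U r] and s = add_hom_closed[OF P_smult(1)[OF U r]]
  show "gmul P p q U x (r \<odot>\<^bsub>gsec P q U\<^esub> y) = r \<odot>\<^bsub>gsec P (p + q) U\<^esub> gmul P p q U x y"
  proof (rule hom_eqI2[OF U x y])
    show "add_hom (gsec P q U) (gsec P (p + q) U) (\<lambda>y. gmul P p q U x (r \<odot>\<^bsub>gsec P q U\<^esub> y))" if "x \<in> sec P p U" for x
      by (rule add_hom_comp[OF sm P_mul(1)[OF U that]])
    show "add_hom (gsec P p U) (gsec P (p + q) U) (\<lambda>x. gmul P p q U x (r \<odot>\<^bsub>gsec P q U\<^esub> y))" if "y \<in> sec P q U" for y
      by (rule P_mul(2)[OF U s[OF that]])
    show "add_hom (gsec P q U) (gsec P (p + q) U) (\<lambda>y. r \<odot>\<^bsub>gsec P (p + q) U\<^esub> gmul P p q U x y)" if "x \<in> sec P p U" for x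
      by (rule add_hom_comp[OF P_mul(1)[OF U that] sm])
    show "add_hom (gsec P p U) (gsec P (p + q) U) (\<lambda>x. r \<odot>\<^bsub>gsec P (p + q) U\<^esub> gmul P p q U x y)" if "y \<in> sec P q U" for y
      by (rule add_hom_comp[OF P_mul(2)[OF U that] sm])
    fix p1 q1 b c p2 q2 b' c'
    assume 1: "p1 + q1 = p" "b \<in> sec B p1 U" "c \<in> sec C q1 U" and 2: "p2 + q2 = q" "b' \<in> sec B p2 U" "c' \<in> sec C q2 U"
    have k: "p1 + p2 + (q1 + q2) = p + q" using 1 2 by auto
    note bb = B.mul_closed[OF U 1(2) 2(2)] C.mul_closed[OF U 1(3) 2(3)]
    show "gmul P p q U (ten p1 q1 U b c) (r \<odot>\<^bsub>gsec P q U\<^esub> ten p2 q2 U b' c') =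
        r \<odot>\<^bsub>gsec P (p + q) U\<^esub> gmul P p q U (ten p1 q1 U b c) (ten p2 q2 U b' c')"
      by (simp add: P_smult(2)[OF U r 2] P_mul(3)[OF U 1 2(1) B.pre.smult_closed[OF U r 2(2)] 2(3)] P_mul(3)[OF U 1 2]
        add_hom_pow[OF sm ten_closed[OF k bb]] P_smult(2)[OF U r k bb] B.mul_smult_right[OF U r 1(2) 2(2)])
  qed
next
  fix U V assume U: "opn Y U" and V: "opn Y V" "V \<subseteq> U"
  show "gres P 0 U V (gone P U) = gone P V"
    unfolding one_P
    by (simp add: P_res(2)[OF U V add_0 B.one_closed[OF U] C.one_closed[OF U]] B.one_res[OF U V] C.one_res[OF U V])
  note hr = P_res(1)[OF U V] and Br = B.pre.res_closed[OF U V] and Cr = C.pre.res_closed[OF U V]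
  show "gres P l U V (x \<oplus>\<^bsub>gsec P l U\<^esub> x') = gres P l U V x \<oplus>\<^bsub>gsec P l V\<^esub> gres P l U V x'"
    if "x \<in> sec P l U" "x' \<in> sec P l U" for l x x' by (rule add_hom_add[OF hr that])
  show "gres P l U V (r \<odot>\<^bsub>gsec P l U\<^esub> x) = rres Y U V r \<odot>\<^bsub>gsec P l V\<^esub> gres P l U V x"
    if r: "r \<in> carrier (rsec Y U)" and x: "x \<in> sec P l U" for l r x
  proof -
    note r' = ringed_res_closed[OF ringed U V r]
    show ?thesis
    proof (rule hom_eqI[OF U add_hom_comp[OF P_smult(1)[OF U r] hr] add_hom_comp[OF hr P_smult(1)[OF V(1) r']] _ x], goal_cases)
      case (1 p q b c) note * = 1
      show ?case
        by (simp add: P_smult(2)[OF U r *] P_res(2)[OF U V *(1) B.pre.smult_closed[OF U r *(2)] *(3)]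
          P_res(2)[OF U V *] P_smult(2)[OF V(1) r' *(1) Br[OF *(2)] Cr[OF *(3)]] B.res_smult[OF U V r *(2)])
    qed
  qed
  fix x p assume x: "x \<in> sec P p U"
  show "gres P (p + 1) U V (gdif P p U x) = gdif P p V (gres P p U V x)"
  proof (rule hom_eqI[OF U add_hom_comp[OF P_dif(1)[OF U] hr] add_hom_comp[OF hr P_dif(1)[OF V(1)]] _ x], goal_cases)
    case (1 p' q b c) note * = 1
    have k: "p' + 1 + q = p + 1" "p' + (q + 1) = p + 1" using * by auto
    note b = B.dif_closed[OF U *(2)] and c = C.dif_closed[OF U *(3)]
    show ?case
      by (simp add: P_dif(2)[OF U *] P_res(2)[OF U V *] P_dif(2)[OF V(1) *(1) Br[OF *(2)] Cr[OF *(3)]]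
        add_hom_add[OF hr ten_closed[OF k(1) b *(3)] add_pow_closed[OF abelian_P[OF U] ten_closed[OF k(2) *(2) c]]]
        add_hom_pow[OF hr ten_closed[OF k(2) *(2) c]] P_res(2)[OF U V k(1) b *(3)] P_res(2)[OF U V k(2) *(2) c]
        B.dif_res[OF U V *(2)] C.dif_res[OF U V *(3)])
  qed
  fix y q assume y: "y \<in> sec P q U"
  show "gres P (p + q) U V (gmul P p q U x y) = gmul P p q V (gres P p U V x) (gres P q U V y)"
  proof (rule hom_eqI2[OF U x y])
    note cl = add_hom_closed[OF hr]
    show "add_hom (gsec P q U) (gsec P (p + q) V) (\<lambda>y. gres P (p + q) U V (gmul P p q U x y))" if "x \<in> sec P p U" for x
      by (rule add_hom_comp[OF P_mul(1)[OF U that] hr])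
    show "add_hom (gsec P p U) (gsec P (p + q) V) (\<lambda>x. gres P (p + q) U V (gmul P p q U x y))" if "y \<in> sec P q U" for y
      by (rule add_hom_comp[OF P_mul(2)[OF U that] hr])
    show "add_hom (gsec P q U) (gsec P (p + q) V) (\<lambda>y. gmul P p q V (gres P p U V x) (gres P q U V y))" if "x \<in> sec P p U" for x
      by (rule add_hom_comp[OF hr P_mul(1)[OF V(1) cl[OF that]]])
    show "add_hom (gsec P p U) (gsec P (p + q) V) (\<lambda>x. gmul P p q V (gres P p U V x) (gres P q U V y))" if "y \<in> sec P q U" for y
      by (rule add_hom_comp[OF hr P_mul(2)[OF V(1) cl[OF that]]])
    fix p1 q1 b c p2 q2 b' c'
    assume 1: "p1 + q1 = p" "b \<in> sec B p1 U" "c \<in> sec C q1 U" and 2: "p2 + q2 = q" "b' \<in> sec B p2 U" "c' \<in> sec C q2 U"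
    have k: "p1 + p2 + (q1 + q2) = p + q" using 1 2 by auto
    note bb = B.mul_closed[OF U 1(2) 2(2)] C.mul_closed[OF U 1(3) 2(3)]
    show "gres P (p + q) U V (gmul P p q U (ten p1 q1 U b c) (ten p2 q2 U b' c')) =
        gmul P p q V (gres P p U V (ten p1 q1 U b c)) (gres P q U V (ten p2 q2 U b' c'))"
      by (simp add: P_mul(3)[OF U 1 2] P_res(2)[OF U V 1] P_res(2)[OF U V 2] add_hom_pow[OF hr ten_closed[OF k bb]]
        P_res(2)[OF U V k bb] P_mul(3)[OF V(1) 1(1) Br[OF 1(2)] Cr[OF 1(3)] 2(1) Br[OF 2(2)] Cr[OF 2(3)]]
        B.mul_res[OF U V 1(2) 2(2)] C.mul_res[OF U V 1(3) 2(3)])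
  qed
qed

end

section \<open>The sheaf tensor product, its inclusions and its universal property\<close>

context tensor_product
begin

sublocale sh: sheafification Y P
  by (intro sheafification.intro sheafification_axioms.intro dg_presheaf_P ringed)

abbreviation "T \<equiv> tensor Y A B f C g"
abbreviation "i1 \<equiv> incl1 Y A B f C g"
abbreviation "i2 \<equiv> incl2 Y A B f C g"

lemma dg_T: "dg_algebra_sheaf Y T"
  unfolding tensor_def by (rule sh.dg_sheaf_S)

sublocale T: dg_algebra_sheaf Y T by (rule dg_T)

abbreviation "ind \<equiv> sh.induced"

lemmas ind_closed = sh.induced_closed[folded tensor_def]
  and ind_add = sh.induced_add[folded tensor_def]
  and ind_mul = sh.induced_mul[folded tensor_def]
  and ind_dif = sh.induced_dif[folded tensor_def]
  and ind_one = sh.induced_one[folded tensor_def]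
  and ind_smult = sh.induced_smult[folded tensor_def]
  and ind_res = sh.induced_res[folded tensor_def]
  and add_hom_ind = sh.add_hom_induced[folded tensor_def]

lemma i1_ind: "i1 l U b = ind l U (ten l 0 U b (gone C U))"
  by (simp add: incl1_def sh.induced_def ten_def)

lemma i2_ind: "i2 l U c = ind l U (ten 0 l U (gone B U) c)"
  by (simp add: incl2_def sh.induced_def ten_def)

lemma dg_hom_i1: "dg_alg_hom Y B T i1"
proof (rule dg_alg_homI)
  fix U l b assume U: "opn Y U" and b: "b \<in> sec B l U"
  have k: "l + 0 = l" by simp
  note o = C.one_closed[OF U] and t = ten_closed[OF k b C.one_closed[OF U]]
  show "i1 l U b \<in> sec T l U" unfolding i1_ind by (rule ind_closed[OF U t])
  show "i1 l U (b \<oplus>\<^bsub>gsec B l U\<^esub> b') = i1 l U b \<oplus>\<^bsub>gsec T l U\<^esub> i1 l U b'" if b': "b' \<in> sec B l U" for b'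
    unfolding i1_ind ten_add_left[OF U k b b' o] by (rule ind_add[OF U t ten_closed[OF k b' o]])
  show "i1 l U (r \<odot>\<^bsub>gsec B l U\<^esub> b) = r \<odot>\<^bsub>gsec T l U\<^esub> i1 l U b" if r: "r \<in> carrier (rsec Y U)" for r
    unfolding i1_ind P_smult(2)[OF U r k b o, symmetric] by (rule ind_smult[OF U r t])
  show "i1 l V (gres B l U V b) = gres T l U V (i1 l U b)" if V: "opn Y V" "V \<subseteq> U" for V
    unfolding i1_ind C.one_res[OF U V, symmetric] P_res(2)[OF U V k b o, symmetric] by (rule ind_res[OF U V t])
  show "i1 (l + 1) U (gdif B l U b) = gdif T l U (i1 l U b)"
  proof -
    have k': "l + 1 + 0 = l + 1" "l + (0 + 1) = l + 1" by auto
    note d = B.dif_closed[OF U b]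
    interpret M: abelian_group "gsec P (l + 1) U" by (rule abelian_P[OF U])
    have "ten l (0 + 1) U b (gdif C 0 U (gone C U)) = \<zero>\<^bsub>gsec P (l + 1) U\<^esub>"
      using add_hom_zero[OF add_hom_ten_right[OF U k'(2) b]] C.pre.dif_one[OF U] by simp
    then have "gdif P l U (ten l 0 U b (gone C U)) = ten (l + 1) 0 U (gdif B l U b) (gone C U)"
      using P_dif(2)[OF U k b o] ten_closed[OF k'(1) d o] by (simp add: M.add_pow_zero)
    then show ?thesis unfolding i1_ind ind_dif[OF U t, symmetric] by simp
  qed
  fix q b' assume b': "b' \<in> sec B q U"
  have k: "q + 0 = q" by simp
  have k': "l + q + (0 + 0) = l + q" by simp
  have oo: "gone C U \<in> sec C (0 + 0) U" using o by simp
  have "gmul P l q U (ten l 0 U b (gone C U)) (ten q 0 U b' (gone C U)) = ten (l + q) 0 U (gmul B l q U b b') (gone C U)"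
    using P_mul(3)[OF U _ b o k b' o, of l] C.one_left[OF U o]
      abelian_group.signed_even[OF abelian_P[OF U] ten_closed[OF k' B.mul_closed[OF U b b'] oo], of 0]
    by simp
  then show "i1 (l + q) U (gmul B l q U b b') = gmul T l q U (i1 l U b) (i1 q U b')"
    unfolding i1_ind ind_mul[OF U t ten_closed[OF k b' o], symmetric] by simp
next
  fix U assume U: "opn Y U"
  show "i1 0 U (gone B U) = gone T U"
    unfolding i1_ind ind_one[OF U, symmetric] one_P ..
qed

lemma dg_hom_i2: "dg_alg_hom Y C T i2"
proof (rule dg_alg_homI)
  fix U l c assume U: "opn Y U" and c: "c \<in> sec C l U"
  have k: "0 + l = l" by simp
  note o = B.one_closed[OF U] and t = ten_closed[OF k B.one_closed[OF U] c]
  show "i2 l U c \<in> sec T l U" unfolding i2_ind by (rule ind_closed[OF U t])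
  show "i2 l U (c \<oplus>\<^bsub>gsec C l U\<^esub> c') = i2 l U c \<oplus>\<^bsub>gsec T l U\<^esub> i2 l U c'" if c': "c' \<in> sec C l U" for c'
    unfolding i2_ind ten_add_right[OF U k o c c'] by (rule ind_add[OF U t ten_closed[OF k o c']])
  show "i2 l V (gres C l U V c) = gres T l U V (i2 l U c)" if V: "opn Y V" "V \<subseteq> U" for V
    unfolding i2_ind B.one_res[OF U V, symmetric] P_res(2)[OF U V k o c, symmetric] by (rule ind_res[OF U V t])
  show "i2 l U (r \<odot>\<^bsub>gsec C l U\<^esub> c) = r \<odot>\<^bsub>gsec T l U\<^esub> i2 l U c" if r: "r \<in> carrier (rsec Y U)" for r
  proof -
    \<comment> \<open>By definition scalars act on the first factor. To reach the second one, the
      scalar is viewed as a section of \<open>A\<close> and moved across by balancing.\<close>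
    let ?r = "r \<odot>\<^bsub>gsec A 0 U\<^esub> gone A U"
    have ra: "?r \<in> sec A 0 U" by (rule A.pre.smult_closed[OF U r A.one_closed[OF U]])
    have f1: "f 0 U ?r = r \<odot>\<^bsub>gsec B 0 U\<^esub> gone B U" "g 0 U ?r = r \<odot>\<^bsub>gsec C 0 U\<^esub> gone C U"
      using dg_hom_smult[OF f U r A.one_closed[OF U]] dg_hom_smult[OF g U r A.one_closed[OF U]]
        dg_hom_one[OF f U] dg_hom_one[OF g U] by simp_all
    have "ten 0 l U (r \<odot>\<^bsub>gsec B 0 U\<^esub> gone B U) c = ten 0 l U (gone B U) (r \<odot>\<^bsub>gsec C l U\<^esub> c)"
      using ten_balanced[OF U o ra c] f1 B.one_left[OF U B.pre.smult_closed[OF U r o]]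
        C.mul_smult_left[OF U r C.one_closed[OF U] c] C.one_left[OF U c] by simp
    then show ?thesis
      unfolding i2_ind ind_smult[OF U r t, symmetric] P_smult(2)[OF U r k o c] by simp
  qed
  show "i2 (l + 1) U (gdif C l U c) = gdif T l U (i2 l U c)"
  proof -
    have k': "0 + 1 + l = l + 1" "0 + (l + 1) = l + 1" by auto
    note d = C.dif_closed[OF U c]
    interpret M: abelian_group "gsec P (l + 1) U" by (rule abelian_P[OF U])
    have "ten (0 + 1) l U (gdif B 0 U (gone B U)) c = \<zero>\<^bsub>gsec P (l + 1) U\<^esub>"
      using add_hom_zero[OF add_hom_ten_left[OF U k'(1) c]] B.pre.dif_one[OF U] by simp
    then have "gdif P l U (ten 0 l U (gone B U) c) = ten 0 (l + 1) U (gone B U) (gdif C l U c)"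
      using P_dif(2)[OF U k o c] ten_closed[OF k'(2) o d] M.signed_even[of "ten 0 (l + 1) U (gone B U) (gdif C l U c)" 0] by simp
    then show ?thesis unfolding i2_ind ind_dif[OF U t, symmetric] by simp
  qed
  fix q c' assume c': "c' \<in> sec C q U"
  have k: "0 + q = q" by simp
  have k': "0 + 0 + (l + q) = l + q" by simp
  have oo: "gone B U \<in> sec B (0 + 0) U" using o by simp
  have "gmul P l q U (ten 0 l U (gone B U) c) (ten 0 q U (gone B U) c') = ten 0 (l + q) U (gone B U) (gmul C l q U c c')"
    using P_mul(3)[OF U _ o c k o c', of l] B.one_left[OF U o]
      abelian_group.signed_even[OF abelian_P[OF U] ten_closed[OF k' oo C.mul_closed[OF U c c']], of 0]
    by simp
  then show "i2 (l + q) U (gmul C l q U c c') = gmul T l q U (i2 l U c) (i2 q U c')"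
    unfolding i2_ind ind_mul[OF U t ten_closed[OF k o c'], symmetric] by simp
next
  fix U assume U: "opn Y U"
  show "i2 0 U (gone C U) = gone T U"
    unfolding i2_ind ind_one[OF U, symmetric] one_P ..
qed

lemma i1_f: "opn Y U \<Longrightarrow> a \<in> sec A l U \<Longrightarrow> i1 l U (f l U a) = i2 l U (g l U a)"
  using ten_balanced[of U "gone B U" 0 a l "gone C U" 0] B.one_left[of U "f l U a" l] C.pre.one_right[of U "g l U a" l]
  by (simp add: i1_ind i2_ind B.one_closed C.one_closed f_closed g_closed)

abbreviation tens where "tens p q U b c \<equiv> gmul T p q U (i1 p U b) (i2 q U c)"

text \<open>A pure tensor is the product of its two images, so from here on homomorphisms and
  derivations are controlled by their values on the two factors.\<close>

lemma ind_ten: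
  assumes U: "opn Y U" and b: "b \<in> sec B p U" and c: "c \<in> sec C q U"
  shows "ind (p + q) U (ten p q U b c) = tens p q U b c"
proof -
  have k: "p + 0 + (0 + q) = p + q" by simp
  have k1: "p + 0 = p" and k2: "0 + q = q" by simp_all
  note o = B.one_closed[OF U] C.one_closed[OF U]
  have "gmul P p q U (ten p 0 U b (gone C U)) (ten 0 q U (gone B U) c) = ten p q U b c"
    using P_mul(3)[OF U k1 b o(2) k2 o(1) c] B.pre.one_right[OF U b] C.one_left[OF U c]
      abelian_group.signed_even[OF abelian_P[OF U] ten_closed[OF refl b c], of 0]
    by simp
  then show ?thesis
    unfolding i1_ind i2_ind ind_mul[OF U ten_closed[OF k1 b o(2)] ten_closed[OF k2 o(1) c], symmetric] by simp
qed

lemma tens_closed: "\<lbrakk>opn Y U; b \<in> sec B p U; c \<in> sec C q U\<rbrakk> \<Longrightarrow> tens p q U b c \<in> sec T (p + q) U"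
  by (intro T.mul_closed dg_hom_closed[OF dg_hom_i1] dg_hom_closed[OF dg_hom_i2])

lemma tens_mul:
  assumes U: "opn Y U" and 1: "b \<in> sec B p U" "c \<in> sec C q U" and 2: "b' \<in> sec B p' U" "c' \<in> sec C q' U"
  shows "gmul T (p + q) (p' + q') U (tens p q U b c) (tens p' q' U b' c') =
    signed (gsec T (p + q + (p' + q')) U) (q * p') (tens (p + p') (q + q') U (gmul B p p' U b b') (gmul C q q' U c c'))"
  using T.pre.interchange[OF U dg_hom_closed[OF dg_hom_i1 U 1(1)] dg_hom_closed[OF dg_hom_i2 U 1(2)]
      dg_hom_closed[OF dg_hom_i1 U 2(1)] dg_hom_closed[OF dg_hom_i2 U 2(2)]]
  by (simp add: dg_hom_mul[OF dg_hom_i1 U 1(1) 2(1)] dg_hom_mul[OF dg_hom_i2 U 1(2) 2(2)])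

lemma tensor_agree:
  fixes D :: "('a, 'r, 'd) dgalg" and h k :: "('a, ('a, 'b, 'c) tsec, 'd) family"
  assumes D: "dg_algebra_sheaf Y D" and U: "opn Y U"
    and h: "\<And>V. opn Y V \<Longrightarrow> V \<subseteq> U \<Longrightarrow> add_hom (gsec T l V) (gsec D m V) (h l V)"
    and k: "\<And>V. opn Y V \<Longrightarrow> V \<subseteq> U \<Longrightarrow> add_hom (gsec T l V) (gsec D m V) (k l V)"
    and hr: "\<And>V x. \<lbrakk>opn Y V; V \<subseteq> U; x \<in> sec T l U\<rbrakk> \<Longrightarrow>
      h l V (gres T l U V x) = gres D m U V (h l U x)"
    and kr: "\<And>V x. \<lbrakk>opn Y V; V \<subseteq> U; x \<in> sec T l U\<rbrakk> \<Longrightarrow>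
      k l V (gres T l U V x) = gres D m U V (k l U x)"
    and gen: "\<And>V p q b c. \<lbrakk>opn Y V; V \<subseteq> U; p + q = l; b \<in> sec B p V; c \<in> sec C q V\<rbrakk> \<Longrightarrow>
      h l V (tens p q V b c) = k l V (tens p q V b c)"
    and x: "x \<in> sec T l U"
  shows "h l U x = k l U x"
proof -
  interpret D: dg_algebra_sheaf Y D by (rule D)
  show ?thesis
  proof (rule sheaf_eqI[OF D.sheaf U])
    show "h l U x \<in> sec D m U" "k l U x \<in> sec D m U" using add_hom_closed[OF h[OF U]] add_hom_closed[OF k[OF U]] x by auto
    fix y assume "y \<in> U"
    with x[unfolded tensor_def] obtain V s where V: "y \<in> V" "V \<subseteq> U" "sh.rep l V x s" by (rule sh.secE)
    note o = sh.repD(1)[OF V(3)] and s = sh.repD(2)[OF V(3)]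
    have xV: "gres T l U V x = ind l V s"
      unfolding tensor_def sh.res_S by (rule sh.rep_eq_induced[OF V(3)])
    have "h l V (ind l V s) = k l V (ind l V s)"
    proof (rule hom_eqI[OF o add_hom_comp[OF add_hom_ind[OF o] h[OF o V(2)]] add_hom_comp[OF add_hom_ind[OF o] k[OF o V(2)]] _ s], goal_cases)
      case (1 p q b c) note * = 1
      show ?case
        using gen[OF o V(2) *] ind_ten[OF o *(2,3)] *(1) by simp
    qed
    then have "gres D m U V (h l U x) = gres D m U V (k l U x)"
      using hr[OF o V(2) x] kr[OF o V(2) x] xV by simp
    then show "\<exists>V. opn Y V \<and> y \<in> V \<and> V \<subseteq> U \<and> gres D m U V (h l U x) = gres D m U V (k l U x)"
      using o V by blast
  qed
qed

text \<open>A section in the other slot cannot be held fixed while the open set shrinks; it has to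
  be restricted along. Naturality is therefore demanded in both arguments at once, and the arguments
  are treated in turn.\<close>

lemma tensor_agree2:
  fixes D :: "('a, 'r, 'd) dgalg" and h k :: "'a set \<Rightarrow> ('a, 'b, 'c) tsec \<Rightarrow> ('a, 'b, 'c) tsec \<Rightarrow> 'd"
  assumes D: "dg_algebra_sheaf Y D" and U: "opn Y U"
    and h: "\<And>V x. \<lbrakk>opn Y V; V \<subseteq> U; x \<in> sec T l V\<rbrakk> \<Longrightarrow> add_hom (gsec T l' V) (gsec D m V) (h V x)"
      "\<And>V y. \<lbrakk>opn Y V; V \<subseteq> U; y \<in> sec T l' V\<rbrakk> \<Longrightarrow> add_hom (gsec T l V) (gsec D m V) (\<lambda>x. h V x y)"
    and k: "\<And>V x. \<lbrakk>opn Y V; V \<subseteq> U; x \<in> sec T l V\<rbrakk> \<Longrightarrow> add_hom (gsec T l' V) (gsec D m V) (k V x)"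
      "\<And>V y. \<lbrakk>opn Y V; V \<subseteq> U; y \<in> sec T l' V\<rbrakk> \<Longrightarrow> add_hom (gsec T l V) (gsec D m V) (\<lambda>x. k V x y)"
    and hr: "\<And>V W x y. \<lbrakk>opn Y V; V \<subseteq> U; opn Y W; W \<subseteq> V; x \<in> sec T l V; y \<in> sec T l' V\<rbrakk> \<Longrightarrow>
      h W (gres T l V W x) (gres T l' V W y) = gres D m V W (h V x y)"
    and kr: "\<And>V W x y. \<lbrakk>opn Y V; V \<subseteq> U; opn Y W; W \<subseteq> V; x \<in> sec T l V; y \<in> sec T l' V\<rbrakk> \<Longrightarrow>
      k W (gres T l V W x) (gres T l' V W y) = gres D m V W (k V x y)"
    and gen: "\<And>V p q b c p' q' b' c'. \<lbrakk>opn Y V; V \<subseteq> U; p + q = l; b \<in> sec B p V; c \<in> sec C q V;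
      p' + q' = l'; b' \<in> sec B p' V; c' \<in> sec C q' V\<rbrakk> \<Longrightarrow>
      h V (tens p q V b c) (tens p' q' V b' c') = k V (tens p q V b c) (tens p' q' V b' c')"
    and x: "x \<in> sec T l U" and y: "y \<in> sec T l' U"
  shows "h U x y = k U x y"
proof -
  \<comment> \<open>First the case of a pure tensor in the left slot and an arbitrary section in the
    right one.\<close>
  have step: "h V (tens p q V b c) y = k V (tens p q V b c) y"
    if V: "opn Y V" "V \<subseteq> U" and *: "p + q = l" "b \<in> sec B p V" "c \<in> sec C q V" and y: "y \<in> sec T l' V" for V p q b c y
  proof -
    let ?x = "tens p q V b c"
    have xc: "?x \<in> sec T l V" using tens_closed[OF V(1) *(2,3)] *(1) by simp
    have res: "gres T l V W ?x = tens p q W (gres B p V W b) (gres C q V W c)" if W: "opn Y W" "W \<subseteq> V" for W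
      using T.mul_res[OF V(1) W dg_hom_closed[OF dg_hom_i1 V(1) *(2)] dg_hom_closed[OF dg_hom_i2 V(1) *(3)]] *(1)
      by (simp add: dg_hom_res[OF dg_hom_i1 V(1) W *(2)] dg_hom_res[OF dg_hom_i2 V(1) W *(3)])
    have WU: "W \<subseteq> U" if "W \<subseteq> V" for W using that V by blast
    note xr = T.pre.res_closed[OF V(1) _ _ xc]
    show ?thesis
    \<comment> \<open>The left argument enters as its restriction to each smaller open set. Over
      \<open>V\<close> itself that restriction is the identity, which is unfolded to recover the
      claim.\<close>
    proof (rule tensor_agree[OF D V(1), where h = "\<lambda>_ W. h W (gres T l V W ?x)" and k = "\<lambda>_ W. k W (gres T l V W ?x)" and l = l' and m = m
          and x = y, unfolded T.pre.res_id[OF V(1) xc]])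
      fix W assume W: "opn Y W" "W \<subseteq> V"
      show "add_hom (gsec T l' W) (gsec D m W) (h W (gres T l V W ?x))"
        "add_hom (gsec T l' W) (gsec D m W) (k W (gres T l V W ?x))"
        by (rule h(1)[OF W(1) WU[OF W(2)] xr[OF W]], rule k(1)[OF W(1) WU[OF W(2)] xr[OF W]])
      show "h W (gres T l V W ?x) (gres T l' V W y) = gres D m V W (h V ?x y)"
        "k W (gres T l V W ?x) (gres T l' V W y) = gres D m V W (k V ?x y)" if "y \<in> sec T l' V" for y
        by (rule hr[OF V W xc that], rule kr[OF V W xc that])
      fix p' q' b' c' assume **: "p' + q' = l'" "b' \<in> sec B p' W" "c' \<in> sec C q' W"
      show "h W (gres T l V W ?x) (tens p' q' W b' c') = k W (gres T l V W ?x) (tens p' q' W b' c')"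
        unfolding res[OF W]
        by (rule gen[OF W(1) WU[OF W(2)] *(1) B.pre.res_closed[OF V(1) W *(2)] C.pre.res_closed[OF V(1) W *(3)] **])
    qed (rule y)
  qed
  note yr = T.pre.res_closed[OF U _ _ y]
  show ?thesis
  proof (rule tensor_agree[OF D U, where h = "\<lambda>_ W x. h W x (gres T l' U W y)" and k = "\<lambda>_ W x. k W x (gres T l' U W y)" and l = l and m = m
        and x = x, unfolded T.pre.res_id[OF U y]])
    fix W assume W: "opn Y W" "W \<subseteq> U"
    show "add_hom (gsec T l W) (gsec D m W) (\<lambda>x. h W x (gres T l' U W y))"
      "add_hom (gsec T l W) (gsec D m W) (\<lambda>x. k W x (gres T l' U W y))"
      by (rule h(2)[OF W yr[OF W]], rule k(2)[OF W yr[OF W]])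
    show "h W (gres T l U W x) (gres T l' U W y) = gres D m U W (h U x y)"
      "k W (gres T l U W x) (gres T l' U W y) = gres D m U W (k U x y)" if "x \<in> sec T l U" for x
      by (rule hr[OF U order_refl W that y], rule kr[OF U order_refl W that y])
    show "h W (tens p q W b c) (gres T l' U W y) = k W (tens p q W b c) (gres T l' U W y)"
      if "p + q = l" "b \<in> sec B p W" "c \<in> sec C q W" for p q b c
      by (rule step[OF W that yr[OF W]])
  qed (rule x)
qed

text \<open>The universal property in additive form, with a shift of degree: \<open>d = 0\<close>
  serves homomorphisms, general \<open>d\<close> serves derivations of degree \<open>d\<close>.
  Multiplicativity or the Leibniz rule is established afterwards by comparison on pure
  tensors.\<close>

lemma tensor_extend:
  fixes D :: "('a, 'r, 'd) dgalg"
  assumes D: "dg_algebra_sheaf Y D" and U: "opn Y U"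
    and \<psi>: "\<And>l V. opn Y V \<Longrightarrow> V \<subseteq> U \<Longrightarrow> bilinear l V (gsec D (l + d) V) (\<psi> V)"
    and nat: "\<And>V W p q b c. \<lbrakk>opn Y V; V \<subseteq> U; opn Y W; W \<subseteq> V; b \<in> sec B p V; c \<in> sec C q V\<rbrakk> \<Longrightarrow>
      gres D (p + q + d) V W (\<psi> V p q b c) = \<psi> W p q (gres B p V W b) (gres C q V W c)"
  obtains \<chi> :: "('a, ('a, 'b, 'c) tsec, 'd) family" where
    "\<And>l V. opn Y V \<Longrightarrow> V \<subseteq> U \<Longrightarrow> add_hom (gsec T l V) (gsec D (l + d) V) (\<chi> l V)"
    "\<And>l V W x. \<lbrakk>opn Y V; V \<subseteq> U; opn Y W; W \<subseteq> V; x \<in> sec T l V\<rbrakk> \<Longrightarrow>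
      \<chi> l W (gres T l V W x) = gres D (l + d) V W (\<chi> l V x)"
    "\<And>p q V b c. \<lbrakk>opn Y V; V \<subseteq> U; b \<in> sec B p V; c \<in> sec C q V\<rbrakk> \<Longrightarrow>
      \<chi> (p + q) V (tens p q V b c) = \<psi> V p q b c"
proof -
  interpret D: dg_algebra_sheaf Y D by (rule D)
  define u where "u l V = (SOME u. add_hom (gsec P l V) (gsec D (l + d) V) u \<and>
    (\<forall>p q b c. p + q = l \<and> b \<in> sec B p V \<and> c \<in> sec C q V \<longrightarrow> u (ten p q V b c) = \<psi> V p q b c))" for l V
  have u: "add_hom (gsec P l V) (gsec D (l + d) V) (u l V) \<and>
    (\<forall>p q b c. p + q = l \<and> b \<in> sec B p V \<and> c \<in> sec C q V \<longrightarrow> u l V (ten p q V b c) = \<psi> V p q b c)"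
    if "opn Y V" "V \<subseteq> U" for l V
  proof -
    note V = that
    obtain u where "add_hom (gsec P l V) (gsec D (l + d) V) u"
      "\<And>p q b c. \<lbrakk>p + q = l; b \<in> sec B p V; c \<in> sec C q V\<rbrakk> \<Longrightarrow> u (ten p q V b c) = \<psi> V p q b c"
      by (rule ten_universal[OF V(1) \<psi>[OF V]]) (rule that)
    then have "\<exists>u. add_hom (gsec P l V) (gsec D (l + d) V) u \<and>
      (\<forall>p q b c. p + q = l \<and> b \<in> sec B p V \<and> c \<in> sec C q V \<longrightarrow> u (ten p q V b c) = \<psi> V p q b c)"
      by (intro exI[of _ u]) simp
    from someI_ex[OF this, folded u_def] show ?thesis .
  qed
  note uh = conjunct1[OF u] and ut = conjunct2[OF u, rule_format, OF _ _ conjI[OF _ conjI]]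
  \<comment> \<open>The maps \<open>u\<close> were chosen for each open set and degree
    independently. Naturality follows because both sides are additive and agree on pure
    tensors.\<close>
  have unat: "gres D (l + d) V W (u l V s) = u l W (gres P l V W s)"
    if V: "opn Y V" "V \<subseteq> U" "opn Y W" "W \<subseteq> V" and s: "s \<in> sec P l V" for l V W s
  proof -
    have WU: "W \<subseteq> U" using V by blast
    show ?thesis
    proof (rule hom_eqI[OF V(1) add_hom_comp[OF uh[OF V(1,2)] D.pre.add_hom_res[OF V(1,3,4)]]
          add_hom_comp[OF P_res(1)[OF V(1,3,4)] uh[OF V(3) WU]] _ s])
      fix p q b c assume *: "p + q = l" "b \<in> sec B p V" "c \<in> sec C q V"
      show "gres D (l + d) V W (u l V (ten p q V b c)) = u l W (gres P l V W (ten p q V b c))"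
        using nat[OF V *(2,3)] *(1)
        by (simp add: ut[OF V(1,2) *] P_res(2)[OF V(1,3,4) *]
          ut[OF V(3) WU *(1) B.pre.res_closed[OF V(1,3,4) *(2)] C.pre.res_closed[OF V(1,3,4) *(3)]])
    qed
  qed
  obtain \<chi> where \<chi>: "\<And>l V \<sigma>. \<lbrakk>opn Y V; V \<subseteq> U; \<sigma> \<in> sec sh.S l V\<rbrakk> \<Longrightarrow> \<chi> l V \<sigma> \<in> sec D (l + d) V"
    "\<And>l V \<sigma> W s. \<lbrakk>opn Y V; V \<subseteq> U; \<sigma> \<in> sec sh.S l V; W \<subseteq> V; sh.rep l W \<sigma> s\<rbrakk> \<Longrightarrow>
       gres D (l + d) V W (\<chi> l V \<sigma>) = u l W s"
  proof (rule sh.extend_to_sheafification[of "\<lambda>l. sec D (l + d)" "\<lambda>l. gres D (l + d)" U u])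
    show "sheaf_on (tp Y) (sec D (l + d)) (gres D (l + d))" for l by (rule D.sheaf)
    show "u l V s \<in> sec D (l + d) V" if "opn Y V" "V \<subseteq> U" "s \<in> sec P l V" for l V s
      by (rule add_hom_closed[OF uh[OF that(1,2)] that(3)])
    show "gres D (l + d) V W (u l V s) = u l W (gres P l V W s)"
      if "opn Y V" "V \<subseteq> U" "opn Y W" "W \<subseteq> V" "s \<in> sec P l V" for l V W s
      by (rule unat[OF that])
  qed (rule U, rule that)
  show ?thesis
  proof (rule that[of \<chi>])
    fix l V assume V: "opn Y V" "V \<subseteq> U"
    note cl = \<chi>(1)[OF V, folded tensor_def]
    show "add_hom (gsec T l V) (gsec D (l + d) V) (\<chi> l V)"
    proof (rule add_homI[OF T.pre.abelian[OF V(1)] D.pre.abelian[OF V(1)] cl])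
      fix x y assume x: "x \<in> sec T l V" and y: "y \<in> sec T l V"
      note xy = T.pre.add_closed[OF V(1) x y]
      show "\<chi> l V (x \<oplus>\<^bsub>gsec T l V\<^esub> y) = \<chi> l V x \<oplus>\<^bsub>gsec D (l + d) V\<^esub> \<chi> l V y"
      proof (rule sheaf_eqI[OF D.sheaf V(1) cl[OF xy] D.pre.add_closed[OF V(1) cl[OF x] cl[OF y]]])
        fix z assume "z \<in> V"
        with x[unfolded tensor_def] y[unfolded tensor_def] obtain W s t
          where W: "z \<in> W" "W \<subseteq> V" "sh.rep l W x s" "sh.rep l W y t" by (rule sh.secE2)
        have o: "opn Y W" and st: "s \<in> sec P l W" "t \<in> sec P l W" using W sh.repD by blast+
        have WU: "W \<subseteq> U" using W V by blast
        have "gres D (l + d) V W (\<chi> l V (x \<oplus>\<^bsub>gsec T l V\<^esub> y)) = u l W (s \<oplus>\<^bsub>gsec P l W\<^esub> t)"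
          using \<chi>(2)[OF V xy[unfolded tensor_def] W(2) sh.rep_add[OF W(3,4,2)]] by (simp add: tensor_def)
        also have "\<dots> = gres D (l + d) V W (\<chi> l V x \<oplus>\<^bsub>gsec D (l + d) V\<^esub> \<chi> l V y)"
          using \<chi>(2)[OF V x[unfolded tensor_def] W(2,3)] \<chi>(2)[OF V y[unfolded tensor_def] W(2,4)]
          by (simp add: add_hom_add[OF uh[OF o WU] st] D.res_add[OF V(1) o W(2) cl[OF x] cl[OF y]])
        finally show "\<exists>W. opn Y W \<and> z \<in> W \<and> W \<subseteq> V \<and> gres D (l + d) V W (\<chi> l V (x \<oplus>\<^bsub>gsec T l V\<^esub> y)) =
            gres D (l + d) V W (\<chi> l V x \<oplus>\<^bsub>gsec D (l + d) V\<^esub> \<chi> l V y)" using o W by blast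
      qed
    qed
    fix W x assume W: "opn Y W" "W \<subseteq> V" and x: "x \<in> sec T l V"
    have WU: "W \<subseteq> U" using W V by blast
    note xW = T.pre.res_closed[OF V(1) W x]
    show "\<chi> l W (gres T l V W x) = gres D (l + d) V W (\<chi> l V x)"
    proof (rule sheaf_eqI[OF D.sheaf W(1)])
      show "\<chi> l W (gres T l V W x) \<in> sec D (l + d) W" by (rule \<chi>(1)[OF W(1) WU xW[unfolded tensor_def], folded tensor_def])
      show "gres D (l + d) V W (\<chi> l V x) \<in> sec D (l + d) W" by (rule D.pre.res_closed[OF V(1) W cl[OF x]])
      fix z assume "z \<in> W"
      with xW[unfolded tensor_def] obtain W' s where W': "z \<in> W'" "W' \<subseteq> W" "sh.rep l W' (gres sh.S l V W x) s"
        by (rule sh.secE)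
      have o: "opn Y W'" using W' sh.repD by blast
      have "sh.rep l W' x s" using W'(3) unfolding sh.res_S by (rule sh.rep_of_restrict[OF _ W'(2)])
      then have "gres D (l + d) V W' (\<chi> l V x) = u l W' s"
        using \<chi>(2)[OF V x[unfolded tensor_def] subset_trans[OF W'(2) W(2)]] by blast
      moreover have "gres D (l + d) W W' (\<chi> l W (gres T l V W x)) = u l W' s"
        using \<chi>(2)[OF W(1) WU xW[unfolded tensor_def] W'(2,3)] by (simp add: tensor_def)
      ultimately have "gres D (l + d) W W' (\<chi> l W (gres T l V W x)) = gres D (l + d) W W' (gres D (l + d) V W (\<chi> l V x))"
        using D.pre.res_res[OF V(1) W(1) o W'(2) W(2) cl[OF x]] by simp
      then show "\<exists>W'. opn Y W' \<and> z \<in> W' \<and> W' \<subseteq> W \<and>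
          gres D (l + d) W W' (\<chi> l W (gres T l V W x)) = gres D (l + d) W W' (gres D (l + d) V W (\<chi> l V x))"
        using o W' by blast
    qed
  next
    fix p q V b c assume V: "opn Y V" "V \<subseteq> U" and b: "b \<in> sec B p V" and c: "c \<in> sec C q V"
    note s = ten_closed[OF refl b c]
    have t: "tens p q V b c \<in> sec sh.S (p + q) V" using tens_closed[OF V(1) b c] by (simp add: tensor_def)
    have "gres D (p + q + d) V V (\<chi> (p + q) V (tens p q V b c)) = u (p + q) V (ten p q V b c)"
      using \<chi>(2)[OF V t order_refl] sh.rep_induced'[OF V(1) s] ind_ten[OF V(1) b c] by simp
    then show "\<chi> (p + q) V (tens p q V b c) = \<psi> V p q b c"
      using ut[OF V refl b c] D.pre.res_id[OF V(1) \<chi>(1)[OF V t]] by simp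
  qed
qed

end

section \<open>Signs under scalars and restriction, and products with a prescribed total
  degree\<close>

context graded_module_presheaf
begin

lemma smult_signed: "\<lbrakk>opn Y U; r \<in> carrier (rsec Y U); x \<in> sec M l U\<rbrakk> \<Longrightarrow>
    r \<odot>\<^bsub>gsec M l U\<^esub> signed (gsec M l U) n x = signed (gsec M l U) n (r \<odot>\<^bsub>gsec M l U\<^esub> x)"
  by (rule add_hom_pow[OF add_hom_smult])

lemma res_signed: "\<lbrakk>opn Y U; opn Y V; V \<subseteq> U; x \<in> sec M l U\<rbrakk> \<Longrightarrow>
    gres M l U V (signed (gsec M l U) n x) = signed (gsec M l V) n (gres M l U V x)"
  by (rule add_hom_pow[OF add_hom_res])

end

context dg_algebra_presheaf
begin

text \<open>In this group of lemmas the total degree is supplied by an equation, so that terms of a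
  Leibniz formula, whose degrees arise as differently ordered sums, can be added without
  rewriting.\<close>

lemma mul_closed': "\<lbrakk>p + q = n; opn Y U; x \<in> sec A p U; y \<in> sec A q U\<rbrakk> \<Longrightarrow> gmul A p q U x y \<in> sec A n U"
  by (hypsubst, rule mul_closed)

lemma mul_hom_left: "\<lbrakk>p + q = n; opn Y U; y \<in> sec A q U\<rbrakk> \<Longrightarrow>
    add_hom (gsec A p U) (gsec A n U) (\<lambda>x. gmul A p q U x y)"
  by (hypsubst, rule add_hom_mul_left)

lemma mul_hom_right: "\<lbrakk>p + q = n; opn Y U; x \<in> sec A p U\<rbrakk> \<Longrightarrow>
    add_hom (gsec A q U) (gsec A n U) (\<lambda>y. gmul A p q U x y)"
  by (hypsubst, rule add_hom_mul_right)

lemma mul_assoc': "\<lbrakk>p + q = i; q + n = j; opn Y U; x \<in> sec A p U; y \<in> sec A q U; z \<in> sec A n U\<rbrakk> \<Longrightarrow>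
    gmul A i n U (gmul A p q U x y) z = gmul A p j U x (gmul A q n U y z)"
  by (hypsubst, rule mul_assoc)

end

lemma add_hom_dg:
  assumes "dg_alg_hom Y A B f" "opn Y U" "abelian_group (gsec A l U)" "abelian_group (gsec B l U)"
  shows "add_hom (gsec A l U) (gsec B l U) (f l U)"
  by (rule add_homI[OF assms(3,4) dg_hom_closed[OF assms(1,2)] dg_hom_add[OF assms(1,2)]])

lemma dg_hom_id: "dg_alg_hom Y A A fid"
  by (rule dg_alg_homI) (simp_all add: fid_def)

lemma dg_hom_comp:
  assumes f: "dg_alg_hom Y A B f" and g: "dg_alg_hom Y B C g"
  shows "dg_alg_hom Y A C (g \<circ>\<circ>\<circ> f)"
  by (rule dg_alg_homI)
    (simp_all add: fcomp_def dg_hom_closed[OF f] dg_hom_closed[OF g] dg_hom_add[OF f] dg_hom_add[OF g]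
      dg_hom_smult[OF f] dg_hom_smult[OF g] dg_hom_mul[OF f] dg_hom_mul[OF g] dg_hom_one[OF f] dg_hom_one[OF g]
      dg_hom_res[OF f] dg_hom_res[OF g] dg_hom_dif[OF f] dg_hom_dif[OF g])

section \<open>Derivations\<close>

lemma ext_fam_apply: "\<lbrakk>opn Y V; V \<subseteq> U; x \<in> sec A l V\<rbrakk> \<Longrightarrow> ext_fam Y A U D l V x = D l V x"
  by (simp add: ext_fam_def)

lemma ext_fam_ext_fam: "V \<subseteq> U \<Longrightarrow> ext_fam Y A V (ext_fam Y A U D) = ext_fam Y A V D"
  by (auto simp: ext_fam_def fun_eq_iff)

lemma ext_fam_cong:
  assumes "\<And>l V x. \<lbrakk>opn Y V; V \<subseteq> U; x \<in> sec A l V\<rbrakk> \<Longrightarrow> D l V x = D' l V x"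
  shows "ext_fam Y A U D = ext_fam Y A U D'"
  using assms by (auto simp: ext_fam_def fun_eq_iff)

lemma
  assumes "D \<in> O_derivations Y A B \<phi> d U"
  shows O_derivation_ext: "ext_fam Y A U D = D"
    and O_derivation_closed: "\<lbrakk>opn Y V; V \<subseteq> U; x \<in> sec A l V\<rbrakk> \<Longrightarrow> D l V x \<in> sec B (l + d) V"
    and O_derivation_add: "\<lbrakk>opn Y V; V \<subseteq> U; x \<in> sec A l V; x' \<in> sec A l V\<rbrakk> \<Longrightarrow>
       D l V (x \<oplus>\<^bsub>gsec A l V\<^esub> x') = D l V x \<oplus>\<^bsub>gsec B (l + d) V\<^esub> D l V x'"
    and O_derivation_mul: "\<lbrakk>opn Y V; V \<subseteq> U; x \<in> sec A p V; y \<in> sec A q V\<rbrakk> \<Longrightarrow>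
       D (p + q) V (gmul A p q V x y) =
             gmul B (p + d) q V (D p V x) (\<phi> q V y) \<oplus>\<^bsub>gsec B (p + q + d) V\<^esub>
             signed (gsec B (p + q + d) V) (d * p) (gmul B p (q + d) V (\<phi> p V x) (D q V y))"
    and O_derivation_res: "\<lbrakk>opn Y V; V \<subseteq> U; opn Y W; W \<subseteq> V; x \<in> sec A l V\<rbrakk> \<Longrightarrow>
       D l W (gres A l V W x) = gres B (l + d) V W (D l V x)"
    and O_derivation_smult: "\<lbrakk>opn Y V; V \<subseteq> U; r \<in> carrier (rsec Y V); x \<in> sec A l V\<rbrakk> \<Longrightarrow>
       D l V (r \<odot>\<^bsub>gsec A l V\<^esub> x) = r \<odot>\<^bsub>gsec B (l + d) V\<^esub> D l V x"
proof -
  note O = assms[unfolded O_derivations_def mem_Collect_eq]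
  note s = O[THEN conjunct2]
  note D = O[THEN conjunct1, unfolded derivations_def mem_Collect_eq]
  show "ext_fam Y A U D = D" by (rule D[THEN conjunct1])
  assume V: "opn Y V" "V \<subseteq> U"
  note c = D[THEN conjunct2, THEN spec, THEN mp, OF conjI[OF V]]
  note c1 = c[THEN conjunct1] and c2 = c[THEN conjunct2, THEN conjunct1]
    and c3 = c[THEN conjunct2, THEN conjunct2, THEN conjunct1] and c4 = c[THEN conjunct2, THEN conjunct2, THEN conjunct2]
  show "x \<in> sec A l V \<Longrightarrow> D l V x \<in> sec B (l + d) V" using c1 by (simp add: Pi_iff)
  show "x \<in> sec A l V \<Longrightarrow> x' \<in> sec A l V \<Longrightarrow>
       D l V (x \<oplus>\<^bsub>gsec A l V\<^esub> x') = D l V x \<oplus>\<^bsub>gsec B (l + d) V\<^esub> D l V x'" using c2 by simp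
  show "x \<in> sec A p V \<Longrightarrow> y \<in> sec A q V \<Longrightarrow> D (p + q) V (gmul A p q V x y) =
             gmul B (p + d) q V (D p V x) (\<phi> q V y) \<oplus>\<^bsub>gsec B (p + q + d) V\<^esub>
             signed (gsec B (p + q + d) V) (d * p) (gmul B p (q + d) V (\<phi> p V x) (D q V y))" using c3 by simp
  show "\<lbrakk>opn Y W; W \<subseteq> V; x \<in> sec A l V\<rbrakk> \<Longrightarrow> D l W (gres A l V W x) = gres B (l + d) V W (D l V x)"
    using c4 by simp
  show "r \<in> carrier (rsec Y V) \<Longrightarrow> x \<in> sec A l V \<Longrightarrow> D l V (r \<odot>\<^bsub>gsec A l V\<^esub> x) = r \<odot>\<^bsub>gsec B (l + d) V\<^esub> D l V x"
    using s V by simp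
qed

lemma O_derivation_hom:
  assumes "D \<in> O_derivations Y A B \<phi> d U" "opn Y V" "V \<subseteq> U" "abelian_group (gsec A l V)" "abelian_group (gsec B (l + d) V)"
  shows "add_hom (gsec A l V) (gsec B (l + d) V) (D l V)"
  by (rule add_homI[OF assms(4,5) O_derivation_closed[OF assms(1-3)] O_derivation_add[OF assms(1-3)]])

text \<open>Derivations are constructed as formulas on sections and then truncated by
  \<open>ext_fam\<close>. The truncation stays invisible in the laws because all sections that occur
  in them again live over open subsets of \<open>U\<close>.\<close>

lemma ext_fam_O_derivation:
  assumes A: "dg_algebra_sheaf Y A"
    and cl: "\<And>l V x. \<lbrakk>opn Y V; V \<subseteq> U; x \<in> sec A l V\<rbrakk> \<Longrightarrow> D l V x \<in> sec B (l + d) V"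
    and ad: "\<And>l V x x'. \<lbrakk>opn Y V; V \<subseteq> U; x \<in> sec A l V; x' \<in> sec A l V\<rbrakk> \<Longrightarrow>
       D l V (x \<oplus>\<^bsub>gsec A l V\<^esub> x') = D l V x \<oplus>\<^bsub>gsec B (l + d) V\<^esub> D l V x'"
    and mu: "\<And>p q V x y. \<lbrakk>opn Y V; V \<subseteq> U; x \<in> sec A p V; y \<in> sec A q V\<rbrakk> \<Longrightarrow>
       D (p + q) V (gmul A p q V x y) =
             gmul B (p + d) q V (D p V x) (\<phi> q V y) \<oplus>\<^bsub>gsec B (p + q + d) V\<^esub>
             signed (gsec B (p + q + d) V) (d * p) (gmul B p (q + d) V (\<phi> p V x) (D q V y))"
    and re: "\<And>l V W x. \<lbrakk>opn Y V; V \<subseteq> U; opn Y W; W \<subseteq> V; x \<in> sec A l V\<rbrakk> \<Longrightarrow>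
       D l W (gres A l V W x) = gres B (l + d) V W (D l V x)"
    and sm: "\<And>l V r x. \<lbrakk>opn Y V; V \<subseteq> U; r \<in> carrier (rsec Y V); x \<in> sec A l V\<rbrakk> \<Longrightarrow>
       D l V (r \<odot>\<^bsub>gsec A l V\<^esub> x) = r \<odot>\<^bsub>gsec B (l + d) V\<^esub> D l V x"
  shows "ext_fam Y A U D \<in> O_derivations Y A B \<phi> d U"
proof -
  interpret A: dg_algebra_sheaf Y A by (rule A)
  have WU: "W \<subseteq> U" if "V \<subseteq> U" "W \<subseteq> V" for V W using that by blast
  have "ext_fam Y A U D \<in> derivations Y A B \<phi> d U"
    unfolding derivations_def
    by (intro CollectI conjI allI impI ballI Pi_I; (elim conjE)?)
      (simp_all add: ext_fam_ext_fam ext_fam_apply cl ad mu re WU A.pre.add_closed A.mul_closed A.pre.res_closed)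
  then show ?thesis
    unfolding O_derivations_def
    by (intro CollectI conjI allI impI ballI; (elim conjE)?) (simp_all add: ext_fam_apply sm A.pre.smult_closed)
qed

lemma O_derivation_eqI:
  assumes "D \<in> O_derivations Y A B \<phi> d U" "D' \<in> O_derivations Y A B \<phi> d U"
    and "\<And>l V x. \<lbrakk>opn Y V; V \<subseteq> U; x \<in> sec A l V\<rbrakk> \<Longrightarrow> D l V x = D' l V x"
  shows "D = D'"
proof -
  have "ext_fam Y A U D = ext_fam Y A U D'" by (rule ext_fam_cong) (rule assms(3))
  then show ?thesis using O_derivation_ext[OF assms(1)] O_derivation_ext[OF assms(2)] by simp
qed

section \<open>Homomorphisms and derivations on tensor products\<close>

context tensor_product
begin

lemma i1_closed: "opn Y V \<Longrightarrow> b \<in> sec B p V \<Longrightarrow> i1 p V b \<in> sec T p V"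
  by (rule dg_hom_closed[OF dg_hom_i1])

lemma i2_closed: "opn Y V \<Longrightarrow> c \<in> sec C q V \<Longrightarrow> i2 q V c \<in> sec T q V"
  by (rule dg_hom_closed[OF dg_hom_i2])

lemma tens_smult: "\<lbrakk>opn Y V; r \<in> carrier (rsec Y V); b \<in> sec B p V; c \<in> sec C q V\<rbrakk> \<Longrightarrow>
    tens p q V (r \<odot>\<^bsub>gsec B p V\<^esub> b) c = r \<odot>\<^bsub>gsec T (p + q) V\<^esub> tens p q V b c"
  by (simp add: dg_hom_smult[OF dg_hom_i1] T.mul_smult_left i1_closed i2_closed)

lemma tens_one_right: "opn Y V \<Longrightarrow> b \<in> sec B p V \<Longrightarrow> tens p 0 V b (gone C V) = i1 p V b"
  by (simp add: dg_hom_one[OF dg_hom_i2] T.pre.one_right i1_closed)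

lemma tens_one_left: "opn Y V \<Longrightarrow> c \<in> sec C q V \<Longrightarrow> tens 0 q V (gone B V) c = i2 q V c"
  by (simp add: dg_hom_one[OF dg_hom_i1] T.one_left i2_closed)

text \<open>In the comparison the scalar has to be restricted together with the open set, so both
  sides are taken as functions of the smaller set \<open>W\<close> with scalar
  \<open>rres Y V W r\<close>.\<close>

lemma tensor_smult:
  fixes D :: "('a, 'r, 'd) dgalg"
  assumes D: "dg_algebra_sheaf Y D"
    and \<chi>: "\<And>l V. opn Y V \<Longrightarrow> V \<subseteq> U \<Longrightarrow> add_hom (gsec T l V) (gsec D (l + d) V) (\<chi> l V)"
    and \<chi>r: "\<And>l V W x. \<lbrakk>opn Y V; V \<subseteq> U; opn Y W; W \<subseteq> V; x \<in> sec T l V\<rbrakk> \<Longrightarrow>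
      \<chi> l W (gres T l V W x) = gres D (l + d) V W (\<chi> l V x)"
    and gen: "\<And>p q V r b c. \<lbrakk>opn Y V; V \<subseteq> U; r \<in> carrier (rsec Y V); b \<in> sec B p V; c \<in> sec C q V\<rbrakk> \<Longrightarrow>
      \<chi> (p + q) V (tens p q V (r \<odot>\<^bsub>gsec B p V\<^esub> b) c) = r \<odot>\<^bsub>gsec D (p + q + d) V\<^esub> \<chi> (p + q) V (tens p q V b c)"
    and V: "opn Y V" "V \<subseteq> U" and r: "r \<in> carrier (rsec Y V)" and x: "x \<in> sec T l V"
  shows "\<chi> l V (r \<odot>\<^bsub>gsec T l V\<^esub> x) = r \<odot>\<^bsub>gsec D (l + d) V\<^esub> \<chi> l V x"
proof -
  interpret D: dg_algebra_sheaf Y D by (rule D)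
  have WU: "W \<subseteq> U" if "W \<subseteq> V" for W using that V by blast
  show ?thesis
  proof (rule tensor_agree[OF D V(1), where l = l and m = "l + d" and x = x
        and h = "\<lambda>l W x. \<chi> l W (rres Y V W r \<odot>\<^bsub>gsec T l W\<^esub> x)" and k = "\<lambda>l W x. rres Y V W r \<odot>\<^bsub>gsec D (l + d) W\<^esub> \<chi> l W x",
        unfolded ringed_res_id[OF ringed V(1) r]])
    fix W assume W: "opn Y W" "W \<subseteq> V"
    note r' = ringed_res_closed[OF ringed V(1) W r]
    show "add_hom (gsec T l W) (gsec D (l + d) W) (\<lambda>x. \<chi> l W (rres Y V W r \<odot>\<^bsub>gsec T l W\<^esub> x))"
      by (rule add_hom_comp[OF T.pre.add_hom_smult[OF W(1) r'] \<chi>[OF W(1) WU[OF W(2)]]])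
    show "add_hom (gsec T l W) (gsec D (l + d) W) (\<lambda>x. rres Y V W r \<odot>\<^bsub>gsec D (l + d) W\<^esub> \<chi> l W x)"
      by (rule add_hom_comp[OF \<chi>[OF W(1) WU[OF W(2)]] D.pre.add_hom_smult[OF W(1) r']])
    fix x assume x: "x \<in> sec T l V"
    show "\<chi> l W (rres Y V W r \<odot>\<^bsub>gsec T l W\<^esub> gres T l V W x) = gres D (l + d) V W (\<chi> l V (r \<odot>\<^bsub>gsec T l V\<^esub> x))"
      using \<chi>r[OF V W T.pre.smult_closed[OF V(1) r x]] T.res_smult[OF V(1) W r x] by simp
    show "rres Y V W r \<odot>\<^bsub>gsec D (l + d) W\<^esub> \<chi> l W (gres T l V W x) = gres D (l + d) V W (r \<odot>\<^bsub>gsec D (l + d) V\<^esub> \<chi> l V x)"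
      using \<chi>r[OF V W x] D.res_smult[OF V(1) W r add_hom_closed[OF \<chi>[OF V] x]] by simp
  next
    fix W p q b c assume W: "opn Y W" "W \<subseteq> V" and *: "p + q = l" "b \<in> sec B p W" "c \<in> sec C q W"
    note r' = ringed_res_closed[OF ringed V(1) W r]
    show "\<chi> l W (rres Y V W r \<odot>\<^bsub>gsec T l W\<^esub> tens p q W b c) = rres Y V W r \<odot>\<^bsub>gsec D (l + d) W\<^esub> \<chi> l W (tens p q W b c)"
      using gen[OF W(1) WU[OF W(2)] r' *(2,3)] *(1) by (simp add: tens_smult[OF W(1) r' *(2,3)])
  qed (rule x)
qed

lemma hom_eq_on_tensor:
  fixes D :: "('a, 'r, 'd) dgalg"
  assumes D: "dg_algebra_sheaf Y D" and u: "dg_alg_hom Y T D u" and v: "dg_alg_hom Y T D v"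
    and 1: "\<And>l U b. opn Y U \<Longrightarrow> b \<in> sec B l U \<Longrightarrow> u l U (i1 l U b) = v l U (i1 l U b)"
    and 2: "\<And>l U c. opn Y U \<Longrightarrow> c \<in> sec C l U \<Longrightarrow> u l U (i2 l U c) = v l U (i2 l U c)"
  shows "eq_on_sections Y T u v"
proof -
  interpret D: dg_algebra_sheaf Y D by (rule D)
  have "u l U x = v l U x" if U: "opn Y U" and x: "x \<in> sec T l U" for l U x
  proof (rule tensor_agree[OF D U, where m = l and l = l])
    fix V assume V: "opn Y V" "V \<subseteq> U"
    show "add_hom (gsec T l V) (gsec D l V) (u l V)" "add_hom (gsec T l V) (gsec D l V) (v l V)"
      using add_hom_dg[OF u V(1)] add_hom_dg[OF v V(1)] T.pre.abelian[OF V(1)] D.pre.abelian[OF V(1)] by auto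
    show "u l V (gres T l U V x) = gres D l U V (u l U x)" "v l V (gres T l U V x) = gres D l U V (v l U x)"
      if "x \<in> sec T l U" for x
      by (rule dg_hom_res[OF u U V that], rule dg_hom_res[OF v U V that])
    show "u l V (tens p q V b c) = v l V (tens p q V b c)" if "p + q = l" "b \<in> sec B p V" "c \<in> sec C q V" for p q b c
      using dg_hom_mul[OF u V(1) i1_closed[OF V(1) that(2)] i2_closed[OF V(1) that(3)]]
        dg_hom_mul[OF v V(1) i1_closed[OF V(1) that(2)] i2_closed[OF V(1) that(3)]]
        1[OF V(1) that(2)] 2[OF V(1) that(3)] that(1) by simp
  qed (rule x)
  then show ?thesis by (simp add: eq_on_sections_def)
qed

text \<open>The map sends \<open>b \<otimes> c\<close> to the product of \<open>h b\<close> and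
  \<open>k c\<close>; it is balanced by \<open>compat\<close>, and its compatibility with products
  and differentials is checked on pure tensors. Existence is what gives the choice in
  \<open>copair\<close> a meaning.\<close>

lemma copair_exists:
  fixes D :: "('a, 'r, 'd) dgalg"
  assumes D: "dg_algebra_sheaf Y D" and h: "dg_alg_hom Y B D h" and k: "dg_alg_hom Y C D k"
    and compat: "\<And>l U a. opn Y U \<Longrightarrow> a \<in> sec A l U \<Longrightarrow> h l U (f l U a) = k l U (g l U a)"
  shows "\<exists>u. dg_alg_hom Y T D u \<and> eq_on_sections Y B (u \<circ>\<circ>\<circ> i1) h \<and> eq_on_sections Y C (u \<circ>\<circ>\<circ> i2) k"
proof -
  interpret D: dg_algebra_sheaf Y D by (rule D)
  let ?U = "topspace (tp Y)"
  have sub: "V \<subseteq> ?U" if "opn Y V" for V using that by (rule openin_subset)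
  define \<psi> where "\<psi> = (\<lambda>V p q b c. gmul D p q V (h p V b) (k q V c))"
  note hc = dg_hom_closed[OF h] and kc = dg_hom_closed[OF k]
  have bil: "bilinear l V (gsec D (l + 0) V) (\<psi> V)" if V: "opn Y V" for l V
    unfolding \<psi>_def
  proof (rule bilinear_homI[OF D.pre.abelian[OF V]])
    note hh = add_hom_dg[OF h V B.pre.abelian[OF V] D.pre.abelian[OF V]]
      and kh = add_hom_dg[OF k V C.pre.abelian[OF V] D.pre.abelian[OF V]]
    show "add_hom (gsec B p V) (gsec D (l + 0) V) (\<lambda>b. gmul D p q V (h p V b) (k q V c))"
      if "p + q = l" "c \<in> sec C q V" for p q c
      by (rule add_hom_comp[OF hh D.pre.mul_hom_left[OF _ V kc[OF V that(2)]]]) (use that in simp)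
    show "add_hom (gsec C q V) (gsec D (l + 0) V) (\<lambda>c. gmul D p q V (h p V b) (k q V c))"
      if "p + q = l" "b \<in> sec B p V" for p q b
      by (rule add_hom_comp[OF kh D.pre.mul_hom_right[OF _ V hc[OF V that(2)]]]) (use that in simp)
    show "gmul D (p + j) q V (h (p + j) V (gmul B p j V b (f j V a))) (k q V c) =
        gmul D p (j + q) V (h p V b) (k (j + q) V (gmul C j q V (g j V a) c))"
      if "b \<in> sec B p V" "a \<in> sec A j V" "c \<in> sec C q V" for p j q b a c
      by (simp add: dg_hom_mul[OF h V that(1) f_closed[OF V that(2)]] dg_hom_mul[OF k V g_closed[OF V that(2)] that(3)]
        compat[OF V that(2)] D.mul_assoc[OF V hc[OF V that(1)] kc[OF V g_closed[OF V that(2)]] kc[OF V that(3)]])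
  qed
  have nat: "gres D (p + q + 0) V W (\<psi> V p q b c) = \<psi> W p q (gres B p V W b) (gres C q V W c)"
    if V: "opn Y V" "opn Y W" "W \<subseteq> V" and "b \<in> sec B p V" "c \<in> sec C q V" for V W p q b c
    using that by (simp add: \<psi>_def D.mul_res[OF V] hc kc dg_hom_res[OF h V] dg_hom_res[OF k V])
  obtain u where u: "\<And>l V. opn Y V \<Longrightarrow> V \<subseteq> ?U \<Longrightarrow> add_hom (gsec T l V) (gsec D (l + 0) V) (u l V)"
    "\<And>l V W x. \<lbrakk>opn Y V; V \<subseteq> ?U; opn Y W; W \<subseteq> V; x \<in> sec T l V\<rbrakk> \<Longrightarrow>
      u l W (gres T l V W x) = gres D (l + 0) V W (u l V x)"
    "\<And>p q V b c. \<lbrakk>opn Y V; V \<subseteq> ?U; b \<in> sec B p V; c \<in> sec C q V\<rbrakk> \<Longrightarrow>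
      u (p + q) V (tens p q V b c) = \<psi> V p q b c"
    by (rule tensor_extend[OF D openin_topspace, of 0 \<psi>]) (erule bil, erule nat, assumption+, rule that)
  note uh = u(1)[OF _ sub, simplified] and ur = u(2)[OF _ sub, simplified] and ut = u(3)[OF _ sub]
  have u1: "u l V (i1 l V b) = h l V b" if V: "opn Y V" and b: "b \<in> sec B l V" for l V b
    using ut[OF V V b C.one_closed[OF V]] tens_one_right[OF V b] dg_hom_one[OF k V] D.pre.one_right[OF V hc[OF V b]]
    by (simp add: \<psi>_def)
  have u2: "u l V (i2 l V c) = k l V c" if V: "opn Y V" and c: "c \<in> sec C l V" for l V c
    using ut[OF V V B.one_closed[OF V] c] tens_one_left[OF V c] dg_hom_one[OF h V] D.one_left[OF V kc[OF V c]]
    by (simp add: \<psi>_def)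
  have cl: "u l V x \<in> sec D l V" if "opn Y V" "x \<in> sec T l V" for l V x
    by (rule add_hom_closed[OF uh[OF that(1) that(1)] that(2)])
  have "dg_alg_hom Y T D u"
  proof (rule dg_alg_homI)
    fix U assume U: "opn Y U"
    show "u 0 U (gone T U) = gone D U"
      using u1[OF U B.one_closed[OF U]] by (simp add: dg_hom_one[OF dg_hom_i1 U] dg_hom_one[OF h U])
    fix l x assume x: "x \<in> sec T l U"
    show "u l U x \<in> sec D l U" by (rule cl[OF U x])
    show "u l U (x \<oplus>\<^bsub>gsec T l U\<^esub> x') = u l U x \<oplus>\<^bsub>gsec D l U\<^esub> u l U x'" if "x' \<in> sec T l U" for x'
      by (rule add_hom_add[OF uh[OF U U] x that])
    show "u l V (gres T l U V x) = gres D l U V (u l U x)" if "opn Y V" "V \<subseteq> U" for V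
      by (rule ur[OF U U that x])
    show "u l U (r \<odot>\<^bsub>gsec T l U\<^esub> x) = r \<odot>\<^bsub>gsec D l U\<^esub> u l U x" if r: "r \<in> carrier (rsec Y U)" for r
    proof (rule tensor_smult[OF D, where d = 0 and U = ?U, simplified, OF uh ur _ U sub[OF U] r x])
      fix p q V r b c assume V: "opn Y V" and r: "r \<in> carrier (rsec Y V)" and b: "b \<in> sec B p V" and c: "c \<in> sec C q V"
      show "u (p + q) V (tens p q V (r \<odot>\<^bsub>gsec B p V\<^esub> b) c) = r \<odot>\<^bsub>gsec D (p + q) V\<^esub> u (p + q) V (tens p q V b c)"
        by (simp add: ut[OF V V b c] ut[OF V V B.pre.smult_closed[OF V r b] c] \<psi>_def dg_hom_smult[OF h V r b]
          D.mul_smult_left[OF V r hc[OF V b] kc[OF V c]])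
    qed
    show "u (l + 1) U (gdif T l U x) = gdif D l U (u l U x)"
    proof (rule tensor_agree[OF D U, where m = "l + 1" and l = l and h = "\<lambda>l V x. u (l + 1) V (gdif T l V x)"
          and k = "\<lambda>l V x. gdif D l V (u l V x)"])
      fix V assume V: "opn Y V" "V \<subseteq> U"
      show "add_hom (gsec T l V) (gsec D (l + 1) V) (\<lambda>x. u (l + 1) V (gdif T l V x))"
        by (rule add_hom_comp[OF T.pre.add_hom_dif[OF V(1)] uh[OF V(1) V(1)]])
      show "add_hom (gsec T l V) (gsec D (l + 1) V) (\<lambda>x. gdif D l V (u l V x))"
        by (rule add_hom_comp[OF uh[OF V(1) V(1)] D.pre.add_hom_dif[OF V(1)]])
      show "u (l + 1) V (gdif T l V (gres T l U V x)) = gres D (l + 1) U V (u (l + 1) U (gdif T l U x))"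
        if "x \<in> sec T l U" for x
        using ur[OF U U V T.dif_closed[OF U that]] T.dif_res[OF U V that] by simp
      show "gdif D l V (u l V (gres T l U V x)) = gres D (l + 1) U V (gdif D l U (u l U x))"
        if "x \<in> sec T l U" for x
        using ur[OF U U V that] D.dif_res[OF U V cl[OF U that]] by simp
    next
      fix V p q b c assume V: "opn Y V" and *: "p + q = l" "b \<in> sec B p V" "c \<in> sec C q V"
      note o = i1_closed[OF V *(2)] i2_closed[OF V *(3)]
      note db = B.dif_closed[OF V *(2)] and dc = C.dif_closed[OF V *(3)]
      have e: "p + 1 + q = p + q + 1" "p + (q + 1) = p + q + 1" by auto
      note t1 = tens_closed[OF V db *(3), unfolded e] and t2 = tens_closed[OF V *(2) dc, unfolded e]
      note A = D.pre.abelian[OF V] and TA = T.pre.abelian[OF V]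
      have "u (p + q + 1) V (gdif T (p + q) V (tens p q V b c)) =
          u (p + q + 1) V (tens (p + 1) q V (gdif B p V b) c \<oplus>\<^bsub>gsec T (p + q + 1) V\<^esub>
            signed (gsec T (p + q + 1) V) p (tens p (q + 1) V b (gdif C q V c)))"
        by (simp add: T.dif_mul[OF V o] dg_hom_dif[OF dg_hom_i1 V *(2)] dg_hom_dif[OF dg_hom_i2 V *(3)])
      also have "\<dots> = u (p + q + 1) V (tens (p + 1) q V (gdif B p V b) c) \<oplus>\<^bsub>gsec D (p + q + 1) V\<^esub>
            signed (gsec D (p + q + 1) V) p (u (p + q + 1) V (tens p (q + 1) V b (gdif C q V c)))"
        using add_hom_add[OF uh[OF V V] t1 add_pow_closed[OF TA t2]] add_hom_pow[OF uh[OF V V] t2] by simp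
      also have "\<dots> = gmul D (p + 1) q V (h (p + 1) V (gdif B p V b)) (k q V c) \<oplus>\<^bsub>gsec D (p + q + 1) V\<^esub>
            signed (gsec D (p + q + 1) V) p (gmul D p (q + 1) V (h p V b) (k (q + 1) V (gdif C q V c)))"
        using ut[OF V V db *(3)] ut[OF V V *(2) dc] by (simp only: \<psi>_def e)
      also have "\<dots> = gdif D (p + q) V (u (p + q) V (tens p q V b c))"
        using ut[OF V V *(2,3)] D.dif_mul[OF V hc[OF V *(2)] kc[OF V *(3)]]
        by (simp add: \<psi>_def dg_hom_dif[OF h V *(2)] dg_hom_dif[OF k V *(3)])
      finally show "u (l + 1) V (gdif T l V (tens p q V b c)) = gdif D l V (u l V (tens p q V b c))"
        using *(1) by simp
    qed (rule x)
    fix l' y assume y: "y \<in> sec T l' U"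
    show "u (l + l') U (gmul T l l' U x y) = gmul D l l' U (u l U x) (u l' U y)"
    proof (rule tensor_agree2[OF D U, where m = "l + l'" and l = l and l' = l' and h = "\<lambda>V x y. u (l + l') V (gmul T l l' V x y)"
          and k = "\<lambda>V x y. gmul D l l' V (u l V x) (u l' V y)"])
      fix V assume V: "opn Y V" "V \<subseteq> U"
      note uV = uh[OF V(1) V(1)]
      show "add_hom (gsec T l' V) (gsec D (l + l') V) (\<lambda>y. u (l + l') V (gmul T l l' V x y))" if "x \<in> sec T l V" for x
        by (rule add_hom_comp[OF T.pre.add_hom_mul_right[OF V(1) that] uV])
      show "add_hom (gsec T l V) (gsec D (l + l') V) (\<lambda>x. u (l + l') V (gmul T l l' V x y))" if "y \<in> sec T l' V" for y
        by (rule add_hom_comp[OF T.pre.add_hom_mul_left[OF V(1) that] uV])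
      show "add_hom (gsec T l' V) (gsec D (l + l') V) (\<lambda>y. gmul D l l' V (u l V x) (u l' V y))" if "x \<in> sec T l V" for x
        by (rule add_hom_comp[OF uV D.pre.add_hom_mul_right[OF V(1) cl[OF V(1) that]]])
      show "add_hom (gsec T l V) (gsec D (l + l') V) (\<lambda>x. gmul D l l' V (u l V x) (u l' V y))" if "y \<in> sec T l' V" for y
        by (rule add_hom_comp[OF uV D.pre.add_hom_mul_left[OF V(1) cl[OF V(1) that]]])
      fix W x y assume W: "opn Y W" "W \<subseteq> V" and x: "x \<in> sec T l V" and y: "y \<in> sec T l' V"
      show "u (l + l') W (gmul T l l' W (gres T l V W x) (gres T l' V W y)) = gres D (l + l') V W (u (l + l') V (gmul T l l' V x y))"
        using ur[OF V(1) V(1) W T.mul_closed[OF V(1) x y]] T.mul_res[OF V(1) W x y] by simp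
      show "gmul D l l' W (u l W (gres T l V W x)) (u l' W (gres T l' V W y)) = gres D (l + l') V W (gmul D l l' V (u l V x) (u l' V y))"
        using ur[OF V(1) V(1) W x] ur[OF V(1) V(1) W y] D.mul_res[OF V(1) W cl[OF V(1) x] cl[OF V(1) y]] by simp
    next
      fix V p q b c p' q' b' c' assume V: "opn Y V" and 1: "p + q = l" "b \<in> sec B p V" "c \<in> sec C q V"
        and 2: "p' + q' = l'" "b' \<in> sec B p' V" "c' \<in> sec C q' V"
      have e: "p + p' + (q + q') = p + q + (p' + q')" by simp
      note bb = B.mul_closed[OF V 1(2) 2(2)] and cc = C.mul_closed[OF V 1(3) 2(3)]
      note t = tens_closed[OF V bb cc, unfolded e]
      have "u (p + q + (p' + q')) V (gmul T (p + q) (p' + q') V (tens p q V b c) (tens p' q' V b' c')) =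
        signed (gsec D (p + q + (p' + q')) V) (q * p') (u (p + q + (p' + q')) V (tens (p + p') (q + q') V (gmul B p p' V b b') (gmul C q q' V c c')))"
        using tens_mul[OF V 1(2,3) 2(2,3)] add_hom_pow[OF uh[OF V V] t] by simp
      also have "\<dots> = signed (gsec D (p + q + (p' + q')) V) (q * p') (gmul D (p + p') (q + q') V
          (gmul D p p' V (h p V b) (h p' V b')) (gmul D q q' V (k q V c) (k q' V c')))"
        using ut[OF V V bb cc] by (simp add: \<psi>_def e dg_hom_mul[OF h V 1(2) 2(2)] dg_hom_mul[OF k V 1(3) 2(3)])
      also have "\<dots> = gmul D (p + q) (p' + q') V (u (p + q) V (tens p q V b c)) (u (p' + q') V (tens p' q' V b' c'))"
        using D.pre.interchange[OF V hc[OF V 1(2)] kc[OF V 1(3)] hc[OF V 2(2)] kc[OF V 2(3)]]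
          ut[OF V V 1(2,3)] ut[OF V V 2(2,3)] by (simp add: \<psi>_def)
      finally show "u (l + l') V (gmul T l l' V (tens p q V b c) (tens p' q' V b' c')) =
          gmul D l l' V (u l V (tens p q V b c)) (u l' V (tens p' q' V b' c'))"
        using 1(1) 2(1) by simp
    qed (rule x, rule y)
  qed
  then show ?thesis using u1 u2 by (intro exI[of _ u]) (simp add: eq_on_sections_def fcomp_def)
qed

lemma
  fixes D :: "('a, 'r, 'd) dgalg"
  assumes D: "dg_algebra_sheaf Y D" and h: "dg_alg_hom Y B D h" and k: "dg_alg_hom Y C D k"
    and compat: "\<And>l U a. opn Y U \<Longrightarrow> a \<in> sec A l U \<Longrightarrow> h l U (f l U a) = k l U (g l U a)"
  shows copair_hom: "dg_alg_hom Y T D (copair Y A B f C g D h k)"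
    and copair_i1: "opn Y U \<Longrightarrow> b \<in> sec B l U \<Longrightarrow> copair Y A B f C g D h k l U (i1 l U b) = h l U b"
    and copair_i2: "opn Y U \<Longrightarrow> c \<in> sec C l U \<Longrightarrow> copair Y A B f C g D h k l U (i2 l U c) = k l U c"
  using someI_ex[OF copair_exists[OF D h k compat], folded copair_def]
  by (simp_all add: eq_on_sections_def fcomp_def)

lemma O_derivation_eq_on_tensor:
  fixes D :: "('a, 'r, 'd) dgalg"
  assumes D: "dg_algebra_sheaf Y D"
    and \<delta>: "\<delta> \<in> O_derivations Y T D \<phi> d U" and \<delta>': "\<delta>' \<in> O_derivations Y T D \<phi> d U"
    and 1: "\<And>l V b. \<lbrakk>opn Y V; V \<subseteq> U; b \<in> sec B l V\<rbrakk> \<Longrightarrow> \<delta> l V (i1 l V b) = \<delta>' l V (i1 l V b)"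
    and 2: "\<And>l V c. \<lbrakk>opn Y V; V \<subseteq> U; c \<in> sec C l V\<rbrakk> \<Longrightarrow> \<delta> l V (i2 l V c) = \<delta>' l V (i2 l V c)"
  shows "\<delta> = \<delta>'"
proof (rule O_derivation_eqI[OF \<delta> \<delta>'])
  interpret D: dg_algebra_sheaf Y D by (rule D)
  fix l V x assume V: "opn Y V" "V \<subseteq> U" and x: "x \<in> sec T l V"
  have WU: "W \<subseteq> U" if "W \<subseteq> V" for W using that V by blast
  show "\<delta> l V x = \<delta>' l V x"
  proof (rule tensor_agree[OF D V(1), where m = "l + d" and l = l])
    fix W assume W: "opn Y W" "W \<subseteq> V"
    show "add_hom (gsec T l W) (gsec D (l + d) W) (\<delta> l W)" "add_hom (gsec T l W) (gsec D (l + d) W) (\<delta>' l W)"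
      by (rule O_derivation_hom[OF _ W(1) WU[OF W(2)] T.pre.abelian[OF W(1)] D.pre.abelian[OF W(1)]], rule \<delta> \<delta>')+
    show "\<delta> l W (gres T l V W x) = gres D (l + d) V W (\<delta> l V x)" "\<delta>' l W (gres T l V W x) = gres D (l + d) V W (\<delta>' l V x)"
      if "x \<in> sec T l V" for x
      by (rule O_derivation_res[OF \<delta> V W that], rule O_derivation_res[OF \<delta>' V W that])
    show "\<delta> l W (tens p q W b c) = \<delta>' l W (tens p q W b c)" if "p + q = l" "b \<in> sec B p W" "c \<in> sec C q W" for p q b c
      using O_derivation_mul[OF \<delta> W(1) WU[OF W(2)] i1_closed[OF W(1) that(2)] i2_closed[OF W(1) that(3)]]
        O_derivation_mul[OF \<delta>' W(1) WU[OF W(2)] i1_closed[OF W(1) that(2)] i2_closed[OF W(1) that(3)]]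
        1[OF W(1) WU[OF W(2)] that(2)] 2[OF W(1) WU[OF W(2)] that(3)] that(1) by simp
  qed (rule x)
qed

end

section \<open>Extension of a derivation from the first tensor factor\<close>

context tensor_product
begin

text \<open>The extension sends \<open>b \<otimes> c\<close> to the product of \<open>D b\<close>
  with \<open>c\<close>. It is balanced because \<open>D\<close> kills the image of
  \<open>A\<close>, so that \<open>D (b a)\<close> is \<open>D b\<close> times \<open>a\<close>.
  Extending from the first factor involves no sign; from the second one, \<open>D\<close> would have
  to pass \<open>b\<close>.\<close>

lemma tensor_derivation:
  assumes U: "opn Y U" and D: "D \<in> O_derivations Y B T i1 d U"
    and zero: "\<And>l V a. \<lbrakk>opn Y V; V \<subseteq> U; a \<in> sec A l V\<rbrakk> \<Longrightarrow> D l V (f l V a) = \<zero>\<^bsub>gsec T (l + d) V\<^esub>"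
  obtains \<delta> where "\<delta> \<in> O_derivations Y T T fid d U"
    "\<And>l V b. \<lbrakk>opn Y V; V \<subseteq> U; b \<in> sec B l V\<rbrakk> \<Longrightarrow> \<delta> l V (i1 l V b) = D l V b"
    "\<And>l V c. \<lbrakk>opn Y V; V \<subseteq> U; c \<in> sec C l V\<rbrakk> \<Longrightarrow> \<delta> l V (i2 l V c) = \<zero>\<^bsub>gsec T (l + d) V\<^esub>"
proof -
  note Dc = O_derivation_closed[OF D]
  define \<psi> where "\<psi> = (\<lambda>V p q b c. gmul T (p + d) q V (D p V b) (i2 q V c))"
  have bil: "bilinear l V (gsec T (l + d) V) (\<psi> V)" if V: "opn Y V" "V \<subseteq> U" for l V
  proof (rule bilinear_homI[OF T.pre.abelian[OF V(1)]])
    let ?M = "gsec T (l + d) V"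
    note Dh = O_derivation_hom[OF D V B.pre.abelian[OF V(1)] T.pre.abelian[OF V(1)]]
      and h2 = add_hom_dg[OF dg_hom_i2 V(1) C.pre.abelian[OF V(1)] T.pre.abelian[OF V(1)]]
    show "add_hom (gsec B p V) ?M (\<lambda>b. \<psi> V p q b c)" if "p + q = l" "c \<in> sec C q V" for p q c
    proof -
      have k: "p + d + q = l + d" using that by auto
      show ?thesis unfolding \<psi>_def by (rule add_hom_comp[OF Dh T.pre.mul_hom_left[OF k V(1) i2_closed[OF V(1) that(2)]]])
    qed
    show "add_hom (gsec C q V) ?M (\<lambda>c. \<psi> V p q b c)" if "p + q = l" "b \<in> sec B p V" for p q b
    proof -
      have k: "p + d + q = l + d" using that by auto
      show ?thesis unfolding \<psi>_def by (rule add_hom_comp[OF h2 T.pre.mul_hom_right[OF k V(1) Dc[OF V that(2)]]])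
    qed
    fix p j q b a c assume b: "b \<in> sec B p V" and a: "a \<in> sec A j V" and c: "c \<in> sec C q V"
    note fa = f_closed[OF V(1) a] and ga = g_closed[OF V(1) a] and Db = Dc[OF V b]
    have k: "p + (j + d) = p + j + d" "p + d + j = p + j + d" by auto
    interpret M: abelian_group "gsec T (p + j + d) V" by (rule T.pre.abelian[OF V(1)])
    note ifa = i1_closed[OF V(1) fa]
    have "D (p + j) V (gmul B p j V b (f j V a)) = gmul T (p + d) j V (D p V b) (i1 j V (f j V a))"
      unfolding O_derivation_mul[OF D V b fa] zero[OF V a] add_hom_zero[OF T.pre.mul_hom_right[OF k(1) V(1) i1_closed[OF V(1) b]]]
        M.add.int_pow_one by (rule M.r_zero[OF T.pre.mul_closed'[OF k(2) V(1) Db ifa]])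
    then show "\<psi> V (p + j) q (gmul B p j V b (f j V a)) c = \<psi> V p (j + q) b (gmul C j q V (g j V a) c)"
      unfolding \<psi>_def dg_hom_mul[OF dg_hom_i2 V(1) ga c] i1_f[OF V(1) a, symmetric]
      using T.pre.mul_assoc'[OF k(2) refl V(1) Db ifa i2_closed[OF V(1) c]] by simp
  qed
  have nat: "gres T (p + q + d) V W (\<psi> V p q b c) = \<psi> W p q (gres B p V W b) (gres C q V W c)"
    if V: "opn Y V" "V \<subseteq> U" and W: "opn Y W" "W \<subseteq> V" and b: "b \<in> sec B p V" and c: "c \<in> sec C q V" for V W p q b c
  proof -
    have k: "p + d + q = p + q + d" by simp
    show ?thesis
      unfolding \<psi>_def T.mul_res[OF V(1) W Dc[OF V b] i2_closed[OF V(1) c], unfolded k]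
        O_derivation_res[OF D V W b] dg_hom_res[OF dg_hom_i2 V(1) W c] ..
  qed
  obtain \<chi> where \<chi>: "\<And>l V. opn Y V \<Longrightarrow> V \<subseteq> U \<Longrightarrow> add_hom (gsec T l V) (gsec T (l + d) V) (\<chi> l V)"
    "\<And>l V W x. \<lbrakk>opn Y V; V \<subseteq> U; opn Y W; W \<subseteq> V; x \<in> sec T l V\<rbrakk> \<Longrightarrow>
      \<chi> l W (gres T l V W x) = gres T (l + d) V W (\<chi> l V x)"
    "\<And>p q V b c. \<lbrakk>opn Y V; V \<subseteq> U; b \<in> sec B p V; c \<in> sec C q V\<rbrakk> \<Longrightarrow>
      \<chi> (p + q) V (tens p q V b c) = \<psi> V p q b c"
    by (rule tensor_extend[OF dg_T U, of d \<psi>]) (erule bil, assumption, erule nat, assumption+, rule that)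
  have cl: "\<chi> l V x \<in> sec T (l + d) V" if "opn Y V" "V \<subseteq> U" "x \<in> sec T l V" for l V x
    by (rule add_hom_closed[OF \<chi>(1)[OF that(1,2)] that(3)])
  have \<chi>sm: "\<chi> l V (r \<odot>\<^bsub>gsec T l V\<^esub> x) = r \<odot>\<^bsub>gsec T (l + d) V\<^esub> \<chi> l V x"
    if V: "opn Y V" "V \<subseteq> U" and r: "r \<in> carrier (rsec Y V)" and x: "x \<in> sec T l V" for l V r x
  proof (rule tensor_smult[OF dg_T \<chi>(1,2) _ V r x])
    fix p q V r b c assume V: "opn Y V" "V \<subseteq> U" and r: "r \<in> carrier (rsec Y V)" and b: "b \<in> sec B p V" and c: "c \<in> sec C q V"
    have k: "p + d + q = p + q + d" by simp
    show "\<chi> (p + q) V (tens p q V (r \<odot>\<^bsub>gsec B p V\<^esub> b) c) = r \<odot>\<^bsub>gsec T (p + q + d) V\<^esub> \<chi> (p + q) V (tens p q V b c)"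
      unfolding \<chi>(3)[OF V b c] \<chi>(3)[OF V B.pre.smult_closed[OF V(1) r b] c] \<psi>_def O_derivation_smult[OF D V r b]
        T.mul_smult_left[OF V(1) r Dc[OF V b] i2_closed[OF V(1) c], unfolded k] ..
  qed
  \<comment> \<open>On pure tensors both sides consist of a term with \<open>D b\<close> and a term
    with \<open>D b'\<close>. The parity \<open>d q\<close> occurs twice in the latter, once from
    the degree of the left tensor and once from moving \<open>D b'\<close> past \<open>c\<close>,
    and so drops out.\<close>
  have leibniz: "\<chi> (m + n) V (gmul T m n V x y) = gmul T (m + d) n V (\<chi> m V x) y \<oplus>\<^bsub>gsec T (m + n + d) V\<^esub>
      signed (gsec T (m + n + d) V) (d * m) (gmul T m (n + d) V x (\<chi> n V y))"
    if V: "opn Y V" "V \<subseteq> U" and x: "x \<in> sec T m V" and y: "y \<in> sec T n V" for m n V x y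
  proof (rule tensor_agree2[OF dg_T V(1), where m = "m + n + d" and l = m and l' = n and h = "\<lambda>V x y. \<chi> (m + n) V (gmul T m n V x y)"
        and k = "\<lambda>V x y. gmul T (m + d) n V (\<chi> m V x) y \<oplus>\<^bsub>gsec T (m + n + d) V\<^esub>
      signed (gsec T (m + n + d) V) (d * m) (gmul T m (n + d) V x (\<chi> n V y))"])
    have e: "m + d + n = m + n + d" "m + (n + d) = m + n + d" by auto
    fix W assume W: "opn Y W" "W \<subseteq> V"
    have WU: "W \<subseteq> U" using W V by blast
    let ?M = "gsec T (m + n + d) W"
    note hW = \<chi>(1)[OF W(1) WU] and sc = add_hom_scale[OF T.pre.abelian[OF W(1)]] and clW = cl[OF W(1) WU]
    show "add_hom (gsec T n W) ?M (\<lambda>y. \<chi> (m + n) W (gmul T m n W x y))" if "x \<in> sec T m W" for x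
      by (rule add_hom_comp[OF T.pre.add_hom_mul_right[OF W(1) that] hW])
    show "add_hom (gsec T m W) ?M (\<lambda>x. \<chi> (m + n) W (gmul T m n W x y))" if "y \<in> sec T n W" for y
      by (rule add_hom_comp[OF T.pre.add_hom_mul_left[OF W(1) that] hW])
    show "add_hom (gsec T n W) ?M (\<lambda>y. gmul T (m + d) n W (\<chi> m W x) y \<oplus>\<^bsub>?M\<^esub>
      signed ?M (d * m) (gmul T m (n + d) W x (\<chi> n W y)))" if "x \<in> sec T m W" for x
      by (rule add_hom_plus[OF T.pre.mul_hom_right[OF e(1) W(1) clW[OF that]]
        add_hom_comp[OF add_hom_comp[OF hW T.pre.mul_hom_right[OF e(2) W(1) that]] sc]])
    show "add_hom (gsec T m W) ?M (\<lambda>x. gmul T (m + d) n W (\<chi> m W x) y \<oplus>\<^bsub>?M\<^esub>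
      signed ?M (d * m) (gmul T m (n + d) W x (\<chi> n W y)))" if "y \<in> sec T n W" for y
      by (rule add_hom_plus[OF add_hom_comp[OF hW T.pre.mul_hom_left[OF e(1) W(1) that]]
        add_hom_comp[OF T.pre.mul_hom_left[OF e(2) W(1) clW[OF that]] sc]])
    fix W' x y assume W': "opn Y W'" "W' \<subseteq> W" and x: "x \<in> sec T m W" and y: "y \<in> sec T n W"
    show "\<chi> (m + n) W' (gmul T m n W' (gres T m W W' x) (gres T n W W' y)) = gres T (m + n + d) W W' (\<chi> (m + n) W (gmul T m n W x y))"
      using \<chi>(2)[OF W(1) WU W' T.mul_closed[OF W(1) x y]] T.mul_res[OF W(1) W' x y] by simp
    note a = T.mul_closed[OF W(1) clW[OF x] y, unfolded e] and b = T.mul_closed[OF W(1) x clW[OF y], unfolded e]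
    show "gmul T (m + d) n W' (\<chi> m W' (gres T m W W' x)) (gres T n W W' y) \<oplus>\<^bsub>gsec T (m + n + d) W'\<^esub>
      signed (gsec T (m + n + d) W') (d * m) (gmul T m (n + d) W' (gres T m W W' x) (\<chi> n W' (gres T n W W' y))) =
      gres T (m + n + d) W W' (gmul T (m + d) n W (\<chi> m W x) y \<oplus>\<^bsub>?M\<^esub> signed ?M (d * m) (gmul T m (n + d) W x (\<chi> n W y)))"
      by (simp only: T.res_add[OF W(1) W' a T.pre.sign_closed[OF W(1) b]] T.pre.res_signed[OF W(1) W' b]
        T.mul_res[OF W(1) W' clW[OF x] y, unfolded e] T.mul_res[OF W(1) W' x clW[OF y], unfolded e]
        \<chi>(2)[OF W(1) WU W' x] \<chi>(2)[OF W(1) WU W' y])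
  next
    fix W p q b c p' q' b' c' assume W: "opn Y W" "W \<subseteq> V" and 1: "p + q = m" "b \<in> sec B p W" "c \<in> sec C q W"
      and 2: "p' + q' = n" "b' \<in> sec B p' W" "c' \<in> sec C q' W"
    have WU: "W \<subseteq> U" using W V by blast
    let ?M = "gsec T (m + n + d) W"
    note ib = i1_closed[OF W(1) 1(2)] and ib' = i1_closed[OF W(1) 2(2)] and ic = i2_closed[OF W(1) 1(3)] and ic' = i2_closed[OF W(1) 2(3)]
    note db = Dc[OF W(1) WU 1(2)] and db' = Dc[OF W(1) WU 2(2)]
    note mu = T.mul_closed[OF W(1)] and mu' = T.pre.mul_closed'[OF _ W(1)]
    have k: "p + (p' + d) = p + d + p'" "p + p' + d = p + d + p'" "p + d + p' + (q + q') = m + n + d"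
      "p + q + (p' + q') = m + n" "p + p' + (q + q') = m + n" "p + d + q = m + d" "p' + d + q' = n + d"
      "m + d + n = m + n + d" "m + (n + d) = m + n + d" using 1 2 by auto
    note cc = mu[OF ic ic'] and b1 = mu[OF db ib'] and b2 = mu'[OF k(1) ib db']
    let ?c = "gmul T q q' W (i2 q W c) (i2 q' W c')"
    let ?z1 = "gmul T (p + d + p') (q + q') W (gmul T (p + d) p' W (D p W b) (i1 p' W b')) ?c"
    let ?z2 = "gmul T (p + d + p') (q + q') W (gmul T p (p' + d) W (i1 p W b) (D p' W b')) ?c"
    note bb = B.mul_closed[OF W(1) 1(2) 2(2)] and cC = C.mul_closed[OF W(1) 1(3) 2(3)]
    note hl = T.pre.mul_hom_left[OF k(3) W(1) cc]
    have t: "tens (p + p') (q + q') W (gmul B p p' W b b') (gmul C q q' W c c') \<in> sec T (m + n) W"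
      using tens_closed[OF W(1) bb cC] unfolding k .
    have L: "\<chi> (m + n) W (gmul T m n W (tens p q W b c) (tens p' q' W b' c')) =
        signed ?M (q * p') (?z1 \<oplus>\<^bsub>?M\<^esub> signed ?M (d * p) ?z2)"
    proof -
      have "\<psi> W (p + p') (q + q') (gmul B p p' W b b') (gmul C q q' W c c') = ?z1 \<oplus>\<^bsub>?M\<^esub> signed ?M (d * p) ?z2"
        unfolding \<psi>_def k(2) by (simp only: O_derivation_mul[OF D W(1) WU 1(2) 2(2), unfolded k(2)]
          dg_hom_mul[OF dg_hom_i2 W(1) 1(3) 2(3)] add_hom_add[OF hl b1 T.pre.sign_closed[OF W(1) b2]] add_hom_pow[OF hl b2])
      then show ?thesis
        using tens_mul[OF W(1) 1(2,3) 2(2,3)] \<chi>(3)[OF W(1) WU bb cC, unfolded k(5)] add_hom_pow[OF \<chi>(1)[OF W(1) WU] t]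
        by (simp only: 1(1) 2(1) k)
    qed
    have R: "gmul T (m + d) n W (\<psi> W p q b c) (tens p' q' W b' c') = signed ?M (q * p') ?z1"
      "gmul T m (n + d) W (tens p q W b c) (\<psi> W p' q' b' c') = signed ?M (q * (p' + d)) ?z2"
      using T.pre.interchange[OF W(1) db ic ib' ic', unfolded k(6) 2(1) k(8)]
        T.pre.interchange[OF W(1) ib ic db' ic', unfolded k(7) 1(1) k(9,1)] unfolding \<psi>_def by simp_all
    have "signed ?M (q * p') (x1 \<oplus>\<^bsub>?M\<^esub> signed ?M (d * p) x2) =
        signed ?M (q * p') x1 \<oplus>\<^bsub>?M\<^esub> signed ?M (d * (p + q)) (signed ?M (q * (p' + d)) x2)"
      if "x1 \<in> carrier ?M" "x2 \<in> carrier ?M" for x1 x2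
      apply (rule frag_rep_eqI, (rule frag_rep_rules that T.pre.abelian[OF W(1)])+)
      apply (cases "even p"; cases "even q"; cases "even p'"; cases "even d"; simp add: ksign_def algebra_simps)
      done
    from this[OF mu'[OF k(3) b1 cc] mu'[OF k(3) b2 cc]]
    show "\<chi> (m + n) W (gmul T m n W (tens p q W b c) (tens p' q' W b' c')) =
      gmul T (m + d) n W (\<chi> m W (tens p q W b c)) (tens p' q' W b' c') \<oplus>\<^bsub>?M\<^esub>
      signed ?M (d * m) (gmul T m (n + d) W (tens p q W b c) (\<chi> n W (tens p' q' W b' c')))"
      unfolding L using R \<chi>(3)[OF W(1) WU 1(2,3)] \<chi>(3)[OF W(1) WU 2(2,3)] by (simp only: 1(1) 2(1))
  qed (rule x, rule y)
  show ?thesis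
  proof (rule that[of "ext_fam Y T U \<chi>"])
    show "ext_fam Y T U \<chi> \<in> O_derivations Y T T fid d U"
    proof (rule ext_fam_O_derivation[OF dg_T])
      fix p q V x y assume "opn Y V" "V \<subseteq> U" "x \<in> sec T p V" "y \<in> sec T q V"
      then show "\<chi> (p + q) V (gmul T p q V x y) =
             gmul T (p + d) q V (\<chi> p V x) (fid q V y) \<oplus>\<^bsub>gsec T (p + q + d) V\<^esub>
             signed (gsec T (p + q + d) V) (d * p) (gmul T p (q + d) V (fid p V x) (\<chi> q V y))"
        unfolding fid_def by (rule leibniz)
    qed (erule cl, assumption+, rule add_hom_add[OF \<chi>(1)], assumption+, erule \<chi>(2), assumption+, erule \<chi>sm, assumption+)
    fix l V assume V: "opn Y V" "V \<subseteq> U"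
    show "ext_fam Y T U \<chi> l V (i1 l V b) = D l V b" if b: "b \<in> sec B l V" for b
      using \<chi>(3)[OF V b C.one_closed[OF V(1)]] tens_one_right[OF V(1) b]
        dg_hom_one[OF dg_hom_i2 V(1)] T.pre.one_right[OF V(1) Dc[OF V b]]
      by (simp add: \<psi>_def ext_fam_apply[OF V i1_closed[OF V(1) b]])
    show "ext_fam Y T U \<chi> l V (i2 l V c) = \<zero>\<^bsub>gsec T (l + d) V\<^esub>" if c: "c \<in> sec C l V" for c
    proof -
      have k: "0 + d + l = l + d" by simp
      have "D 0 V (gone B V) = \<zero>\<^bsub>gsec T (0 + d) V\<^esub>"
        using zero[OF V A.one_closed[OF V(1)]] dg_hom_one[OF f V(1)] by simp
      then show ?thesis
        using \<chi>(3)[OF V B.one_closed[OF V(1)] c] tens_one_left[OF V(1) c]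
          add_hom_zero[OF T.pre.mul_hom_left[OF k V(1) i2_closed[OF V(1) c]]]
        by (simp add: \<psi>_def ext_fam_apply[OF V i2_closed[OF V(1) c]])
    qed
  qed
qed

end

section \<open>The sheaf of derivations\<close>

text \<open>Derivations along a homomorphism rather than of one algebra, so that a single
  development covers the vector fields on objects, those on arrows, and the derivations along the
  unit that make up the algebroid of the groupoid.\<close>

locale derivation_sheaf =
  fixes Y :: "('a, 'r, 'y) ringed_space_scheme" and A :: "('a, 'r, 'm) dgalg" and B :: "('a, 'r, 'n) dgalg"
    and \<phi> :: "('a, 'm, 'n) family"
  assumes ringed: "is_ringed_space Y"
    and A: "dg_algebra_sheaf Y A" and B: "dg_algebra_sheaf Y B" and \<phi>: "dg_alg_hom Y A B \<phi>"
begin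

sublocale A: dg_algebra_sheaf Y A by (rule A)
sublocale B: dg_algebra_sheaf Y B by (rule B)

abbreviation "Der \<equiv> O_derivations Y A B \<phi>"
abbreviation "DerM \<equiv> fam_module Y A B Der"

lemma DerM_simps: "carrier (DerM d U) = Der d U" "D \<oplus>\<^bsub>DerM d U\<^esub> D' = fam_add Y A B d U D D'"
  "\<zero>\<^bsub>DerM d U\<^esub> = fam_zero Y A B d U" "r \<odot>\<^bsub>DerM d U\<^esub> D = fam_smult Y A B d U r D"
  by (simp_all add: fam_module_def)

lemma \<phi>_closed: "opn Y V \<Longrightarrow> x \<in> sec A l V \<Longrightarrow> \<phi> l V x \<in> sec B l V"
  by (rule dg_hom_closed[OF \<phi>])

lemma
  assumes V: "opn Y V" "V \<subseteq> U" and x: "x \<in> sec A l V"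
  shows fam_add_apply: "fam_add Y A B d U D D' l V x = D l V x \<oplus>\<^bsub>gsec B (l + d) V\<^esub> D' l V x"
    and fam_zero_apply: "fam_zero Y A B d U l V x = \<zero>\<^bsub>gsec B (l + d) V\<^esub>"
    and fam_smult_apply: "fam_smult Y A B d U r D l V x = rres Y U V r \<odot>\<^bsub>gsec B (l + d) V\<^esub> D l V x"
    and fam_act_apply: "fam_act Y A B p d U a D l V x = gmul B p (l + d) V (gres B p U V a) (D l V x)"
  unfolding fam_add_def fam_zero_def fam_smult_def fam_act_def by (rule ext_fam_apply[OF V x])+

lemma der_hom: "\<lbrakk>D \<in> Der d U; opn Y V; V \<subseteq> U; l + d = m\<rbrakk> \<Longrightarrow> add_hom (gsec A l V) (gsec B m V) (D l V)"
  using O_derivation_hom[of D Y A B \<phi> d U V l] A.pre.abelian B.pre.abelian by simp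

lemma zero_Der: assumes U: "opn Y U" shows "fam_zero Y A B d U \<in> Der d U"
  unfolding fam_zero_def
proof (rule ext_fam_O_derivation[OF A])
  fix l V assume V: "opn Y V" "V \<subseteq> U"
  interpret M: abelian_group "gsec B (l + d) V" by (rule B.pre.abelian[OF V(1)])
  show "\<zero>\<^bsub>gsec B (l + d) V\<^esub> \<in> sec B (l + d) V" by simp
  show "\<zero>\<^bsub>gsec B (l + d) V\<^esub> = \<zero>\<^bsub>gsec B (l + d) V\<^esub> \<oplus>\<^bsub>gsec B (l + d) V\<^esub> \<zero>\<^bsub>gsec B (l + d) V\<^esub>" by simp
  show "\<zero>\<^bsub>gsec B (l + d) W\<^esub> = gres B (l + d) V W \<zero>\<^bsub>gsec B (l + d) V\<^esub>" if "opn Y W" "W \<subseteq> V" for W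
    using add_hom_zero[OF B.pre.add_hom_res[OF V(1) that]] by simp
  show "\<zero>\<^bsub>gsec B (l + d) V\<^esub> = r \<odot>\<^bsub>gsec B (l + d) V\<^esub> \<zero>\<^bsub>gsec B (l + d) V\<^esub>" if "r \<in> carrier (rsec Y V)" for r
    using add_hom_zero[OF B.pre.add_hom_smult[OF V(1) that]] by simp
  fix q x y assume x: "x \<in> sec A l V" and y: "y \<in> sec A q V"
  interpret N: abelian_group "gsec B (l + q + d) V" by (rule B.pre.abelian[OF V(1)])
  have e: "l + d + q = l + q + d" "l + (q + d) = l + q + d" by auto
  show "\<zero>\<^bsub>gsec B (l + q + d) V\<^esub> = gmul B (l + d) q V \<zero>\<^bsub>gsec B (l + d) V\<^esub> (\<phi> q V y) \<oplus>\<^bsub>gsec B (l + q + d) V\<^esub>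
      signed (gsec B (l + q + d) V) (d * l) (gmul B l (q + d) V (\<phi> l V x) \<zero>\<^bsub>gsec B (q + d) V\<^esub>)"
    using add_hom_zero[OF B.pre.mul_hom_left[OF e(1) V(1) \<phi>_closed[OF V(1) y]]]
      add_hom_zero[OF B.pre.mul_hom_right[OF e(2) V(1) \<phi>_closed[OF V(1) x]]] by (simp add: N.add_pow_zero)
qed

lemma add_Der: assumes U: "opn Y U" and D: "D \<in> Der d U" and D': "D' \<in> Der d U"
  shows "fam_add Y A B d U D D' \<in> Der d U"
  unfolding fam_add_def
proof (rule ext_fam_O_derivation[OF A])
  fix l V x assume V: "opn Y V" "V \<subseteq> U" and x: "x \<in> sec A l V"
  note Dc = O_derivation_closed[OF D V] and Dc' = O_derivation_closed[OF D' V]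
  show "D l V x \<oplus>\<^bsub>gsec B (l + d) V\<^esub> D' l V x \<in> sec B (l + d) V" by (rule B.pre.add_closed[OF V(1) Dc[OF x] Dc'[OF x]])
  show "D l V (x \<oplus>\<^bsub>gsec A l V\<^esub> x') \<oplus>\<^bsub>gsec B (l + d) V\<^esub> D' l V (x \<oplus>\<^bsub>gsec A l V\<^esub> x') =
      D l V x \<oplus>\<^bsub>gsec B (l + d) V\<^esub> D' l V x \<oplus>\<^bsub>gsec B (l + d) V\<^esub> (D l V x' \<oplus>\<^bsub>gsec B (l + d) V\<^esub> D' l V x')"
    if "x' \<in> sec A l V" for x'
    by (rule add_hom_add[OF add_hom_plus[OF der_hom[OF D V refl] der_hom[OF D' V refl]] x that])
  show "D l W (gres A l V W x) \<oplus>\<^bsub>gsec B (l + d) W\<^esub> D' l W (gres A l V W x) =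
      gres B (l + d) V W (D l V x \<oplus>\<^bsub>gsec B (l + d) V\<^esub> D' l V x)" if "opn Y W" "W \<subseteq> V" for W
    by (simp only: B.res_add[OF V(1) that Dc[OF x] Dc'[OF x]] O_derivation_res[OF D V that x] O_derivation_res[OF D' V that x])
  show "D l V (r \<odot>\<^bsub>gsec A l V\<^esub> x) \<oplus>\<^bsub>gsec B (l + d) V\<^esub> D' l V (r \<odot>\<^bsub>gsec A l V\<^esub> x) =
      r \<odot>\<^bsub>gsec B (l + d) V\<^esub> (D l V x \<oplus>\<^bsub>gsec B (l + d) V\<^esub> D' l V x)" if "r \<in> carrier (rsec Y V)" for r
    by (simp only: B.pre.smult_add[OF V(1) that Dc[OF x] Dc'[OF x]] O_derivation_smult[OF D V that x] O_derivation_smult[OF D' V that x])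
  fix q y assume y: "y \<in> sec A q V"
  let ?M = "gsec B (l + q + d) V"
  have e: "l + d + q = l + q + d" "l + (q + d) = l + q + d" by auto
  note hl = B.pre.mul_hom_left[OF e(1) V(1) \<phi>_closed[OF V(1) y]] and hr = B.pre.mul_hom_right[OF e(2) V(1) \<phi>_closed[OF V(1) x]]
  have "(a \<oplus>\<^bsub>?M\<^esub> signed ?M (d * l) b) \<oplus>\<^bsub>?M\<^esub> (a' \<oplus>\<^bsub>?M\<^esub> signed ?M (d * l) b') =
      (a \<oplus>\<^bsub>?M\<^esub> a') \<oplus>\<^bsub>?M\<^esub> signed ?M (d * l) (b \<oplus>\<^bsub>?M\<^esub> b')"
    if "a \<in> carrier ?M" "a' \<in> carrier ?M" "b \<in> carrier ?M" "b' \<in> carrier ?M" for a b a' b'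
    apply (rule frag_rep_eqI, (rule frag_rep_rules that B.pre.abelian[OF V(1)])+)
    apply (simp add: frag_cmul_distrib2 add_ac)
    done
  from this[OF add_hom_closed[OF hl Dc[OF x]] add_hom_closed[OF hl Dc'[OF x]] add_hom_closed[OF hr Dc[OF y]] add_hom_closed[OF hr Dc'[OF y]]]
  show "D (l + q) V (gmul A l q V x y) \<oplus>\<^bsub>?M\<^esub> D' (l + q) V (gmul A l q V x y) =
      gmul B (l + d) q V (D l V x \<oplus>\<^bsub>gsec B (l + d) V\<^esub> D' l V x) (\<phi> q V y) \<oplus>\<^bsub>?M\<^esub>
      signed ?M (d * l) (gmul B l (q + d) V (\<phi> l V x) (D q V y \<oplus>\<^bsub>gsec B (q + d) V\<^esub> D' q V y))"
    by (simp only: O_derivation_mul[OF D V x y] O_derivation_mul[OF D' V x y] add_hom_add[OF hl Dc[OF x] Dc'[OF x]]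
      add_hom_add[OF hr Dc[OF y] Dc'[OF y]])
qed

lemma smult_Der: assumes U: "opn Y U" and r: "r \<in> carrier (rsec Y U)" and D: "D \<in> Der d U"
  shows "fam_smult Y A B d U r D \<in> Der d U"
  unfolding fam_smult_def
proof (rule ext_fam_O_derivation[OF A])
  fix l V x assume V: "opn Y V" "V \<subseteq> U" and x: "x \<in> sec A l V"
  note Dc = O_derivation_closed[OF D V] and r' = ringed_res_closed[OF ringed U V r]
  show "rres Y U V r \<odot>\<^bsub>gsec B (l + d) V\<^esub> D l V x \<in> sec B (l + d) V" by (rule B.pre.smult_closed[OF V(1) r' Dc[OF x]])
  show "rres Y U V r \<odot>\<^bsub>gsec B (l + d) V\<^esub> D l V (x \<oplus>\<^bsub>gsec A l V\<^esub> x') =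
      rres Y U V r \<odot>\<^bsub>gsec B (l + d) V\<^esub> D l V x \<oplus>\<^bsub>gsec B (l + d) V\<^esub> rres Y U V r \<odot>\<^bsub>gsec B (l + d) V\<^esub> D l V x'"
    if "x' \<in> sec A l V" for x'
    by (rule add_hom_add[OF add_hom_comp[OF der_hom[OF D V refl] B.pre.add_hom_smult[OF V(1) r']] x that])
  show "rres Y U W r \<odot>\<^bsub>gsec B (l + d) W\<^esub> D l W (gres A l V W x) =
      gres B (l + d) V W (rres Y U V r \<odot>\<^bsub>gsec B (l + d) V\<^esub> D l V x)" if "opn Y W" "W \<subseteq> V" for W
    by (simp only: B.res_smult[OF V(1) that r' Dc[OF x]] O_derivation_res[OF D V that x] ringed_res_res[OF ringed U V(1) that V(2) r])
  show "rres Y U V r \<odot>\<^bsub>gsec B (l + d) V\<^esub> D l V (s \<odot>\<^bsub>gsec A l V\<^esub> x) =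
      s \<odot>\<^bsub>gsec B (l + d) V\<^esub> (rres Y U V r \<odot>\<^bsub>gsec B (l + d) V\<^esub> D l V x)" if s: "s \<in> carrier (rsec Y V)" for s
  proof -
    interpret N: module "rsec Y V" "gsec B (l + d) V" by (rule B.module[OF V(1)])
    show ?thesis
      using N.smult_assoc1[OF r' s Dc[OF x]] N.smult_assoc1[OF s r' Dc[OF x]] N.R.m_comm[OF r' s]
      by (simp add: O_derivation_smult[OF D V s x])
  qed
  fix q y assume y: "y \<in> sec A q V"
  let ?M = "gsec B (l + q + d) V"
  have e: "l + d + q = l + q + d" "l + (q + d) = l + q + d" by auto
  note u = B.mul_closed[OF V(1) Dc[OF x] \<phi>_closed[OF V(1) y], unfolded e]
    and w = B.mul_closed[OF V(1) \<phi>_closed[OF V(1) x] Dc[OF y], unfolded e]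
  show "rres Y U V r \<odot>\<^bsub>?M\<^esub> D (l + q) V (gmul A l q V x y) =
      gmul B (l + d) q V (rres Y U V r \<odot>\<^bsub>gsec B (l + d) V\<^esub> D l V x) (\<phi> q V y) \<oplus>\<^bsub>?M\<^esub>
      signed ?M (d * l) (gmul B l (q + d) V (\<phi> l V x) (rres Y U V r \<odot>\<^bsub>gsec B (q + d) V\<^esub> D q V y))"
    by (simp only: O_derivation_mul[OF D V x y] B.pre.smult_add[OF V(1) r' u B.pre.sign_closed[OF V(1) w]]
      B.pre.smult_signed[OF V(1) r' w] B.mul_smult_left[OF V(1) r' Dc[OF x] \<phi>_closed[OF V(1) y], unfolded e]
      B.mul_smult_right[OF V(1) r' \<phi>_closed[OF V(1) x] Dc[OF y], unfolded e])
qed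

text \<open>In the second term of the Leibniz rule \<open>a\<close> has to pass
  \<open>\<phi> x\<close>, which contributes the sign \<open>p l\<close>; together with
  \<open>d l\<close> this is the sign expected of a derivation of degree
  \<open>p + d\<close>.\<close>

lemma act_Der: assumes U: "opn Y U" and a: "a \<in> sec B p U" and D: "D \<in> Der d U"
  shows "fam_act Y A B p d U a D \<in> Der (p + d) U"
  unfolding fam_act_def
proof (rule ext_fam_O_derivation[OF A])
  fix l V x assume V: "opn Y V" "V \<subseteq> U" and x: "x \<in> sec A l V"
  note Dc = O_derivation_closed[OF D V] and a' = B.pre.res_closed[OF U V a]
  let ?a = "gres B p U V a"
  have e: "p + (l + d) = l + (p + d)" by simp
  note hr = B.pre.mul_hom_right[OF e V(1) a']
  show "gmul B p (l + d) V ?a (D l V x) \<in> sec B (l + (p + d)) V" by (rule add_hom_closed[OF hr Dc[OF x]])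
  show "gmul B p (l + d) V ?a (D l V (x \<oplus>\<^bsub>gsec A l V\<^esub> x')) =
      gmul B p (l + d) V ?a (D l V x) \<oplus>\<^bsub>gsec B (l + (p + d)) V\<^esub> gmul B p (l + d) V ?a (D l V x')"
    if "x' \<in> sec A l V" for x'
    by (rule add_hom_add[OF add_hom_comp[OF der_hom[OF D V refl] hr] x that])
  show "gmul B p (l + d) W (gres B p U W a) (D l W (gres A l V W x)) = gres B (l + (p + d)) V W (gmul B p (l + d) V ?a (D l V x))"
    if "opn Y W" "W \<subseteq> V" for W
    by (simp only: B.mul_res[OF V(1) that a' Dc[OF x], unfolded e] O_derivation_res[OF D V that x]
      B.pre.res_res[OF U V(1) that V(2) a])
  show "gmul B p (l + d) V ?a (D l V (r \<odot>\<^bsub>gsec A l V\<^esub> x)) = r \<odot>\<^bsub>gsec B (l + (p + d)) V\<^esub> gmul B p (l + d) V ?a (D l V x)"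
    if r: "r \<in> carrier (rsec Y V)" for r
    by (simp only: O_derivation_smult[OF D V r x] B.mul_smult_right[OF V(1) r a' Dc[OF x], unfolded e])
  fix q y assume y: "y \<in> sec A q V"
  let ?M = "gsec B (l + q + (p + d)) V"
  note fx = \<phi>_closed[OF V(1) x] and fy = \<phi>_closed[OF V(1) y]
  have k: "l + d + q = l + q + d" "l + (q + d) = l + q + d" "p + (l + q + d) = l + q + (p + d)" "p + (l + d) = l + (p + d)"
    "l + p = p + l" "p + (q + d) = q + (p + d)" "p + l + (q + d) = l + q + (p + d)" "l + (q + (p + d)) = l + q + (p + d)" by auto
  note u = B.mul_closed[OF V(1) Dc[OF x] fy, unfolded k(1)] and w = B.mul_closed[OF V(1) fx Dc[OF y], unfolded k(2)]
  note h = B.pre.mul_hom_right[OF k(3) V(1) a']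
  note M = B.pre.abelian[OF V(1)]
  let ?v = "gmul B l (q + (p + d)) V (\<phi> l V x) (gmul B p (q + d) V ?a (D q V y))"
  have v: "?v \<in> carrier ?M" by (rule B.pre.mul_closed'[OF k(8) V(1) fx B.pre.mul_closed'[OF k(6) V(1) a' Dc[OF y]]])
  have 1: "gmul B p (l + q + d) V ?a (gmul B (l + d) q V (D l V x) (\<phi> q V y)) =
      gmul B (l + (p + d)) q V (gmul B p (l + d) V ?a (D l V x)) (\<phi> q V y)"
    by (rule B.pre.mul_assoc'[OF k(4,1) V(1) a' Dc[OF x] fy, symmetric])
  have "gmul B p (l + q + d) V ?a (gmul B l (q + d) V (\<phi> l V x) (D q V y)) =
      gmul B (p + l) (q + d) V (gmul B p l V ?a (\<phi> l V x)) (D q V y)"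
    by (rule B.pre.mul_assoc'[OF refl k(2) V(1) a' fx Dc[OF y], symmetric])
  also have "\<dots> = gmul B (p + l) (q + d) V (signed (gsec B (p + l) V) (p * l) (gmul B l p V (\<phi> l V x) ?a)) (D q V y)"
    by (simp only: B.mul_graded_comm[OF V(1) a' fx])
  also have "\<dots> = signed ?M (p * l) (gmul B (p + l) (q + d) V (gmul B l p V (\<phi> l V x) ?a) (D q V y))"
    by (rule add_hom_pow[OF B.pre.mul_hom_left[OF k(7) V(1) Dc[OF y]] B.mul_closed[OF V(1) fx a', unfolded k(5)]])
  also have "\<dots> = signed ?M (p * l) ?v"
    by (simp only: B.pre.mul_assoc'[OF k(5,6) V(1) fx a' Dc[OF y]])
  finally have 2: "gmul B p (l + q + d) V ?a (gmul B l (q + d) V (\<phi> l V x) (D q V y)) = signed ?M (p * l) ?v" .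
  have "signed ?M (d * l) (signed ?M (p * l) ?v) = signed ?M ((p + d) * l) ?v"
    using signed_signed[OF M v] by (simp add: distrib_right add.commute)
  then show "gmul B p (l + q + d) V ?a (D (l + q) V (gmul A l q V x y)) =
      gmul B (l + (p + d)) q V (gmul B p (l + d) V ?a (D l V x)) (\<phi> q V y) \<oplus>\<^bsub>?M\<^esub>
      signed ?M ((p + d) * l) (gmul B l (q + (p + d)) V (\<phi> l V x) (gmul B p (q + d) V ?a (D q V y)))"
    by (simp only: O_derivation_mul[OF D V x y] add_hom_add[OF h u B.pre.sign_closed[OF V(1) w]] add_hom_pow[OF h w] 1 2)
qed

lemma restrict_Der: assumes D: "D \<in> Der d U" and U: "U' \<subseteq> U" shows "ext_fam Y A U' D \<in> Der d U'"
proof (rule ext_fam_O_derivation[OF A])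
  note s = subset_trans[OF _ U]
  show "D l V x \<in> sec B (l + d) V" if "opn Y V" "V \<subseteq> U'" "x \<in> sec A l V" for l V x
    by (rule O_derivation_closed[OF D that(1) s[OF that(2)] that(3)])
  show "D l V (x \<oplus>\<^bsub>gsec A l V\<^esub> x') = D l V x \<oplus>\<^bsub>gsec B (l + d) V\<^esub> D l V x'"
    if "opn Y V" "V \<subseteq> U'" "x \<in> sec A l V" "x' \<in> sec A l V" for l V x x'
    by (rule O_derivation_add[OF D that(1) s[OF that(2)] that(3,4)])
  show "D (p + q) V (gmul A p q V x y) = gmul B (p + d) q V (D p V x) (\<phi> q V y) \<oplus>\<^bsub>gsec B (p + q + d) V\<^esub>
     signed (gsec B (p + q + d) V) (d * p) (gmul B p (q + d) V (\<phi> p V x) (D q V y))"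
    if "opn Y V" "V \<subseteq> U'" "x \<in> sec A p V" "y \<in> sec A q V" for p q V x y
    by (rule O_derivation_mul[OF D that(1) s[OF that(2)] that(3,4)])
  show "D l W (gres A l V W x) = gres B (l + d) V W (D l V x)"
    if "opn Y V" "V \<subseteq> U'" "opn Y W" "W \<subseteq> V" "x \<in> sec A l V" for l V W x
    by (rule O_derivation_res[OF D that(1) s[OF that(2)] that(3-5)])
  show "D l V (r \<odot>\<^bsub>gsec A l V\<^esub> x) = r \<odot>\<^bsub>gsec B (l + d) V\<^esub> D l V x"
    if "opn Y V" "V \<subseteq> U'" "r \<in> carrier (rsec Y V)" "x \<in> sec A l V" for l V r x
    by (rule O_derivation_smult[OF D that(1) s[OF that(2)] that(3,4)])
qed

lemma abelian_Der: assumes U: "opn Y U" shows "abelian_group (DerM d U)"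
proof (rule abelian_groupI; unfold DerM_simps)
  show z: "fam_zero Y A B d U \<in> Der d U" by (rule zero_Der[OF U])
  fix D D' D'' assume D: "D \<in> Der d U"
  note ab = B.pre.abelian
  have c: "D l V x \<in> sec B (l + d) V" if "D \<in> Der d U" "opn Y V" "V \<subseteq> U" "x \<in> sec A l V" for D l V x
    by (rule O_derivation_closed[OF that])
  show "fam_add Y A B d U (fam_zero Y A B d U) D = D"
    by (rule O_derivation_eqI[OF add_Der[OF U z D] D])
      (simp add: fam_add_apply fam_zero_apply abelian_monoid.l_zero[OF abelian_group.axioms(1)[OF ab]] c[OF D])
  show "\<exists>E\<in>Der d U. fam_add Y A B d U E D = fam_zero Y A B d U"
  proof -
    interpret R: cring "rsec Y U" by (rule ringed_cring[OF ringed U])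
    let ?m = "\<ominus>\<^bsub>rsec Y U\<^esub> \<one>\<^bsub>rsec Y U\<^esub>"
    have m: "?m \<in> carrier (rsec Y U)" by simp
    note mD = smult_Der[OF U m D]
    have "fam_add Y A B d U (fam_smult Y A B d U ?m D) D = fam_zero Y A B d U"
    proof (rule O_derivation_eqI[OF add_Der[OF U mD D] z], goal_cases)
      case (1 l V x) note V = 1(1-2) and x = 1(3)
      interpret N: module "rsec Y V" "gsec B (l + d) V" by (rule B.module[OF V(1)])
      show ?case
        using c[OF D V x]
        by (simp add: fam_add_apply[OF V x] fam_zero_apply[OF V x] fam_smult_apply[OF V x] ringed_res_minus_one[OF ringed U V]
          N.smult_l_minus N.l_neg)
    qed
    then show ?thesis using mD by blast
  qed
  assume D': "D' \<in> Der d U"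
  show "fam_add Y A B d U D D' \<in> Der d U" by (rule add_Der[OF U D D'])
  show "fam_add Y A B d U D D' = fam_add Y A B d U D' D"
    by (rule O_derivation_eqI[OF add_Der[OF U D D'] add_Der[OF U D' D]])
      (simp add: fam_add_apply abelian_monoid.a_comm[OF abelian_group.axioms(1)[OF ab]] c[OF D] c[OF D'])
  assume D'': "D'' \<in> Der d U"
  show "fam_add Y A B d U (fam_add Y A B d U D D') D'' = fam_add Y A B d U D (fam_add Y A B d U D' D'')"
    by (rule O_derivation_eqI[OF add_Der[OF U add_Der[OF U D D'] D''] add_Der[OF U D add_Der[OF U D' D'']]])
      (simp add: fam_add_apply abelian_monoid.a_assoc[OF abelian_group.axioms(1)[OF ab]] c[OF D] c[OF D'] c[OF D''])
qed

text \<open>Signs and negatives in the module of derivations are abstract group powers and inverses.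
  Since evaluation at a section is additive, they can be computed value by value.\<close>

lemma eval_hom: "\<lbrakk>opn Y U; opn Y V; V \<subseteq> U; x \<in> sec A l V\<rbrakk> \<Longrightarrow>
    add_hom (DerM d U) (gsec B (l + d) V) (\<lambda>D. D l V x)"
  by (rule add_homI[OF abelian_Der B.pre.abelian])
    (simp_all add: DerM_simps fam_add_apply O_derivation_closed)

lemma module_Der: assumes U: "opn Y U" shows "module (rsec Y U) (DerM d U)"
proof (rule moduleI[OF ringed_cring[OF ringed U] abelian_Der[OF U]]; unfold DerM_simps)
  interpret R: cring "rsec Y U" by (rule ringed_cring[OF ringed U])
  have c: "D l V x \<in> sec B (l + d) V" if "D \<in> Der d U" "opn Y V" "V \<subseteq> U" "x \<in> sec A l V" for D l V x
    by (rule O_derivation_closed[OF that])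
  fix a D assume a: "a \<in> carrier (rsec Y U)" and D: "D \<in> Der d U"
  show aD: "fam_smult Y A B d U a D \<in> Der d U" by (rule smult_Der[OF U a D])
  fix b assume b: "b \<in> carrier (rsec Y U)"
  note bD = smult_Der[OF U b D]
  note rc = ringed_res_closed[OF ringed U]
  show "fam_smult Y A B d U (a \<oplus>\<^bsub>rsec Y U\<^esub> b) D = fam_add Y A B d U (fam_smult Y A B d U a D) (fam_smult Y A B d U b D)"
  proof (rule O_derivation_eqI[OF smult_Der[OF U R.a_closed[OF a b] D] add_Der[OF U aD bD]])
    fix l V x assume V: "opn Y V" "V \<subseteq> U" and x: "x \<in> sec A l V"
    show "fam_smult Y A B d U (a \<oplus>\<^bsub>rsec Y U\<^esub> b) D l V x =
        fam_add Y A B d U (fam_smult Y A B d U a D) (fam_smult Y A B d U b D) l V x"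
      by (simp only: fam_add_apply[OF V x] fam_smult_apply[OF V x] ring_hom_add[OF ringed_res_hom[OF ringed U V] a b]
        module.smult_l_distr[OF B.module[OF V(1)] rc[OF V a] rc[OF V b] c[OF D V x]])
  qed
  show "fam_smult Y A B d U (a \<otimes>\<^bsub>rsec Y U\<^esub> b) D = fam_smult Y A B d U a (fam_smult Y A B d U b D)"
  proof (rule O_derivation_eqI[OF smult_Der[OF U R.m_closed[OF a b] D] smult_Der[OF U a bD]], goal_cases)
    case (1 l V x) note V = 1(1-2) and x = 1(3)
    show ?case
      by (simp only: fam_smult_apply[OF V x] ring_hom_mult[OF ringed_res_hom[OF ringed U V] a b]
        module.smult_assoc1[OF B.module[OF V(1)] rc[OF V a] rc[OF V b] c[OF D V x]])
  qed
  fix D' assume D': "D' \<in> Der d U"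
  show "fam_smult Y A B d U a (fam_add Y A B d U D D') = fam_add Y A B d U (fam_smult Y A B d U a D) (fam_smult Y A B d U a D')"
  proof (rule O_derivation_eqI[OF smult_Der[OF U a add_Der[OF U D D']] add_Der[OF U aD smult_Der[OF U a D']]])
    fix l V x assume V: "opn Y V" "V \<subseteq> U" and x: "x \<in> sec A l V"
    show "fam_smult Y A B d U a (fam_add Y A B d U D D') l V x =
        fam_add Y A B d U (fam_smult Y A B d U a D) (fam_smult Y A B d U a D') l V x"
      by (simp only: fam_add_apply[OF V x] fam_smult_apply[OF V x] B.pre.smult_add[OF V(1) rc[OF V a] c[OF D V x] c[OF D' V x]])
  qed
next
  interpret R: cring "rsec Y U" by (rule ringed_cring[OF ringed U])
  fix D assume D: "D \<in> Der d U"
  show "fam_smult Y A B d U \<one>\<^bsub>rsec Y U\<^esub> D = D"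
  proof (rule O_derivation_eqI[OF smult_Der[OF U R.one_closed D] D], goal_cases)
    case (1 l V x) note V = 1(1-2) and x = 1(3)
    show ?case
      by (simp only: fam_smult_apply[OF V x] ring_hom_one[OF ringed_res_hom[OF ringed U V]]
        module.smult_one[OF B.module[OF V(1)] O_derivation_closed[OF D V x]])
  qed
qed

text \<open>There is two-fold gluing: a derivation over the union is a family of maps, and each
  value of such a map is itself a section glued from the values of the given local derivations. The
  laws then hold because they hold on open sets inside a member of the family.\<close>

lemma sheaf_Der: "sheaf_on (tp Y) (Der d) (\<lambda>U V D. ext_fam Y A V D)"
proof -
  have pre: "presheaf_on (tp Y) (Der d) (\<lambda>U V D. ext_fam Y A V D)"
    unfolding presheaf_on_def
    by (intro conjI allI impI ballI Pi_I; (elim conjE)?) (simp_all add: restrict_Der O_derivation_ext ext_fam_ext_fam)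
  have *: "\<exists>!D. D \<in> Der d (\<Union>\<U>) \<and> (\<forall>U\<in>\<U>. ext_fam Y A U D = \<sigma> U)"
    if U: "\<And>U. U \<in> \<U> \<Longrightarrow> opn Y U" and \<sigma>: "\<And>U. U \<in> \<U> \<Longrightarrow> \<sigma> U \<in> Der d U"
      and compat: "\<And>U V. U \<in> \<U> \<Longrightarrow> V \<in> \<U> \<Longrightarrow> ext_fam Y A (U \<inter> V) (\<sigma> U) = ext_fam Y A (U \<inter> V) (\<sigma> V)" for \<U> \<sigma>
  proof -
    have agree: "\<sigma> U l W y = \<sigma> V l W y"
      if "U \<in> \<U>" "V \<in> \<U>" "opn Y W" "W \<subseteq> U" "W \<subseteq> V" "y \<in> sec A l W" for U V l W y
    proof -
      have "ext_fam Y A (U \<inter> V) (\<sigma> U) l W y = ext_fam Y A (U \<inter> V) (\<sigma> V) l W y" using compat[OF that(1,2)] by simp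
      then show ?thesis using that by (simp add: ext_fam_apply)
    qed
    \<comment> \<open>The value on \<open>x\<close> over \<open>W\<close> is characterized by its
      restrictions to all open sets that lie in some member of the family; \<open>agree\<close>
      makes this prescription independent of the member.\<close>
    have ex: "\<exists>s\<in>sec B (l + d) W. \<forall>W' t. opn Y W' \<and> W' \<subseteq> W \<and> t \<in> sec B (l + d) W' \<and>
        (\<exists>U\<in>\<U>. W' \<subseteq> U \<and> t = \<sigma> U l W' (gres A l W W' x)) \<longrightarrow> gres B (l + d) W W' s = t"
      if W: "opn Y W" "W \<subseteq> \<Union>\<U>" and x: "x \<in> sec A l W" for l W x
    proof (rule sheaf_glue[OF B.sheaf W(1)])
      fix z assume "z \<in> W"
      then obtain U0 where U0: "U0 \<in> \<U>" "z \<in> U0" using W by blast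
      have o: "opn Y (W \<inter> U0)" using W U[OF U0(1)] by blast
      have "\<sigma> U0 l (W \<inter> U0) (gres A l W (W \<inter> U0) x) \<in> sec B (l + d) (W \<inter> U0)"
        by (rule O_derivation_closed[OF \<sigma>[OF U0(1)] o]) (use A.pre.res_closed[OF W(1) o _ x] in auto)
      then show "\<exists>V s. opn Y V \<and> z \<in> V \<and> V \<subseteq> W \<and> s \<in> sec B (l + d) V \<and>
          (\<exists>U\<in>\<U>. V \<subseteq> U \<and> s = \<sigma> U l V (gres A l W V x))"
        using o U0 \<open>z \<in> W\<close> by (intro exI[of _ "W \<inter> U0"] exI conjI bexI[of _ U0]) auto
    next
      fix V s t assume V: "opn Y V" "V \<subseteq> W" and "\<exists>U\<in>\<U>. V \<subseteq> U \<and> s = \<sigma> U l V (gres A l W V x)"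
        "\<exists>U\<in>\<U>. V \<subseteq> U \<and> t = \<sigma> U l V (gres A l W V x)"
      then show "s = t" using agree[OF _ _ V(1) _ _ A.pre.res_closed[OF W(1) V x]] by auto
    next
      fix V V' s assume V: "opn Y V" "V \<subseteq> W" and V': "opn Y V'" "V' \<subseteq> V"
        and "\<exists>U\<in>\<U>. V \<subseteq> U \<and> s = \<sigma> U l V (gres A l W V x)"
      then obtain U0 where U0: "U0 \<in> \<U>" "V \<subseteq> U0" "s = \<sigma> U0 l V (gres A l W V x)" by blast
      have "gres B (l + d) V V' s = \<sigma> U0 l V' (gres A l W V' x)"
        using O_derivation_res[OF \<sigma>[OF U0(1)] V(1) U0(2) V' A.pre.res_closed[OF W(1) V x]]
          A.pre.res_res[OF W(1) V(1) V'(1) V'(2) V(2) x] U0(3) by simp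
      then show "\<exists>U\<in>\<U>. V' \<subseteq> U \<and> gres B (l + d) V V' s = \<sigma> U l V' (gres A l W V' x)"
        using U0 V' by (intro bexI[of _ U0]) auto
    qed
    define D where "D l W x = (SOME s. s \<in> sec B (l + d) W \<and> (\<forall>W' t. opn Y W' \<and> W' \<subseteq> W \<and> t \<in> sec B (l + d) W' \<and>
        (\<exists>U\<in>\<U>. W' \<subseteq> U \<and> t = \<sigma> U l W' (gres A l W W' x)) \<longrightarrow> gres B (l + d) W W' s = t))" for l W x
    have D: "D l W x \<in> sec B (l + d) W \<and> (\<forall>W' t. opn Y W' \<and> W' \<subseteq> W \<and> t \<in> sec B (l + d) W' \<and>
        (\<exists>U\<in>\<U>. W' \<subseteq> U \<and> t = \<sigma> U l W' (gres A l W W' x)) \<longrightarrow> gres B (l + d) W W' (D l W x) = t)"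
      if "opn Y W" "W \<subseteq> \<Union>\<U>" "x \<in> sec A l W" for l W x
      using someI_ex[OF ex[OF that, unfolded Bex_def[of "sec B (l + d) W"]], folded D_def] .
    note Dc = D[THEN conjunct1]
    have Dv: "gres B (l + d) W W' (D l W x) = \<sigma> U0 l W' (gres A l W W' x)"
      if W: "opn Y W" "W \<subseteq> \<Union>\<U>" "x \<in> sec A l W" and W': "opn Y W'" "W' \<subseteq> W" and U0: "U0 \<in> \<U>" "W' \<subseteq> U0"
      for l W x W' U0
    proof -
      have "\<sigma> U0 l W' (gres A l W W' x) \<in> sec B (l + d) W'"
        by (rule O_derivation_closed[OF \<sigma>[OF U0(1)] W'(1) U0(2) A.pre.res_closed[OF W(1) W' W(3)]])
      then show ?thesis using D[OF W] W' U0 by blast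
    qed
    \<comment> \<open>Sections of \<open>B\<close> over \<open>W\<close> may be compared on open
      sets contained in single members of the family, where the glued map is one of the given
      derivations.\<close>
    have loc: "s = t" if W: "opn Y W" "W \<subseteq> \<Union>\<U>" and st: "s \<in> sec B m W" "t \<in> sec B m W"
      and *: "\<And>W' U0. \<lbrakk>opn Y W'; W' \<subseteq> W; U0 \<in> \<U>; W' \<subseteq> U0\<rbrakk> \<Longrightarrow> gres B m W W' s = gres B m W W' t" for W s t m
    proof (rule sheaf_eqI[OF B.sheaf W(1) st])
      fix z assume "z \<in> W"
      then obtain U0 where U0: "U0 \<in> \<U>" "z \<in> U0" using W by blast
      have o: "opn Y (W \<inter> U0)" using W U[OF U0(1)] by blast
      show "\<exists>V. opn Y V \<and> z \<in> V \<and> V \<subseteq> W \<and> gres B m W V s = gres B m W V t"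
        using *[OF o _ U0(1)] o U0 \<open>z \<in> W\<close> by (intro exI[of _ "W \<inter> U0"]) auto
    qed
    let ?D = "ext_fam Y A (\<Union>\<U>) D"
    have Dder: "?D \<in> Der d (\<Union>\<U>)"
    proof (rule ext_fam_O_derivation[OF A])
      fix l W x assume W: "opn Y W" "W \<subseteq> \<Union>\<U>" and x: "x \<in> sec A l W"
      show "D l W x \<in> sec B (l + d) W" by (rule Dc[OF W x])
      show "D l W (x \<oplus>\<^bsub>gsec A l W\<^esub> x') = D l W x \<oplus>\<^bsub>gsec B (l + d) W\<^esub> D l W x'" if x': "x' \<in> sec A l W" for x'
      proof (rule loc[OF W Dc[OF W A.pre.add_closed[OF W(1) x x']] B.pre.add_closed[OF W(1) Dc[OF W x] Dc[OF W x']]])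
        fix W' U0 assume W': "opn Y W'" "W' \<subseteq> W" and U0: "U0 \<in> \<U>" "W' \<subseteq> U0"
        show "gres B (l + d) W W' (D l W (x \<oplus>\<^bsub>gsec A l W\<^esub> x')) = gres B (l + d) W W' (D l W x \<oplus>\<^bsub>gsec B (l + d) W\<^esub> D l W x')"
          by (simp only: B.res_add[OF W(1) W' Dc[OF W x] Dc[OF W x']] Dv[OF W x W' U0] Dv[OF W x' W' U0]
            Dv[OF W A.pre.add_closed[OF W(1) x x'] W' U0] A.res_add[OF W(1) W' x x']
            O_derivation_add[OF \<sigma>[OF U0(1)] W'(1) U0(2) A.pre.res_closed[OF W(1) W' x] A.pre.res_closed[OF W(1) W' x']])
      qed
      show "D l W (r \<odot>\<^bsub>gsec A l W\<^esub> x) = r \<odot>\<^bsub>gsec B (l + d) W\<^esub> D l W x" if r: "r \<in> carrier (rsec Y W)" for r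
      proof (rule loc[OF W Dc[OF W A.pre.smult_closed[OF W(1) r x]] B.pre.smult_closed[OF W(1) r Dc[OF W x]]])
        fix W' U0 assume W': "opn Y W'" "W' \<subseteq> W" and U0: "U0 \<in> \<U>" "W' \<subseteq> U0"
        show "gres B (l + d) W W' (D l W (r \<odot>\<^bsub>gsec A l W\<^esub> x)) = gres B (l + d) W W' (r \<odot>\<^bsub>gsec B (l + d) W\<^esub> D l W x)"
          by (simp only: B.res_smult[OF W(1) W' r Dc[OF W x]] Dv[OF W x W' U0] Dv[OF W A.pre.smult_closed[OF W(1) r x] W' U0]
            A.res_smult[OF W(1) W' r x] O_derivation_smult[OF \<sigma>[OF U0(1)] W'(1) U0(2) ringed_res_closed[OF ringed W(1) W' r]
            A.pre.res_closed[OF W(1) W' x]])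
      qed
      show "D l V (gres A l W V x) = gres B (l + d) W V (D l W x)" if V: "opn Y V" "V \<subseteq> W" for V
      proof -
        have VU: "V \<subseteq> \<Union>\<U>" using V W by blast
        note xV = A.pre.res_closed[OF W(1) V x]
        show ?thesis
        proof (rule loc[OF V(1) VU Dc[OF V(1) VU xV] B.pre.res_closed[OF W(1) V Dc[OF W x]]])
          fix W' U0 assume W': "opn Y W'" "W' \<subseteq> V" and U0: "U0 \<in> \<U>" "W' \<subseteq> U0"
          show "gres B (l + d) V W' (D l V (gres A l W V x)) = gres B (l + d) V W' (gres B (l + d) W V (D l W x))"
            by (simp only: Dv[OF V(1) VU xV W' U0] B.pre.res_res[OF W(1) V(1) W'(1,2) V(2) Dc[OF W x]]
              Dv[OF W x W'(1) subset_trans[OF W'(2) V(2)] U0] A.pre.res_res[OF W(1) V(1) W'(1,2) V(2) x])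
        qed
      qed
      fix q y assume y: "y \<in> sec A q W"
      have e: "l + d + q = l + q + d" "l + (q + d) = l + q + d" by auto
      note fx = \<phi>_closed[OF W(1) x] and fy = \<phi>_closed[OF W(1) y]
      note u = B.mul_closed[OF W(1) Dc[OF W x] fy, unfolded e] and w = B.mul_closed[OF W(1) fx Dc[OF W y], unfolded e]
      note sw = B.pre.sign_closed[OF W(1) w]
      show "D (l + q) W (gmul A l q W x y) = gmul B (l + d) q W (D l W x) (\<phi> q W y) \<oplus>\<^bsub>gsec B (l + q + d) W\<^esub>
          signed (gsec B (l + q + d) W) (d * l) (gmul B l (q + d) W (\<phi> l W x) (D q W y))"
      proof (rule loc[OF W Dc[OF W A.mul_closed[OF W(1) x y]] B.pre.add_closed[OF W(1) u sw]])
        fix W' U0 assume W': "opn Y W'" "W' \<subseteq> W" and U0: "U0 \<in> \<U>" "W' \<subseteq> U0"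
        show "gres B (l + q + d) W W' (D (l + q) W (gmul A l q W x y)) =
            gres B (l + q + d) W W' (gmul B (l + d) q W (D l W x) (\<phi> q W y) \<oplus>\<^bsub>gsec B (l + q + d) W\<^esub>
            signed (gsec B (l + q + d) W) (d * l) (gmul B l (q + d) W (\<phi> l W x) (D q W y)))"
          by (simp only: Dv[OF W A.mul_closed[OF W(1) x y] W' U0] A.mul_res[OF W(1) W' x y]
            O_derivation_mul[OF \<sigma>[OF U0(1)] W'(1) U0(2) A.pre.res_closed[OF W(1) W' x] A.pre.res_closed[OF W(1) W' y]]
            B.res_add[OF W(1) W' u sw] B.pre.res_signed[OF W(1) W' w] B.mul_res[OF W(1) W' Dc[OF W x] fy, unfolded e]
            B.mul_res[OF W(1) W' fx Dc[OF W y], unfolded e] Dv[OF W x W' U0] Dv[OF W y W' U0]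
            dg_hom_res[OF \<phi> W(1) W' x] dg_hom_res[OF \<phi> W(1) W' y])
      qed
    qed
    have 1: "ext_fam Y A U0 ?D = \<sigma> U0" if U0: "U0 \<in> \<U>" for U0
    proof -
      have sub: "U0 \<subseteq> \<Union>\<U>" using U0 by blast
      show ?thesis
      proof (rule O_derivation_eqI[OF restrict_Der[OF Dder sub] \<sigma>[OF U0]], goal_cases)
        case (1 l V x) note V = 1(1-2) and x = 1(3)
        have VU: "V \<subseteq> \<Union>\<U>" using V sub by blast
        show ?case
          using Dv[OF V(1) VU x V(1) order_refl U0 V(2)] B.pre.res_id[OF V(1) Dc[OF V(1) VU x]] A.pre.res_id[OF V(1) x]
          by (simp add: ext_fam_apply[OF V x] ext_fam_apply[OF V(1) VU x])
      qed
    qed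
    have 2: "E = ?D" if E: "E \<in> Der d (\<Union>\<U>)" and Er: "\<And>U. U \<in> \<U> \<Longrightarrow> ext_fam Y A U E = \<sigma> U" for E
    proof (rule O_derivation_eqI[OF E Dder], goal_cases)
      case (1 l W x) note W = 1(1-2) and x = 1(3)
      have "E l W x = D l W x"
      proof (rule loc[OF W O_derivation_closed[OF E W x] Dc[OF W x]])
        fix W' U0 assume W': "opn Y W'" "W' \<subseteq> W" and U0: "U0 \<in> \<U>" "W' \<subseteq> U0"
        show "gres B (l + d) W W' (E l W x) = gres B (l + d) W W' (D l W x)"
          unfolding Dv[OF W x W' U0] Er[OF U0(1), symmetric]
          by (simp add: O_derivation_res[OF E W W' x] ext_fam_apply[OF W'(1) U0(2) A.pre.res_closed[OF W(1) W' x]])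
      qed
      then show ?case by (simp add: ext_fam_apply[OF W x])
    qed
    show ?thesis
    proof (rule ex1I[of _ ?D])
      show "?D \<in> Der d (\<Union>\<U>) \<and> (\<forall>U\<in>\<U>. ext_fam Y A U ?D = \<sigma> U)" using Dder 1 by (rule conjI[OF _ ballI])
      show "E = ?D" if "E \<in> Der d (\<Union>\<U>) \<and> (\<forall>U\<in>\<U>. ext_fam Y A U E = \<sigma> U)" for E
        using that by (intro 2) (erule conjunct1, erule conjE, erule (1) bspec)
    qed
  qed
  have "\<forall>\<U> \<sigma>. (\<forall>U\<in>\<U>. opn Y U \<and> \<sigma> U \<in> Der d U) \<and>
      (\<forall>U\<in>\<U>. \<forall>V\<in>\<U>. ext_fam Y A (U \<inter> V) (\<sigma> U) = ext_fam Y A (U \<inter> V) (\<sigma> V)) \<longrightarrow>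
      (\<exists>!s. s \<in> Der d (\<Union>\<U>) \<and> (\<forall>U\<in>\<U>. ext_fam Y A U s = \<sigma> U))"
  proof (intro allI impI; elim conjE)
    fix \<U> \<sigma> assume 1: "\<forall>U\<in>\<U>. opn Y U \<and> \<sigma> U \<in> Der d U"
      and 2: "\<forall>U\<in>\<U>. \<forall>V\<in>\<U>. ext_fam Y A (U \<inter> V) (\<sigma> U) = ext_fam Y A (U \<inter> V) (\<sigma> V)"
    show "\<exists>!s. s \<in> Der d (\<Union>\<U>) \<and> (\<forall>U\<in>\<U>. ext_fam Y A U s = \<sigma> U)"
    proof (rule *)
      fix U assume "U \<in> \<U>"
      from bspec[OF 1 this] show "opn Y U" "\<sigma> U \<in> Der d U" by blast+
      show "ext_fam Y A (U \<inter> V) (\<sigma> U) = ext_fam Y A (U \<inter> V) (\<sigma> V)" if "V \<in> \<U>" for V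
        by (rule bspec[OF bspec[OF 2 \<open>U \<in> \<U>\<close>] that])
    qed
  qed
  with pre show ?thesis unfolding sheaf_on_def by (rule conjI)
qed

end

section \<open>The relative tangent algebroid\<close>

lemma add_signed_diff:
  assumes M: "abelian_group M" and c: "a \<in> carrier M" "a' \<in> carrier M" "b \<in> carrier M" "b' \<in> carrier M"
  shows "(a \<oplus>\<^bsub>M\<^esub> a') \<ominus>\<^bsub>M\<^esub> signed M n (b \<oplus>\<^bsub>M\<^esub> b') = (a \<ominus>\<^bsub>M\<^esub> signed M n b) \<oplus>\<^bsub>M\<^esub> (a' \<ominus>\<^bsub>M\<^esub> signed M n b')"
  apply (rule frag_rep_eqI, (rule frag_rep_rules c M)+)
  apply (simp add: frag_cmul_distrib2 algebra_simps)
  done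

section \<open>The module structure on derivations\<close>

context derivation_sheaf
begin

lemma der_closed: "\<lbrakk>D \<in> Der d U; opn Y V; V \<subseteq> U; l + d = m; x \<in> sec A l V\<rbrakk> \<Longrightarrow> D l V x \<in> sec B m V"
  using O_derivation_closed[of D Y A B \<phi> d U V x l] by simp

lemma signed_apply: "\<lbrakk>opn Y U; D \<in> Der d U; opn Y V; V \<subseteq> U; x \<in> sec A l V\<rbrakk> \<Longrightarrow>
    signed (DerM d U) n D l V x = signed (gsec B (l + d) V) n (D l V x)"
  using add_hom_pow[OF eval_hom[of U V x l d], of D "ksign n"] by (simp add: DerM_simps)

lemma neg_apply: "\<lbrakk>opn Y U; D \<in> Der d U; opn Y V; V \<subseteq> U; x \<in> sec A l V\<rbrakk> \<Longrightarrow>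
    (\<ominus>\<^bsub>DerM d U\<^esub> D) l V x = \<ominus>\<^bsub>gsec B (l + d) V\<^esub> D l V x"
  using add_hom_neg[OF eval_hom[of U V x l d], of D] by (simp add: DerM_simps)

lemma signed_Der: "opn Y U \<Longrightarrow> D \<in> Der d U \<Longrightarrow> signed (DerM d U) n D \<in> Der d U"
  using abelian_group.signed_closed[OF abelian_Der, of U D d n] by (simp add: DerM_simps)

lemma neg_Der: "opn Y U \<Longrightarrow> D \<in> Der d U \<Longrightarrow> \<ominus>\<^bsub>DerM d U\<^esub> D \<in> Der d U"
  using abelian_group.a_inv_closed[OF abelian_Der, of U D d] by (simp add: DerM_simps)

lemma act_add_left:
  assumes U: "opn Y U" and a: "a \<in> sec B p U" and b: "b \<in> sec B p U" and D: "D \<in> Der d U"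
  shows "fam_act Y A B p d U (a \<oplus>\<^bsub>gsec B p U\<^esub> b) D = fam_add Y A B (p + d) U (fam_act Y A B p d U a D) (fam_act Y A B p d U b D)"
proof (rule O_derivation_eqI[OF act_Der[OF U B.pre.add_closed[OF U a b] D] add_Der[OF U act_Der[OF U a D] act_Der[OF U b D]]])
  fix l V x assume V: "opn Y V" "V \<subseteq> U" and x: "x \<in> sec A l V"
  have e: "p + (l + d) = l + (p + d)" by simp
  note r = B.pre.res_closed[OF U V]
  show "fam_act Y A B p d U (a \<oplus>\<^bsub>gsec B p U\<^esub> b) D l V x =
      fam_add Y A B (p + d) U (fam_act Y A B p d U a D) (fam_act Y A B p d U b D) l V x"
    by (simp only: fam_act_apply[OF V x] fam_add_apply[OF V x] B.res_add[OF U V a b]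
      add_hom_add[OF B.pre.mul_hom_left[OF e V(1) O_derivation_closed[OF D V x]] r[OF a] r[OF b]])
qed

lemma act_add_right:
  assumes U: "opn Y U" and a: "a \<in> sec B p U" and D: "D \<in> Der d U" and D': "D' \<in> Der d U"
  shows "fam_act Y A B p d U a (fam_add Y A B d U D D') = fam_add Y A B (p + d) U (fam_act Y A B p d U a D) (fam_act Y A B p d U a D')"
proof (rule O_derivation_eqI[OF act_Der[OF U a add_Der[OF U D D']] add_Der[OF U act_Der[OF U a D] act_Der[OF U a D']]])
  fix l V x assume V: "opn Y V" "V \<subseteq> U" and x: "x \<in> sec A l V"
  have e: "p + (l + d) = l + (p + d)" by simp
  show "fam_act Y A B p d U a (fam_add Y A B d U D D') l V x =
      fam_add Y A B (p + d) U (fam_act Y A B p d U a D) (fam_act Y A B p d U a D') l V x"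
    by (simp only: fam_act_apply[OF V x] fam_add_apply[OF V x]
      add_hom_add[OF B.pre.mul_hom_right[OF e V(1) B.pre.res_closed[OF U V a]] O_derivation_closed[OF D V x] O_derivation_closed[OF D' V x]])
qed

lemma act_assoc:
  assumes U: "opn Y U" and a: "a \<in> sec B p U" and b: "b \<in> sec B q U" and D: "D \<in> Der d U"
  shows "fam_act Y A B (p + q) d U (gmul B p q U a b) D = fam_act Y A B p (q + d) U a (fam_act Y A B q d U b D)"
proof (rule O_derivation_eqI[OF act_Der[OF U B.mul_closed[OF U a b] D] act_Der[OF U a act_Der[OF U b D], folded add.assoc]], goal_cases)
  case (1 l V x) note V = 1(1-2) and x = 1(3)
  note r = B.pre.res_closed[OF U V]
  have e: "q + (l + d) = l + (q + d)" by simp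
  show ?case
    by (simp only: fam_act_apply[OF V x] B.mul_res[OF U V a b]
      B.pre.mul_assoc'[OF refl e V(1) r[OF a] r[OF b] O_derivation_closed[OF D V x]])
qed

lemma act_one:
  assumes U: "opn Y U" and D: "D \<in> Der d U"
  shows "fam_act Y A B 0 d U (gone B U) D = D"
proof (rule O_derivation_eqI[OF act_Der[OF U B.one_closed[OF U] D, unfolded add_0] D], goal_cases)
  case (1 l V x) note V = 1(1-2) and x = 1(3)
  show ?case
    by (simp only: fam_act_apply[OF V x] B.one_res[OF U V] B.one_left[OF V(1) O_derivation_closed[OF D V x]])
qed

lemma smult_act:
  assumes U: "opn Y U" and r: "r \<in> carrier (rsec Y U)" and D: "D \<in> Der d U"
  shows "fam_smult Y A B d U r D = fam_act Y A B 0 d U (r \<odot>\<^bsub>gsec B 0 U\<^esub> gone B U) D"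
proof (rule O_derivation_eqI[OF smult_Der[OF U r D] act_Der[OF U B.pre.smult_closed[OF U r B.one_closed[OF U]] D, unfolded add_0]], goal_cases)
  case (1 l V x) note V = 1(1-2) and x = 1(3)
  note Dx = O_derivation_closed[OF D V x]
  show ?case
    by (simp only: fam_act_apply[OF V x] fam_smult_apply[OF V x] B.res_smult[OF U V r B.one_closed[OF U]] B.one_res[OF U V]
      B.mul_smult_left[OF V(1) ringed_res_closed[OF ringed U V r] B.one_closed[OF V(1)] Dx] B.one_left[OF V(1) Dx] add_0)
qed

lemma act_res:
  assumes U: "opn Y U" and V: "opn Y V" "V \<subseteq> U" and a: "a \<in> sec B p U"
  shows "ext_fam Y A V (fam_act Y A B p d U a D) = fam_act Y A B p d V (gres B p U V a) (ext_fam Y A V D)"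
proof -
  have "ext_fam Y A V (fam_act Y A B p d U a D) = ext_fam Y A V (\<lambda>l W x. gmul B p (l + d) W (gres B p V W (gres B p U V a)) (ext_fam Y A V D l W x))"
  proof (rule ext_fam_cong, goal_cases)
    case (1 l W x) note W = 1(1-2) and x = 1(3)
    have WU: "W \<subseteq> U" using V W by blast
    show ?case
      by (simp only: fam_act_apply[OF W(1) WU x] ext_fam_apply[OF W x] B.pre.res_res[OF U V(1) W V(2) a])
  qed
  then show ?thesis by (simp only: fam_act_def[of Y A B p d V])
qed

lemma add_res:
  assumes V: "V \<subseteq> U"
  shows "ext_fam Y A V (fam_add Y A B d U D D') = fam_add Y A B d V (ext_fam Y A V D) (ext_fam Y A V D')"
proof -
  have "ext_fam Y A V (fam_add Y A B d U D D') = ext_fam Y A V (\<lambda>l W x. ext_fam Y A V D l W x \<oplus>\<^bsub>gsec B (l + d) W\<^esub> ext_fam Y A V D' l W x)"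
  proof (rule ext_fam_cong, goal_cases)
    case (1 l W x) note W = 1(1-2) and x = 1(3)
    have WU: "W \<subseteq> U" using V W by blast
    show ?case
      by (simp only: fam_add_apply[OF W(1) WU x] ext_fam_apply[OF W x])
  qed
  then show ?thesis by (simp only: fam_add_def[of Y A B d V])
qed

lemma smult_res:
  assumes U: "opn Y U" and V: "opn Y V" "V \<subseteq> U" and r: "r \<in> carrier (rsec Y U)"
  shows "ext_fam Y A V (fam_smult Y A B d U r D) = fam_smult Y A B d V (rres Y U V r) (ext_fam Y A V D)"
proof -
  have "ext_fam Y A V (fam_smult Y A B d U r D) = ext_fam Y A V (\<lambda>l W x. rres Y V W (rres Y U V r) \<odot>\<^bsub>gsec B (l + d) W\<^esub> ext_fam Y A V D l W x)"
  proof (rule ext_fam_cong, goal_cases)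
    case (1 l W x) note W = 1(1-2) and x = 1(3)
    have WU: "W \<subseteq> U" using V W by blast
    show ?case
      by (simp only: fam_smult_apply[OF W(1) WU x] ext_fam_apply[OF W x] ringed_res_res[OF ringed U V(1) W V(2) r])
  qed
  then show ?thesis by (simp only: fam_smult_def[of Y A B d V])
qed

lemma graded_module_sheaf_Der:
  assumes g: "\<And>d. gsec g d = DerM d" "\<And>d. gres g d = (\<lambda>U V D. ext_fam Y A V D)"
  shows "graded_module_sheaf Y g"
  by (rule graded_module_sheaf.intro) (simp_all add: g DerM_simps sheaf_Der module_Der add_res smult_res)

end

section \<open>Graded commutators of derivations\<close>

locale relative_derivations = derivation_sheaf Y A A fid
  for Y :: "('a, 'r, 'y) ringed_space_scheme" and A :: "('a, 'r, 'm) dgalg"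
begin

abbreviation "comm \<equiv> fam_commutator Y A"

text \<open>Truncating the differential of \<open>A\<close> to \<open>U\<close> makes it a section
  of the sheaf of derivations of degree 1, so that statements about the differential of the tangent
  sheaf become instances of statements about commutators.\<close>

definition "Q U = ext_fam Y A U (gdif A)"

lemma Q_apply: "\<lbrakk>opn Y V; V \<subseteq> U; x \<in> sec A l V\<rbrakk> \<Longrightarrow> Q U l V x = gdif A l V x"
  unfolding Q_def by (rule ext_fam_apply)

lemma Q_Der: "opn Y U \<Longrightarrow> Q U \<in> Der 1 U"
  unfolding Q_def
  by (rule ext_fam_O_derivation[OF A])
    (simp_all add: A.dif_closed A.dif_add A.dif_res A.dif_smult A.dif_mul fid_def)

lemma Q_res: "V \<subseteq> U \<Longrightarrow> ext_fam Y A V (Q U) = Q V"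
  by (simp add: Q_def ext_fam_ext_fam)

lemma comm_apply:
  assumes V: "opn Y V" "V \<subseteq> U" and x: "x \<in> sec A l V"
  shows "comm d e U D D' l V x = D (l + e) V (D' l V x) \<ominus>\<^bsub>gsec A (l + (d + e)) V\<^esub>
     signed (gsec A (l + (d + e)) V) (d * e) (D' (l + d) V (D l V x))"
  unfolding fam_commutator_def ext_fam_apply[OF V x] by (simp only: add.assoc)

text \<open>The second-order Leibniz rule, written out once because the commutator needs it for both
  orders of composition.\<close>

lemma der_der_mul:
  assumes D: "D \<in> Der d U" and D': "D' \<in> Der e U" and V: "opn Y V" "V \<subseteq> U"
    and x: "x \<in> sec A i V" and y: "y \<in> sec A j V"
  shows "D (i + j + e) V (D' (i + j) V (gmul A i j V x y)) =
    (gmul A (i + (d + e)) j V (D (i + e) V (D' i V x)) y \<oplus>\<^bsub>gsec A (i + j + (d + e)) V\<^esub>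
      signed (gsec A (i + j + (d + e)) V) (d * (i + e)) (gmul A (i + e) (j + d) V (D' i V x) (D j V y))) \<oplus>\<^bsub>gsec A (i + j + (d + e)) V\<^esub>
    signed (gsec A (i + j + (d + e)) V) (e * i) (gmul A (i + d) (j + e) V (D i V x) (D' j V y) \<oplus>\<^bsub>gsec A (i + j + (d + e)) V\<^esub>
      signed (gsec A (i + j + (d + e)) V) (d * i) (gmul A i (j + (d + e)) V x (D (j + e) V (D' j V y))))"
proof -
  have k: "i + e + j = i + j + e" "i + j + e + d = i + j + (d + e)" "i + e + d = i + (d + e)" "i + (j + e) = i + j + e"
    "j + e + d = j + (d + e)" by auto
  note D'x = O_derivation_closed[OF D' V x] and D'y = O_derivation_closed[OF D' V y]
  note 1 = O_derivation_mul[OF D V D'x y, unfolded fid_def k] and 2 = O_derivation_mul[OF D V x D'y, unfolded fid_def k]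
  note u = A.mul_closed[OF V(1) D'x y, unfolded k] and w = A.mul_closed[OF V(1) x D'y, unfolded k]
  note h = der_hom[OF D V k(2)]
  show ?thesis
    unfolding O_derivation_mul[OF D' V x y, unfolded fid_def] add_hom_add[OF h u A.pre.sign_closed[OF V(1) w]] add_hom_pow[OF h w] 1 2 ..
qed

lemma comm_Der:
  assumes U: "opn Y U" and D: "D \<in> Der d U" and D': "D' \<in> Der e U"
  shows "comm d e U D D' \<in> Der (d + e) U"
  unfolding fam_commutator_def add.assoc
proof (rule ext_fam_O_derivation[OF A])
  have k: "l + d + e = l + (d + e)" "l + e + d = l + (d + e)" for l by auto
  fix l V x assume V: "opn Y V" "V \<subseteq> U" and x: "x \<in> sec A l V"
  let ?c = "\<lambda>l V x. D (l + e) V (D' l V x) \<ominus>\<^bsub>gsec A (l + (d + e)) V\<^esub>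
     signed (gsec A (l + (d + e)) V) (d * e) (D' (l + d) V (D l V x))"
  have DD': "D (l + e) V (D' l V x) \<in> sec A (l + (d + e)) V" "D' (l + d) V (D l V x) \<in> sec A (l + (d + e)) V"
    if "x \<in> sec A l V" for l x
    by (rule der_closed[OF D V k(2) O_derivation_closed[OF D' V that]], rule der_closed[OF D' V k(1) O_derivation_closed[OF D V that]])
  have hom: "add_hom (gsec A l V) (gsec A (l + (d + e)) V) (\<lambda>x. D (l + e) V (D' l V x))"
    "add_hom (gsec A l V) (gsec A (l + (d + e)) V) (\<lambda>x. D' (l + d) V (D l V x))" for l
    by (rule add_hom_comp[OF der_hom[OF D' V refl] der_hom[OF D V k(2)]],
      rule add_hom_comp[OF der_hom[OF D V refl] der_hom[OF D' V k(1)]])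
  note M = A.pre.abelian[OF V(1)]
  show "?c l V x \<in> sec A (l + (d + e)) V"
    by (intro A.pre.minus_closed[OF V(1)] A.pre.sign_closed[OF V(1)] DD' x)
  show "?c l V (x \<oplus>\<^bsub>gsec A l V\<^esub> x') = ?c l V x \<oplus>\<^bsub>gsec A (l + (d + e)) V\<^esub> ?c l V x'" if x': "x' \<in> sec A l V" for x'
  proof -
    from add_signed_diff[OF M DD'(1)[OF x] DD'(1)[OF x'] DD'(2)[OF x] DD'(2)[OF x']] show ?thesis
      by (simp only: add_hom_add[OF hom(1) x x'] add_hom_add[OF hom(2) x x'])
  qed
  show "?c l W (gres A l V W x) = gres A (l + (d + e)) V W (?c l V x)" if W: "opn Y W" "W \<subseteq> V" for W
    by (simp only: add_hom_minus[OF A.pre.add_hom_res[OF V(1) W] DD'(1)[OF x] A.pre.sign_closed[OF V(1) DD'(2)[OF x]]]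
      A.pre.res_signed[OF V(1) W DD'(2)[OF x]] O_derivation_res[OF D V W x] O_derivation_res[OF D' V W x]
      O_derivation_res[OF D V W O_derivation_closed[OF D' V x], unfolded k] O_derivation_res[OF D' V W O_derivation_closed[OF D V x], unfolded k])
  show "?c l V (r \<odot>\<^bsub>gsec A l V\<^esub> x) = r \<odot>\<^bsub>gsec A (l + (d + e)) V\<^esub> ?c l V x" if r: "r \<in> carrier (rsec Y V)" for r
    by (simp only: add_hom_minus[OF A.pre.add_hom_smult[OF V(1) r] DD'(1)[OF x] A.pre.sign_closed[OF V(1) DD'(2)[OF x]]]
      A.pre.smult_signed[OF V(1) r DD'(2)[OF x]] O_derivation_smult[OF D V r x] O_derivation_smult[OF D' V r x]
      O_derivation_smult[OF D V r O_derivation_closed[OF D' V x], unfolded k] O_derivation_smult[OF D' V r O_derivation_closed[OF D V x], unfolded k])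
  fix q y assume y: "y \<in> sec A q V"
  let ?M = "gsec A (l + q + (d + e)) V"
  have ed: "e + d = d + e" by simp
  have n: "l + (d + e) + q = l + q + (d + e)" "l + (q + (d + e)) = l + q + (d + e)" "l + d + (q + e) = l + q + (d + e)"
    "l + e + (q + d) = l + q + (d + e)" by auto
  note Dx = O_derivation_closed[OF D V x] and Dy = O_derivation_closed[OF D V y]
    and D'x = O_derivation_closed[OF D' V x] and D'y = O_derivation_closed[OF D' V y]
  note hl = A.pre.mul_hom_left[OF n(1) V(1) y] and hr = A.pre.mul_hom_right[OF n(2) V(1) x]
  note p2 = A.pre.mul_closed'[OF n(4) V(1) D'x Dy] and p3 = A.pre.mul_closed'[OF n(3) V(1) Dx D'y]
  \<comment> \<open>The terms \<open>p1\<close> and \<open>q1\<close> have both derivations on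
    \<open>x\<close>, and \<open>p4\<close> and \<open>q4\<close> have both on \<open>y\<close>. The
    mixed terms \<open>p2\<close> and \<open>p3\<close> are shared by the two orders of composition
    and cancel.\<close>
  have "((p1 \<oplus>\<^bsub>?M\<^esub> signed ?M (d * (l + e)) p2) \<oplus>\<^bsub>?M\<^esub> signed ?M (e * l) (p3 \<oplus>\<^bsub>?M\<^esub> signed ?M (d * l) p4)) \<ominus>\<^bsub>?M\<^esub>
      signed ?M (d * e) ((q1 \<oplus>\<^bsub>?M\<^esub> signed ?M (e * (l + d)) p3) \<oplus>\<^bsub>?M\<^esub> signed ?M (d * l) (p2 \<oplus>\<^bsub>?M\<^esub> signed ?M (e * l) q4)) =
      (p1 \<ominus>\<^bsub>?M\<^esub> signed ?M (d * e) q1) \<oplus>\<^bsub>?M\<^esub> signed ?M ((d + e) * l) (p4 \<ominus>\<^bsub>?M\<^esub> signed ?M (d * e) q4)"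
    if "p1 \<in> carrier ?M" "p2 \<in> carrier ?M" "p3 \<in> carrier ?M" "p4 \<in> carrier ?M" "q1 \<in> carrier ?M" "q4 \<in> carrier ?M"
    for p1 p2 p3 p4 q1 q4
    apply (rule frag_rep_eqI, (rule frag_rep_rules that M)+)
    apply (cases "even d"; cases "even e"; cases "even l"; simp add: ksign_def algebra_simps)
    done
  from this[OF add_hom_closed[OF hl DD'(1)[OF x]] p2 p3 add_hom_closed[OF hr DD'(1)[OF y]]
      add_hom_closed[OF hl DD'(2)[OF x]] add_hom_closed[OF hr DD'(2)[OF y]]]
  show "?c (l + q) V (gmul A l q V x y) = gmul A (l + (d + e)) q V (?c l V x) (fid q V y) \<oplus>\<^bsub>?M\<^esub>
      signed ?M ((d + e) * l) (gmul A l (q + (d + e)) V (fid l V x) (?c q V y))"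
    unfolding fid_def
    by (simp only: der_der_mul[OF D D' V x y] der_der_mul[OF D' D V x y, unfolded ed]
      add_hom_minus[OF hl DD'(1)[OF x] A.pre.sign_closed[OF V(1) DD'(2)[OF x]]] add_hom_pow[OF hl DD'(2)[OF x]]
      add_hom_minus[OF hr DD'(1)[OF y] A.pre.sign_closed[OF V(1) DD'(2)[OF y]]] add_hom_pow[OF hr DD'(2)[OF y]])
qed

lemma comm_res:
  assumes V: "V \<subseteq> U" and D: "D \<in> Der d U" and D': "D' \<in> Der e U"
  shows "ext_fam Y A V (comm d e U D D') = comm d e V (ext_fam Y A V D) (ext_fam Y A V D')"
proof -
  have "ext_fam Y A V (comm d e U D D') = ext_fam Y A V (\<lambda>l W x. ext_fam Y A V D (l + e) W (ext_fam Y A V D' l W x) \<ominus>\<^bsub>gsec A (l + d + e) W\<^esub>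
     signed (gsec A (l + d + e) W) (d * e) (ext_fam Y A V D' (l + d) W (ext_fam Y A V D l W x)))"
  proof (rule ext_fam_cong, goal_cases)
    case (1 l W x) note W = 1(1-2) and x = 1(3)
    have WU: "W \<subseteq> U" using V W by blast
    show ?case
      by (simp only: fam_commutator_def ext_fam_apply[OF W(1) WU x] ext_fam_apply[OF W x]
        ext_fam_apply[OF W O_derivation_closed[OF D' W(1) WU x]] ext_fam_apply[OF W O_derivation_closed[OF D W(1) WU x]])
  qed
  then show ?thesis by (simp only: fam_commutator_def[of Y A d e V])
qed

lemma comm_dif: "D \<in> Der d U \<Longrightarrow> comm 1 d U (gdif A) D = comm 1 d U (Q U) D"
  unfolding fam_commutator_def
  by (rule ext_fam_cong) (simp add: Q_apply O_derivation_closed)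

lemma comm_add_left:
  assumes U: "opn Y U" and D: "D \<in> Der d U" and E: "E \<in> Der d U" and D': "D' \<in> Der e U"
  shows "comm d e U (fam_add Y A A d U D E) D' = fam_add Y A A (d + e) U (comm d e U D D') (comm d e U E D')"
proof (rule O_derivation_eqI[OF comm_Der[OF U add_Der[OF U D E] D'] add_Der[OF U comm_Der[OF U D D'] comm_Der[OF U E D']]], goal_cases)
  case (1 l V x) note V = 1(1-2) and x = 1(3)
  have k: "l + d + e = l + (d + e)" "l + e + d = l + (d + e)" by auto
  let ?M = "gsec A (l + (d + e)) V"
  note Dx = O_derivation_closed[OF D V x] and Ex = O_derivation_closed[OF E V x] and D'x = O_derivation_closed[OF D' V x]
  note h = der_hom[OF D' V k(1)]
  from add_signed_diff[OF A.pre.abelian[OF V(1)] der_closed[OF D V k(2) D'x] der_closed[OF E V k(2) D'x] add_hom_closed[OF h Dx] add_hom_closed[OF h Ex]]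
  show ?case
    by (simp only: comm_apply[OF V x] fam_add_apply[OF V x] fam_add_apply[OF V D'x] add_hom_add[OF h Dx Ex] k)
qed

lemma comm_antisym:
  assumes U: "opn Y U" and D: "D \<in> Der d U" and D': "D' \<in> Der e U"
  shows "comm d e U D D' = \<ominus>\<^bsub>DerM (d + e) U\<^esub> signed (DerM (d + e) U) (d * e) (comm e d U D' D)"
proof -
  have ed: "e + d = d + e" "e * d = d * e" by simp_all
  note c' = comm_Der[OF U D' D, unfolded ed]
  show ?thesis
  proof (rule O_derivation_eqI[OF comm_Der[OF U D D'] neg_Der[OF U signed_Der[OF U c']]], goal_cases)
    case (1 l V x) note V = 1(1-2) and x = 1(3)
    have k: "l + d + e = l + (d + e)" "l + e + d = l + (d + e)" by auto
    let ?M = "gsec A (l + (d + e)) V"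
    have "a \<ominus>\<^bsub>?M\<^esub> signed ?M (d * e) b = \<ominus>\<^bsub>?M\<^esub> signed ?M (d * e) (b \<ominus>\<^bsub>?M\<^esub> signed ?M (d * e) a)"
      if "a \<in> carrier ?M" "b \<in> carrier ?M" for a b
      apply (rule frag_rep_eqI, (rule frag_rep_rules that A.pre.abelian[OF V(1)])+)
      apply (cases "even (d * e)"; simp add: ksign_def)
      done
    from this[OF der_closed[OF D V k(2) O_derivation_closed[OF D' V x]] der_closed[OF D' V k(1) O_derivation_closed[OF D V x]]]
    show ?case
      by (simp only: neg_apply[OF U signed_Der[OF U c'] V x] signed_apply[OF U c' V x] comm_apply[OF V x] ed)
  qed
qed

lemma comm_add_right:
  assumes U: "opn Y U" and D: "D \<in> Der d U" and D': "D' \<in> Der e U" and E: "E \<in> Der e U"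
  shows "comm d e U D (fam_add Y A A e U D' E) = fam_add Y A A (d + e) U (comm d e U D D') (comm d e U D E)"
proof (rule O_derivation_eqI[OF comm_Der[OF U D add_Der[OF U D' E]] add_Der[OF U comm_Der[OF U D D'] comm_Der[OF U D E]]], goal_cases)
  case (1 l V x) note V = 1(1-2) and x = 1(3)
  have k: "l + d + e = l + (d + e)" "l + e + d = l + (d + e)" by auto
  let ?M = "gsec A (l + (d + e)) V"
  note Dx = O_derivation_closed[OF D V x] and Ex = O_derivation_closed[OF E V x] and D'x = O_derivation_closed[OF D' V x]
  note h = der_hom[OF D V k(2)]
  from add_signed_diff[OF A.pre.abelian[OF V(1)] add_hom_closed[OF h D'x] add_hom_closed[OF h Ex] der_closed[OF D' V k(1) Dx] der_closed[OF E V k(1) Dx]]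
  show ?case
    by (simp only: comm_apply[OF V x] fam_add_apply[OF V x] fam_add_apply[OF V Dx] add_hom_add[OF h D'x Ex] k)
qed

text \<open>Linearity over the structure sheaf rather than over constants: \<open>D'\<close> is
  itself linear, so the term in which it would differentiate the scalar is absent.\<close>

lemma comm_smult_left:
  assumes U: "opn Y U" and r: "r \<in> carrier (rsec Y U)" and D: "D \<in> Der d U" and D': "D' \<in> Der e U"
  shows "comm d e U (fam_smult Y A A d U r D) D' = fam_smult Y A A (d + e) U r (comm d e U D D')"
proof (rule O_derivation_eqI[OF comm_Der[OF U smult_Der[OF U r D] D'] smult_Der[OF U r comm_Der[OF U D D']]], goal_cases)
  case (1 l V x) note V = 1(1-2) and x = 1(3)
  have k: "l + d + e = l + (d + e)" "l + e + d = l + (d + e)" by auto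
  note Dx = O_derivation_closed[OF D V x] and D'x = O_derivation_closed[OF D' V x]
  note r' = ringed_res_closed[OF ringed U V r]
  note u = der_closed[OF D V k(2) D'x] and w = der_closed[OF D' V k(1) Dx]
  show ?case
    by (simp only: comm_apply[OF V x] fam_smult_apply[OF V x] fam_smult_apply[OF V D'x] O_derivation_smult[OF D' V r' Dx] k
      add_hom_minus[OF A.pre.add_hom_smult[OF V(1) r'] u A.pre.sign_closed[OF V(1) w]] A.pre.smult_signed[OF V(1) r' w])
qed

lemma comm_smult_right:
  assumes U: "opn Y U" and r: "r \<in> carrier (rsec Y U)" and D: "D \<in> Der d U" and D': "D' \<in> Der e U"
  shows "comm d e U D (fam_smult Y A A e U r D') = fam_smult Y A A (d + e) U r (comm d e U D D')"
proof (rule O_derivation_eqI[OF comm_Der[OF U D smult_Der[OF U r D']] smult_Der[OF U r comm_Der[OF U D D']]], goal_cases)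
  case (1 l V x) note V = 1(1-2) and x = 1(3)
  have k: "l + d + e = l + (d + e)" "l + e + d = l + (d + e)" by auto
  note Dx = O_derivation_closed[OF D V x] and D'x = O_derivation_closed[OF D' V x]
  note r' = ringed_res_closed[OF ringed U V r]
  note u = der_closed[OF D V k(2) D'x] and w = der_closed[OF D' V k(1) Dx]
  show ?case
    by (simp only: comm_apply[OF V x] fam_smult_apply[OF V x] fam_smult_apply[OF V Dx] O_derivation_smult[OF D V r' D'x] k
      add_hom_minus[OF A.pre.add_hom_smult[OF V(1) r'] u A.pre.sign_closed[OF V(1) w]] A.pre.smult_signed[OF V(1) r' w])
qed

text \<open>All six orders of composing \<open>D\<close>, \<open>E\<close> and \<open>F\<close> are
  named. The left side contains four of them; on the right the two with \<open>D\<close> in the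
  middle, \<open>?a3\<close> and \<open>?a5\<close>, cancel.\<close>

lemma comm_jacobi:
  assumes U: "opn Y U" and D: "D \<in> Der d U" and E: "E \<in> Der e U" and F: "F \<in> Der n U"
  shows "comm d (e + n) U D (comm e n U E F) =
    fam_add Y A A (d + e + n) U (comm (d + e) n U (comm d e U D E) F)
      (signed (DerM (d + e + n) U) (d * e) (comm e (d + n) U E (comm d n U D F)))"
proof -
  note DE = comm_Der[OF U D E] and EF = comm_Der[OF U E F] and DF = comm_Der[OF U D F]
  have i: "d + (e + n) = d + e + n" "e + (d + n) = d + e + n" by auto
  note R2 = comm_Der[OF U E DF, unfolded i]
  show ?thesis
  proof (rule O_derivation_eqI[OF comm_Der[OF U D EF, unfolded i] add_Der[OF U comm_Der[OF U DE F] signed_Der[OF U R2]]])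
    fix l V x assume V: "opn Y V" "V \<subseteq> U" and x: "x \<in> sec A l V"
    let ?M = "gsec A (l + (d + e + n)) V"
    have k: "l + e + d = l + (d + e)" "l + n + e = l + (e + n)" "l + n + d = l + (d + n)"
      "l + d + (e + n) = l + (d + e + n)" "l + n + (d + e) = l + (d + e + n)" "l + e + (d + n) = l + (d + e + n)"
      "l + d + e = l + (d + e)" "l + e + n = l + (e + n)" "l + d + n = l + (d + n)"
      "l + (e + n) + d = l + (d + e + n)" "l + (d + n) + e = l + (d + e + n)" "l + (d + e) + n = l + (d + e + n)" by auto
    note xD = O_derivation_closed[OF D V x] and xE = O_derivation_closed[OF E V x] and xF = O_derivation_closed[OF F V x]
    note xEF = der_closed[OF E V k(2) xF] and xDF = der_closed[OF D V k(3) xF] and xDE = der_closed[OF D V k(1) xE]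
      and xED = der_closed[OF E V k(7) xD] and xFE = der_closed[OF F V k(8) xE] and xFD = der_closed[OF F V k(9) xD]
    note hD = der_hom[OF D V k(10)] and hE = der_hom[OF E V k(11)] and hF = der_hom[OF F V k(12)]
    note s = A.pre.sign_closed[OF V(1)]
    let ?a1 = "D (l + (e + n)) V (E (l + n) V (F l V x))" and ?a2 = "D (l + (e + n)) V (F (l + e) V (E l V x))"
    let ?a3 = "E (l + (d + n)) V (D (l + n) V (F l V x))" and ?a4 = "E (l + (d + n)) V (F (l + d) V (D l V x))"
    let ?a5 = "F (l + (d + e)) V (D (l + e) V (E l V x))" and ?a6 = "F (l + (d + e)) V (E (l + d) V (D l V x))"
    have L: "comm d (e + n) U D (comm e n U E F) l V x =
        (?a1 \<ominus>\<^bsub>?M\<^esub> signed ?M (e * n) ?a2) \<ominus>\<^bsub>?M\<^esub> signed ?M (d * (e + n)) (?a4 \<ominus>\<^bsub>?M\<^esub> signed ?M (e * n) ?a6)"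
      unfolding comm_apply[OF V x] comm_apply[OF V xD] i k
        add_hom_minus[OF hD xEF s[OF xFE]] add_hom_pow[OF hD xFE] ..
    have R1: "comm (d + e) n U (comm d e U D E) F l V x =
        (?a1 \<ominus>\<^bsub>?M\<^esub> signed ?M (d * e) ?a3) \<ominus>\<^bsub>?M\<^esub> signed ?M ((d + e) * n) (?a5 \<ominus>\<^bsub>?M\<^esub> signed ?M (d * e) ?a6)"
      unfolding comm_apply[OF V x] comm_apply[OF V xF] i k
        add_hom_minus[OF hF xDE s[OF xED]] add_hom_pow[OF hF xED] ..
    have R2': "comm e (d + n) U E (comm d n U D F) l V x =
        (?a3 \<ominus>\<^bsub>?M\<^esub> signed ?M (d * n) ?a4) \<ominus>\<^bsub>?M\<^esub> signed ?M (e * (d + n)) (?a2 \<ominus>\<^bsub>?M\<^esub> signed ?M (d * n) ?a5)"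
      unfolding comm_apply[OF V x] comm_apply[OF V xE] i k
        add_hom_minus[OF hE xDF s[OF xFD]] add_hom_pow[OF hE xFD] ..
    have "(a1 \<ominus>\<^bsub>?M\<^esub> signed ?M (e * n) a2) \<ominus>\<^bsub>?M\<^esub> signed ?M (d * (e + n)) (a4 \<ominus>\<^bsub>?M\<^esub> signed ?M (e * n) a6) =
        ((a1 \<ominus>\<^bsub>?M\<^esub> signed ?M (d * e) a3) \<ominus>\<^bsub>?M\<^esub> signed ?M ((d + e) * n) (a5 \<ominus>\<^bsub>?M\<^esub> signed ?M (d * e) a6)) \<oplus>\<^bsub>?M\<^esub>
        signed ?M (d * e) ((a3 \<ominus>\<^bsub>?M\<^esub> signed ?M (d * n) a4) \<ominus>\<^bsub>?M\<^esub> signed ?M (e * (d + n)) (a2 \<ominus>\<^bsub>?M\<^esub> signed ?M (d * n) a5))"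
      if "a1 \<in> carrier ?M" "a2 \<in> carrier ?M" "a3 \<in> carrier ?M" "a4 \<in> carrier ?M" "a5 \<in> carrier ?M" "a6 \<in> carrier ?M"
      for a1 a2 a3 a4 a5 a6
      apply (rule frag_rep_eqI, (rule frag_rep_rules that A.pre.abelian[OF V(1)])+)
      apply (cases "even d"; cases "even e"; cases "even n"; simp add: ksign_def algebra_simps)
      done
    from this[OF add_hom_closed[OF hD xEF] add_hom_closed[OF hD xFE] add_hom_closed[OF hE xDF] add_hom_closed[OF hE xFD]
        add_hom_closed[OF hF xDE] add_hom_closed[OF hF xED]]
    show "comm d (e + n) U D (comm e n U E F) l V x =
      fam_add Y A A (d + e + n) U (comm (d + e) n U (comm d e U D E) F)
        (signed (DerM (d + e + n) U) (d * e) (comm e (d + n) U E (comm d n U D F))) l V x"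
      unfolding fam_add_apply[OF V x] signed_apply[OF U R2 V x] L R1 R2' .
  qed
qed

text \<open>The composite of \<open>D\<close> with multiplication by \<open>a\<close> splits into
  \<open>D a\<close> times \<open>E\<close> and \<open>a\<close> times the composite of
  \<open>D\<close> and \<open>E\<close>; the latter joins the opposite composition to form the
  commutator.\<close>

lemma comm_act:
  assumes U: "opn Y U" and a: "a \<in> sec A p U" and D: "D \<in> Der d U" and E: "E \<in> Der e U"
  shows "comm d (p + e) U D (fam_act Y A A p e U a E) =
    fam_add Y A A (p + d + e) U (fam_act Y A A (p + d) e U (D p U a) E)
      (signed (DerM (p + d + e) U) (p * d) (fam_act Y A A p (d + e) U a (comm d e U D E)))"
proof -
  note DE = comm_Der[OF U D E] and aE = act_Der[OF U a E] and Da = O_derivation_closed[OF D U order_refl a]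
  have i: "d + (p + e) = p + d + e" "p + (d + e) = p + d + e" by auto
  note R2 = act_Der[OF U a DE, unfolded i]
  show ?thesis
  proof (rule O_derivation_eqI[OF comm_Der[OF U D aE, unfolded i] add_Der[OF U act_Der[OF U Da E] signed_Der[OF U R2]]])
    fix l V x assume V: "opn Y V" "V \<subseteq> U" and x: "x \<in> sec A l V"
    let ?M = "gsec A (l + (p + d + e)) V" and ?a = "gres A p U V a"
    note xD = O_derivation_closed[OF D V x] and xE = O_derivation_closed[OF E V x] and a' = A.pre.res_closed[OF U V a]
    have k: "l + d + e = l + (d + e)" "l + e + d = l + (d + e)" "p + (l + e) = l + (p + e)" "p + (l + (d + e)) = l + (p + d + e)"
      "p + (l + e) + d = l + (p + d + e)" "p + d + (l + e) = l + (p + d + e)" "l + (p + e) + d = l + (p + d + e)" by auto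
    note xDE = der_closed[OF D V k(2) xE] and xED = der_closed[OF E V k(1) xD]
    note hr = A.pre.mul_hom_right[OF k(4) V(1) a']
    have Dres: "D p V ?a = gres A (p + d) U V (D p U a)" by (rule O_derivation_res[OF D U order_refl V a])
    note b1 = A.pre.mul_closed'[OF k(6) V(1) O_derivation_closed[OF D V a'] xE]
    let ?b1 = "gmul A (p + d) (l + e) V (gres A (p + d) U V (D p U a)) (E l V x)"
    let ?b2 = "gmul A p (l + (d + e)) V ?a (D (l + e) V (E l V x))" and ?b3 = "gmul A p (l + (d + e)) V ?a (E (l + d) V (D l V x))"
    have L: "comm d (p + e) U D (fam_act Y A A p e U a E) l V x =
        (?b1 \<oplus>\<^bsub>?M\<^esub> signed ?M (d * p) ?b2) \<ominus>\<^bsub>?M\<^esub> signed ?M (d * (p + e)) ?b3"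
      using O_derivation_mul[OF D V a' xE, unfolded fid_def k Dres]
      unfolding comm_apply[OF V x] fam_act_apply[OF V x] fam_act_apply[OF V xD] i k by simp
    have R: "fam_act Y A A p (d + e) U a (comm d e U D E) l V x = ?b2 \<ominus>\<^bsub>?M\<^esub> signed ?M (d * e) ?b3"
      unfolding fam_act_apply[OF V x] comm_apply[OF V x] add_hom_minus[OF hr xDE A.pre.sign_closed[OF V(1) xED]]
        add_hom_pow[OF hr xED] ..
    have F: "fam_act Y A A (p + d) e U (D p U a) E l V x = ?b1" by (rule fam_act_apply[OF V x])
    have "(b1 \<oplus>\<^bsub>?M\<^esub> signed ?M (d * p) b2) \<ominus>\<^bsub>?M\<^esub> signed ?M (d * (p + e)) b3 =
        b1 \<oplus>\<^bsub>?M\<^esub> signed ?M (p * d) (b2 \<ominus>\<^bsub>?M\<^esub> signed ?M (d * e) b3)"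
      if "b1 \<in> carrier ?M" "b2 \<in> carrier ?M" "b3 \<in> carrier ?M" for b1 b2 b3
      apply (rule frag_rep_eqI, (rule frag_rep_rules that A.pre.abelian[OF V(1)])+)
      apply (cases "even d"; cases "even e"; cases "even p"; simp add: ksign_def algebra_simps)
      done
    from this[OF b1[unfolded Dres] add_hom_closed[OF hr xDE] add_hom_closed[OF hr xED]]
    show "comm d (p + e) U D (fam_act Y A A p e U a E) l V x =
      fam_add Y A A (p + d + e) U (fam_act Y A A (p + d) e U (D p U a) E)
        (signed (DerM (p + d + e) U) (p * d) (fam_act Y A A p (d + e) U a (comm d e U D E))) l V x"
      unfolding fam_add_apply[OF V x] signed_apply[OF U R2 V x] L R F .
  qed
qed

text \<open>Of the four composites, the two in which the differential is applied twice in a row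
  vanish. The other two are both \<open>Q D Q\<close> and cancel.\<close>

lemma comm_Q_Q:
  assumes U: "opn Y U" and D: "D \<in> Der d U"
  shows "comm 1 (1 + d) U (Q U) (comm 1 d U (Q U) D) = fam_zero Y A A (1 + (1 + d)) U"
proof (rule O_derivation_eqI[OF comm_Der[OF U Q_Der[OF U] comm_Der[OF U Q_Der[OF U] D]] zero_Der[OF U]], goal_cases)
  case (1 l V x) note V = 1(1-2) and x = 1(3)
  let ?M = "gsec A (l + (1 + (1 + d))) V"
  have k: "l + d + 1 = l + (1 + d)" "l + 1 + d = l + (1 + d)" "l + (1 + d) + 1 = l + (1 + (1 + d))"
    "l + 1 + (1 + d) = l + (1 + (1 + d))" "l + d + 1 + 1 = l + (1 + (1 + d))" "l + 1 + 1 + d = l + (1 + (1 + d))" by auto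
  note QU = Q_Der[OF U]
  note xD = O_derivation_closed[OF D V x] and xQ = O_derivation_closed[OF QU V x]
  note xQD = der_closed[OF QU V k(1) xD] and xDQ = der_closed[OF D V k(2) xQ]
  note h = der_hom[OF QU V k(3)]
  have z1: "Q U (l + (1 + d)) V (Q U (l + d) V (D l V x)) = \<zero>\<^bsub>?M\<^esub>"
    using A.dif_dif[OF V(1) xD] xQD unfolding k Q_apply[OF V xD] Q_apply[OF V xQD[unfolded Q_apply[OF V xD]]] by simp
  have z2: "D (l + 1 + 1) V (Q U (l + 1) V (Q U l V x)) = \<zero>\<^bsub>?M\<^esub>"
    using A.dif_dif[OF V(1) x] xQ add_hom_zero[OF der_hom[OF D V k(6)]]
    unfolding Q_apply[OF V x] Q_apply[OF V xQ[unfolded Q_apply[OF V x]]] by simp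
  have "(\<zero>\<^bsub>?M\<^esub> \<ominus>\<^bsub>?M\<^esub> signed ?M (1 * d) b) \<ominus>\<^bsub>?M\<^esub> signed ?M (1 * (1 + d)) (b \<ominus>\<^bsub>?M\<^esub> signed ?M (1 * d) \<zero>\<^bsub>?M\<^esub>) = \<zero>\<^bsub>?M\<^esub>"
    if "b \<in> carrier ?M" for b
    apply (rule frag_rep_eqI, (rule frag_rep_rules that A.pre.abelian[OF V(1)])+)
    apply (cases "even d"; simp add: ksign_def algebra_simps)
    done
  from this[OF add_hom_closed[OF h xDQ]]
  show ?case
    unfolding comm_apply[OF V x] comm_apply[OF V xQ] fam_zero_apply[OF V x] k(1-5)
      add_hom_minus[OF h xQD A.pre.sign_closed[OF V(1) xDQ]] add_hom_pow[OF h xDQ] z1 z2 .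
qed

end

lemma relative_tangent_simps:
  "gsec (relative_tangent Y A) = fam_module Y A A (O_derivations Y A A fid)"
  "gres (relative_tangent Y A) = (\<lambda>d U V D. ext_fam Y A V D)"
  "lact (relative_tangent Y A) = fam_act Y A A"
  "lbr (relative_tangent Y A) = fam_commutator Y A"
  "ldif (relative_tangent Y A) = (\<lambda>d U D. fam_commutator Y A 1 d U (gdif A) D)"
  "lanc (relative_tangent Y A) = (\<lambda>d U D. D)"
  by (simp_all add: relative_tangent_def)

text \<open>The axioms about the differential are those about the bracket with \<open>Q\<close> in
  the first slot: the Jacobi identity yields \<open>dif_br\<close>, the Leibniz rule of the bracket
  yields \<open>dif_act\<close>, and \<open>comm_Q_Q\<close> yields \<open>dif_dif\<close>.\<close>

theorem relative_tangent_algebroid: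
  fixes K :: "'k ring" and Y :: "('a, 'r, 'k) kspace" and A :: "('a, 'r, 'm) dgalg"
  assumes ringed: "is_ringed_space Y" and A: "dg_algebra_sheaf Y A"
    and scal: "\<And>U c. opn Y U \<Longrightarrow> c \<in> carrier K \<Longrightarrow> scal Y U c \<in> carrier (rsec Y U)"
  shows "dg_lie_algebroid_over_OY K Y A (relative_tangent Y A)"
proof -
  let ?g = "relative_tangent Y A"
  interpret R: relative_derivations Y A
    by (intro relative_derivations.intro derivation_sheaf.intro ringed A dg_hom_id)
  note S = relative_tangent_simps R.DerM_simps
  have ac: "1 + d = d + 1" "d + (1::int) + e = 1 + (d + e)" "1 + (d + e) = d + e + 1" for d e :: int by auto
  have cD: "fam_commutator Y A 1 d U (gdif A) D = fam_commutator Y A 1 d U (R.Q U) D" if "D \<in> R.Der d U" for d U D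
    by (rule R.comm_dif[OF that])
  \<comment> \<open>Commutators with the differential come out in degree \<open>1 + d\<close>,
    whereas the axioms of an algebroid speak of \<open>d + 1\<close>.\<close>
  have dc: "fam_commutator Y A 1 d U (gdif A) D \<in> R.Der (d + 1) U" if "opn Y U" "D \<in> R.Der d U" for d U D
    using R.comm_Der[OF that(1) R.Q_Der[OF that(1)] that(2)] by (simp add: cD[OF that(2)] add.commute)
  have "dg_lie_algebroid K Y A ?g"
  proof (intro dg_lie_algebroid.intro dg_lie_algebroid_axioms.intro; (rule A)?)
    show "graded_module_sheaf Y ?g"
      by (rule R.graded_module_sheaf_Der) (simp_all add: relative_tangent_simps)
  next
    fix U a p D d assume U: "opn Y U" and a: "a \<in> sec A p U" and "D \<in> sec ?g d U"
    then have D: "D \<in> R.Der d U" by (simp add: S)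
    show "lact ?g p d U a D \<in> sec ?g (p + d) U"
      unfolding S by (rule R.act_Der[OF U a D])
    show "lanc ?g (p + d) U (lact ?g p d U a D) =
        fam_act Y A A p d U a (lanc ?g d U D)" unfolding S ..
    show "ldif ?g (p + d) U (lact ?g p d U a D) =
         lact ?g (p + 1) d U (gdif A p U a) D \<oplus>\<^bsub>gsec ?g (p + d + 1) U\<^esub>
         signed (gsec ?g (p + d + 1) U) p (lact ?g p (d + 1) U a (ldif ?g d U D))"
      using R.comm_act[OF U a R.Q_Der[OF U] D]
      unfolding S cD[OF D] cD[OF R.act_Der[OF U a D]] R.Q_apply[OF U order_refl a] by (simp add: ac_simps)
    show "lact ?g p d U (a \<oplus>\<^bsub>gsec A p U\<^esub> b) D = lact ?g p d U a D \<oplus>\<^bsub>gsec ?g (p + d) U\<^esub> lact ?g p d U b D"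
      if "b \<in> sec A p U" for b unfolding S by (rule R.act_add_left[OF U a that D])
    show "lact ?g (p + q) d U (gmul A p q U a b) D = lact ?g p (q + d) U a (lact ?g q d U b D)"
      if "b \<in> sec A q U" for b q unfolding S by (rule R.act_assoc[OF U a that D])
  next
    fix U a p D d E assume U: "opn Y U" and a: "a \<in> sec A p U" and "D \<in> sec ?g d U" "E \<in> sec ?g d U"
    then have D: "D \<in> R.Der d U" and E: "E \<in> R.Der d U" by (simp_all add: S)
    show "lact ?g p d U a (D \<oplus>\<^bsub>gsec ?g d U\<^esub> E) =
        lact ?g p d U a D \<oplus>\<^bsub>gsec ?g (p + d) U\<^esub> lact ?g p d U a E"
      unfolding S by (rule R.act_add_right[OF U a D E])
  next
    fix U D d assume U: "opn Y U" and "D \<in> sec ?g d U"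
    then have D: "D \<in> R.Der d U" by (simp add: S)
    show "lact ?g 0 d U (gone A U) D = D" unfolding S by (rule R.act_one[OF U D])
    show "ldif ?g d U D \<in> sec ?g (d + 1) U" unfolding S by (rule dc[OF U D])
    show "ldif ?g (d + 1) U (ldif ?g d U D) = \<zero>\<^bsub>gsec ?g (d + 1 + 1) U\<^esub>"
      using R.comm_Q_Q[OF U D] cD[OF dc[OF U D]] unfolding S cD[OF D] by (simp add: ac_simps)
    show "lanc ?g d U D \<in> k_derivations K Y A d U"
    proof -
      have "D \<in> derivations Y A A fid d U" using D unfolding O_derivations_def by (rule CollectE) (erule conjunct1)
      then show ?thesis
        unfolding S k_derivations_def by (intro CollectI conjI allI impI ballI; (elim conjE)?)
          (simp_all add: O_derivation_smult[OF D] scal)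
    qed
    show "lanc ?g (d + 1) U (ldif ?g d U D) =
        fam_commutator Y A 1 d U (gdif A) (lanc ?g d U D)" unfolding S ..
    show "r \<odot>\<^bsub>gsec ?g d U\<^esub> D = lact ?g 0 d U (r \<odot>\<^bsub>gsec A 0 U\<^esub> gone A U) D"
      if "r \<in> carrier (rsec Y U)" for r unfolding S by (rule R.smult_act[OF U that D])
    show "ldif ?g d U (scal Y U c \<odot>\<^bsub>gsec ?g d U\<^esub> D) =
        scal Y U c \<odot>\<^bsub>gsec ?g (d + 1) U\<^esub> ldif ?g d U D" if "c \<in> carrier K" for c
      using R.comm_smult_right[OF U scal[OF U that] R.Q_Der[OF U] D]
      unfolding S cD[OF D] cD[OF R.smult_Der[OF U scal[OF U that] D]] by (simp add: add.commute)
    fix E assume "E \<in> sec ?g d U"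
    then have E: "E \<in> R.Der d U" by (simp add: S)
    show "ldif ?g d U (D \<oplus>\<^bsub>gsec ?g d U\<^esub> E) =
        ldif ?g d U D \<oplus>\<^bsub>gsec ?g (d + 1) U\<^esub> ldif ?g d U E"
      using R.comm_add_right[OF U R.Q_Der[OF U] D E]
      unfolding S cD[OF D] cD[OF E] cD[OF R.add_Der[OF U D E]] by (simp add: add.commute)
    show "lanc ?g d U (D \<oplus>\<^bsub>gsec ?g d U\<^esub> E) =
        fam_add Y A A d U (lanc ?g d U D) (lanc ?g d U E)" unfolding S ..
  next
    fix U V a p D d assume U: "opn Y U" and V: "opn Y V" "V \<subseteq> U" and a: "a \<in> sec A p U"
      and "D \<in> sec ?g d U"
    show "gres ?g (p + d) U V (lact ?g p d U a D) =
        lact ?g p d V (gres A p U V a) (gres ?g d U V D)"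
      unfolding S by (rule R.act_res[OF U V a])
  next
    fix U V D d assume U: "opn Y U" and V: "opn Y V" "V \<subseteq> U" and "D \<in> sec ?g d U"
    then have D: "D \<in> R.Der d U" by (simp add: S)
    show "gres ?g (d + 1) U V (ldif ?g d U D) =
        ldif ?g d V (gres ?g d U V D)"
      unfolding S cD[OF D] cD[OF R.restrict_Der[OF D V(2)]] R.comm_res[OF V(2) R.Q_Der[OF U] D] R.Q_res[OF V(2)] ..
    show "lanc ?g d V (gres ?g d U V D) = ext_fam Y A V (lanc ?g d U D)"
      unfolding S ..
    fix E e assume "E \<in> sec ?g e U"
    then have E: "E \<in> R.Der e U" by (simp add: S)
    show "gres ?g (d + e) U V (lbr ?g d e U D E) =
        lbr ?g d e V (gres ?g d U V D) (gres ?g e U V E)"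
      unfolding S by (rule R.comm_res[OF V(2) D E])
  next
    fix U D d E e assume U: "opn Y U" and "D \<in> sec ?g d U" "E \<in> sec ?g e U"
    then have D: "D \<in> R.Der d U" and E: "E \<in> R.Der e U" by (simp_all add: S)
    show "lbr ?g d e U D E \<in> sec ?g (d + e) U" unfolding S by (rule R.comm_Der[OF U D E])
    show "lbr ?g d e U D E =
        \<ominus>\<^bsub>gsec ?g (d + e) U\<^esub> signed (gsec ?g (d + e) U) (d * e) (lbr ?g e d U E D)"
      unfolding relative_tangent_simps by (rule R.comm_antisym[OF U D E])
    show "lanc ?g (d + e) U (lbr ?g d e U D E) =
        fam_commutator Y A d e U (lanc ?g d U D) (lanc ?g e U E)" unfolding S ..
    show "lbr ?g d e U (scal Y U c \<odot>\<^bsub>gsec ?g d U\<^esub> D) E =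
        scal Y U c \<odot>\<^bsub>gsec ?g (d + e) U\<^esub> lbr ?g d e U D E" if "c \<in> carrier K" for c
      unfolding S by (rule R.comm_smult_left[OF U scal[OF U that] D E])
    show "lbr ?g d e U D (scal Y U c \<odot>\<^bsub>gsec ?g e U\<^esub> E) =
        scal Y U c \<odot>\<^bsub>gsec ?g (d + e) U\<^esub> lbr ?g d e U D E" if "c \<in> carrier K" for c
      unfolding S by (rule R.comm_smult_right[OF U scal[OF U that] D E])
    show "ldif ?g (d + e) U (lbr ?g d e U D E) =
         lbr ?g (d + 1) e U (ldif ?g d U D) E \<oplus>\<^bsub>gsec ?g (d + e + 1) U\<^esub>
         signed (gsec ?g (d + e + 1) U) d (lbr ?g d (e + 1) U D (ldif ?g e U E))"
      using R.comm_jacobi[OF U R.Q_Der[OF U] D E]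
      unfolding S cD[OF D] cD[OF E] cD[OF R.comm_Der[OF U D E]] by (simp add: ac_simps)
    show "lbr ?g d (p + e) U D (lact ?g p e U a E) =
         lact ?g (p + d) e U (lanc ?g d U D p U a) E \<oplus>\<^bsub>gsec ?g (p + d + e) U\<^esub>
         signed (gsec ?g (p + d + e) U) (p * d) (lact ?g p (d + e) U a (lbr ?g d e U D E))"
      if "a \<in> sec A p U" for a p
      unfolding S by (rule R.comm_act[OF U that D E])
    show "lbr ?g d (e + n) U D (lbr ?g e n U E F) =
         lbr ?g (d + e) n U (lbr ?g d e U D E) F \<oplus>\<^bsub>gsec ?g (d + e + n) U\<^esub>
         signed (gsec ?g (d + e + n) U) (d * e) (lbr ?g e (d + n) U E (lbr ?g d n U D F))"
      if "F \<in> sec ?g n U" for F n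
      using that unfolding S by (rule R.comm_jacobi[OF U D E])
    show "lbr ?g d e U (D \<oplus>\<^bsub>gsec ?g d U\<^esub> D') E =
        lbr ?g d e U D E \<oplus>\<^bsub>gsec ?g (d + e) U\<^esub> lbr ?g d e U D' E"
      if "D' \<in> sec ?g d U" for D'
      using that unfolding S by (rule R.comm_add_left[OF U D _ E])
    show "lbr ?g d e U D (E \<oplus>\<^bsub>gsec ?g e U\<^esub> E') =
        lbr ?g d e U D E \<oplus>\<^bsub>gsec ?g (d + e) U\<^esub> lbr ?g d e U D E'"
      if "E' \<in> sec ?g e U" for E'
      using that unfolding S by (rule R.comm_add_right[OF U D E])
  qed
  then show ?thesis
  proof (rule dg_lie_algebroid_over_OY.intro)
    show "dg_lie_algebroid_over_OY_axioms Y A ?g"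
    proof (rule dg_lie_algebroid_over_OY_axioms.intro; unfold S)
      fix U r D d E e assume U: "opn Y U" and r: "r \<in> carrier (rsec Y U)" and D: "D \<in> R.Der d U" and E: "E \<in> R.Der e U"
      show "fam_commutator Y A d e U (fam_smult Y A A d U r D) E = fam_smult Y A A (d + e) U r (fam_commutator Y A d e U D E)"
        by (rule R.comm_smult_left[OF U r D E])
      show "fam_commutator Y A d e U D (fam_smult Y A A e U r E) = fam_smult Y A A (d + e) U r (fam_commutator Y A d e U D E)"
        by (rule R.comm_smult_right[OF U r D E])
    qed
  qed
qed

section \<open>The structure sheaf as a dg-algebra\<close>

lemma structure_alg_simps:
  "sec (structure_alg Y) l U = (if l = 0 then carrier (rsec Y U) else {\<zero>\<^bsub>rsec Y U\<^esub>})"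
  "x \<oplus>\<^bsub>gsec (structure_alg Y) l U\<^esub> y = x \<oplus>\<^bsub>rsec Y U\<^esub> y"
  "\<zero>\<^bsub>gsec (structure_alg Y) l U\<^esub> = \<zero>\<^bsub>rsec Y U\<^esub>"
  "r \<odot>\<^bsub>gsec (structure_alg Y) l U\<^esub> x = r \<otimes>\<^bsub>rsec Y U\<^esub> x"
  "gres (structure_alg Y) l = rres Y"
  "gmul (structure_alg Y) p q U x y = x \<otimes>\<^bsub>rsec Y U\<^esub> y"
  "gone (structure_alg Y) U = \<one>\<^bsub>rsec Y U\<^esub>"
  "gdif (structure_alg Y) l U x = \<zero>\<^bsub>rsec Y U\<^esub>"
  by (simp_all add: structure_alg_def concentrated_def)

context
  fixes Y :: "('a, 'r, 'y) ringed_space_scheme"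
  assumes ringed: "is_ringed_space Y"
begin

abbreviation "OY \<equiv> structure_alg Y"

lemma ringed_res_zero:
  assumes U: "opn Y U" and V: "opn Y V" "V \<subseteq> U"
  shows "rres Y U V \<zero>\<^bsub>rsec Y U\<^esub> = \<zero>\<^bsub>rsec Y V\<^esub>"
proof -
  interpret U: cring "rsec Y U" by (rule ringed_cring[OF ringed U])
  interpret V: cring "rsec Y V" by (rule ringed_cring[OF ringed V(1)])
  interpret h: ring_hom_cring "rsec Y U" "rsec Y V" "rres Y U V"
    by (unfold_locales) (rule ringed_res_hom[OF ringed U V])
  show ?thesis by (rule h.hom_zero)
qed

lemma structure_sheaf_on: "sheaf_on (tp Y) (sec OY l) (rres Y)"
proof (cases "l = 0")
  case True
  then show ?thesis using ringed by (simp add: structure_alg_simps is_ringed_space_def cong: if_cong)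
next
  case False
  then show ?thesis
    by (auto simp: structure_alg_simps sheaf_on_def presheaf_on_def ringed_res_zero openin_Union intro!: ex1I ringed_res_zero)
qed

lemma structure_module:
  assumes U: "opn Y U"
  shows "module (rsec Y U) (gsec OY l U)"
proof -
  interpret R: cring "rsec Y U" by (rule ringed_cring[OF ringed U])
  have "abelian_group (gsec OY l U)"
  proof (rule abelian_groupI; unfold structure_alg_simps)
    show "\<zero>\<^bsub>rsec Y U\<^esub> \<in> (if l = 0 then carrier (rsec Y U) else {\<zero>\<^bsub>rsec Y U\<^esub>})" by simp
    fix x y z assume x: "x \<in> (if l = 0 then carrier (rsec Y U) else {\<zero>\<^bsub>rsec Y U\<^esub>})"
    then have [simp]: "x \<in> carrier (rsec Y U)" by (simp split: if_splits)
    show "\<zero>\<^bsub>rsec Y U\<^esub> \<oplus>\<^bsub>rsec Y U\<^esub> x = x" by simp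
    show "\<exists>y\<in>if l = 0 then carrier (rsec Y U) else {\<zero>\<^bsub>rsec Y U\<^esub>}. y \<oplus>\<^bsub>rsec Y U\<^esub> x = \<zero>\<^bsub>rsec Y U\<^esub>"
      using x by (intro bexI[of _ "\<ominus>\<^bsub>rsec Y U\<^esub> x"]) (simp_all add: R.l_neg split: if_splits)
    assume y: "y \<in> (if l = 0 then carrier (rsec Y U) else {\<zero>\<^bsub>rsec Y U\<^esub>})"
    then have [simp]: "y \<in> carrier (rsec Y U)" by (simp split: if_splits)
    show "x \<oplus>\<^bsub>rsec Y U\<^esub> y \<in> (if l = 0 then carrier (rsec Y U) else {\<zero>\<^bsub>rsec Y U\<^esub>})" using x y by (simp split: if_splits)
    show "x \<oplus>\<^bsub>rsec Y U\<^esub> y = y \<oplus>\<^bsub>rsec Y U\<^esub> x" by (rule R.a_comm) simp_all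
    assume "z \<in> (if l = 0 then carrier (rsec Y U) else {\<zero>\<^bsub>rsec Y U\<^esub>})"
    then have "z \<in> carrier (rsec Y U)" by (simp split: if_splits)
    then show "x \<oplus>\<^bsub>rsec Y U\<^esub> y \<oplus>\<^bsub>rsec Y U\<^esub> z = x \<oplus>\<^bsub>rsec Y U\<^esub> (y \<oplus>\<^bsub>rsec Y U\<^esub> z)" by (simp add: R.a_assoc)
  qed
  then show ?thesis
    by (rule moduleI[OF ringed_cring[OF ringed U]])
      (auto simp: structure_alg_simps R.l_distr R.r_distr R.m_assoc split: if_splits)
qed

lemma structure_closed: "opn Y U \<Longrightarrow> x \<in> sec OY l U \<Longrightarrow> x \<in> carrier (rsec Y U)"
  using cring.cring_simprules(2)[OF ringed_cring[OF ringed]] by (auto simp: structure_alg_simps split: if_splits)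

lemma structure_zero: "l \<noteq> 0 \<Longrightarrow> x \<in> sec OY l U \<Longrightarrow> x = \<zero>\<^bsub>rsec Y U\<^esub>"
  by (simp add: structure_alg_simps)

lemma dg_structure_alg: "dg_algebra_sheaf Y OY"
proof (intro dg_algebra_sheaf.intro graded_module_sheaf.intro dg_algebra_sheaf_axioms.intro)
  show "sheaf_on (tp Y) (sec OY l) (gres OY l)" for l
    using structure_sheaf_on by (simp add: structure_alg_simps(5))
  fix U assume U: "opn Y U"
  interpret R: cring "rsec Y U" by (rule ringed_cring[OF ringed U])
  show "module (rsec Y U) (gsec OY l U)" for l by (rule structure_module[OF U])
  show "gone OY U \<in> sec OY 0 U" by (simp add: structure_alg_simps)
  show "gres OY 0 U V (gone OY U) = gone OY V"
    if "opn Y V" "V \<subseteq> U" for V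
    using ring_hom_one[OF ringed_res_hom[OF ringed U that]] by (simp add: structure_alg_simps)
  fix l x assume x: "x \<in> sec OY l U"
  note x' [simp] = structure_closed[OF U x]
  show "gmul OY 0 l U (gone OY U) x = x" by (simp add: structure_alg_simps(6,7))
  show "gdif OY l U x \<in> sec OY (l + 1) U" by (simp add: structure_alg_simps)
  show "gdif OY (l + 1) U (gdif OY l U x) = \<zero>\<^bsub>gsec OY (l + 1 + 1) U\<^esub>"
    by (simp add: structure_alg_simps)
  show "gdif OY l U (x \<oplus>\<^bsub>gsec OY l U\<^esub> x'') =
      gdif OY l U x \<oplus>\<^bsub>gsec OY (l + 1) U\<^esub> gdif OY l U x''" for x''
    by (simp add: structure_alg_simps)
  show "gdif OY l U (r \<odot>\<^bsub>gsec OY l U\<^esub> x) = r \<odot>\<^bsub>gsec OY (l + 1) U\<^esub> gdif OY l U x"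
    if "r \<in> carrier (rsec Y U)" for r using that by (simp add: structure_alg_simps)
  { fix V assume V: "opn Y V" "V \<subseteq> U"
    interpret h: ring_hom_cring "rsec Y U" "rsec Y V" "rres Y U V"
      using ringed_cring[OF ringed V(1)] ringed_res_hom[OF ringed U V] R.cring_axioms
      by (simp add: ring_hom_cring_def ring_hom_cring_axioms_def)
    show "gres OY (l + 1) U V (gdif OY l U x) = gdif OY l V (gres OY l U V x)"
      by (simp add: structure_alg_simps)
    show "gres OY l U V (r \<odot>\<^bsub>gsec OY l U\<^esub> x) =
        rres Y U V r \<odot>\<^bsub>gsec OY l V\<^esub> gres OY l U V x" if "r \<in> carrier (rsec Y U)" for r
      using that by (simp add: structure_alg_simps)
    fix m y assume "y \<in> sec OY m U"
    note y' [simp] = structure_closed[OF U this]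
    show "gres OY l U V (x \<oplus>\<^bsub>gsec OY l U\<^esub> y) =
        gres OY l U V x \<oplus>\<^bsub>gsec OY l V\<^esub> gres OY l U V y"
      by (simp add: structure_alg_simps)
    show "gres OY (l + m) U V (gmul OY l m U x y) =
        gmul OY l m V (gres OY l U V x) (gres OY m U V y)"
      by (simp add: structure_alg_simps) }
  fix m y assume y: "y \<in> sec OY m U"
  note y' [simp] = structure_closed[OF U y]
  \<comment> \<open>A section outside degree 0 is zero, so a product can be nonzero only in degree
    0, where the sign of graded commutativity is 1.\<close>
  have xy: "x \<otimes>\<^bsub>rsec Y U\<^esub> y = \<zero>\<^bsub>rsec Y U\<^esub>" if "l \<noteq> 0 \<or> m \<noteq> 0"
    using that structure_zero[OF _ x] structure_zero[OF _ y] by auto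
  interpret M: module "rsec Y U" "gsec OY (l + m) U" by (rule structure_module[OF U])
  interpret M': abelian_group "gsec OY (l + m + 1) U"
    by (rule module.axioms(2)[OF structure_module[OF U]])
  show c: "gmul OY l m U x y \<in> sec OY (l + m) U"
    using xy by (cases "l = 0 \<and> m = 0") (auto simp: structure_alg_simps)
  have "add_pow (gsec OY (l + m) U) (1 :: int) (x \<otimes>\<^bsub>rsec Y U\<^esub> y) = x \<otimes>\<^bsub>rsec Y U\<^esub> y"
    using M.add.int_pow_1[of "x \<otimes>\<^bsub>rsec Y U\<^esub> y"] c by (simp add: structure_alg_simps(6))
  moreover have "add_pow (gsec OY (l + m) U) (n :: int) \<zero>\<^bsub>rsec Y U\<^esub> = \<zero>\<^bsub>rsec Y U\<^esub>" for n
    using M.add.int_pow_one[of n] by (simp add: structure_alg_simps(3))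
  ultimately show "gmul OY l m U x y =
      signed (gsec OY (l + m) U) (l * m) (gmul OY m l U y x)"
    using xy R.m_comm[OF x' y'] by (cases "l = 0 \<and> m = 0") (auto simp: structure_alg_simps(6) ksign_def)
  show "gmul OY l m U (x \<oplus>\<^bsub>gsec OY l U\<^esub> x'') y =
      gmul OY l m U x y \<oplus>\<^bsub>gsec OY (l + m) U\<^esub> gmul OY l m U x'' y"
    if "x'' \<in> sec OY l U" for x'' using structure_closed[OF U that] by (simp add: structure_alg_simps R.l_distr)
  show "gmul OY l m U x (y \<oplus>\<^bsub>gsec OY m U\<^esub> y'') =
      gmul OY l m U x y \<oplus>\<^bsub>gsec OY (l + m) U\<^esub> gmul OY l m U x y''"
    if "y'' \<in> sec OY m U" for y'' using structure_closed[OF U that] by (simp add: structure_alg_simps R.r_distr)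
  show "gmul OY l m U (r \<odot>\<^bsub>gsec OY l U\<^esub> x) y = r \<odot>\<^bsub>gsec OY (l + m) U\<^esub> gmul OY l m U x y"
    "gmul OY l m U x (r \<odot>\<^bsub>gsec OY m U\<^esub> y) = r \<odot>\<^bsub>gsec OY (l + m) U\<^esub> gmul OY l m U x y"
    if "r \<in> carrier (rsec Y U)" for r using that by (simp_all add: structure_alg_simps R.m_assoc R.m_lcomm)
  show "gmul OY (l + m) n U (gmul OY l m U x y) z =
      gmul OY l (m + n) U x (gmul OY m n U y z)" if "z \<in> sec OY n U" for n z
    using structure_closed[OF U that] by (simp add: structure_alg_simps R.m_assoc)
  have "add_pow (gsec OY (l + m + 1) U) (n :: int) \<zero>\<^bsub>rsec Y U\<^esub> = \<zero>\<^bsub>rsec Y U\<^esub>" for n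
    using M'.add.int_pow_one[of n] by (simp add: structure_alg_simps(3))
  then show "gdif OY (l + m) U (gmul OY l m U x y) =
      gmul OY (l + 1) m U (gdif OY l U x) y \<oplus>\<^bsub>gsec OY (l + m + 1) U\<^esub>
      signed (gsec OY (l + m + 1) U) l (gmul OY l (m + 1) U x (gdif OY m U y))"
    by (simp add: structure_alg_simps(2,6,8))
qed

text \<open>Compatibility with differentials holds because the differential of \<open>A\<close> is
  linear over the structure sheaf and kills the unit, hence kills all scalars.\<close>

lemma dg_hom_unit_map:
  assumes A: "dg_algebra_sheaf Y A"
  shows "dg_alg_hom Y OY A (unit_map Y A)"
proof -
  interpret A: dg_algebra_sheaf Y A by (rule A)
  interpret O: dg_algebra_sheaf Y OY by (rule dg_structure_alg)
  show ?thesis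
  proof (rule dg_alg_homI)
    fix U assume U: "opn Y U"
    interpret R: cring "rsec Y U" by (rule ringed_cring[OF ringed U])
    note one = A.one_closed[OF U]
    have M: "module (rsec Y U) (gsec A l U)" for l by (rule A.module[OF U])
    have ab: "abelian_group (gsec A l U)" for l by (rule A.pre.abelian[OF U])
    have z: "\<zero>\<^bsub>gsec A l U\<^esub> \<in> sec A l U" for l by (rule A.pre.zero_closed[OF U])
    have zz: "\<zero>\<^bsub>gsec A l U\<^esub> \<oplus>\<^bsub>gsec A l U\<^esub> \<zero>\<^bsub>gsec A l U\<^esub> = \<zero>\<^bsub>gsec A l U\<^esub>" for l
      by (rule abelian_monoid.l_zero[OF abelian_group.axioms(1)[OF ab] z])
    have rz: "r \<odot>\<^bsub>gsec A l U\<^esub> \<zero>\<^bsub>gsec A l U\<^esub> = \<zero>\<^bsub>gsec A l U\<^esub>" if "r \<in> carrier (rsec Y U)" for r l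
      by (rule add_hom_zero[OF A.pre.add_hom_smult[OF U that]])
    have zr: "\<zero>\<^bsub>rsec Y U\<^esub> \<odot>\<^bsub>gsec A l U\<^esub> x = \<zero>\<^bsub>gsec A l U\<^esub>" if "x \<in> sec A l U" for x l
      by (rule module.smult_l_null[OF M that])
    show "unit_map Y A 0 U (gone OY U) = gone A U"
      using module.smult_one[OF M one] by (simp add: unit_map_def structure_alg_simps)
    fix l x assume x: "x \<in> sec OY l U"
    note x' = structure_closed[OF U x]
    show cl: "unit_map Y A l U x \<in> sec A l U"
      using A.pre.smult_closed[OF U x' one] z by (simp add: unit_map_def)
    show "unit_map Y A l U (x \<oplus>\<^bsub>gsec OY l U\<^esub> x'') = unit_map Y A l U x \<oplus>\<^bsub>gsec A l U\<^esub> unit_map Y A l U x''"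
      if "x'' \<in> sec OY l U" for x''
      using module.smult_l_distr[OF M x' structure_closed[OF U that] one] zz by (simp add: unit_map_def structure_alg_simps)
    show "unit_map Y A l U (r \<odot>\<^bsub>gsec OY l U\<^esub> x) = r \<odot>\<^bsub>gsec A l U\<^esub> unit_map Y A l U x"
      if "r \<in> carrier (rsec Y U)" for r
      using module.smult_assoc1[OF M that x' one] rz[OF that] by (simp add: unit_map_def structure_alg_simps)
    show "unit_map Y A l V (gres OY l U V x) = gres A l U V (unit_map Y A l U x)"
      if V: "opn Y V" "V \<subseteq> U" for V
      using A.res_smult[OF U V x' one] A.one_res[OF U V] add_hom_zero[OF A.pre.add_hom_res[OF U V]]
      by (simp add: unit_map_def structure_alg_simps)
    show "unit_map Y A (l + 1) U (gdif OY l U x) = gdif A l U (unit_map Y A l U x)"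
    proof -
      have "gdif A l U (unit_map Y A l U x) = \<zero>\<^bsub>gsec A (l + 1) U\<^esub>"
      proof (cases "l = 0")
        case True
        then show ?thesis
          using A.dif_smult[OF U x' one] A.pre.dif_one[OF U] rz[OF x', of 1] by (simp add: unit_map_def)
      next
        case False
        then show ?thesis using add_hom_zero[OF A.pre.add_hom_dif[OF U]] by (simp add: unit_map_def)
      qed
      then show ?thesis using zr[OF one] by (simp add: unit_map_def structure_alg_simps)
    qed
    fix m y assume y: "y \<in> sec OY m U"
    note y' = structure_closed[OF U y]
    have cly: "unit_map Y A m U y \<in> sec A m U"
      using A.pre.smult_closed[OF U y' one] z by (simp add: unit_map_def)
    show "unit_map Y A (l + m) U (gmul OY l m U x y) = gmul A l m U (unit_map Y A l U x) (unit_map Y A m U y)"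
    proof (cases "l = 0 \<and> m = 0")
      case True
      then show ?thesis
        using A.mul_smult_left[OF U x' one A.pre.smult_closed[OF U y' one]] A.one_left[OF U A.pre.smult_closed[OF U y' one]]
          module.smult_assoc1[OF M x' y' one] by (simp add: unit_map_def structure_alg_simps)
    next
      case False
      have "x \<otimes>\<^bsub>rsec Y U\<^esub> y = \<zero>\<^bsub>rsec Y U\<^esub>"
        using False structure_zero[OF _ x] structure_zero[OF _ y] x' y' by auto
      then have 1: "unit_map Y A (l + m) U (gmul OY l m U x y) = \<zero>\<^bsub>gsec A (l + m) U\<^esub>"
        using zr[OF one] by (simp add: unit_map_def structure_alg_simps)
      have "gmul A l m U (unit_map Y A l U x) (unit_map Y A m U y) = \<zero>\<^bsub>gsec A (l + m) U\<^esub>"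
      proof (cases "l = 0")
        case True
        then have "m \<noteq> 0" using False by simp
        then have "unit_map Y A m U y = \<zero>\<^bsub>gsec A m U\<^esub>" by (simp add: unit_map_def)
        then show ?thesis using add_hom_zero[OF A.pre.mul_hom_right[OF refl U cl]] by simp
      next
        case False
        then have "unit_map Y A l U x = \<zero>\<^bsub>gsec A l U\<^esub>" by (simp add: unit_map_def)
        then show ?thesis using add_hom_zero[OF A.pre.mul_hom_left[OF refl U cly]] by simp
      qed
      with 1 show ?thesis by simp
    qed
  qed
qed

text \<open>Homomorphisms are linear over the structure sheaf and hence commute with the structure
  maps. So any two homomorphisms from \<open>A\<close> satisfy the compatibility that a map out of
  the fibre square requires.\<close>

lemma dg_hom_unit:
  assumes A: "dg_algebra_sheaf Y A" and B: "dg_algebra_sheaf Y B" and h: "dg_alg_hom Y A B h"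
    and U: "opn Y U" and r: "r \<in> sec OY l U"
  shows "h l U (unit_map Y A l U r) = unit_map Y B l U r"
proof -
  interpret A: dg_algebra_sheaf Y A by (rule A)
  interpret B: dg_algebra_sheaf Y B by (rule B)
  show ?thesis
    using dg_hom_smult[OF h U structure_closed[OF U r] A.one_closed[OF U]] dg_hom_one[OF h U]
      add_hom_zero[OF add_hom_dg[OF h U A.pre.abelian[OF U] B.pre.abelian[OF U]]]
    by (simp add: unit_map_def)
qed

end

section \<open>The pair groupoid\<close>

lemma fcomp_apply: "(g \<circ>\<circ>\<circ> f) l U x = g l U (f l U x)"
  by (simp add: fcomp_def)

lemma fid_apply: "fid l U x = x"
  by (simp add: fid_def)

locale fibre_groupoid =
  fixes Y :: "('a, 'r, 'y) ringed_space_scheme" and A :: "('a, 'r, 'm) dgalg"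
  assumes ringed: "is_ringed_space Y" and A: "dg_algebra_sheaf Y A"
begin

sublocale A: dg_algebra_sheaf Y A by (rule A)

abbreviation "G \<equiv> fibre_square Y A"
abbreviation "s \<equiv> proj1 Y A"
abbreviation "t \<equiv> proj2 Y A"

lemma square: "tensor_product Y (structure_alg Y) A (unit_map Y A) A (unit_map Y A)"
  by (intro tensor_product.intro ringed dg_structure_alg dg_hom_unit_map A)

lemma dg_G: "dg_algebra_sheaf Y G"
  unfolding fibre_square_def by (rule tensor_product.dg_T[OF square])

lemma s_hom: "dg_alg_hom Y A G s"
  unfolding fibre_square_def proj1_def by (rule tensor_product.dg_hom_i1[OF square])

lemma t_hom: "dg_alg_hom Y A G t"
  unfolding fibre_square_def proj2_def by (rule tensor_product.dg_hom_i2[OF square])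

sublocale G: dg_algebra_sheaf Y G by (rule dg_G)

text \<open>Functions on composable pairs \<open>(h, k)\<close>: the first copy of the arrows is
  glued along its source, the second along its target. Below, \<open>tr\<close> belongs to
  composable triples, with \<open>pr.T\<close> and the source of \<open>k\<close> in the role of the
  first copy.\<close>

sublocale pr: tensor_product Y A G s G t
  by (intro tensor_product.intro ringed A dg_G s_hom t_hom)

sublocale tr: tensor_product Y A pr.T "pr.i2 \<circ>\<circ>\<circ> s" G t
  by (intro tensor_product.intro ringed A dg_G pr.dg_T t_hom dg_hom_comp[OF s_hom pr.dg_hom_i2])

lemmas s_closed = dg_hom_closed[OF s_hom] and t_closed = dg_hom_closed[OF t_hom]

lemma hom_eq_on_square:
  assumes D: "dg_algebra_sheaf Y D" and u: "dg_alg_hom Y G D u" and v: "dg_alg_hom Y G D v"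
    and 1: "\<And>l U a. opn Y U \<Longrightarrow> a \<in> sec A l U \<Longrightarrow> u l U (s l U a) = v l U (s l U a)"
    and 2: "\<And>l U a. opn Y U \<Longrightarrow> a \<in> sec A l U \<Longrightarrow> u l U (t l U a) = v l U (t l U a)"
  shows "eq_on_sections Y G u v"
  by (rule tensor_product.hom_eq_on_tensor[OF square, folded fibre_square_def proj1_def proj2_def, OF D u v 1 2])

lemma derivation_eq_on_square:
  assumes D: "dg_algebra_sheaf Y D" and \<delta>: "\<delta> \<in> O_derivations Y G D \<phi> d U" and \<delta>': "\<delta>' \<in> O_derivations Y G D \<phi> d U"
    and 1: "\<And>l V a. \<lbrakk>opn Y V; V \<subseteq> U; a \<in> sec A l V\<rbrakk> \<Longrightarrow> \<delta> l V (s l V a) = \<delta>' l V (s l V a)"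
    and 2: "\<And>l V a. \<lbrakk>opn Y V; V \<subseteq> U; a \<in> sec A l V\<rbrakk> \<Longrightarrow> \<delta> l V (t l V a) = \<delta>' l V (t l V a)"
  shows "\<delta> = \<delta>'"
  by (rule tensor_product.O_derivation_eq_on_tensor[OF square, folded fibre_square_def proj1_def proj2_def, OF D \<delta> \<delta>' 1 2])

lemma
  assumes D: "dg_algebra_sheaf Y D" and h: "dg_alg_hom Y A D h" and k: "dg_alg_hom Y A D k"
  shows into_square_hom: "dg_alg_hom Y G D (into_square Y A D h k)"
    and into_square_s: "opn Y U \<Longrightarrow> a \<in> sec A l U \<Longrightarrow> into_square Y A D h k l U (s l U a) = h l U a"
    and into_square_t: "opn Y U \<Longrightarrow> a \<in> sec A l U \<Longrightarrow> into_square Y A D h k l U (t l U a) = k l U a"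
proof -
  have c: "h l U (unit_map Y A l U a) = k l U (unit_map Y A l U a)"
    if "opn Y U" "a \<in> sec (structure_alg Y) l U" for l U a
    by (simp only: dg_hom_unit[OF ringed A D h that] dg_hom_unit[OF ringed A D k that])
  show "dg_alg_hom Y G D (into_square Y A D h k)"
    unfolding into_square_def fibre_square_def by (rule tensor_product.copair_hom[OF square D h k c])
  show "opn Y U \<Longrightarrow> a \<in> sec A l U \<Longrightarrow> into_square Y A D h k l U (s l U a) = h l U a"
    unfolding into_square_def proj1_def by (rule tensor_product.copair_i1[OF square D h k c])
  show "opn Y U \<Longrightarrow> a \<in> sec A l U \<Longrightarrow> into_square Y A D h k l U (t l U a) = k l U a"
    unfolding into_square_def proj2_def by (rule tensor_product.copair_i2[OF square D h k c])
qed

abbreviation "e \<equiv> into_square Y A A fid fid"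
abbreviation "mu \<equiv> into_square Y A pr.T (pr.i2 \<circ>\<circ>\<circ> s) (pr.i1 \<circ>\<circ>\<circ> t)"
abbreviation "iv \<equiv> into_square Y A G t s"

lemmas e_hom = into_square_hom[OF A dg_hom_id dg_hom_id]
lemmas mu_hom = into_square_hom[OF pr.dg_T dg_hom_comp[OF s_hom pr.dg_hom_i2] dg_hom_comp[OF t_hom pr.dg_hom_i1]]
lemmas iv_hom = into_square_hom[OF dg_G t_hom s_hom]

text \<open>Since the structure maps are chosen by \<open>copair\<close>, all that can be said about
  them is their effect on functions of the source and of the target. The lemmas from here to
  \<open>triple_eq\<close> collect these values, and the groupoid laws are rewriting with
  them.\<close>

lemma e_s: "opn Y U \<Longrightarrow> a \<in> sec A l U \<Longrightarrow> e l U (s l U a) = a"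
  using into_square_s[OF A dg_hom_id dg_hom_id, of U a l] by (simp add: fid_def)

lemma e_t: "opn Y U \<Longrightarrow> a \<in> sec A l U \<Longrightarrow> e l U (t l U a) = a"
  using into_square_t[OF A dg_hom_id dg_hom_id, of U a l] by (simp add: fid_def)

lemma mu_s: "opn Y U \<Longrightarrow> a \<in> sec A l U \<Longrightarrow> mu l U (s l U a) = pr.i2 l U (s l U a)"
  using into_square_s[OF pr.dg_T dg_hom_comp[OF s_hom pr.dg_hom_i2] dg_hom_comp[OF t_hom pr.dg_hom_i1], of U a l]
  by (simp add: fcomp_def)

lemma mu_t: "opn Y U \<Longrightarrow> a \<in> sec A l U \<Longrightarrow> mu l U (t l U a) = pr.i1 l U (t l U a)"
  using into_square_t[OF pr.dg_T dg_hom_comp[OF s_hom pr.dg_hom_i2] dg_hom_comp[OF t_hom pr.dg_hom_i1], of U a l]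
  by (simp add: fcomp_def)

lemmas iv_s = into_square_s[OF dg_G t_hom s_hom] and iv_t = into_square_t[OF dg_G t_hom s_hom]

lemma triple_eq: "opn Y U \<Longrightarrow> a \<in> sec A l U \<Longrightarrow> tr.i1 l U (pr.i2 l U (s l U a)) = tr.i2 l U (t l U a)"
  using tr.i1_f[of U a l] by (simp add: fcomp_def)

abbreviation "cps D h k \<equiv> copair Y A G s G t D h k \<circ>\<circ>\<circ> mu"

text \<open>Homomorphisms from \<open>G\<close> to \<open>D\<close> are arrows with values in
  \<open>D\<close>. Their composite has the source of \<open>k\<close> and the target of
  \<open>h\<close>, which determines it.\<close>

lemma
  assumes D: "dg_algebra_sheaf Y D" and h: "dg_alg_hom Y G D h" and k: "dg_alg_hom Y G D k"
    and c: "\<And>l U a. opn Y U \<Longrightarrow> a \<in> sec A l U \<Longrightarrow> h l U (s l U a) = k l U (t l U a)"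
  shows cps_hom: "dg_alg_hom Y G D (cps D h k)"
    and cps_s: "opn Y U \<Longrightarrow> a \<in> sec A l U \<Longrightarrow> cps D h k l U (s l U a) = k l U (s l U a)"
    and cps_t: "opn Y U \<Longrightarrow> a \<in> sec A l U \<Longrightarrow> cps D h k l U (t l U a) = h l U (t l U a)"
proof -
  show "dg_alg_hom Y G D (cps D h k)" by (rule dg_hom_comp[OF mu_hom pr.copair_hom[OF D h k c]])
  show "opn Y U \<Longrightarrow> a \<in> sec A l U \<Longrightarrow> cps D h k l U (s l U a) = k l U (s l U a)"
    by (simp add: fcomp_def[of _ mu] mu_s pr.copair_i2[OF D h k c] s_closed)
  show "opn Y U \<Longrightarrow> a \<in> sec A l U \<Longrightarrow> cps D h k l U (t l U a) = h l U (t l U a)"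
    by (simp add: fcomp_def[of _ mu] mu_t pr.copair_i1[OF D h k c] t_closed)
qed

text \<open>An arrow of the pair groupoid is nothing but its two ends, so a law about a composite
  holds once the sources and the targets agree.\<close>

lemma cps_eqI:
  assumes D: "dg_algebra_sheaf Y D" and h: "dg_alg_hom Y G D h" and k: "dg_alg_hom Y G D k"
    and c: "\<And>l U a. opn Y U \<Longrightarrow> a \<in> sec A l U \<Longrightarrow> h l U (s l U a) = k l U (t l U a)"
    and v: "dg_alg_hom Y G D v"
    and 1: "\<And>l U a. opn Y U \<Longrightarrow> a \<in> sec A l U \<Longrightarrow> k l U (s l U a) = v l U (s l U a)"
    and 2: "\<And>l U a. opn Y U \<Longrightarrow> a \<in> sec A l U \<Longrightarrow> h l U (t l U a) = v l U (t l U a)"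
  shows "eq_on_sections Y G (cps D h k) v"
  by (rule hom_eq_on_square[OF D cps_hom[OF D h k c] v])
    (simp_all only: cps_s[OF D h k c] cps_t[OF D h k c] 1 2)

lemma pair_groupoid_simps:
  "obj (pair_groupoid Y A) = A" "arr (pair_groupoid Y A) = G" "src (pair_groupoid Y A) = s" "tgt (pair_groupoid Y A) = t"
  "unt (pair_groupoid Y A) = e" "cmp (pair_groupoid Y A) = mu" "inver (pair_groupoid Y A) = iv"
  by (simp_all add: pair_groupoid_def Let_def)

lemma dg_groupoid_pair_groupoid: "dg_groupoid Y (pair_groupoid Y A)"
  unfolding dg_groupoid_def pair_groupoid_simps
proof (intro conjI A dg_G s_hom t_hom e_hom mu_hom iv_hom pr.dg_T tr.dg_T)
  note simps = fcomp_apply fid_apply e_s e_t mu_s mu_t iv_s iv_t triple_eq s_closed t_closed pr.i1_f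
  note id = dg_hom_id[of Y G]
  note h12 = dg_hom_comp[OF mu_hom tr.dg_hom_i1] and h1 = dg_hom_comp[OF pr.dg_hom_i1 tr.dg_hom_i1]
    and h2 = dg_hom_comp[OF pr.dg_hom_i2 tr.dg_hom_i1]
  show "eq_on_sections Y A (e \<circ>\<circ>\<circ> s) fid" "eq_on_sections Y A (e \<circ>\<circ>\<circ> t) fid"
    "eq_on_sections Y A (mu \<circ>\<circ>\<circ> s) (pr.i2 \<circ>\<circ>\<circ> s)" "eq_on_sections Y A (mu \<circ>\<circ>\<circ> t) (pr.i1 \<circ>\<circ>\<circ> t)"
    "eq_on_sections Y A (iv \<circ>\<circ>\<circ> s) t" "eq_on_sections Y A (iv \<circ>\<circ>\<circ> t) s"
    by (simp_all add: eq_on_sections_def simps)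
  show "eq_on_sections Y G (cps G fid (s \<circ>\<circ>\<circ> e)) fid"
    by (rule cps_eqI[OF dg_G id dg_hom_comp[OF e_hom s_hom] _ id]) (simp_all add: simps)
  show "eq_on_sections Y G (cps G (t \<circ>\<circ>\<circ> e) fid) fid"
    by (rule cps_eqI[OF dg_G dg_hom_comp[OF e_hom t_hom] id _ id]) (simp_all add: simps)
  show "eq_on_sections Y G (cps G fid iv) (t \<circ>\<circ>\<circ> e)"
    by (rule cps_eqI[OF dg_G id iv_hom _ dg_hom_comp[OF e_hom t_hom]]) (simp_all add: simps)
  show "eq_on_sections Y G (cps G iv fid) (s \<circ>\<circ>\<circ> e)"
    by (rule cps_eqI[OF dg_G iv_hom id _ dg_hom_comp[OF e_hom s_hom]]) (simp_all add: simps)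
  have c2: "(tr.i1 \<circ>\<circ>\<circ> pr.i2) l U (s l U a) = tr.i2 l U (t l U a)" if "opn Y U" "a \<in> sec A l U" for l U a
    using that by (simp add: simps)
  \<comment> \<open>The composite of the second and third arrow of a triple. It has to be known as a
    homomorphism with given source and target before the first arrow can be composed with
    it.\<close>
  let ?k = "cps tr.T (tr.i1 \<circ>\<circ>\<circ> pr.i2) tr.i2"
  have inner: "dg_alg_hom Y G tr.T ?k" by (rule cps_hom[OF tr.dg_T h2 tr.dg_hom_i2 c2])
  have inner_s: "?k l U (s l U a) = tr.i2 l U (s l U a)" if "opn Y U" "a \<in> sec A l U" for l U a
    by (rule cps_s[OF tr.dg_T h2 tr.dg_hom_i2 c2 that])
  have inner_t: "?k l U (t l U a) = (tr.i1 \<circ>\<circ>\<circ> pr.i2) l U (t l U a)" if "opn Y U" "a \<in> sec A l U" for l U a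
    by (rule cps_t[OF tr.dg_T h2 tr.dg_hom_i2 c2 that])
  have c1: "(tr.i1 \<circ>\<circ>\<circ> pr.i1) l U (s l U a) = ?k l U (t l U a)" if "opn Y U" "a \<in> sec A l U" for l U a
    unfolding inner_t[OF that] using that by (simp add: simps)
  show "eq_on_sections Y G (cps tr.T (tr.i1 \<circ>\<circ>\<circ> mu) tr.i2) (cps tr.T (tr.i1 \<circ>\<circ>\<circ> pr.i1) ?k)"
  proof (rule cps_eqI[OF tr.dg_T h12 tr.dg_hom_i2])
    show "dg_alg_hom Y G tr.T (cps tr.T (tr.i1 \<circ>\<circ>\<circ> pr.i1) ?k)" by (rule cps_hom[OF tr.dg_T h1 inner c1])
    fix l U a assume Ua: "opn Y U" "a \<in> sec A l U"
    show "(tr.i1 \<circ>\<circ>\<circ> mu) l U (s l U a) = tr.i2 l U (t l U a)" using Ua by (simp add: simps)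
    have "cps tr.T (tr.i1 \<circ>\<circ>\<circ> pr.i1) ?k l U (s l U a) = ?k l U (s l U a)" by (rule cps_s[OF tr.dg_T h1 inner c1 Ua])
    then show "tr.i2 l U (s l U a) = cps tr.T (tr.i1 \<circ>\<circ>\<circ> pr.i1) ?k l U (s l U a)" by (simp only: inner_s[OF Ua])
    have "cps tr.T (tr.i1 \<circ>\<circ>\<circ> pr.i1) ?k l U (t l U a) = (tr.i1 \<circ>\<circ>\<circ> pr.i1) l U (t l U a)" by (rule cps_t[OF tr.dg_T h1 inner c1 Ua])
    then show "(tr.i1 \<circ>\<circ>\<circ> mu) l U (t l U a) = cps tr.T (tr.i1 \<circ>\<circ>\<circ> pr.i1) ?k l U (t l U a)"
      by (simp only: fcomp_apply[of tr.i1] mu_t[OF Ua])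
  qed
qed

end

section \<open>Composition of derivations with homomorphisms\<close>

lemma dg_hom_zero:
  assumes A: "dg_algebra_sheaf Y A" and B: "dg_algebra_sheaf Y B" and f: "dg_alg_hom Y A B f" and U: "opn Y U"
  shows "f l U \<zero>\<^bsub>gsec A l U\<^esub> = \<zero>\<^bsub>gsec B l U\<^esub>"
proof -
  interpret A: dg_algebra_sheaf Y A by (rule A)
  interpret B: dg_algebra_sheaf Y B by (rule B)
  show ?thesis by (rule add_hom_zero[OF add_hom_dg[OF f U A.pre.abelian[OF U] B.pre.abelian[OF U]]])
qed

text \<open>The homomorphism \<open>\<phi>'\<close> is only required to agree with the composite on
  sections: in the applications equalities such as that of \<open>iv\<close> applied twice with the
  identity hold only there.\<close>

lemma hom_comp_O_derivation:
  assumes A: "dg_algebra_sheaf Y A" and B: "dg_algebra_sheaf Y B" and C: "dg_algebra_sheaf Y C"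
    and D: "D \<in> O_derivations Y A B \<phi> d U" and \<phi>: "dg_alg_hom Y A B \<phi>" and \<psi>: "dg_alg_hom Y B C \<psi>"
    and \<phi>': "\<And>l V x. opn Y V \<Longrightarrow> x \<in> sec A l V \<Longrightarrow> \<phi>' l V x = \<psi> l V (\<phi> l V x)"
  shows "ext_fam Y A U (\<lambda>l V x. \<psi> (l + d) V (D l V x)) \<in> O_derivations Y A C \<phi>' d U"
proof (rule ext_fam_O_derivation[OF A])
  interpret B: dg_algebra_sheaf Y B by (rule B)
  interpret C: dg_algebra_sheaf Y C by (rule C)
  fix l V x assume V: "opn Y V" "V \<subseteq> U" and x: "x \<in> sec A l V"
  note Dx = O_derivation_closed[OF D V x]
  show "\<psi> (l + d) V (D l V x) \<in> sec C (l + d) V" by (rule dg_hom_closed[OF \<psi> V(1) Dx])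
  show "\<psi> (l + d) V (D l V (x \<oplus>\<^bsub>gsec A l V\<^esub> x')) = \<psi> (l + d) V (D l V x) \<oplus>\<^bsub>gsec C (l + d) V\<^esub> \<psi> (l + d) V (D l V x')"
    if "x' \<in> sec A l V" for x'
    by (simp only: O_derivation_add[OF D V x that] dg_hom_add[OF \<psi> V(1) Dx O_derivation_closed[OF D V that]])
  show "\<psi> (l + d) W (D l W (gres A l V W x)) = gres C (l + d) V W (\<psi> (l + d) V (D l V x))"
    if W: "opn Y W" "W \<subseteq> V" for W
    by (simp only: O_derivation_res[OF D V W x] dg_hom_res[OF \<psi> V(1) W Dx])
  show "\<psi> (l + d) V (D l V (r \<odot>\<^bsub>gsec A l V\<^esub> x)) = r \<odot>\<^bsub>gsec C (l + d) V\<^esub> \<psi> (l + d) V (D l V x)"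
    if r: "r \<in> carrier (rsec Y V)" for r
    by (simp only: O_derivation_smult[OF D V r x] dg_hom_smult[OF \<psi> V(1) r Dx])
  fix q y assume y: "y \<in> sec A q V"
  have k: "l + d + q = l + q + d" "l + (q + d) = l + q + d" by auto
  note Dy = O_derivation_closed[OF D V y] and \<phi>x = dg_hom_closed[OF \<phi> V(1) x] and \<phi>y = dg_hom_closed[OF \<phi> V(1) y]
  note u = B.mul_closed[OF V(1) Dx \<phi>y, unfolded k] and w = B.mul_closed[OF V(1) \<phi>x Dy, unfolded k]
  show "\<psi> (l + q + d) V (D (l + q) V (gmul A l q V x y)) =
      gmul C (l + d) q V (\<psi> (l + d) V (D l V x)) (\<phi>' q V y) \<oplus>\<^bsub>gsec C (l + q + d) V\<^esub>
      signed (gsec C (l + q + d) V) (d * l) (gmul C l (q + d) V (\<phi>' l V x) (\<psi> (q + d) V (D q V y)))"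
    by (simp only: O_derivation_mul[OF D V x y] dg_hom_add[OF \<psi> V(1) u B.pre.sign_closed[OF V(1) w]]
      add_hom_pow[OF add_hom_dg[OF \<psi> V(1) B.pre.abelian[OF V(1)] C.pre.abelian[OF V(1)]] w] \<phi>'[OF V(1) x] \<phi>'[OF V(1) y]
      dg_hom_mul[OF \<psi> V(1) Dx \<phi>y, unfolded k] dg_hom_mul[OF \<psi> V(1) \<phi>x Dy, unfolded k])
qed

lemma O_derivation_comp_hom:
  assumes A: "dg_algebra_sheaf Y A" and \<chi>: "dg_alg_hom Y A B \<chi>" and D: "D \<in> O_derivations Y B C \<phi> d U"
    and \<phi>': "\<And>l V x. opn Y V \<Longrightarrow> x \<in> sec A l V \<Longrightarrow> \<phi>' l V x = \<phi> l V (\<chi> l V x)"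
  shows "ext_fam Y A U (\<lambda>l V x. D l V (\<chi> l V x)) \<in> O_derivations Y A C \<phi>' d U"
proof (rule ext_fam_O_derivation[OF A])
  fix l V x assume V: "opn Y V" "V \<subseteq> U" and x: "x \<in> sec A l V"
  note \<chi>x = dg_hom_closed[OF \<chi> V(1) x]
  show "D l V (\<chi> l V x) \<in> sec C (l + d) V" by (rule O_derivation_closed[OF D V \<chi>x])
  show "D l V (\<chi> l V (x \<oplus>\<^bsub>gsec A l V\<^esub> x')) = D l V (\<chi> l V x) \<oplus>\<^bsub>gsec C (l + d) V\<^esub> D l V (\<chi> l V x')"
    if "x' \<in> sec A l V" for x'
    by (simp only: dg_hom_add[OF \<chi> V(1) x that] O_derivation_add[OF D V \<chi>x dg_hom_closed[OF \<chi> V(1) that]])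
  show "D l W (\<chi> l W (gres A l V W x)) = gres C (l + d) V W (D l V (\<chi> l V x))"
    if W: "opn Y W" "W \<subseteq> V" for W
    by (simp only: dg_hom_res[OF \<chi> V(1) W x] O_derivation_res[OF D V W \<chi>x])
  show "D l V (\<chi> l V (r \<odot>\<^bsub>gsec A l V\<^esub> x)) = r \<odot>\<^bsub>gsec C (l + d) V\<^esub> D l V (\<chi> l V x)"
    if r: "r \<in> carrier (rsec Y V)" for r
    by (simp only: dg_hom_smult[OF \<chi> V(1) r x] O_derivation_smult[OF D V r \<chi>x])
  fix q y assume y: "y \<in> sec A q V"
  show "D (l + q) V (\<chi> (l + q) V (gmul A l q V x y)) =
      gmul C (l + d) q V (D l V (\<chi> l V x)) (\<phi>' q V y) \<oplus>\<^bsub>gsec C (l + q + d) V\<^esub>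
      signed (gsec C (l + q + d) V) (d * l) (gmul C l (q + d) V (\<phi>' l V x) (D q V (\<chi> q V y)))"
    by (simp only: dg_hom_mul[OF \<chi> V(1) x y] O_derivation_mul[OF D V \<chi>x dg_hom_closed[OF \<chi> V(1) y]] \<phi>'[OF V(1) x] \<phi>'[OF V(1) y])
qed

context derivation_sheaf
begin

lemma der_zero: "\<lbrakk>D \<in> Der d U; opn Y V; V \<subseteq> U\<rbrakk> \<Longrightarrow> D l V \<zero>\<^bsub>gsec A l V\<^esub> = \<zero>\<^bsub>gsec B (l + d) V\<^esub>"
  by (rule add_hom_zero[OF der_hom[OF _ _ _ refl]])

lemma der_one:
  assumes D: "D \<in> Der d U" and V: "opn Y V" "V \<subseteq> U"
  shows "D 0 V (gone A V) = \<zero>\<^bsub>gsec B (0 + d) V\<^esub>"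
proof -
  interpret M: abelian_group "gsec B d V" by (rule B.pre.abelian[OF V(1)])
  note one = A.one_closed[OF V(1)] and c = O_derivation_closed[OF D V A.one_closed[OF V(1)], simplified]
  have "D 0 V (gone A V) = D 0 V (gone A V) \<oplus>\<^bsub>gsec B d V\<^esub> D 0 V (gone A V)"
    using O_derivation_mul[OF D V one one] A.one_left[OF V(1) one] dg_hom_one[OF \<phi> V(1)] B.one_left[OF V(1) c]
      B.pre.one_right[OF V(1) c] M.add.int_pow_1[OF c] by (simp add: ksign_def)
  then show ?thesis using M.add.r_cancel_one'[OF c c] by simp
qed

text \<open>Linearity reduces the claim to the unit, which a derivation kills. This is the condition
  under which a derivation of one factor extends to the tensor product over the structure
  sheaf.\<close>

lemma der_unit:
  assumes D: "D \<in> Der d U" and V: "opn Y V" "V \<subseteq> U" and r: "r \<in> sec (structure_alg Y) l V"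
  shows "D l V (unit_map Y A l V r) = \<zero>\<^bsub>gsec B (l + d) V\<^esub>"
proof -
  note r' = structure_closed[OF ringed V(1) r]
  show ?thesis
    using O_derivation_smult[OF D V r' A.one_closed[OF V(1)]] der_one[OF D V] der_zero[OF D V]
      add_hom_zero[OF B.pre.add_hom_smult[OF V(1) r']]
    by (simp add: unit_map_def)
qed

end

section \<open>Lifting derivations to the pair groupoid\<close>

context fibre_groupoid
begin

sublocale RA: relative_derivations Y A
  by (intro relative_derivations.intro derivation_sheaf.intro ringed A dg_hom_id)
sublocale RG: relative_derivations Y G
  by (intro relative_derivations.intro derivation_sheaf.intro ringed dg_G dg_hom_id)
sublocale RE: derivation_sheaf Y G A e
  by (intro derivation_sheaf.intro ringed A dg_G e_hom)

text \<open>Derivations extend most easily from the first tensor factor; the inverse of the groupoid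
  exchanges the factors.\<close>

lemma lift_exists:
  assumes U: "opn Y U" and T: "T \<in> RA.Der d U"
  shows "\<exists>D\<in>RG.Der d U. \<forall>l V a. opn Y V \<longrightarrow> V \<subseteq> U \<longrightarrow> a \<in> sec A l V \<longrightarrow>
    D l V (s l V a) = \<zero>\<^bsub>gsec G (l + d) V\<^esub> \<and> D l V (t l V a) = t (l + d) V (T l V a)"
proof -
  let ?w = "ext_fam Y A U (\<lambda>l V a. s (l + d) V (T l V a))"
  have w: "?w \<in> O_derivations Y A G s d U"
    by (rule hom_comp_O_derivation[OF A A dg_G T dg_hom_id s_hom]) (simp add: fid_def)
  have z: "?w l V (unit_map Y A l V r) = \<zero>\<^bsub>gsec G (l + d) V\<^esub>"
    if V: "opn Y V" "V \<subseteq> U" and r: "r \<in> sec (structure_alg Y) l V" for l V r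
    unfolding ext_fam_apply[OF V dg_hom_closed[OF dg_hom_unit_map[OF ringed A] V(1) r]] RA.der_unit[OF T V r]
    by (rule dg_hom_zero[OF A dg_G s_hom V(1)])
  \<comment> \<open>The derivation built below has \<open>iv\<close> on both sides and is a
    derivation along \<open>iv\<close> applied twice; to be a derivation of \<open>G\<close> it must
    be one along the identity.\<close>
  have iviv: "iv l V (iv l V x) = x" if "opn Y V" "x \<in> sec G l V" for l V x
    using hom_eq_on_square[OF dg_G dg_hom_comp[OF iv_hom iv_hom] dg_hom_id] that
    by (simp add: eq_on_sections_def fcomp_apply fid_apply[of _ _ x] fid_apply[of _ _ "s _ _ _"] fid_apply[of _ _ "t _ _ _"] iv_s iv_t)
  show ?thesis
  proof (rule tensor_product.tensor_derivation[OF square, folded fibre_square_def proj1_def proj2_def, OF U w])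
    show "?w l V (unit_map Y A l V r) = \<zero>\<^bsub>gsec G (l + d) V\<^esub>"
      if "opn Y V" "V \<subseteq> U" "r \<in> sec (structure_alg Y) l V" for l V r
      by (rule z[OF that])
  next
    fix D assume D: "D \<in> RG.Der d U"
      and s: "\<And>l V a. \<lbrakk>opn Y V; V \<subseteq> U; a \<in> sec A l V\<rbrakk> \<Longrightarrow> D l V (s l V a) = ?w l V a"
      and t: "\<And>l V a. \<lbrakk>opn Y V; V \<subseteq> U; a \<in> sec A l V\<rbrakk> \<Longrightarrow> D l V (t l V a) = \<zero>\<^bsub>gsec G (l + d) V\<^esub>"
    let ?E = "ext_fam Y G U (\<lambda>l V x. D l V (iv l V x))" and ?F = "\<lambda>E. ext_fam Y G U (\<lambda>l V x. iv (l + d) V (E l V x))"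
    have "?F ?E \<in> RG.Der d U"
      by (rule hom_comp_O_derivation[OF dg_G dg_G dg_G O_derivation_comp_hom[OF dg_G iv_hom D] iv_hom iv_hom])
        (simp_all add: fid_apply[of _ _ "iv _ _ _"] fid_apply[of _ _ "_ :: 'a \<Rightarrow> _"] iviv)
    then show ?thesis
    proof (intro bexI[of _ "?F ?E"] allI impI)
      fix l V a assume V: "opn Y V" "V \<subseteq> U" and a: "a \<in> sec A l V"
      show "?F ?E l V (s l V a) = \<zero>\<^bsub>gsec G (l + d) V\<^esub> \<and> ?F ?E l V (t l V a) = t (l + d) V (T l V a)"
        unfolding ext_fam_apply[OF V s_closed[OF V(1) a]] ext_fam_apply[OF V t_closed[OF V(1) a]] iv_s[OF V(1) a] iv_t[OF V(1) a]
          s[OF V a] t[OF V a] ext_fam_apply[OF V a] iv_s[OF V(1) O_derivation_closed[OF T V a]] dg_hom_zero[OF dg_G dg_G iv_hom V(1)]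
        by simp
    qed
  qed
qed

definition lift :: "int \<Rightarrow> 'a set \<Rightarrow> ('a, 'm, 'm) family \<Rightarrow> ('a, ('a, 'm, 'm) tsec, ('a, 'm, 'm) tsec) family" where
  "lift d U T = (SOME D. D \<in> RG.Der d U \<and> (\<forall>l V a. opn Y V \<longrightarrow> V \<subseteq> U \<longrightarrow> a \<in> sec A l V \<longrightarrow>
    D l V (s l V a) = \<zero>\<^bsub>gsec G (l + d) V\<^esub> \<and> D l V (t l V a) = t (l + d) V (T l V a)))"

lemma
  assumes U: "opn Y U" and T: "T \<in> RA.Der d U"
  shows lift_Der: "lift d U T \<in> RG.Der d U"
    and lift_s: "\<lbrakk>opn Y V; V \<subseteq> U; a \<in> sec A l V\<rbrakk> \<Longrightarrow> lift d U T l V (s l V a) = \<zero>\<^bsub>gsec G (l + d) V\<^esub>"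
    and lift_t: "\<lbrakk>opn Y V; V \<subseteq> U; a \<in> sec A l V\<rbrakk> \<Longrightarrow> lift d U T l V (t l V a) = t (l + d) V (T l V a)"
  using someI_ex[OF lift_exists[OF U T, unfolded Bex_def]] unfolding lift_def[symmetric] by simp_all

lemma lift_unique:
  assumes U: "opn Y U" and T: "T \<in> RA.Der d U" and D: "D \<in> RG.Der d U"
    and 1: "\<And>l V a. \<lbrakk>opn Y V; V \<subseteq> U; a \<in> sec A l V\<rbrakk> \<Longrightarrow> D l V (s l V a) = \<zero>\<^bsub>gsec G (l + d) V\<^esub>"
    and 2: "\<And>l V a. \<lbrakk>opn Y V; V \<subseteq> U; a \<in> sec A l V\<rbrakk> \<Longrightarrow> D l V (t l V a) = t (l + d) V (T l V a)"
  shows "D = lift d U T"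
  by (rule derivation_eq_on_square[OF dg_G D lift_Der[OF U T]]) (simp_all only: 1 2 lift_s[OF U T] lift_t[OF U T])

abbreviation "PG \<equiv> pair_groupoid Y A"
abbreviation "ru \<equiv> restrict_unit Y PG"

text \<open>Verticality is defined as linearity over functions of the source. Evaluated on the unit,
  which \<open>D\<close> kills, it says that \<open>D\<close> kills those functions; the Leibniz
  rule gives the converse. In this form it is the hypothesis for extending \<open>D\<close> to
  composable pairs.\<close>

lemma vertical_iff:
  assumes U: "opn Y U"
  shows "D \<in> vertical_derivations Y PG d U \<longleftrightarrow> D \<in> RG.Der d U \<and>
    (\<forall>l V a. opn Y V \<longrightarrow> V \<subseteq> U \<longrightarrow> a \<in> sec A l V \<longrightarrow> D l V (s l V a) = \<zero>\<^bsub>gsec G (l + d) V\<^esub>)"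
proof (intro iffI conjI allI impI)
  assume *: "D \<in> vertical_derivations Y PG d U"
  then show D: "D \<in> RG.Der d U" by (simp add: vertical_derivations_def pair_groupoid_simps)
  fix l V a assume V: "opn Y V" "V \<subseteq> U" and a: "a \<in> sec A l V"
  note sa = s_closed[OF V(1) a] and one = G.one_closed[OF V(1)]
  interpret M: abelian_group "gsec G (l + d) V" by (rule G.pre.abelian[OF V(1)])
  have "D (l + 0) V (gmul G l 0 V (s l V a) (gone G V)) =
      signed (gsec G (l + 0 + d) V) (d * l) (gmul G l (0 + d) V (s l V a) (D 0 V (gone G V)))"
    using * V a one by (simp add: vertical_derivations_def pair_groupoid_simps del: add_0_right)
  also have "gmul G l (0 + d) V (s l V a) (D 0 V (gone G V)) = \<zero>\<^bsub>gsec G (l + d) V\<^esub>"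
    using add_hom_zero[OF G.pre.mul_hom_right[OF refl V(1) sa]] RG.der_one[OF D V] by simp
  finally show "D l V (s l V a) = \<zero>\<^bsub>gsec G (l + d) V\<^esub>"
    using G.pre.one_right[OF V(1) sa] M.add.int_pow_one[of "ksign (d * l)"] by simp
next
  assume *: "D \<in> RG.Der d U \<and> (\<forall>l V a. opn Y V \<longrightarrow> V \<subseteq> U \<longrightarrow> a \<in> sec A l V \<longrightarrow> D l V (s l V a) = \<zero>\<^bsub>gsec G (l + d) V\<^esub>)"
  then have D: "D \<in> RG.Der d U" ..
  have z: "D l V (s l V a) = \<zero>\<^bsub>gsec G (l + d) V\<^esub>"
    if "opn Y V" "V \<subseteq> U" "a \<in> sec A l V" for l V a
    using * that by simp
  show "D \<in> vertical_derivations Y PG d U"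
    unfolding vertical_derivations_def pair_groupoid_simps
  proof (intro CollectI conjI allI impI ballI D; (elim conjE)?)
    fix p q V a x assume V: "opn Y V" "V \<subseteq> U" and a: "a \<in> sec A p V" and x: "x \<in> sec G q V"
    note sa = s_closed[OF V(1) a]
    interpret M: abelian_group "gsec G (p + q + d) V" by (rule G.pre.abelian[OF V(1)])
    have k: "p + d + q = p + q + d" "p + (q + d) = p + q + d" by auto
    note w = G.mul_closed[OF V(1) sa O_derivation_closed[OF D V x], unfolded k]
    show "D (p + q) V (gmul G p q V (s p V a) x) =
        signed (gsec G (p + q + d) V) (d * p) (gmul G p (q + d) V (s p V a) (D q V x))"
      using O_derivation_mul[OF D V sa x] z[OF V a] add_hom_zero[OF G.pre.mul_hom_left[OF k(1) V(1) x]]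
        M.l_zero[OF G.pre.sign_closed[OF V(1) w]] by (simp add: fid_def)
  qed
qed

end

section \<open>Invariant derivations and restriction along the unit\<close>

context fibre_groupoid
begin

text \<open>The lift kills functions of the source, along which the left arrow of a composable pair
  is glued to the right one, so the derivation that acts on the left arrow only is well defined on
  pairs.\<close>

lemma lift_invariant:
  assumes U: "opn Y U" and T: "T \<in> RA.Der d U"
  shows "lift d U T \<in> invariant_derivations Y PG d U"
proof -
  let ?D = "lift d U T"
  note D = lift_Der[OF U T] and Ds = lift_s[OF U T] and Dt = lift_t[OF U T]
  let ?w = "ext_fam Y G U (\<lambda>l V x. pr.i1 (l + d) V (?D l V x))"
  have w: "?w \<in> O_derivations Y G pr.T pr.i1 d U"
    by (rule hom_comp_O_derivation[OF dg_G dg_G pr.dg_T D dg_hom_id pr.dg_hom_i1]) (simp add: fid_def)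
  have z: "?w l V (s l V a) = \<zero>\<^bsub>gsec pr.T (l + d) V\<^esub>" if V: "opn Y V" "V \<subseteq> U" and a: "a \<in> sec A l V" for l V a
    unfolding ext_fam_apply[OF V s_closed[OF V(1) a]] Ds[OF V a] by (rule dg_hom_zero[OF dg_G pr.dg_T pr.dg_hom_i1 V(1)])
  have "\<exists>D1\<in>O_derivations Y pr.T pr.T fid d U. \<forall>l V. opn Y V \<and> V \<subseteq> U \<longrightarrow> (\<forall>x\<in>sec G l V.
      D1 l V (pr.i1 l V x) = pr.i1 (l + d) V (?D l V x) \<and> D1 l V (pr.i2 l V x) = \<zero>\<^bsub>gsec pr.T (l + d) V\<^esub> \<and>
      D1 l V (mu l V x) = mu (l + d) V (?D l V x))"
  proof (rule pr.tensor_derivation[OF U w])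
    show "?w l V (s l V a) = \<zero>\<^bsub>gsec pr.T (l + d) V\<^esub>" if "opn Y V" "V \<subseteq> U" "a \<in> sec A l V" for l V a
      by (rule z[OF that])
    fix D1 assume D1: "D1 \<in> O_derivations Y pr.T pr.T fid d U"
      and 1: "\<And>l V x. \<lbrakk>opn Y V; V \<subseteq> U; x \<in> sec G l V\<rbrakk> \<Longrightarrow> D1 l V (pr.i1 l V x) = ?w l V x"
      and 2: "\<And>l V x. \<lbrakk>opn Y V; V \<subseteq> U; x \<in> sec G l V\<rbrakk> \<Longrightarrow> D1 l V (pr.i2 l V x) = \<zero>\<^bsub>gsec pr.T (l + d) V\<^esub>"
    have 1: "D1 l V (pr.i1 l V x) = pr.i1 (l + d) V (?D l V x)" if "opn Y V" "V \<subseteq> U" "x \<in> sec G l V" for l V x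
      unfolding 1[OF that] by (rule ext_fam_apply[OF that])
    \<comment> \<open>Both sides are derivations along \<open>mu\<close>. On functions of the
      source, which \<open>mu\<close> takes from the right arrow, both vanish; on functions of the
      target, which \<open>mu\<close> takes from the left arrow, both are given by
      \<open>T\<close>.\<close>
    have "ext_fam Y G U (\<lambda>l V x. D1 l V (mu l V x)) = ext_fam Y G U (\<lambda>l V x. mu (l + d) V (?D l V x))"
    proof (rule derivation_eq_on_square[OF pr.dg_T])
      show "ext_fam Y G U (\<lambda>l V x. D1 l V (mu l V x)) \<in> O_derivations Y G pr.T mu d U"
        by (rule O_derivation_comp_hom[OF dg_G mu_hom D1]) (simp add: fid_def)
      show "ext_fam Y G U (\<lambda>l V x. mu (l + d) V (?D l V x)) \<in> O_derivations Y G pr.T mu d U"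
        by (rule hom_comp_O_derivation[OF dg_G dg_G pr.dg_T D dg_hom_id mu_hom]) (simp add: fid_def)
      fix l V a assume V: "opn Y V" "V \<subseteq> U" and a: "a \<in> sec A l V"
      note sa = s_closed[OF V(1) a] and ta = t_closed[OF V(1) a]
      show "ext_fam Y G U (\<lambda>l V x. D1 l V (mu l V x)) l V (s l V a) = ext_fam Y G U (\<lambda>l V x. mu (l + d) V (?D l V x)) l V (s l V a)"
        unfolding ext_fam_apply[OF V sa] mu_s[OF V(1) a] 2[OF V sa] Ds[OF V a]
        by (rule dg_hom_zero[OF dg_G pr.dg_T mu_hom V(1), symmetric])
      show "ext_fam Y G U (\<lambda>l V x. D1 l V (mu l V x)) l V (t l V a) = ext_fam Y G U (\<lambda>l V x. mu (l + d) V (?D l V x)) l V (t l V a)"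
        unfolding ext_fam_apply[OF V ta] mu_t[OF V(1) a] 1[OF V ta] Dt[OF V a] mu_t[OF V(1) O_derivation_closed[OF T V a]] ..
    qed
    note mu = this[THEN fun_cong, THEN fun_cong, THEN fun_cong]
    show ?thesis
    proof (intro bexI[OF _ D1] allI impI ballI conjI; (elim conjE)?)
      fix l V x assume V: "opn Y V" "V \<subseteq> U" and x: "x \<in> sec G l V"
      show "D1 l V (pr.i1 l V x) = pr.i1 (l + d) V (?D l V x)" by (rule 1[OF V x])
      show "D1 l V (pr.i2 l V x) = \<zero>\<^bsub>gsec pr.T (l + d) V\<^esub>" by (rule 2[OF V x])
      show "D1 l V (mu l V x) = mu (l + d) V (?D l V x)" using mu[of l V x] unfolding ext_fam_apply[OF V x] .
    qed
  qed
  moreover have "?D \<in> vertical_derivations Y PG d U" unfolding vertical_iff[OF U] using D Ds by simp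
  ultimately show ?thesis unfolding invariant_derivations_def pair_groupoid_simps by simp
qed

text \<open>The anchor in the algebroid of the groupoid: since \<open>e\<close> after
  \<open>t\<close> is the identity, it turns a derivation along the unit into a derivation of
  \<open>A\<close>. It will be the inverse of \<open>\<Phi>\<close>.\<close>

definition "anc d U \<delta> = ext_fam Y A U (\<lambda>l V a. \<delta> l V (t l V a))"

lemma anc_Der: "\<delta> \<in> RE.Der d U \<Longrightarrow> anc d U \<delta> \<in> RA.Der d U"
  unfolding anc_def by (rule O_derivation_comp_hom[OF A t_hom], assumption, rule trans[OF fid_apply sym[OF e_t]])

lemma anc_apply: "\<lbrakk>opn Y V; V \<subseteq> U; a \<in> sec A l V\<rbrakk> \<Longrightarrow> anc d U \<delta> l V a = \<delta> l V (t l V a)"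
  unfolding anc_def by (rule ext_fam_apply)

lemma ru_Der: "D \<in> RG.Der d U \<Longrightarrow> ru d U D \<in> RE.Der d U"
  unfolding restrict_unit_def pair_groupoid_simps
  by (rule hom_comp_O_derivation[OF dg_G dg_G A _ dg_hom_id e_hom]) (simp_all add: fid_def)

lemma ru_apply: "\<lbrakk>opn Y V; V \<subseteq> U; x \<in> sec G l V\<rbrakk> \<Longrightarrow> ru d U D l V x = e (l + d) V (D l V x)"
  unfolding restrict_unit_def pair_groupoid_simps by (rule ext_fam_apply)

text \<open>The isomorphism of algebroids, from derivations of \<open>A\<close> to derivations along
  the unit.\<close>

abbreviation "\<Phi> d U T \<equiv> ru d U (lift d U T)"

lemma
  assumes U: "opn Y U" and T: "T \<in> RA.Der d U"
    and V: "opn Y V" "V \<subseteq> U" and a: "a \<in> sec A l V"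
  shows \<Phi>_s: "\<Phi> d U T l V (s l V a) = \<zero>\<^bsub>gsec A (l + d) V\<^esub>"
    and \<Phi>_t: "\<Phi> d U T l V (t l V a) = T l V a"
  unfolding ru_apply[OF V s_closed[OF V(1) a]] ru_apply[OF V t_closed[OF V(1) a]] lift_s[OF U T V a] lift_t[OF U T V a]
  by (rule dg_hom_zero[OF dg_G A e_hom V(1)], rule e_t[OF V(1) O_derivation_closed[OF T V a]])

lemma \<Phi>_unique:
  assumes U: "opn Y U" and T: "T \<in> RA.Der d U" and \<delta>: "\<delta> \<in> RE.Der d U"
    and 1: "\<And>l V a. \<lbrakk>opn Y V; V \<subseteq> U; a \<in> sec A l V\<rbrakk> \<Longrightarrow> \<delta> l V (s l V a) = \<zero>\<^bsub>gsec A (l + d) V\<^esub>"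
    and 2: "\<And>l V a. \<lbrakk>opn Y V; V \<subseteq> U; a \<in> sec A l V\<rbrakk> \<Longrightarrow> \<delta> l V (t l V a) = T l V a"
  shows "\<delta> = \<Phi> d U T"
  by (rule derivation_eq_on_square[OF A \<delta> ru_Der[OF lift_Der[OF U T]]]) (simp_all only: 1 2 \<Phi>_s[OF U T] \<Phi>_t[OF U T])

lemma anc_\<Phi>:
  assumes U: "opn Y U" and T: "T \<in> RA.Der d U"
  shows "anc d U (\<Phi> d U T) = T"
  by (rule O_derivation_eqI[OF anc_Der[OF ru_Der[OF lift_Der[OF U T]]] T]) (simp only: anc_apply \<Phi>_t[OF U T])

text \<open>The relation defining invariance equates the two images of \<open>D (t a)\<close> in the functions on
  composable pairs; pulling it back along \<open>h \<mapsto> (1, h)\<close> shows that \<open>D (t a)\<close> is a function of the target.\<close>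

lemma invariant_eq_lift:
  assumes U: "opn Y U" and D: "D \<in> invariant_derivations Y PG d U"
  shows "D = lift d U (anc d U (ru d U D))"
proof -
  have v: "D \<in> vertical_derivations Y PG d U" using D by (simp add: invariant_derivations_def)
  then have DG: "D \<in> RG.Der d U" and Ds: "\<And>l V a. \<lbrakk>opn Y V; V \<subseteq> U; a \<in> sec A l V\<rbrakk> \<Longrightarrow> D l V (s l V a) = \<zero>\<^bsub>gsec G (l + d) V\<^esub>"
    by (simp_all add: vertical_iff[OF U])
  have te: "dg_alg_hom Y G G (t \<circ>\<circ>\<circ> e)" by (rule dg_hom_comp[OF e_hom t_hom])
  have c: "(t \<circ>\<circ>\<circ> e) l V (s l V a) = fid l V (t l V a)" if "opn Y V" "a \<in> sec A l V" for l V a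
    by (simp only: fcomp_apply fid_apply[of l V] e_s[OF that])
  obtain D1 where D1: "\<forall>l V. opn Y V \<and> V \<subseteq> U \<longrightarrow> (\<forall>x\<in>sec G l V.
      D1 l V (pr.i1 l V x) = pr.i1 (l + d) V (D l V x) \<and> D1 l V (pr.i2 l V x) = \<zero>\<^bsub>gsec pr.T (l + d) V\<^esub> \<and>
      D1 l V (mu l V x) = mu (l + d) V (D l V x))"
    using D unfolding invariant_derivations_def pair_groupoid_simps by auto
  show ?thesis
  proof (rule lift_unique[OF U anc_Der[OF ru_Der[OF DG]] DG Ds])
    fix l V a assume V: "opn Y V" "V \<subseteq> U" and a: "a \<in> sec A l V"
    note ta = t_closed[OF V(1) a] note w = O_derivation_closed[OF DG V ta]
    note * = D1[rule_format, OF conjI[OF V] ta]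
    \<comment> \<open>The function \<open>t a\<close> has the same image under \<open>mu\<close> and
      under \<open>pr.i1\<close>, because the target of a composite is the target of its left arrow.
      Applying \<open>D1\<close> to this one function in the two ways prescribed by invariance gives
      the equation.\<close>
    have w12: "pr.i1 (l + d) V (D l V (t l V a)) = mu (l + d) V (D l V (t l V a))"
      by (rule trans[OF sym[OF *[THEN conjunct1]] *[THEN conjunct2, THEN conjunct2, unfolded mu_t[OF V(1) a]]])
    \<comment> \<open>The homomorphism \<open>copair\<close> with components
      \<open>t \<circ>\<circ>\<circ> e\<close> and the identity is pullback along the map that sends
      an arrow \<open>h\<close> to the pair consisting of the unit at its target and
      \<open>h\<close> itself.\<close>
    have "(t \<circ>\<circ>\<circ> e) (l + d) V (D l V (t l V a)) =
        copair Y A G s G t G (t \<circ>\<circ>\<circ> e) fid (l + d) V (pr.i1 (l + d) V (D l V (t l V a)))"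
      by (rule pr.copair_i1[OF dg_G te dg_hom_id c V(1) w, symmetric])
    also have "\<dots> = cps G (t \<circ>\<circ>\<circ> e) fid (l + d) V (D l V (t l V a))"
      unfolding w12 fcomp_apply[of _ mu] ..
    \<comment> \<open>The left unit law of the groupoid.\<close>
    also have "\<dots> = D l V (t l V a)"
      using dg_groupoid_pair_groupoid V(1) w unfolding dg_groupoid_def pair_groupoid_simps eq_on_sections_def
      by (simp add: fid_apply[of "l + d"])
    finally show "D l V (t l V a) = t (l + d) V (anc d U (ru d U D) l V a)"
      unfolding anc_apply[OF V a] ru_apply[OF V ta] fcomp_apply[of t e] by (rule sym)
  qed
qed

text \<open>The local condition in the definition forces \<open>\<delta>\<close> to kill functions
  of the source, since vanishing can be tested locally. Conversely such a \<open>\<delta>\<close> is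
  determined by its values on functions of the target, so it is the restriction of the lift of its
  anchor, over all of \<open>U\<close> at once.\<close>

lemma restricted_iff:
  assumes U: "opn Y U"
  shows "\<delta> \<in> restricted_derivations Y PG d U \<longleftrightarrow> \<delta> \<in> RE.Der d U \<and>
    (\<forall>l V a. opn Y V \<longrightarrow> V \<subseteq> U \<longrightarrow> a \<in> sec A l V \<longrightarrow> \<delta> l V (s l V a) = \<zero>\<^bsub>gsec A (l + d) V\<^esub>)"
proof (intro iffI conjI allI impI)
  assume *: "\<delta> \<in> restricted_derivations Y PG d U"
  then show \<delta>: "\<delta> \<in> RE.Der d U" by (simp add: restricted_derivations_def pair_groupoid_simps)
  fix l V a assume V: "opn Y V" "V \<subseteq> U" and a: "a \<in> sec A l V"
  note sa = s_closed[OF V(1) a]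
  show "\<delta> l V (s l V a) = \<zero>\<^bsub>gsec A (l + d) V\<^esub>"
  proof (rule sheaf_eqI[OF A.sheaf V(1) O_derivation_closed[OF \<delta> V sa] A.pre.zero_closed[OF V(1)]])
    fix y assume y: "y \<in> V"
    then have "y \<in> U" using V by blast
    then obtain W D where W: "opn Y W" "y \<in> W" "W \<subseteq> U" and D: "D \<in> vertical_derivations Y PG d W"
      and eq: "ext_fam Y G W \<delta> = ru d W D"
      using * unfolding restricted_derivations_def pair_groupoid_simps by auto
    have D': "D \<in> RG.Der d W" and Ds: "\<And>l V a. \<lbrakk>opn Y V; V \<subseteq> W; a \<in> sec A l V\<rbrakk> \<Longrightarrow> D l V (s l V a) = \<zero>\<^bsub>gsec G (l + d) V\<^esub>"
      using D by (simp_all add: vertical_iff[OF W(1)])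
    let ?N = "V \<inter> W"
    have N: "opn Y ?N" and NV: "?N \<subseteq> V" and NW: "?N \<subseteq> W" using V(1) W(1) by auto
    note a' = A.pre.res_closed[OF V(1) N NV a] note sa' = s_closed[OF N a']
    have "gres A (l + d) V ?N (\<delta> l V (s l V a)) = \<delta> l ?N (s l ?N (gres A l V ?N a))"
      by (simp only: O_derivation_res[OF \<delta> V N NV sa] dg_hom_res[OF s_hom V(1) N NV a])
    also have "\<dots> = e (l + d) ?N (D l ?N (s l ?N (gres A l V ?N a)))"
      using eq[THEN fun_cong, THEN fun_cong, THEN fun_cong, of l ?N "s l ?N (gres A l V ?N a)"]
      unfolding ext_fam_apply[OF N NW sa'] ru_apply[OF N NW sa'] .
    also have "\<dots> = \<zero>\<^bsub>gsec A (l + d) ?N\<^esub>"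
      unfolding Ds[OF N NW a'] by (rule dg_hom_zero[OF dg_G A e_hom N])
    finally have "gres A (l + d) V ?N (\<delta> l V (s l V a)) = gres A (l + d) V ?N \<zero>\<^bsub>gsec A (l + d) V\<^esub>"
      by (simp only: add_hom_zero[OF A.pre.add_hom_res[OF V(1) N NV]])
    then show "\<exists>N. opn Y N \<and> y \<in> N \<and> N \<subseteq> V \<and> gres A (l + d) V N (\<delta> l V (s l V a)) = gres A (l + d) V N \<zero>\<^bsub>gsec A (l + d) V\<^esub>"
      using N NV y W(2) by (intro exI[of _ ?N]) simp
  qed
next
  assume *: "\<delta> \<in> RE.Der d U \<and> (\<forall>l V a. opn Y V \<longrightarrow> V \<subseteq> U \<longrightarrow> a \<in> sec A l V \<longrightarrow> \<delta> l V (s l V a) = \<zero>\<^bsub>gsec A (l + d) V\<^esub>)"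
  then have \<delta>: "\<delta> \<in> RE.Der d U" ..
  note T = anc_Der[OF \<delta>]
  have eq: "\<delta> = \<Phi> d U (anc d U \<delta>)"
    by (rule \<Phi>_unique[OF U T \<delta>]) (use * in \<open>simp_all add: anc_apply\<close>)
  have "lift d U (anc d U \<delta>) \<in> vertical_derivations Y PG d U"
    using lift_invariant[OF U T] by (simp add: invariant_derivations_def)
  moreover have "ext_fam Y G U \<delta> = \<Phi> d U (anc d U \<delta>)" using O_derivation_ext[OF \<delta>] eq by simp
  ultimately show "\<delta> \<in> restricted_derivations Y PG d U"
    unfolding restricted_derivations_def pair_groupoid_simps using \<delta> U by auto
qed

lemma
  assumes U: "opn Y U" and \<delta>: "\<delta> \<in> restricted_derivations Y PG d U"
  shows restricted_anc_Der: "anc d U \<delta> \<in> RA.Der d U" and \<Phi>_anc: "\<Phi> d U (anc d U \<delta>) = \<delta>"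
proof -
  have *: "\<delta> \<in> RE.Der d U" "\<And>l V a. \<lbrakk>opn Y V; V \<subseteq> U; a \<in> sec A l V\<rbrakk> \<Longrightarrow> \<delta> l V (s l V a) = \<zero>\<^bsub>gsec A (l + d) V\<^esub>"
    using \<delta> by (simp_all add: restricted_iff[OF U])
  show T: "anc d U \<delta> \<in> RA.Der d U" by (rule anc_Der[OF *(1)])
  show "\<Phi> d U (anc d U \<delta>) = \<delta>"
    by (rule \<Phi>_unique[OF U T *, symmetric]) (simp_all only: anc_apply)
qed

lemma \<Phi>_restricted:
  assumes U: "opn Y U" and T: "T \<in> RA.Der d U"
  shows "\<Phi> d U T \<in> restricted_derivations Y PG d U"
  unfolding restricted_iff[OF U] using ru_Der[OF lift_Der[OF U T]] by (simp add: \<Phi>_s[OF U T])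

lemma bij_\<Phi>: "opn Y U \<Longrightarrow> bij_betw (\<Phi> d U) (RA.Der d U) (restricted_derivations Y PG d U)"
  by (rule bij_betw_byWitness[of _ "anc d U"])
    (auto simp: anc_\<Phi> \<Phi>_anc restricted_anc_Der \<Phi>_restricted)

text \<open>The inverse passes through derivations of \<open>A\<close>: it lifts the anchor. An
  invariant derivation is the lift of the anchor of its restriction, so the two composites are
  identities.\<close>

lemma bij_restrict_unit:
  assumes U: "opn Y U"
  shows "bij_betw (ru d U) (invariant_derivations Y PG d U) (restricted_derivations Y PG d U)"
proof (rule bij_betw_byWitness[of _ "\<lambda>\<delta>. lift d U (anc d U \<delta>)"])
  have v: "D \<in> RG.Der d U" if "D \<in> invariant_derivations Y PG d U" for D
    using that by (simp add: invariant_derivations_def vertical_iff[OF U])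
  show "\<forall>D\<in>invariant_derivations Y PG d U. lift d U (anc d U (ru d U D)) = D"
    using invariant_eq_lift[OF U, symmetric] by blast
  show "\<forall>\<delta>\<in>restricted_derivations Y PG d U. \<Phi> d U (anc d U \<delta>) = \<delta>"
    using \<Phi>_anc[OF U] by blast
  show "ru d U ` invariant_derivations Y PG d U \<subseteq> restricted_derivations Y PG d U"
  proof (rule image_subsetI)
    fix D assume D: "D \<in> invariant_derivations Y PG d U"
    show "ru d U D \<in> restricted_derivations Y PG d U"
      by (subst invariant_eq_lift[OF U D]) (rule \<Phi>_restricted[OF U anc_Der[OF ru_Der[OF v[OF D]]]])
  qed
  show "(\<lambda>\<delta>. lift d U (anc d U \<delta>)) ` restricted_derivations Y PG d U \<subseteq> invariant_derivations Y PG d U"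
    by (rule image_subsetI) (rule lift_invariant[OF U restricted_anc_Der[OF U]])
qed

text \<open>The bracket of the algebroid of the groupoid is written with the definite description in
  \<open>invariant_lift\<close>; this evaluates it on the image of \<open>\<Phi>\<close>.\<close>

lemma invariant_lift_\<Phi>:
  assumes U: "opn Y U" and T: "T \<in> RA.Der d U"
  shows "invariant_lift Y PG d U (\<Phi> d U T) = lift d U T"
  unfolding invariant_lift_def
proof (rule the_equality)
  show "lift d U T \<in> invariant_derivations Y PG d U \<and> \<Phi> d U T = \<Phi> d U T" by (simp add: lift_invariant[OF U T])
  fix D assume "D \<in> invariant_derivations Y PG d U \<and> ru d U D = \<Phi> d U T"
  then show "D = lift d U T" using invariant_eq_lift[OF U, of D d] anc_\<Phi>[OF U T] by simp
qed

end

section \<open>The isomorphism of algebroids\<close>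

context fibre_groupoid
begin

text \<open>Here \<open>D\<close> need not be vertical; it only has to project to \<open>S\<close>
  along the source and to \<open>T\<close> along the target. The case \<open>S = 0\<close> gives
  compatibility with brackets, and the differential of the arrows, which projects to the
  differential of \<open>A\<close> on both sides, gives compatibility with differentials.\<close>

lemma comm_lift:
  assumes U: "opn Y U" and S: "S \<in> RA.Der d U" and T: "T \<in> RA.Der d U" and T': "T' \<in> RA.Der n U"
    and D: "D \<in> RG.Der d U"
    and 1: "\<And>l V a. \<lbrakk>opn Y V; V \<subseteq> U; a \<in> sec A l V\<rbrakk> \<Longrightarrow> D l V (s l V a) = s (l + d) V (S l V a)"
    and 2: "\<And>l V a. \<lbrakk>opn Y V; V \<subseteq> U; a \<in> sec A l V\<rbrakk> \<Longrightarrow> D l V (t l V a) = t (l + d) V (T l V a)"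
  shows "RG.comm d n U D (lift n U T') = lift (d + n) U (RA.comm d n U T T')"
proof (rule lift_unique[OF U RA.comm_Der[OF U T T'] RG.comm_Der[OF U D lift_Der[OF U T']]])
  have k: "l + n + d = l + (d + n)" "l + d + n = l + (d + n)" for l by auto
  fix l V a assume V: "opn Y V" "V \<subseteq> U" and a: "a \<in> sec A l V"
  note sa = s_closed[OF V(1) a] and ta = t_closed[OF V(1) a]
  note Sa = O_derivation_closed[OF S V a] and Ta = O_derivation_closed[OF T V a] and T'a = O_derivation_closed[OF T' V a]
  interpret M: abelian_group "gsec G (l + (d + n)) V" by (rule G.pre.abelian[OF V(1)])
  show "RG.comm d n U D (lift n U T') l V (s l V a) = \<zero>\<^bsub>gsec G (l + (d + n)) V\<^esub>"
    unfolding RG.comm_apply[OF V sa] lift_s[OF U T' V a] 1[OF V a] lift_s[OF U T' V Sa] RG.der_zero[OF D V] k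
      M.add.int_pow_one by (simp add: M.minus_eq)
  note TT' = O_derivation_closed[OF T V T'a, unfolded k] and T'T = O_derivation_closed[OF T' V Ta, unfolded k]
  note h = add_hom_dg[OF t_hom V(1) A.pre.abelian[OF V(1)] G.pre.abelian[OF V(1)]]
  show "RG.comm d n U D (lift n U T') l V (t l V a) = t (l + (d + n)) V (RA.comm d n U T T' l V a)"
    unfolding RG.comm_apply[OF V ta] RA.comm_apply[OF V a] lift_t[OF U T' V a] 2[OF V a] lift_t[OF U T' V Ta] 2[OF V T'a] k
      add_hom_minus[OF h TT' A.pre.sign_closed[OF V(1) T'T]] add_hom_pow[OF h T'T] ..
qed

lemma lift_comm:
  assumes U: "opn Y U" and T: "T \<in> RA.Der d U" and T': "T' \<in> RA.Der n U"
  shows "lift (d + n) U (RA.comm d n U T T') = RG.comm d n U (lift d U T) (lift n U T')"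
proof (rule comm_lift[OF U RA.zero_Der[OF U] T T' lift_Der[OF U T] _ lift_t[OF U T], symmetric])
  fix l V a assume V: "opn Y V" "V \<subseteq> U" and a: "a \<in> sec A l V"
  show "lift d U T l V (s l V a) = s (l + d) V (fam_zero Y A A d U l V a)"
    unfolding lift_s[OF U T V a] RA.fam_zero_apply[OF V a] dg_hom_zero[OF A dg_G s_hom V(1)] ..
qed

lemma lift_comm_Q:
  assumes U: "opn Y U" and T: "T \<in> RA.Der d U"
  shows "lift (1 + d) U (RA.comm 1 d U (RA.Q U) T) = RG.comm 1 d U (RG.Q U) (lift d U T)"
proof (rule comm_lift[OF U RA.Q_Der[OF U] RA.Q_Der[OF U] T RG.Q_Der[OF U], symmetric])
  fix l V a assume V: "opn Y V" "V \<subseteq> U" and a: "a \<in> sec A l V"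
  show "RG.Q U l V (s l V a) = s (l + 1) V (RA.Q U l V a)"
    unfolding RG.Q_apply[OF V s_closed[OF V(1) a]] RA.Q_apply[OF V a] dg_hom_dif[OF s_hom V(1) a] ..
  show "RG.Q U l V (t l V a) = t (l + 1) V (RA.Q U l V a)"
    unfolding RG.Q_apply[OF V t_closed[OF V(1) a]] RA.Q_apply[OF V a] dg_hom_dif[OF t_hom V(1) a] ..
qed

lemma
  assumes U: "opn Y U" and T: "T \<in> RA.Der d U"
  shows \<Phi>_add: "T' \<in> RA.Der d U \<Longrightarrow> \<Phi> d U (fam_add Y A A d U T T') = fam_add Y G A d U (\<Phi> d U T) (\<Phi> d U T')"
    and \<Phi>_smult: "r \<in> carrier (rsec Y U) \<Longrightarrow> \<Phi> d U (fam_smult Y A A d U r T) = fam_smult Y G A d U r (\<Phi> d U T)"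
    and \<Phi>_act: "b \<in> sec A p U \<Longrightarrow> \<Phi> (p + d) U (fam_act Y A A p d U b T) = fam_act Y G A p d U b (\<Phi> d U T)"
    and \<Phi>_res: "opn Y W \<Longrightarrow> W \<subseteq> U \<Longrightarrow> \<Phi> d W (ext_fam Y A W T) = ext_fam Y G W (\<Phi> d U T)"
proof -
  note P = ru_Der[OF lift_Der[OF U T]]
  { assume T': "T' \<in> RA.Der d U"
    show "\<Phi> d U (fam_add Y A A d U T T') = fam_add Y G A d U (\<Phi> d U T) (\<Phi> d U T')"
    proof (rule \<Phi>_unique[OF U RA.add_Der[OF U T T'] RE.add_Der[OF U P ru_Der[OF lift_Der[OF U T']]], symmetric])
      fix l V a assume V: "opn Y V" "V \<subseteq> U" and a: "a \<in> sec A l V"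
      interpret M: abelian_group "gsec A (l + d) V" by (rule A.pre.abelian[OF V(1)])
      show "fam_add Y G A d U (\<Phi> d U T) (\<Phi> d U T') l V (s l V a) = \<zero>\<^bsub>gsec A (l + d) V\<^esub>"
        unfolding RE.fam_add_apply[OF V s_closed[OF V(1) a]] \<Phi>_s[OF U T V a] \<Phi>_s[OF U T' V a] by simp
      show "fam_add Y G A d U (\<Phi> d U T) (\<Phi> d U T') l V (t l V a) = fam_add Y A A d U T T' l V a"
        unfolding RE.fam_add_apply[OF V t_closed[OF V(1) a]] RA.fam_add_apply[OF V a] \<Phi>_t[OF U T V a] \<Phi>_t[OF U T' V a] ..
    qed }
  { assume r: "r \<in> carrier (rsec Y U)"
    show "\<Phi> d U (fam_smult Y A A d U r T) = fam_smult Y G A d U r (\<Phi> d U T)"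
    proof (rule \<Phi>_unique[OF U RA.smult_Der[OF U r T] RE.smult_Der[OF U r P], symmetric])
      fix l V a assume V: "opn Y V" "V \<subseteq> U" and a: "a \<in> sec A l V"
      show "fam_smult Y G A d U r (\<Phi> d U T) l V (s l V a) = \<zero>\<^bsub>gsec A (l + d) V\<^esub>"
        unfolding RE.fam_smult_apply[OF V s_closed[OF V(1) a]] \<Phi>_s[OF U T V a]
        by (rule add_hom_zero[OF A.pre.add_hom_smult[OF V(1) ringed_res_closed[OF ringed U V r]]])
      show "fam_smult Y G A d U r (\<Phi> d U T) l V (t l V a) = fam_smult Y A A d U r T l V a"
        unfolding RE.fam_smult_apply[OF V t_closed[OF V(1) a]] RA.fam_smult_apply[OF V a] \<Phi>_t[OF U T V a] ..
    qed }
  { assume b: "b \<in> sec A p U"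
    show "\<Phi> (p + d) U (fam_act Y A A p d U b T) = fam_act Y G A p d U b (\<Phi> d U T)"
    proof (rule \<Phi>_unique[OF U RA.act_Der[OF U b T] RE.act_Der[OF U b P], symmetric])
      fix l V a assume V: "opn Y V" "V \<subseteq> U" and a: "a \<in> sec A l V"
      have k: "p + (l + d) = l + (p + d)" by simp
      show "fam_act Y G A p d U b (\<Phi> d U T) l V (s l V a) = \<zero>\<^bsub>gsec A (l + (p + d)) V\<^esub>"
        unfolding RE.fam_act_apply[OF V s_closed[OF V(1) a]] \<Phi>_s[OF U T V a]
        by (rule add_hom_zero[OF A.pre.mul_hom_right[OF k V(1) A.pre.res_closed[OF U V b]]])
      show "fam_act Y G A p d U b (\<Phi> d U T) l V (t l V a) = fam_act Y A A p d U b T l V a"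
        unfolding RE.fam_act_apply[OF V t_closed[OF V(1) a]] RA.fam_act_apply[OF V a] \<Phi>_t[OF U T V a] ..
    qed }
  assume W: "opn Y W" "W \<subseteq> U"
  show "\<Phi> d W (ext_fam Y A W T) = ext_fam Y G W (\<Phi> d U T)"
  proof (rule \<Phi>_unique[OF W(1) RA.restrict_Der[OF T W(2)] RE.restrict_Der[OF P W(2)], symmetric])
    fix l V a assume V: "opn Y V" "V \<subseteq> W" and a: "a \<in> sec A l V"
    have VU: "V \<subseteq> U" using V W by blast
    show "ext_fam Y G W (\<Phi> d U T) l V (s l V a) = \<zero>\<^bsub>gsec A (l + d) V\<^esub>"
      unfolding ext_fam_apply[OF V s_closed[OF V(1) a]] by (rule \<Phi>_s[OF U T V(1) VU a])
    show "ext_fam Y G W (\<Phi> d U T) l V (t l V a) = ext_fam Y A W T l V a"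
      unfolding ext_fam_apply[OF V t_closed[OF V(1) a]] ext_fam_apply[OF V a] by (rule \<Phi>_t[OF U T V(1) VU a])
  qed
qed

lemma groupoid_algebroid_simps:
  "gsec (groupoid_algebroid Y PG) = fam_module Y G A (restricted_derivations Y PG)"
  "gres (groupoid_algebroid Y PG) d U V \<delta> = ext_fam Y G V \<delta>"
  "lact (groupoid_algebroid Y PG) = fam_act Y G A"
  "lbr (groupoid_algebroid Y PG) d n U \<delta> \<delta>' =
     ru (d + n) U (RG.comm d n U (invariant_lift Y PG d U \<delta>) (invariant_lift Y PG n U \<delta>'))"
  "ldif (groupoid_algebroid Y PG) d U \<delta> = ext_fam Y G U (\<lambda>l V x.
     gdif A (l + d) V (\<delta> l V x) \<ominus>\<^bsub>gsec A (l + d + 1) V\<^esub> signed (gsec A (l + d + 1) V) d (\<delta> (l + 1) V (gdif G l V x)))"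
  "lanc (groupoid_algebroid Y PG) d U \<delta> = anc d U \<delta>"
  by (simp_all add: groupoid_algebroid_def pair_groupoid_simps anc_def)

text \<open>The lift of the commutator with the differential of \<open>A\<close> is the commutator
  with the differential of the arrows. Because the unit commutes with differentials, its restriction
  is the formula that defines \<open>ldif\<close>.\<close>

lemma \<Phi>_dif:
  assumes U: "opn Y U" and T: "T \<in> RA.Der d U"
  shows "\<Phi> (d + 1) U (fam_commutator Y A 1 d U (gdif A) T) = ldif (groupoid_algebroid Y PG) d U (\<Phi> d U T)"
proof -
  have k: "d + 1 = 1 + d" by simp
  show ?thesis
    unfolding k RA.comm_dif[OF T] lift_comm_Q[OF U T] groupoid_algebroid_simps
    unfolding restrict_unit_def[of Y PG "1 + d"] pair_groupoid_simps
  proof (rule ext_fam_cong)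
    have k: "l + d + 1 = l + (1 + d)" "l + 1 + d = l + (1 + d)" for l by auto
    fix l V x assume V: "opn Y V" "V \<subseteq> U" and x: "x \<in> sec G l V"
    note D = lift_Der[OF U T] note Dx = O_derivation_closed[OF D V x] and dx = G.dif_closed[OF V(1) x]
    note y = G.dif_closed[OF V(1) Dx, unfolded k] and z = O_derivation_closed[OF D V dx, unfolded k]
    note h = add_hom_dg[OF e_hom V(1) G.pre.abelian[OF V(1)] A.pre.abelian[OF V(1)]]
    show "e (l + (1 + d)) V (RG.comm 1 d U (RG.Q U) (lift d U T) l V x) =
        gdif A (l + d) V (\<Phi> d U T l V x) \<ominus>\<^bsub>gsec A (l + d + 1) V\<^esub>
        signed (gsec A (l + d + 1) V) d (\<Phi> d U T (l + 1) V (gdif G l V x))"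
      unfolding RG.comm_apply[OF V x] RG.Q_apply[OF V Dx] RG.Q_apply[OF V x] ru_apply[OF V x] ru_apply[OF V dx] k
        add_hom_minus[OF h y G.pre.sign_closed[OF V(1) z]] add_hom_pow[OF h z] dg_hom_dif[OF e_hom V(1) Dx, unfolded k] mult_1 ..
  qed
qed

theorem algebroid_of_pair_groupoid: "is_algebroid_of_groupoid Y A (relative_tangent Y A) PG"
  unfolding is_algebroid_of_groupoid_def
proof (intro conjI exI[of _ \<Phi>] allI impI bij_restrict_unit; (rule dg_groupoid_pair_groupoid pair_groupoid_simps)?)
  show "algebroid_iso Y A (relative_tangent Y A) (groupoid_algebroid Y PG) \<Phi>"
    unfolding algebroid_iso_def relative_tangent_simps groupoid_algebroid_simps fam_module_def partial_object.simps
      ring.simps monoid.simps module.simps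
    by (intro conjI allI impI ballI; (elim conjE)?)
      (simp_all add: bij_\<Phi> \<Phi>_add \<Phi>_smult \<Phi>_act lift_comm invariant_lift_\<Phi> \<Phi>_dif[unfolded groupoid_algebroid_simps] anc_\<Phi> \<Phi>_res)
qed

end

theorem proposition1p1:
  fixes K :: "'k ring"
    and Z :: "('x, 's, 'k) kspace" and Y :: "('a, 'r, 'k) kspace"
    and i :: "'x \<Rightarrow> 'a" and i_sharp :: "'a set \<Rightarrow> 'r \<Rightarrow> 's"
    and E :: "('a, 'r, 'e) gmod" and A :: "('a, 'r, 'm) dgalg"
    and \<theta> :: "('a, 'a \<Rightarrow> ('a set \<times> (('r, 'e) smono \<Rightarrow>\<^sub>0 int) set) set, 'm) family"
    and \<epsilon> :: "('a, 'm, 's) family"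
  assumes "alg_closed_char_zero K"
    and "smooth_variety K Z" and "smooth_variety K Y"
    and "closed_embedding K Z Y i i_sharp"
    and "smooth_resolution Z Y i i_sharp E A \<theta> \<epsilon>"
  shows "dg_lie_algebroid_over_OY K Y A (relative_tangent Y A) \<and>
    is_algebroid_of_groupoid Y A (relative_tangent Y A) (pair_groupoid Y A)"
proof
  have Y: "k_scheme K Y" using assms(3) by (simp add: smooth_variety_def)
  then have ringed: "is_ringed_space Y" by (simp add: k_scheme_def is_scheme_def)
  have A: "dg_algebra_sheaf Y A" using assms(5) by (simp add: smooth_resolution_def)
  have "scal Y U c \<in> carrier (rsec Y U)" if "openin (tp Y) U" "c \<in> carrier K" for U c
    using Y that ring_hom_closed by (fastforce simp: k_scheme_def)
  then show "dg_lie_algebroid_over_OY K Y A (relative_tangent Y A)"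
    by (rule relative_tangent_algebroid[OF ringed A])
  show "is_algebroid_of_groupoid Y A (relative_tangent Y A) (pair_groupoid Y A)"
    by (rule fibre_groupoid.algebroid_of_pair_groupoid[OF fibre_groupoid.intro[OF ringed A]])
qed

end
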